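(* Let $n\ge 1$ and let $\Psi$ be a logarithmic growth function with $\Phi(x)=x\Psi'(x)$. Suppose that there exists a real number $\eta<1/2$ such that $$\Phi''(t)=O\big(t^{-\frac12}[\Phi'(t)]^{1+\eta}\big)\quad\text{when } t\to\infty,$$ and, if $n>1$, also $$\Psi''(t)=O\big(t^{-\frac12}[\Psi'(t)]^{1+\eta}\big)\quad\text{when } t\to\infty .$$ If $\nu$ is a nonnegative Borel measure on $\mathbb{C}^n$, then the following statements are equivalent: (i) $\nu$ is a Carleson measure for $\mathcal{A}^2(\Psi)$; (ii) there is a constant $C>0$ such that $$\int_{\mathbb{C}^n}\frac{|K_\Psi(w,z)|^2}{K_\Psi(z,z)}\,e^{-\Psi(|w|^2)}\,d\nu(w)\le C$$ for every $z$ in $\mathbb{C}^n$; (iii) for every positive number $r$, there is a positive number $C$ such that $\nu(B(z,r))\le C|B(z,r)|$ for every $z$ in $\mathbb{C}^n$; (iv) there exist a $\Psi$-lattice $(a_k)$ and a positive number $C$ such that $\nu(B(a_k,r))\le C|B(a_k,r)|$ for every $k$, where $r$ is the maximal covering radius for $(a_k)$.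
   Context: A logarithmic growth function is a $C^3$-function $\Psi:[0,+\infty)\to[0,+\infty)$ with $\Psi'(x)>0$, $\Psi''(x)\ge 0$, $\Psi'''(x)\ge 0$ for all $x$. Notation: $dV$ is Lebesgue measure on $\mathbb{C}^n$; $d\mu_\Psi(z)=e^{-\Psi(|z|^2)}dV(z)$; $|E|$ is the Lebesgue (Euclidean) volume of $E\subset\mathbb{C}^n$. The Fock space $\mathcal{A}^2(\Psi)$ is the closure of the holomorphic polynomials in $L^2(\mu_\Psi)$; it is a reproducing kernel Hilbert space of entire functions, with reproducing kernel $K_\Psi(z,w)$. $\nu$ is a Carleson measure for $\mathcal{A}^2(\Psi)$ if there is a positive constant $C$ such that $\int_{\mathbb{C}^n}|f(z)|^2e^{-\Psi(|z|^2)}d\nu(z)\le C\int_{\mathbb{C}^n}|f(z)|^2d\mu_\Psi(z)$ for every $f\in\mathcal{A}^2(\Psi)$. Bergman metric and distance: $\beta^2(z,\xi)=\sum_{j,k=1}^n\frac{\partial^2\log K_\Psi(z,z)}{\partial z_j\partial\bar z_k}\xi_j\bar\xi_k$, and $\varrho(z,w)=\inf_\gamma\int_0^1\beta(\gamma(t),\gamma'(t))\,dt$, the infimum being over all piecewise $C^1$-smooth curves $\gamma:[0,1]\to\mathbb{C}^n$ with $\gamma(0)=z$, $\gamma(1)=w$. Bergman ball: $B(z,a)=\{w:\varrho(z,w)<a\}$. A sequence of distinct points $(a_k)$ in $\mathbb{C}^n$ is a $\Psi$-lattice if there exists a positive number $r$ such that the balls $B(a_k,r)$ cover $\mathbb{C}^n$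 and the balls $B(a_k,r/2)$ are mutually disjoint. Such an $r$ is called a covering radius for $(a_k)$; the supremum of all covering radii is again a covering radius, called the maximal covering radius. *)

theory Defs
  imports "HOL-Analysis.Analysis" "HOL-Library.Landau_Symbols"
begin

text \<open>
  Derivative of a function on \<open>[0, \<infinity>)\<close>, one-sided at \<open>0\<close>.
\<close>
definition deriv0 :: "(real \<Rightarrow> real) \<Rightarrow> real \<Rightarrow> real"
  where "deriv0 f x = vector_derivative f (at x within {0..})"

definition log_growth :: "(real \<Rightarrow> real) \<Rightarrow> bool"
  where "log_growth \<Psi> \<longleftrightarrow>
    \<Psi> differentiable_on {0..} \<and>
    deriv0 \<Psi> differentiable_on {0..} \<and>
    deriv0 (deriv0 \<Psi>) differentiable_on {0..} \<and>
    continuous_on {0..} (deriv0 (deriv0 (deriv0 \<Psi>))) \<and>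
    (\<forall>x\<ge>0. \<Psi> x \<ge> 0 \<and> deriv0 \<Psi> x > 0 \<and> deriv0 (deriv0 \<Psi>) x \<ge> 0 \<and>
           deriv0 (deriv0 (deriv0 \<Psi>)) x \<ge> 0)"

definition Phi :: "(real \<Rightarrow> real) \<Rightarrow> real \<Rightarrow> real"
  where "Phi \<Psi> x = x * deriv0 \<Psi> x"

definition fock_measure :: "(real \<Rightarrow> real) \<Rightarrow> (complex ^ 'n) measure"
  where "fock_measure \<Psi> = density lborel (\<lambda>z. ennreal (exp (- \<Psi> ((norm z)\<^sup>2))))"

definition holomorphic_polynomials :: "((complex ^ 'n) \<Rightarrow> complex) set"
  where "holomorphic_polynomials =
    {p. \<exists>(A :: ('n \<Rightarrow> nat) set) c. finite A \<and>
          p = (\<lambda>z. \<Sum>\<alpha>\<in>A. c \<alpha> * (\<Prod>j\<in>UNIV. (z $ j) ^ \<alpha> j))}"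

definition entire :: "((complex ^ 'n) \<Rightarrow> complex) \<Rightarrow> bool"
  where "entire f \<longleftrightarrow>
    (\<forall>z. \<exists>L. (f has_derivative L) (at z) \<and> (\<forall>c v. L (c *s v) = c * L v))"

definition L2 :: "'a measure \<Rightarrow> ('a \<Rightarrow> complex) set"
  where "L2 M = {f \<in> borel_measurable M. (\<integral>\<^sup>+x. ennreal ((norm (f x))\<^sup>2) \<partial>M) < \<infinity>}"

text \<open>
  The elements of the \<open>L\<^sup>2\<close>-closure of the polynomials are classes modulo null sets; each class
  contains exactly one entire function, and it is this representative that we take. The choice
  matters because the functions are evaluated at points and integrated against measures that
  may be singular.
\<close>
definition fock_space :: "(real \<Rightarrow> real) \<Rightarrow> ((complex ^ 'n) \<Rightarrow> complex) set"
  where "fock_space \<Psi> =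
    {f \<in> L2 (fock_measure \<Psi>). entire f \<and>
       (\<forall>\<epsilon>>0. \<exists>p\<in>holomorphic_polynomials.
          (\<integral>\<^sup>+z. ennreal ((norm (f z - p z))\<^sup>2) \<partial>fock_measure \<Psi>) < ennreal \<epsilon>)}"

definition fock_kernel :: "(real \<Rightarrow> real) \<Rightarrow> complex ^ 'n \<Rightarrow> complex ^ 'n \<Rightarrow> complex"
  where "fock_kernel \<Psi> z w =
    (THE g. g \<in> fock_space \<Psi> \<and>
       (\<forall>f\<in>fock_space \<Psi>. f w = (\<integral>u. f u * cnj (g u) \<partial>fock_measure \<Psi>))) z"

definition carleson_measure :: "(real \<Rightarrow> real) \<Rightarrow> (complex ^ 'n) measure \<Rightarrow> bool"
  where "carleson_measure \<Psi> \<nu> \<longleftrightarrow>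
    (\<exists>C>0. \<forall>f\<in>fock_space \<Psi>.
       (\<integral>\<^sup>+z. ennreal ((norm (f z))\<^sup>2 * exp (- \<Psi> ((norm z)\<^sup>2))) \<partial>\<nu>)
       \<le> ennreal C * (\<integral>\<^sup>+z. ennreal ((norm (f z))\<^sup>2) \<partial>fock_measure \<Psi>))"

definition real_partial :: "complex ^ 'n \<Rightarrow> (complex ^ 'n \<Rightarrow> complex) \<Rightarrow> complex ^ 'n \<Rightarrow> complex"
  where "real_partial v u z = vector_derivative (\<lambda>t. u (z + t *\<^sub>R v)) (at 0)"

definition wirtinger :: "'n \<Rightarrow> (complex ^ 'n \<Rightarrow> complex) \<Rightarrow> complex ^ 'n \<Rightarrow> complex"
  where "wirtinger j u z =
    (real_partial (axis j 1) u z - \<i> * real_partial (axis j \<i>) u z) / 2"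

definition wirtinger_bar :: "'n \<Rightarrow> (complex ^ 'n \<Rightarrow> complex) \<Rightarrow> complex ^ 'n \<Rightarrow> complex"
  where "wirtinger_bar j u z =
    (real_partial (axis j 1) u z + \<i> * real_partial (axis j \<i>) u z) / 2"

text \<open>The kernel is real and positive on the diagonal, hence the real part.\<close>
definition bergman_metric :: "(real \<Rightarrow> real) \<Rightarrow> complex ^ 'n \<Rightarrow> complex ^ 'n \<Rightarrow> real"
  where "bergman_metric \<Psi> z \<xi> =
    sqrt (Re (\<Sum>j\<in>UNIV. \<Sum>k\<in>UNIV.
      wirtinger j (wirtinger_bar k (\<lambda>w. complex_of_real (ln (Re (fock_kernel \<Psi> w w))))) z
        * \<xi> $ j * cnj (\<xi> $ k)))"

text \<open>
  Lengths take values in \<open>[0, \<infinity>]\<close>: the library's piecewise \<open>C\<^sup>1\<close> paths may have an unbounded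
  derivative near the exceptional points, so some have infinite length. Such additional paths
  do not affect the infimum.
\<close>
definition bergman_dist :: "(real \<Rightarrow> real) \<Rightarrow> complex ^ 'n \<Rightarrow> complex ^ 'n \<Rightarrow> ennreal"
  where "bergman_dist \<Psi> z w =
    (INF \<gamma>\<in>{\<gamma>. \<gamma> piecewise_C1_differentiable_on {0..1} \<and> \<gamma> 0 = z \<and> \<gamma> 1 = w}.
       \<integral>\<^sup>+t\<in>{0..1}. ennreal (bergman_metric \<Psi> (\<gamma> t) (vector_derivative \<gamma> (at t))) \<partial>lborel)"

definition bergman_ball :: "(real \<Rightarrow> real) \<Rightarrow> complex ^ 'n \<Rightarrow> real \<Rightarrow> (complex ^ 'n) set"
  where "bergman_ball \<Psi> z a = {w. bergman_dist \<Psi> z w < ennreal a}"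

definition covering_radius :: "(real \<Rightarrow> real) \<Rightarrow> (nat \<Rightarrow> complex ^ 'n) \<Rightarrow> real \<Rightarrow> bool"
  where "covering_radius \<Psi> a r \<longleftrightarrow>
    r > 0 \<and> (\<Union>k. bergman_ball \<Psi> (a k) r) = UNIV \<and>
    disjoint_family (\<lambda>k. bergman_ball \<Psi> (a k) (r / 2))"

definition lattice_seq :: "(real \<Rightarrow> real) \<Rightarrow> (nat \<Rightarrow> complex ^ 'n) \<Rightarrow> bool"
  where "lattice_seq \<Psi> a \<longleftrightarrow> inj a \<and> (\<exists>r. covering_radius \<Psi> a r)"

definition max_covering_radius :: "(real \<Rightarrow> real) \<Rightarrow> (nat \<Rightarrow> complex ^ 'n) \<Rightarrow> real"
  where "max_covering_radius \<Psi> a = Sup {r. covering_radius \<Psi> a r}"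

end

theory Submission
  imports Defs "HOL-Complex_Analysis.Cauchy_Integral_Formula"
begin

text \<open>
  The growth condition makes \<open>\<Phi>'\<close> slowly varying: at the point \<open>z\<close>, with \<open>x = |z|\<^sup>2\<close>, the weight is, up to a
  holomorphic factor and a bounded factor, constant on the ellipsoid centred at \<open>z\<close> with semi-axis
  \<open>\<Phi>'(x)\<^sup>-\<^sup>1\<^sup>/\<^sup>2\<close> in the direction of \<open>z\<close> and \<open>\<Psi>'(x)\<^sup>-\<^sup>1\<^sup>/\<^sup>2\<close> in the directions orthogonal to it. Hence entire
  functions satisfy a weighted mean value inequality on these ellipsoids.

  The kernel is \<open>K(z,w) = F(\<langle>z,w\<rangle>)\<close>, where the Taylor coefficients \<open>c\<^sub>k\<close> of \<open>F\<close> are, up to explicit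
  factors, reciprocals of moments of \<open>e\<^sup>-\<^sup>\<Psi>\<close>. The weights \<open>c\<^sub>k x\<^sup>k / F(x)\<close> are a probability distribution
  of degrees. Convexity of \<open>\<Psi>\<close> in the variable \<open>ln x\<close> and the mean value inequality show that it is
  spread over a window of width \<open>(x \<Phi>'(x))\<^sup>1\<^sup>/\<^sup>2\<close> around \<open>\<Phi>(x)\<close>, so that \<open>F(x)\<close> is comparable to
  \<open>e\<^sup>\<Psi> \<Phi>' \<Psi>'\<^sup>n\<^sup>-\<^sup>1\<close>, its mean gives \<open>(log F)'\<close> comparable to \<open>\<Psi>'\<close>, and its variance gives
  \<open>(x (log F)')'\<close> comparable to \<open>\<Phi>'\<close>. The Bergman metric is therefore comparable to
  \<open>\<Psi>' |\<xi>|\<^sup>2 + \<Psi>'' |\<langle>\<xi>,z\<rangle>|\<^sup>2\<close>, and Bergman balls of fixed radius to the ellipsoids above.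

  Now (i) implies (ii) by testing on \<open>K(\<cdot>,z)\<close>. By Cauchy's estimate \<open>|K(\<cdot>,z)|\<^sup>2 e\<^sup>-\<^sup>\<Psi>\<close> is at least
  \<open>c K(z,z) / |B(z,\<delta>)|\<close> on a small ball \<open>B(z,\<delta>)\<close>, so (ii) gives (iii) for small radii; larger balls are
  covered by a bounded number of small ones. A maximal separated set is a lattice, which gives (iv).
  Finally the mean value inequality on the balls of a lattice, which overlap boundedly often, gives (i).
\<close>

section \<open>The Hermitian product\<close>

definition herm :: "complex ^ 'n \<Rightarrow> complex ^ 'n \<Rightarrow> complex"
  where "herm z w = (\<Sum>j\<in>UNIV. z $ j * cnj (w $ j))"

lemma herm_add_left: "herm (x + y) z = herm x z + herm y z"
  by (simp add: herm_def sum.distrib algebra_simps)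

lemma herm_add_right: "herm z (x + y) = herm z x + herm z y"
  by (simp add: herm_def sum.distrib algebra_simps)

lemma herm_diff_left: "herm (x - y) z = herm x z - herm y z"
  by (simp add: herm_def sum_subtractf algebra_simps)

lemma herm_diff_right: "herm z (x - y) = herm z x - herm z y"
  by (simp add: herm_def sum_subtractf algebra_simps)

lemma herm_scale_left: "herm (c *s x) z = c * herm x z"
  by (simp add: herm_def sum_distrib_left algebra_simps)

lemma herm_scale_right: "herm z (c *s x) = cnj c * herm z x"
  by (simp add: herm_def sum_distrib_left algebra_simps)

lemma scaleR_eq_smult: "r *\<^sub>R x = complex_of_real r *s x"
  by (simp add: vec_eq_iff scaleR_conv_of_real[symmetric])

lemma herm_scaleR_left: "herm (r *\<^sub>R x) z = complex_of_real r * herm x z"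
  by (simp add: scaleR_eq_smult herm_scale_left)

lemma herm_scaleR_right: "herm z (r *\<^sub>R x) = complex_of_real r * herm z x"
  by (simp add: scaleR_eq_smult herm_scale_right)

lemma herm_zero [simp]: "herm 0 z = 0" "herm z 0 = 0"
  by (simp_all add: herm_def)

lemma herm_axis: "herm (axis k a) z = a * cnj (z $ k)"
proof -
  have "herm (axis k a) z = (\<Sum>j\<in>UNIV. if j = k then a * cnj (z $ k) else 0)"
    unfolding herm_def by (intro sum.cong) (auto simp: axis_def)
  then show ?thesis by simp
qed

lemma cnj_herm: "cnj (herm z w) = herm w z"
  by (simp add: herm_def algebra_simps)

lemma Re_herm: "Re (herm z w) = z \<bullet> w"
  by (simp add: herm_def inner_vec_def inner_complex_def)

lemma herm_self: "herm z z = complex_of_real ((norm z)\<^sup>2)"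
proof -
  have "Im (herm z z) = 0"
    by (simp add: herm_def algebra_simps)
  moreover have "Re (herm z z) = (norm z)\<^sup>2"
    by (simp add: Re_herm power2_norm_eq_inner)
  ultimately show ?thesis
    by (simp add: complex_eq_iff)
qed

lemma norm_smult: "norm (c *s x) = norm c * norm x" for x :: "complex ^ 'n"
  by (simp add: norm_vec_def L2_set_right_distrib norm_mult)

lemma norm_herm_le: "norm (herm z w) \<le> norm z * norm w"
proof (cases "herm z w = 0")
  case False
  define phase where "phase = cnj (herm z w) / norm (herm z w)"
  have "norm phase = 1"
    using False by (simp add: phase_def norm_divide)
  have "phase * herm z w = norm (herm z w)"
    using False complex_norm_square[of "herm z w"]
    by (simp add: phase_def field_simps power2_eq_square)
  then have "norm (herm z w) = Re (herm (phase *s z) w)"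
    by (simp add: herm_scale_left)
  also have "\<dots> \<le> norm (phase *s z) * norm w"
    by (simp add: Re_herm norm_cauchy_schwarz)
  also have "\<dots> = norm z * norm w"
    by (simp add: norm_smult \<open>norm phase = 1\<close>)
  finally show ?thesis .
qed auto

lemma bounded_linear_herm: "bounded_linear (\<lambda>z. herm z w)"
  by (rule bounded_linear_intro[where K = "norm w"])
    (auto simp: herm_add_left herm_scaleR_left norm_herm_le, simp add: scaleR_conv_of_real)

lemma norm_add_herm:
  "(norm (z + w))\<^sup>2 = (norm z)\<^sup>2 + 2 * Re (herm w z) + (norm w)\<^sup>2"
  by (simp add: Re_herm power2_norm_eq_inner inner_add inner_commute)

lemma continuous_on_herm [continuous_intros]:
  "continuous_on S f \<Longrightarrow> continuous_on S g \<Longrightarrow> continuous_on S (\<lambda>x. herm (f x) (g x))"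
  unfolding herm_def by (intro continuous_intros)

lemma borel_measurable_herm [measurable (raw)]:
  "f \<in> borel_measurable M \<Longrightarrow> g \<in> borel_measurable M \<Longrightarrow> (\<lambda>x. herm (f x) (g x)) \<in> borel_measurable M"
  by (rule borel_measurable_continuous_Pair[where H = herm]) (auto intro!: continuous_intros)

lemma borel_measurable_cnj [measurable (raw)]:
  "f \<in> borel_measurable M \<Longrightarrow> (\<lambda>x. cnj (f x)) \<in> borel_measurable M"
  by (erule measurable_compose) (intro borel_measurable_continuous_onI continuous_intros)

lemma continuous_on_smult [continuous_intros]:
  "continuous_on S f \<Longrightarrow> continuous_on S g \<Longrightarrow> continuous_on S (\<lambda>x. f x *s (g x :: complex ^ 'n))"
  unfolding vector_scalar_mult_def by (intro continuous_intros)

lemma borel_measurable_smult [measurable (raw)]: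
  fixes g :: "'a \<Rightarrow> complex ^ 'n"
  shows "f \<in> borel_measurable M \<Longrightarrow> g \<in> borel_measurable M \<Longrightarrow> (\<lambda>x. f x *s g x) \<in> borel_measurable M"
  by (rule borel_measurable_continuous_Pair[where H = "(*s)"]) (auto intro!: continuous_intros)

section \<open>Complex linear and unitary maps\<close>

definition complex_linear :: "(complex ^ 'm \<Rightarrow> complex ^ 'n) \<Rightarrow> bool"
  where "complex_linear T \<longleftrightarrow> linear T \<and> (\<forall>c v. T (c *s v) = c *s T v)"

lemma complex_linear_imp_linear: "complex_linear T \<Longrightarrow> linear T"
  by (simp add: complex_linear_def)

lemma complex_linear_smult: "complex_linear T \<Longrightarrow> T (c *s v) = c *s T v"
  by (simp add: complex_linear_def)

lemma complex_linear_ident: "complex_linear (\<lambda>v. v)"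
  by (simp add: complex_linear_def linear_ident)

lemma complex_linear_homothety: "complex_linear (\<lambda>v. c *s v)"
  unfolding complex_linear_def
  by (auto intro!: linearI simp: scaleR_eq_smult vector_add_ldistrib vector_smult_assoc mult.commute)

lemma complex_linear_compose:
  "complex_linear S \<Longrightarrow> complex_linear T \<Longrightarrow> complex_linear (\<lambda>v. T (S v))"
  using linear_compose[of S T] by (simp add: complex_linear_def o_def)

lemma complex_linear_has_derivative: "complex_linear T \<Longrightarrow> (T has_derivative T) F"
  by (intro bounded_linear_imp_has_derivative)
    (simp add: complex_linear_imp_linear linear_conv_bounded_linear[symmetric])

lemma complex_linear_measurable: "complex_linear T \<Longrightarrow> T \<in> borel_measurable borel"
  by (intro borel_measurable_continuous_onI linear_continuous_on)
    (simp add: complex_linear_imp_linear linear_conv_bounded_linear[symmetric])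

definition unitary :: "(complex ^ 'n \<Rightarrow> complex ^ 'n) \<Rightarrow> bool"
  where "unitary U \<longleftrightarrow> complex_linear U \<and> (\<forall>x y. herm (U x) (U y) = herm x y)"

lemma norm_unitary:
  assumes "unitary U" shows "norm (U x) = norm x"
proof -
  have "herm (U x) (U x) = herm x x"
    using assms by (simp add: unitary_def)
  then have "(norm (U x))\<^sup>2 = (norm x)\<^sup>2"
    by (simp only: herm_self of_real_eq_iff)
  then show ?thesis by simp
qed

text \<open>For \<open>v = 0\<close> the convention \<open>x / 0 = 0\<close> makes this the identity, which is unitary as well.\<close>
definition householder :: "complex ^ 'n \<Rightarrow> complex ^ 'n \<Rightarrow> complex ^ 'n"
  where "householder v x = x - (2 * herm x v / herm v v) *s v"

lemma unitary_householder: "unitary (householder v)"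
  unfolding unitary_def complex_linear_def
proof (intro conjI allI)
  show "linear (householder v)"
    by (rule linearI)
      (auto simp: householder_def herm_add_left herm_scale_left scaleR_eq_smult vector_ssub_ldistrib
        add_divide_distrib vector_sadd_rdistrib vector_smult_assoc algebra_simps)
  show "householder v (c *s x) = c *s householder v x" for c x
    by (simp add: householder_def herm_scale_left vector_ssub_ldistrib vector_smult_assoc algebra_simps)
  have "cnj (herm v v) = herm v v"
    by (rule cnj_herm)
  moreover have "v \<noteq> 0 \<Longrightarrow> herm v v \<noteq> 0"
    by (simp add: herm_self)
  ultimately show "herm (householder v x) (householder v y) = herm x y" for x y
    by (cases "v = 0")
      (simp_all add: householder_def herm_diff_left herm_diff_right herm_scale_left herm_scale_right cnj_herm)
qed

lemma householder_diff_maps: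
  assumes "herm a a = herm e e" "herm a e = herm e a"
  shows "householder (a - e) a = e"
proof (cases "a = e")
  case False
  then have "herm (a - e) (a - e) \<noteq> 0"
    by (simp add: herm_self)
  moreover have "2 * herm a (a - e) = herm (a - e) (a - e)"
    using assms by (simp add: herm_diff_left herm_diff_right)
  ultimately show ?thesis
    by (simp add: householder_def)
qed (simp add: householder_def)

text \<open>After a change of phase \<open>z\<close> has a nonnegative \<open>k\<close>-th coordinate, as the reflection requires.\<close>
lemma unitary_axis_to_direction:
  fixes z :: "complex ^ 'n" and k :: 'n
  obtains U :: "complex ^ 'n \<Rightarrow> complex ^ 'n" and c :: complex where "unitary U" "norm c = 1" "z = (c * norm z) *s U (axis k 1)"
proof (cases "z = 0")
  case True
  then show ?thesis
    by (intro that[OF unitary_householder, of 1]) auto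
next
  case False
  define c where "c = (if z $ k = 0 then 1 else z $ k / norm (z $ k))"
  have norm_c: "norm c = 1" by (simp add: c_def norm_divide)
  then have cnj_c: "cnj c * c = 1"
    by (metis complex_norm_square mult.commute of_real_1 one_power2)
  have coordinate: "cnj c * z $ k = norm (z $ k)"
    using complex_norm_square[of "z $ k"] by (auto simp: c_def field_simps power2_eq_square)
  define e where "e = (cnj c / norm z) *s z"
  have "norm e = 1"
    using False norm_c by (simp add: e_def norm_smult norm_divide)
  then have unit: "herm (axis k 1) (axis k 1) = herm e e"
    by (simp add: herm_self)
  have "herm (axis k 1) e = of_real (norm (z $ k) / norm z)"
    using arg_cong[OF coordinate, of cnj] by (simp add: e_def herm_axis)
  then have real: "herm (axis k 1) e = herm e (axis k 1)"
    by (metis cnj_herm complex_cnj_complex_of_real)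
  have "z = (c * norm z) *s e"
    using False cnj_c by (simp add: e_def vector_smult_assoc mult.commute)
  then show ?thesis
    using that[OF unitary_householder norm_c, of "axis k 1 - e"] householder_diff_maps[OF unit real] by simp
qed

section \<open>Entire functions of several variables\<close>

lemma entireI:
  assumes "\<And>z. \<exists>L. (f has_derivative L) (at z) \<and> (\<forall>c v. L (c *s v) = c * L v)"
  shows "entire f"
  using assms by (simp add: entire_def)

lemma entireE:
  assumes "entire f"
  obtains L where "(f has_derivative L) (at z)" "\<And>c v. L (c *s v) = c * L v"
  using assms unfolding entire_def by blast

lemma entire_const: "entire (\<lambda>z. c)"
  by (rule entireI) (auto intro!: exI[of _ "\<lambda>_. 0"])

lemma entire_add:
  assumes "entire f" "entire g"
  shows "entire (\<lambda>z. f z + g z)"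
proof (rule entireI)
  fix z
  obtain L where "(f has_derivative L) (at z)" "\<And>c v. L (c *s v) = c * L v"
    using entireE[OF assms(1)] by metis
  moreover obtain M where "(g has_derivative M) (at z)" "\<And>c v. M (c *s v) = c * M v"
    using entireE[OF assms(2)] by metis
  ultimately show "\<exists>L. ((\<lambda>z. f z + g z) has_derivative L) (at z) \<and> (\<forall>c v. L (c *s v) = c * L v)"
    by (intro exI[of _ "\<lambda>v. L v + M v"]) (auto intro!: derivative_eq_intros simp: algebra_simps)
qed

lemma entire_mult:
  assumes "entire f" "entire g"
  shows "entire (\<lambda>z. f z * g z)"
proof (rule entireI)
  fix z
  obtain L where "(f has_derivative L) (at z)" "\<And>c v. L (c *s v) = c * L v"
    using entireE[OF assms(1)] by metis
  moreover obtain M where "(g has_derivative M) (at z)" "\<And>c v. M (c *s v) = c * M v"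
    using entireE[OF assms(2)] by metis
  ultimately show "\<exists>L. ((\<lambda>z. f z * g z) has_derivative L) (at z) \<and> (\<forall>c v. L (c *s v) = c * L v)"
    by (intro exI[of _ "\<lambda>v. f z * M v + L v * g z"]) (auto intro!: derivative_eq_intros simp: algebra_simps)
qed

lemma entire_diff: "entire f \<Longrightarrow> entire g \<Longrightarrow> entire (\<lambda>z. f z - g z)"
  using entire_add[of f "\<lambda>z. (- 1) * g z"] entire_mult[OF entire_const, of g "- 1"] by simp

lemma entire_sum: "(\<And>i. i \<in> I \<Longrightarrow> entire (f i)) \<Longrightarrow> entire (\<lambda>z. \<Sum>i\<in>I. f i z)"
  by (induction I rule: infinite_finite_induct) (auto intro: entire_const entire_add)

lemma entire_prod: "(\<And>i. i \<in> I \<Longrightarrow> entire (f i)) \<Longrightarrow> entire (\<lambda>z. \<Prod>i\<in>I. f i z)"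
  by (induction I rule: infinite_finite_induct) (auto intro: entire_const entire_mult)

lemma entire_power: "entire f \<Longrightarrow> entire (\<lambda>z. f z ^ k)"
  by (induction k) (auto intro: entire_const entire_mult)

lemma entire_nth: "entire (\<lambda>z. z $ j)"
  by (rule entireI)
    (auto intro!: exI[of _ "\<lambda>v. v $ j"] bounded_linear_imp_has_derivative bounded_linear_vec_nth)

lemma entire_herm: "entire (\<lambda>z. herm z w)"
  by (rule entireI)
    (auto intro!: exI[of _ "\<lambda>v. herm v w"] bounded_linear_imp_has_derivative bounded_linear_herm
      simp: herm_scale_left)

lemma entire_compose_holomorphic:
  assumes "F holomorphic_on UNIV" "entire f"
  shows "entire (\<lambda>z. F (f z))"
proof (rule entireI)
  fix z
  obtain L where L: "(f has_derivative L) (at z)" "\<And>c v. L (c *s v) = c * L v"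
    using entireE[OF assms(2)] by metis
  have "(F has_derivative (\<lambda>h. deriv F (f z) * h)) (at (f z))"
    using holomorphic_derivI[OF assms(1), of "f z"] by (simp add: has_field_derivative_def)
  from has_derivative_compose[OF L(1) this] L(2)
  show "\<exists>L. ((\<lambda>z. F (f z)) has_derivative L) (at z) \<and> (\<forall>c v. L (c *s v) = c * L v)"
    by (intro exI[of _ "\<lambda>v. deriv F (f z) * L v"]) auto
qed

lemma entire_exp: "entire f \<Longrightarrow> entire (\<lambda>z. exp (f z))"
  by (rule entire_compose_holomorphic) (auto intro: holomorphic_intros)

lemma entire_compose_affine:
  assumes "entire f" "complex_linear T"
  shows "entire (\<lambda>u. f (z + T u))"
proof (rule entireI)
  fix u
  obtain L where L: "(f has_derivative L) (at (z + T u))" "\<And>c v. L (c *s v) = c * L v"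
    using entireE[OF assms(1)] by metis
  have "((\<lambda>u. z + T u) has_derivative T) (at u)"
    by (auto intro!: derivative_eq_intros complex_linear_has_derivative[OF assms(2)])
  from has_derivative_compose[OF this L(1)] L(2)
  show "\<exists>L. ((\<lambda>u. f (z + T u)) has_derivative L) (at u) \<and> (\<forall>c v. L (c *s v) = c * L v)"
    by (intro exI[of _ "\<lambda>v. L (T v)"]) (auto simp: complex_linear_smult[OF assms(2)])
qed

lemma entire_imp_continuous_on: "entire f \<Longrightarrow> continuous_on S f"
  unfolding entire_def
  by (meson continuous_at_imp_continuous_on has_derivative_continuous)

lemma entire_imp_borel_measurable: "entire f \<Longrightarrow> f \<in> borel_measurable borel"
  by (simp add: entire_imp_continuous_on borel_measurable_continuous_onI)

lemma entire_slice_holomorphic: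
  assumes "entire f"
  shows "(\<lambda>c. f (c *s u)) holomorphic_on UNIV"
proof -
  have "\<exists>d. ((\<lambda>c. f (c *s u)) has_field_derivative d) (at c)" for c
  proof -
    obtain L where L: "(f has_derivative L) (at (c *s u))" "\<And>c v. L (c *s v) = c * L v"
      using entireE[OF assms] by metis
    have "linear (\<lambda>c. c *s u)"
      by (rule linearI) (auto simp: scaleR_eq_smult vector_sadd_rdistrib scaleR_conv_of_real vector_smult_assoc)
    then have "((\<lambda>c. c *s u) has_derivative (\<lambda>c. c *s u)) (at c)"
      by (intro bounded_linear_imp_has_derivative) (simp add: linear_conv_bounded_linear)
    from has_derivative_compose[OF this L(1)] L(2)
    have "((\<lambda>c. f (c *s u)) has_derivative (\<lambda>c. L u * c)) (at c)"
      by (simp add: mult.commute)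
    then show ?thesis
      by (auto simp: has_field_derivative_def)
  qed
  then show ?thesis
    by (simp add: holomorphic_on_def field_differentiable_def)
qed

lemma entire_Lipschitz_at_0:
  fixes g :: "complex ^ 'n \<Rightarrow> complex"
  assumes g: "entire g" and bound: "\<And>u. norm u \<le> r \<Longrightarrow> norm (g u) \<le> B"
    and u: "norm u \<le> r / 2" and "r > 0"
  shows "norm (g u - g 0) \<le> 2 * B * norm u / r"
proof (cases "u = 0")
  case False
  define h where "h c = g (c *s u)" for c :: complex
  define \<rho> where "\<rho> = r / norm u / 2"
  have "norm u > 0" using False by simp
  then have \<rho>: "\<rho> \<ge> 1" using u by (simp add: \<rho>_def field_simps)
  have holomorphic: "h holomorphic_on UNIV" unfolding h_def by (rule entire_slice_holomorphic[OF g])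
  have deriv_bound: "norm (deriv h c) \<le> 2 * B * norm u / r" if c: "c \<in> cball 0 1" for c
  proof -
    have "norm ((deriv ^^ 1) h c) \<le> fact 1 * B / \<rho> ^ 1"
    proof (rule Cauchy_inequality)
      show "h holomorphic_on ball c \<rho>" "continuous_on (cball c \<rho>) h"
        using holomorphic by (auto intro: holomorphic_on_subset holomorphic_on_imp_continuous_on)
      show "\<rho> > 0" using \<rho> by simp
      fix x assume x: "norm (c - x) = \<rho>"
      have "norm x \<le> norm c + norm (c - x)" using norm_triangle_ineq4[of c "c - x"] by simp
      also have "\<dots> \<le> 2 * \<rho>" using c x \<rho> by simp
      finally have "norm (x *s u) \<le> r"
        using \<open>norm u > 0\<close> mult_right_mono[of "norm x" "2 * \<rho>" "norm u"] by (simp add: norm_smult \<rho>_def)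
      then show "norm (h x) \<le> B" unfolding h_def by (rule bound)
    qed
    then show ?thesis using \<open>norm u > 0\<close> by (simp add: \<rho>_def mult_ac)
  qed
  have "norm (h 1 - h 0) \<le> 2 * B * norm u / r * norm (1 - 0 :: complex)"
  proof (rule field_differentiable_bound[of "cball 0 1" h "deriv h"])
    fix c :: complex
    show "(h has_field_derivative deriv h c) (at c within cball 0 1)"
      using holomorphic_derivI[OF holomorphic open_UNIV UNIV_I] by (rule has_field_derivative_at_within)
  qed (use deriv_bound in auto)
  then show ?thesis by (simp add: h_def)
qed simp

section \<open>Invariance of Lebesgue measure\<close>

lemma nn_integral_lborel_affine:
  fixes f :: "'a::euclidean_space \<Rightarrow> ennreal"
  assumes [measurable]: "f \<in> borel_measurable borel" and "c \<noteq> 0"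
  shows "(\<integral>\<^sup>+x. f x \<partial>lborel) = ennreal (\<bar>c\<bar> ^ DIM('a)) * (\<integral>\<^sup>+x. f (t + c *\<^sub>R x) \<partial>lborel)"
  by (subst lborel_affine[OF \<open>c \<noteq> 0\<close>, of t])
    (simp add: nn_integral_density nn_integral_distr nn_integral_cmult)

lemma integral_lborel_scale:
  fixes f :: "'a::euclidean_space \<Rightarrow> 'b::{banach, second_countable_topology}"
  assumes [measurable]: "f \<in> borel_measurable borel" and "c > 0"
  shows "(\<integral>x. f x \<partial>lborel) = (c ^ DIM('a)) *\<^sub>R (\<integral>x. f (c *\<^sub>R x) \<partial>lborel)"
  by (subst lborel_affine[of c "0::'a"], use assms in simp, subst integral_density)
    (use assms in \<open>auto simp: integral_distr\<close>)

lemma nn_integral_lborel_reflect: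
  fixes f :: "'a::euclidean_space \<Rightarrow> ennreal"
  assumes "f \<in> borel_measurable borel"
  shows "(\<integral>\<^sup>+y. f (a - y) \<partial>lborel) = (\<integral>\<^sup>+y. f y \<partial>lborel)"
  using nn_integral_lborel_affine[OF assms, of "-1" a] by simp

lemma emeasure_vimage_times_emeasure:
  fixes U :: "'a::euclidean_space \<Rightarrow> 'b::euclidean_space"
  assumes [measurable]: "U \<in> borel_measurable borel" "C \<in> sets borel" "D \<in> sets borel"
  shows "emeasure lborel (U -` C) * emeasure lborel D
    = (\<integral>\<^sup>+y. \<integral>\<^sup>+x. indicator C (U x) * indicator D (U x - y) \<partial>lborel \<partial>lborel)"
proof -
  have D: "emeasure lborel D = (\<integral>\<^sup>+y. indicator D (U x - y) \<partial>lborel)" for x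
    using nn_integral_lborel_reflect[of "indicator D" "U x"] by simp
  have "U -` C \<in> sets borel"
    using measurable_sets[of U borel borel C] by simp
  then have "emeasure lborel (U -` C) = (\<integral>\<^sup>+x. indicator (U -` C) x \<partial>lborel)"
    by simp
  also have "\<dots> = (\<integral>\<^sup>+x. indicator C (U x) \<partial>lborel)"
    by (intro nn_integral_cong) (auto simp: indicator_def)
  finally have "emeasure lborel (U -` C) * emeasure lborel D
      = (\<integral>\<^sup>+x. indicator C (U x) * emeasure lborel D \<partial>lborel)"
    by (simp add: nn_integral_multc)
  also have "\<dots> = (\<integral>\<^sup>+x. indicator C (U x) * (\<integral>\<^sup>+y. indicator D (U x - y) \<partial>lborel) \<partial>lborel)"
    by (intro nn_integral_cong arg_cong2[where f="(*)"] D) simp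
  also have "\<dots> = (\<integral>\<^sup>+x. \<integral>\<^sup>+y. indicator C (U x) * indicator D (U x - y) \<partial>lborel \<partial>lborel)"
    by (simp add: nn_integral_cmult)
  also have "\<dots> = (\<integral>\<^sup>+y. \<integral>\<^sup>+x. indicator C (U x) * indicator D (U x - y) \<partial>lborel \<partial>lborel)"
    by (rule lborel_pair.Fubini') simp
  finally show ?thesis .
qed

text \<open>Shifting \<open>x\<close> and reflecting \<open>y\<close> in the double integral exchanges the roles of \<open>A\<close> and \<open>B\<close>.\<close>
lemma emeasure_linear_vimage_swap:
  fixes U :: "'a::euclidean_space \<Rightarrow> 'a"
  assumes "linear U" "surj U" and [measurable]: "A \<in> sets borel" "B \<in> sets borel"
  shows "emeasure lborel (U -` A) * emeasure lborel B = emeasure lborel (U -` B) * emeasure lborel A"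
proof -
  have [measurable]: "U \<in> borel_measurable borel"
    using assms(1) by (intro borel_measurable_continuous_onI linear_continuous_on)
      (simp add: linear_conv_bounded_linear)
  have "emeasure lborel (U -` A) * emeasure lborel B
      = (\<integral>\<^sup>+y. \<integral>\<^sup>+x. indicator A (U x) * indicator B (U x - y) \<partial>lborel \<partial>lborel)"
    by (rule emeasure_vimage_times_emeasure) auto
  also have "\<dots> = (\<integral>\<^sup>+y. \<integral>\<^sup>+x. indicator A (U x + y) * indicator B (U x) \<partial>lborel \<partial>lborel)"
  proof (rule nn_integral_cong)
    fix y
    obtain b where "y = U b" using \<open>surj U\<close> by auto
    then have "U (b + x) = U x + y" for x
      using linear_add[OF assms(1)] by (simp add: add.commute)
    then show "(\<integral>\<^sup>+x. indicator A (U x) * indicator B (U x - y) \<partial>lborel)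
        = (\<integral>\<^sup>+x. indicator A (U x + y) * indicator B (U x) \<partial>lborel)"
      using nn_integral_lborel_affine[of "\<lambda>x. indicator A (U x) * indicator B (U x - y)" 1 b] by simp
  qed
  also have "\<dots> = (\<integral>\<^sup>+y. \<integral>\<^sup>+x. indicator A (U x - y) * indicator B (U x) \<partial>lborel \<partial>lborel)"
    using nn_integral_lborel_reflect[of "\<lambda>y. \<integral>\<^sup>+x. indicator A (U x + y) * indicator B (U x) \<partial>lborel" 0]
    by simp
  also have "\<dots> = emeasure lborel (U -` B) * emeasure lborel A"
    by (subst emeasure_vimage_times_emeasure) (auto simp: mult.commute)
  finally show ?thesis .
qed

lemma lborel_distr_isometry:
  fixes U :: "'a::euclidean_space \<Rightarrow> 'a"
  assumes "linear U" and isometry: "\<And>x. norm (U x) = norm x"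
  shows "distr lborel borel U = lborel"
proof (rule measure_eqI)
  have [measurable]: "U \<in> borel_measurable borel"
    using assms(1) by (intro borel_measurable_continuous_onI linear_continuous_on)
      (simp add: linear_conv_bounded_linear)
  have "inj U"
    using assms by (simp add: linear_injective_0) (metis norm_eq_zero)
  then have "surj U"
    using assms(1) linear_injective_imp_surjective by blast
  fix A assume "A \<in> sets (distr lborel borel U)"
  then have [measurable]: "A \<in> sets borel" by simp
  let ?B = "ball (0::'a) 1"
  have "U -` ?B = ?B" by (auto simp: isometry)
  then have "emeasure lborel ?B * emeasure lborel (U -` A) = emeasure lborel ?B * emeasure lborel A"
    using emeasure_linear_vimage_swap[OF assms(1) \<open>surj U\<close>, of A ?B] by (simp add: mult.commute)
  moreover have "emeasure lborel ?B \<noteq> 0" "emeasure lborel ?B \<noteq> \<infinity>"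
    using emeasure_lborel_ball_finite[of "0::'a" 1] open_not_negligible[of ?B]
    by (auto simp: negligible_iff_emeasure0 emeasure_completion less_top)
  ultimately have "emeasure lborel (U -` A) = emeasure lborel A"
    by (simp add: ennreal_mult_cancel_left)
  then show "emeasure (distr lborel borel U) A = emeasure lborel A"
    by (simp add: emeasure_distr)
qed simp

lemma nn_integral_unitary:
  fixes f :: "complex ^ 'n \<Rightarrow> ennreal" and U :: "complex ^ 'n \<Rightarrow> complex ^ 'n"
  assumes [measurable]: "f \<in> borel_measurable borel" and U: "unitary U"
  shows "(\<integral>\<^sup>+x. f (U x) \<partial>lborel) = (\<integral>\<^sup>+x. f x \<partial>lborel)"
proof -
  have linear: "complex_linear U" using U by (simp add: unitary_def)
  note [measurable] = complex_linear_measurable[OF linear]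
  have "distr lborel borel U = lborel"
    by (rule lborel_distr_isometry[OF complex_linear_imp_linear[OF linear] norm_unitary[OF U]])
  then show ?thesis
    by (subst (2) \<open>distr lborel borel U = lborel\<close>[symmetric], subst nn_integral_distr) auto
qed

lemma
  fixes f :: "complex ^ 'n \<Rightarrow> 'b::{banach, second_countable_topology}"
  assumes [measurable]: "f \<in> borel_measurable borel" and "norm c = 1"
  shows integrable_rotation: "integrable lborel f \<Longrightarrow> integrable lborel (\<lambda>u. f (c *s u))"
    and integral_rotation: "(\<integral>u. f (c *s u) \<partial>lborel) = (\<integral>u. f u \<partial>lborel)"
proof -
  have lborel: "distr lborel borel (\<lambda>u. c *s u) = (lborel :: (complex ^ 'n) measure)"
    by (intro lborel_distr_isometry complex_linear_imp_linear complex_linear_homothety)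
      (simp add: norm_smult assms(2))
  show "integrable lborel f \<Longrightarrow> integrable lborel (\<lambda>u. f (c *s u))"
    by (rule integrable_distr[where M' = borel]) (auto simp: lborel)
  show "(\<integral>u. f (c *s u) \<partial>lborel) = (\<integral>u. f u \<partial>lborel)"
    by (subst (2) lborel[symmetric], subst integral_distr) auto
qed

definition diag_map :: "'n \<Rightarrow> real \<Rightarrow> real \<Rightarrow> complex ^ 'n \<Rightarrow> complex ^ 'n"
  where "diag_map k a b u = (\<chi> j. (if j = k then a else b) *\<^sub>R u $ j)"

lemma complex_linear_diag_map: "complex_linear (diag_map k a b)"
  unfolding complex_linear_def
  by (auto intro!: linearI simp: diag_map_def vec_eq_iff algebra_simps)

lemma prod_Basis_vec:
  fixes g :: "complex ^ 'n \<Rightarrow> 'b::comm_monoid_mult"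
  shows "(\<Prod>b\<in>Basis. g b) = (\<Prod>i\<in>UNIV. g (axis i 1) * g (axis i \<i>))"
proof -
  have Basis: "(Basis :: (complex ^ 'n) set) = (\<lambda>(i, u). axis i u) ` (UNIV \<times> {1, \<i>})"
    by (auto simp: Basis_vec_def Basis_complex_def)
  have inj: "inj_on (\<lambda>(i, u). axis i u :: complex ^ 'n) (UNIV \<times> {1, \<i>})"
    by (auto simp: inj_on_def axis_eq_axis)
  have "(\<Prod>b\<in>Basis. g b) = (\<Prod>(i, u)\<in>UNIV \<times> {1, \<i>}. g (axis i u))"
    unfolding Basis by (subst prod.reindex[OF inj]) (simp add: case_prod_unfold o_def)
  also have "\<dots> = (\<Prod>i\<in>UNIV. \<Prod>u\<in>{1, \<i>}. g (axis i u))"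
    by (rule prod.cartesian_product[symmetric])
  finally show ?thesis
    by simp
qed

lemma axis_nth_other: "i \<noteq> j \<Longrightarrow> axis i x $ j = 0"
  by (simp add: axis_def)

lemma nn_integral_diag_map:
  fixes f :: "complex ^ 'n \<Rightarrow> ennreal"
  assumes [measurable]: "f \<in> borel_measurable borel" and "a > 0" "b > 0"
  shows "(\<integral>\<^sup>+x. f x \<partial>lborel)
    = ennreal (a\<^sup>2 * (b\<^sup>2) ^ (CARD('n) - 1)) * (\<integral>\<^sup>+u. f (diag_map k a b u) \<partial>lborel)"
proof -
  define c where "c e = (if e $ k \<noteq> 0 then a else b)" for e :: "complex ^ 'n"
  have c_pos: "c j \<noteq> 0" "c j \<ge> 0" for j using assms by (auto simp: c_def)
  have coordinates: "0 + (\<Sum>j\<in>Basis. (c j * (x \<bullet> j)) *\<^sub>R j) = diag_map k a b x" for x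
  proof (rule euclidean_eqI)
    fix e :: "complex ^ 'n" assume e: "e \<in> Basis"
    then obtain i u where iu: "e = axis i u" "u \<in> {1, \<i>}"
      by (auto simp: Basis_vec_def Basis_complex_def)
    have "(0 + (\<Sum>j\<in>Basis. (c j * (x \<bullet> j)) *\<^sub>R j)) \<bullet> e = c e * (x \<bullet> e)"
      using e by (simp add: inner_sum_left_Basis)
    also have "\<dots> = diag_map k a b x \<bullet> e"
      using iu by (cases "i = k") (auto simp: c_def diag_map_def inner_axis axis_nth axis_nth_other)
    finally show "(0 + (\<Sum>j\<in>Basis. (c j * (x \<bullet> j)) *\<^sub>R j)) \<bullet> e = diag_map k a b x \<bullet> e" .
  qed
  have "(\<Prod>j\<in>Basis. \<bar>c j\<bar>) = (\<Prod>i\<in>UNIV. if i = k then a\<^sup>2 else b\<^sup>2)"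
    using assms by (subst prod_Basis_vec) (auto simp: c_def axis_def power2_eq_square intro!: prod.cong)
  also have "\<dots> = a\<^sup>2 * (\<Prod>i\<in>UNIV - {k}. b\<^sup>2)"
    by (subst prod.remove[of _ k]) (auto intro!: arg_cong2[where f="(*)"] prod.cong)
  finally have determinant: "(\<Prod>j\<in>Basis. \<bar>c j\<bar>) = a\<^sup>2 * (b\<^sup>2) ^ (CARD('n) - 1)"
    by (simp add: card_Diff_singleton)
  note [measurable] = complex_linear_measurable[OF complex_linear_diag_map]
  have pushforward: "lborel = density (distr lborel borel (diag_map k a b)) (\<lambda>_. ennreal (a\<^sup>2 * (b\<^sup>2) ^ (CARD('n) - 1)))"
    using lborel_affine_euclidean[of c 0] c_pos by (simp only: coordinates determinant) simp
  show ?thesis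
    by (subst pushforward) (simp add: nn_integral_density nn_integral_distr nn_integral_cmult)
qed

lemma norm_vec_squared: "(norm u)\<^sup>2 = (\<Sum>j\<in>UNIV. (norm (u $ j))\<^sup>2)" for u :: "complex ^ 'n"
  by (simp add: norm_vec_def L2_set_def sum_nonneg)

lemma norm_diag_map_squared:
  "(norm (diag_map k a b u))\<^sup>2 = a\<^sup>2 * (norm (u $ k))\<^sup>2 + b\<^sup>2 * (\<Sum>j\<in>UNIV - {k}. (norm (u $ j))\<^sup>2)"
proof -
  have "(norm (diag_map k a b u))\<^sup>2
      = (norm (diag_map k a b u $ k))\<^sup>2 + (\<Sum>j\<in>UNIV - {k}. (norm (diag_map k a b u $ j))\<^sup>2)"
    unfolding norm_vec_squared by (subst sum.remove[of _ k]) auto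
  also have "(\<Sum>j\<in>UNIV - {k}. (norm (diag_map k a b u $ j))\<^sup>2) = (\<Sum>j\<in>UNIV - {k}. b\<^sup>2 * (norm (u $ j))\<^sup>2)"
    by (intro sum.cong) (auto simp: diag_map_def power_mult_distrib)
  finally show ?thesis
    by (simp add: diag_map_def sum_distrib_left power_mult_distrib)
qed

lemma norm_vec_squared_split:
  "(norm u)\<^sup>2 = (norm (u $ k))\<^sup>2 + (\<Sum>j\<in>UNIV - {k}. (norm (u $ j))\<^sup>2)" for u :: "complex ^ 'n"
  unfolding norm_vec_squared by (rule sum.remove) auto

section \<open>The mean value property\<close>

lemma unit_circle_mean_value:
  assumes "f holomorphic_on UNIV"
  shows "((\<lambda>t. f (cis (2 * pi * t))) has_integral f 0) {0..1}"
proof -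
  have "((\<lambda>u. f u / (u - 0)) has_contour_integral (2 * of_real pi * \<i> * f 0)) (circlepath 0 1)"
    by (rule Cauchy_integral_circlepath_simple) (use assms holomorphic_on_subset in auto)
  then have "((\<lambda>t. f (circlepath 0 1 t) / circlepath 0 1 t * vector_derivative (circlepath 0 1) (at t within {0..1}))
     has_integral (2 * of_real pi * \<i> * f 0)) {0..1}"
    by (simp add: has_contour_integral_def)
  then have "((\<lambda>t. (2 * of_real pi * \<i>) * f (cis (2 * pi * t))) has_integral (2 * of_real pi * \<i> * f 0)) {0..1}"
    by (rule has_integral_eq[rotated])
      (simp add: vector_derivative_circlepath01, simp add: circlepath cis_conv_exp mult_ac)
  from has_integral_mult_right[OF this, of "inverse (2 * of_real pi * \<i>)"] show ?thesis
    by (simp add: field_simps)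
qed

lemma entire_circle_average:
  assumes h: "entire h"
  shows "(\<integral>t. indicator {0..1} t *\<^sub>R h (cis (2 * pi * t) *s u) \<partial>lborel) = h 0"
proof -
  have "continuous_on {0..1} (\<lambda>t. h (cis (2 * pi * t) *s u))"
    by (intro continuous_on_compose2[OF entire_imp_continuous_on[OF h, of UNIV]] continuous_intros) auto
  then have "set_integrable lborel {0..1} (\<lambda>t. h (cis (2 * pi * t) *s u))"
    by (rule borel_integrable_atLeastAtMost')
  from set_borel_integral_eq_integral(2)[OF this]
  have "(\<integral>t. indicator {0..1} t *\<^sub>R h (cis (2 * pi * t) *s u) \<partial>lborel)
      = integral {0..1} (\<lambda>t. h (cis (2 * pi * t) *s u))"
    by (simp add: set_lebesgue_integral_def)
  also have "\<dots> = h (0 *s u)"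
    using unit_circle_mean_value[OF entire_slice_holomorphic[OF h, of u]] by (rule integral_unique)
  finally show ?thesis by simp
qed

lemma integrable_circle_rotations:
  fixes h :: "complex ^ 'n \<Rightarrow> complex" and \<phi> :: "complex ^ 'n \<Rightarrow> real"
  assumes h: "entire h" and [measurable]: "\<phi> \<in> borel_measurable borel"
    and invariant: "\<And>c u. norm c = 1 \<Longrightarrow> \<phi> (c *s u) = \<phi> u"
    and integrable: "integrable lborel (\<lambda>u. \<phi> u *\<^sub>R h u)"
  shows "integrable (lborel \<Otimes>\<^sub>M lborel)
    (\<lambda>(t, u). indicator {0..1::real} t *\<^sub>R \<phi> u *\<^sub>R h (cis (2 * pi * t) *s u))"
    (is "integrable _ ?G")
proof (rule lborel_pair.Fubini_integrable)
  note [measurable] = entire_imp_borel_measurable[OF h]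
  have "continuous_on UNIV (\<lambda>p :: real \<times> (complex ^ 'n). h (cis (2 * pi * fst p) *s snd p))"
    by (intro continuous_on_compose2[OF entire_imp_continuous_on[OF h, of UNIV]] continuous_intros) auto
  then have [measurable]: "(\<lambda>p :: real \<times> (complex ^ 'n). h (cis (2 * pi * fst p) *s snd p))
      \<in> borel_measurable (lborel \<Otimes>\<^sub>M lborel)"
    unfolding lborel_prod by (simp add: borel_measurable_continuous_onI)
  show "?G \<in> borel_measurable (lborel \<Otimes>\<^sub>M lborel)"
    unfolding case_prod_unfold by measurable
  have "(\<integral>u. norm (\<phi> u *\<^sub>R h (cis (2 * pi * t) *s u)) \<partial>lborel) = (\<integral>u. norm (\<phi> u *\<^sub>R h u) \<partial>lborel)" for t
    using integral_rotation[of "\<lambda>u. norm (\<phi> u *\<^sub>R h u)" "cis (2 * pi * t)"] by (simp add: invariant)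
  then have "(\<lambda>t. \<integral>u. norm (?G (t, u)) \<partial>lborel)
      = (\<lambda>t. indicator {0..1} t *\<^sub>R (\<integral>u. norm (\<phi> u *\<^sub>R h u) \<partial>lborel))"
    by (auto simp: fun_eq_iff indicator_def)
  then show "integrable lborel (\<lambda>t. \<integral>u. norm (?G (t, u)) \<partial>lborel)"
    by simp
  have rotation: "integrable lborel (\<lambda>u. \<phi> u *\<^sub>R h (cis (2 * pi * t) *s u))" for t
    using integrable_rotation[OF _ _ integrable, of "cis (2 * pi * t)"] by (simp add: invariant)
  show "AE t in lborel. integrable lborel (\<lambda>u. ?G (t, u))"
    unfolding case_prod_conv by (intro AE_I2 integrable_scaleR_right rotation)
qed

lemma entire_mean_value:
  fixes h :: "complex ^ 'n \<Rightarrow> complex" and \<phi> :: "complex ^ 'n \<Rightarrow> real"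
  assumes h: "entire h" and [measurable]: "\<phi> \<in> borel_measurable borel"
    and invariant: "\<And>c u. norm c = 1 \<Longrightarrow> \<phi> (c *s u) = \<phi> u"
    and integrable: "integrable lborel (\<lambda>u. \<phi> u *\<^sub>R h u)"
  shows "(\<integral>u. \<phi> u *\<^sub>R h u \<partial>lborel) = (\<integral>u. \<phi> u \<partial>lborel) *\<^sub>R h 0"
proof -
  note [measurable] = entire_imp_borel_measurable[OF h]
  define G where "G t u = indicator {0..1::real} t *\<^sub>R \<phi> u *\<^sub>R h (cis (2 * pi * t) *s u)" for t u
  have rotation: "(\<integral>u. \<phi> u *\<^sub>R h (cis (2 * pi * t) *s u) \<partial>lborel) = (\<integral>u. \<phi> u *\<^sub>R h u \<partial>lborel)" for t
    using integral_rotation[of "\<lambda>u. \<phi> u *\<^sub>R h u" "cis (2 * pi * t)"] by (simp add: invariant)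
  have average: "(\<integral>t. G t u \<partial>lborel) = \<phi> u *\<^sub>R h 0" for u
  proof -
    have "(\<integral>t. G t u \<partial>lborel) = (\<integral>t. \<phi> u *\<^sub>R indicator {0..1} t *\<^sub>R h (cis (2 * pi * t) *s u) \<partial>lborel)"
      by (simp add: G_def mult.commute)
    also have "\<dots> = \<phi> u *\<^sub>R h 0"
      by (subst integral_scaleR_right) (simp add: entire_circle_average[OF h])
    finally show ?thesis .
  qed
  have "(\<integral>u. \<phi> u *\<^sub>R h u \<partial>lborel)
      = (\<integral>t. indicator {0..1} t *\<^sub>R (\<integral>u. \<phi> u *\<^sub>R h u \<partial>lborel) \<partial>(lborel::real measure))"
    by simp
  also have "\<dots> = (\<integral>t. (\<integral>u. G t u \<partial>lborel) \<partial>lborel)"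
    unfolding G_def by (intro Bochner_Integration.integral_cong refl) (simp only: integral_scaleR_right rotation)
  also have "\<dots> = (\<integral>u. (\<integral>t. G t u \<partial>lborel) \<partial>lborel)"
    using lborel_pair.Fubini_integral[of G] integrable_circle_rotations[OF h assms(2) invariant integrable]
    by (simp add: G_def case_prod_unfold)
  also have "\<dots> = (\<integral>u. \<phi> u *\<^sub>R h 0 \<partial>lborel)"
    by (simp only: average)
  also have "\<dots> = (\<integral>u. \<phi> u \<partial>lborel) *\<^sub>R h 0"
    by (cases "h 0 = 0") (simp_all add: scaleR_conv_of_real)
  finally show ?thesis .
qed

lemma entire_sub_mean_value_square:
  fixes h :: "complex ^ 'n \<Rightarrow> complex" and \<phi> :: "complex ^ 'n \<Rightarrow> real"
  assumes h: "entire h" and [measurable]: "\<phi> \<in> borel_measurable borel"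
    and invariant: "\<And>c u. norm c = 1 \<Longrightarrow> \<phi> (c *s u) = \<phi> u"
    and nonneg: "\<And>u. \<phi> u \<ge> 0"
  shows "ennreal ((norm (h 0))\<^sup>2 * (\<integral>u. \<phi> u \<partial>lborel)) \<le> (\<integral>\<^sup>+u. ennreal (\<phi> u * (norm (h u))\<^sup>2) \<partial>lborel)"
proof (cases "(\<integral>\<^sup>+u. ennreal (\<phi> u * (norm (h u))\<^sup>2) \<partial>lborel) = \<infinity>")
  case False
  note [measurable] = entire_imp_borel_measurable[OF h]
  have integrable: "integrable lborel (\<lambda>u. \<phi> u *\<^sub>R (h u)\<^sup>2)"
    using False by (intro integrableI_bounded) (auto simp: norm_power nonneg less_top)
  have "(norm (h 0))\<^sup>2 * (\<integral>u. \<phi> u \<partial>lborel) = norm (\<integral>u. \<phi> u *\<^sub>R (h u)\<^sup>2 \<partial>lborel)"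
    using entire_mean_value[OF entire_power[OF h, of 2] assms(2) invariant integrable]
    by (simp add: norm_power nonneg integral_nonneg_AE)
  also have "\<dots> \<le> (\<integral>u. norm (\<phi> u *\<^sub>R (h u)\<^sup>2) \<partial>lborel)"
    by (rule integral_norm_bound)
  finally have "ennreal ((norm (h 0))\<^sup>2 * (\<integral>u. \<phi> u \<partial>lborel)) \<le> ennreal (\<integral>u. norm (\<phi> u *\<^sub>R (h u)\<^sup>2) \<partial>lborel)"
    by (rule ennreal_leI)
  also have "\<dots> = (\<integral>\<^sup>+u. ennreal (norm (\<phi> u *\<^sub>R (h u)\<^sup>2)) \<partial>lborel)"
    by (rule nn_integral_eq_integral[symmetric]) (use integrable_norm[OF integrable] in auto)
  also have "\<dots> = (\<integral>\<^sup>+u. ennreal (\<phi> u * (norm (h u))\<^sup>2) \<partial>lborel)"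
    by (simp add: norm_power nonneg)
  finally show ?thesis .
qed simp

section \<open>Slow variation of the weight\<close>

lemma mvt_halfline:
  fixes f f' :: "real \<Rightarrow> real"
  assumes "0 \<le> x" "0 \<le> y" and deriv: "\<And>t. t \<ge> 0 \<Longrightarrow> (f has_real_derivative f' t) (at t within {0..})"
  obtains t where "min x y \<le> t" "t \<le> max x y" "f y - f x = f' t * (y - x)"
proof -
  have ordered: "\<exists>t. a \<le> t \<and> t \<le> b \<and> f b - f a = f' t * (b - a)" if "0 \<le> a" "a \<le> b" for a b
  proof -
    have "\<exists>t\<in>{a..b}. f b - f a = (\<lambda>h. f' t * h) (b - a)"
    proof (rule mvt_very_simple[OF that(2)])
      fix t assume "a \<le> t" "t \<le> b"
      then have "(f has_real_derivative f' t) (at t within {a..b})"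
        by (intro DERIV_subset[OF deriv]) (use that in auto)
      then show "(f has_derivative (\<lambda>h. f' t * h)) (at t within {a..b})"
        by (simp add: has_field_derivative_def)
    qed
    then show ?thesis by auto
  qed
  show ?thesis
  proof (cases "x \<le> y")
    case True
    then show ?thesis using ordered[of x y] assms(1) that by auto
  next
    case False
    then obtain t where "y \<le> t" "t \<le> x" "f x - f y = f' t * (x - y)"
      using ordered[of y x] assms(2) by auto
    then show ?thesis using that[of t] False by (simp add: algebra_simps)
  qed
qed

lemma nondecreasing_halfline:
  fixes f f' :: "real \<Rightarrow> real"
  assumes "0 \<le> x" "x \<le> y" and deriv: "\<And>t. t \<ge> 0 \<Longrightarrow> (f has_real_derivative f' t) (at t within {0..})"
    and nonneg: "\<And>t. t \<ge> 0 \<Longrightarrow> f' t \<ge> 0"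
  shows "f x \<le> f y"
proof -
  have "0 \<le> y" using assms(1,2) by simp
  then obtain t where "min x y \<le> t" "f y - f x = f' t * (y - x)"
    using mvt_halfline[OF assms(1) _ deriv] by blast
  moreover from this have "f' t * (y - x) \<ge> 0"
    using assms(1,2) by (intro mult_nonneg_nonneg nonneg) auto
  ultimately show ?thesis by simp
qed

text \<open>The last assumption follows from the growth condition because \<open>1 + \<eta> < 3/2\<close> and \<open>\<Phi>'\<close> is bounded below.\<close>
locale growth =
  fixes \<Psi> \<Psi>' \<Psi>'' \<Phi>' \<Phi>'' :: "real \<Rightarrow> real" and growth_const :: real
  assumes Psi_deriv: "\<And>x. x \<ge> 0 \<Longrightarrow> (\<Psi> has_real_derivative \<Psi>' x) (at x within {0..})"
    and Psi'_deriv: "\<And>x. x \<ge> 0 \<Longrightarrow> (\<Psi>' has_real_derivative \<Psi>'' x) (at x within {0..})"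
    and Phi'_deriv: "\<And>x. x \<ge> 0 \<Longrightarrow> (\<Phi>' has_real_derivative \<Phi>'' x) (at x within {0..})"
    and Phi'_eq: "\<And>x. x \<ge> 0 \<Longrightarrow> \<Phi>' x = \<Psi>' x + x * \<Psi>'' x"
    and Psi'_0_pos: "\<Psi>' 0 > 0"
    and Psi''_nonneg: "\<And>x. x \<ge> 0 \<Longrightarrow> \<Psi>'' x \<ge> 0"
    and Psi''_mono: "\<And>x y. 0 \<le> x \<Longrightarrow> x \<le> y \<Longrightarrow> \<Psi>'' x \<le> \<Psi>'' y"
    and Phi''_nonneg: "\<And>x. x \<ge> 0 \<Longrightarrow> \<Phi>'' x \<ge> 0"
    and growth_const_pos: "growth_const > 0"
    and Phi''_le: "\<And>x. x \<ge> 0 \<Longrightarrow> sqrt (1 + x) * \<Phi>'' x \<le> growth_const * (\<Phi>' x * sqrt (\<Phi>' x))"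
begin

definition \<Phi> :: "real \<Rightarrow> real" where "\<Phi> x = x * \<Psi>' x"

lemma Psi_continuous: "continuous_on {0..} \<Psi>"
  by (rule DERIV_continuous_on[of _ _ \<Psi>']) (use Psi_deriv in auto)

lemma Psi'_continuous: "continuous_on {0..} \<Psi>'"
  by (rule DERIV_continuous_on[of _ _ \<Psi>'']) (use Psi'_deriv in auto)

lemma Phi'_continuous: "continuous_on {0..} \<Phi>'"
  by (rule DERIV_continuous_on[of _ _ \<Phi>'']) (use Phi'_deriv in auto)

lemma Psi'_mono: "0 \<le> x \<Longrightarrow> x \<le> y \<Longrightarrow> \<Psi>' x \<le> \<Psi>' y"
  by (rule nondecreasing_halfline[OF _ _ Psi'_deriv Psi''_nonneg])

lemma Psi'_ge: "x \<ge> 0 \<Longrightarrow> \<Psi>' x \<ge> \<Psi>' 0"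
  using Psi'_mono[of 0 x] by simp

lemma Psi'_pos: "x \<ge> 0 \<Longrightarrow> \<Psi>' x > 0"
  using Psi'_ge[of x] Psi'_0_pos by simp

lemma Phi'_mono: "0 \<le> x \<Longrightarrow> x \<le> y \<Longrightarrow> \<Phi>' x \<le> \<Phi>' y"
  by (rule nondecreasing_halfline[OF _ _ Phi'_deriv Phi''_nonneg])

lemma Psi'_le_Phi': "x \<ge> 0 \<Longrightarrow> \<Psi>' x \<le> \<Phi>' x"
  by (simp add: Phi'_eq Psi''_nonneg)

lemma Phi'_ge: "x \<ge> 0 \<Longrightarrow> \<Phi>' x \<ge> \<Psi>' 0"
  using Psi'_ge[of x] Psi'_le_Phi'[of x] by simp

lemma Phi'_pos: "x \<ge> 0 \<Longrightarrow> \<Phi>' x > 0"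
  using Phi'_ge[of x] Psi'_0_pos by simp

lemma Psi_ge:
  assumes "x \<ge> 0" shows "\<Psi> x \<ge> \<Psi> 0 + \<Psi>' 0 * x"
proof -
  obtain t where t: "0 \<le> t" "\<Psi> x - \<Psi> 0 = \<Psi>' t * (x - 0)"
    using mvt_halfline[of 0 x, OF _ assms Psi_deriv] assms by auto
  have "\<Psi>' 0 * x \<le> \<Psi>' t * x"
    using Psi'_ge[OF t(1)] assms by (intro mult_right_mono)
  then show ?thesis using t by simp
qed

lemma Phi_deriv:
  assumes "x \<ge> 0" shows "(\<Phi> has_real_derivative \<Phi>' x) (at x within {0..})"
  unfolding \<Phi>_def using Psi'_deriv[OF assms]
  by (auto intro!: derivative_eq_intros simp: Phi'_eq[OF assms])

lemma Phi_diff_ge: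
  assumes "0 \<le> x" "x \<le> y" shows "(y - x) * \<Phi>' x \<le> \<Phi> y - \<Phi> x"
proof -
  obtain t where t: "min x y \<le> t" "\<Phi> y - \<Phi> x = \<Phi>' t * (y - x)"
    using mvt_halfline[of x y, OF _ _ Phi_deriv] assms by auto
  have "(y - x) * \<Phi>' x \<le> (y - x) * \<Phi>' t"
    using t(1) assms by (intro mult_left_mono Phi'_mono) auto
  then show ?thesis using t(2) by (simp add: mult.commute)
qed

lemma Phi_nonneg: "x \<ge> 0 \<Longrightarrow> \<Phi> x \<ge> 0"
  using Psi'_pos[of x] by (simp add: \<Phi>_def)

lemma Phi_mono: "0 \<le> x \<Longrightarrow> x \<le> y \<Longrightarrow> \<Phi> x \<le> \<Phi> y"
  by (rule nondecreasing_halfline[OF _ _ Phi_deriv less_imp_le[OF Phi'_pos]])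

text \<open>The length on which the weight is essentially constant near \<open>x = |z|\<^sup>2\<close>.\<close>
definition scale :: "real \<Rightarrow> real" where "scale x = sqrt ((1 + x) / \<Phi>' x)"

lemma scale_pos: "x \<ge> 0 \<Longrightarrow> scale x > 0"
  using Phi'_pos[of x] by (simp add: scale_def)

lemma scale_squared: "x \<ge> 0 \<Longrightarrow> (scale x)\<^sup>2 = (1 + x) / \<Phi>' x"
  using Phi'_pos[of x] by (simp add: scale_def)

lemma scale_eq: "scale x = sqrt (1 + x) / sqrt (\<Phi>' x)"
  by (simp add: scale_def real_sqrt_divide)

lemma sqrt_diff_le:
  fixes a b :: real
  assumes "0 < a" "a \<le> b" shows "sqrt b - sqrt a \<le> (b - a) / (2 * sqrt a)"
proof -
  have "(sqrt b - sqrt a)\<^sup>2 \<ge> 0" by simp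
  then have "2 * (sqrt a * sqrt b) \<le> a + b"
    using assms by (simp add: power2_diff algebra_simps)
  moreover have "(sqrt b - sqrt a) * (2 * sqrt a) = 2 * (sqrt a * sqrt b) - 2 * (sqrt a * sqrt a)"
    by (simp add: algebra_simps)
  ultimately have "(sqrt b - sqrt a) * (2 * sqrt a) \<le> b - a"
    using assms by simp
  then show ?thesis
    using assms by (simp add: pos_le_divide_eq)
qed

text \<open>The growth condition says that \<open>\<Phi>'\<^sup>-\<^sup>1\<^sup>/\<^sup>2\<close>, as a function of \<open>sqrt (1 + x)\<close>, is Lipschitz.\<close>
lemma inverse_sqrt_Phi'_diff_le:
  assumes "0 \<le> x" "x \<le> y"
  shows "1 / sqrt (\<Phi>' x) - 1 / sqrt (\<Phi>' y) \<le> growth_const * (y - x) / (2 * sqrt (1 + x))"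
proof -
  define g where "g t = 1 / sqrt (\<Phi>' t) + growth_const * sqrt (1 + t)" for t
  define g' where "g' t = - (\<Phi>'' t / (2 * (\<Phi>' t * sqrt (\<Phi>' t)))) + growth_const / (2 * sqrt (1 + t))" for t
  have "(g has_real_derivative g' t) (at t within {0..})" if "t \<ge> 0" for t
    unfolding g_def g'_def using Phi'_pos[OF that] that
    by (auto intro!: derivative_eq_intros Phi'_deriv[OF that] simp: field_simps)
  moreover have "g' t \<ge> 0" if "t \<ge> 0" for t
    using Phi''_le[OF that] Phi'_pos[OF that] that by (simp add: g'_def field_simps)
  ultimately have "g x \<le> g y"
    by (rule nondecreasing_halfline[OF assms])
  then have "1 / sqrt (\<Phi>' x) - 1 / sqrt (\<Phi>' y) \<le> growth_const * (sqrt (1 + y) - sqrt (1 + x))"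
    by (simp add: g_def algebra_simps)
  also have "\<dots> \<le> growth_const * ((y - x) / (2 * sqrt (1 + x)))"
    using sqrt_diff_le[of "1 + x" "1 + y"] assms growth_const_pos by (intro mult_left_mono) auto
  finally show ?thesis by simp
qed

definition stability_radius :: real
  where "stability_radius = min (1 / growth_const) (sqrt (\<Psi>' 0) / 2)"

lemma stability_radius_pos: "stability_radius > 0"
  using growth_const_pos Psi'_0_pos by (simp add: stability_radius_def)

lemma growth_const_stability_le:
  assumes "x \<ge> 0" "d \<le> stability_radius * scale x" shows "growth_const * d \<le> scale x"
proof -
  have "d \<le> 1 / growth_const * scale x"
    using scale_pos[OF assms(1)]
    by (intro order_trans[OF assms(2)] mult_right_mono) (auto simp: stability_radius_def)
  then show ?thesis using growth_const_pos by (simp add: field_simps)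
qed

lemma stability_radius_scale_le:
  assumes "x \<ge> 0" shows "stability_radius * scale x \<le> (1 + x) / 2"
proof -
  have "stability_radius * scale x \<le> sqrt (\<Psi>' 0) / 2 * scale x"
    using scale_pos[OF assms] by (intro mult_right_mono) (auto simp: stability_radius_def)
  also have "\<dots> = sqrt (1 + x) * (sqrt (\<Psi>' 0) / sqrt (\<Phi>' x)) / 2"
    by (simp add: scale_eq mult.commute)
  also have "\<dots> \<le> (1 + x) * 1 / 2"
    using assms Phi'_ge[OF assms] Phi'_pos[OF assms] Psi'_0_pos
    by (intro divide_right_mono mult_mono) (auto simp: real_le_lsqrt power2_eq_square algebra_simps)
  finally show ?thesis by simp
qed

lemma Phi'_le_forward:
  assumes "0 \<le> x" "x \<le> y" "y - x \<le> stability_radius * scale x"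
  shows "\<Phi>' y \<le> 4 * \<Phi>' x"
proof -
  have pos: "sqrt (\<Phi>' x) > 0" "sqrt (\<Phi>' y) > 0" "sqrt (1 + x) > 0"
    using assms Phi'_pos by auto
  have "growth_const * (y - x) / (2 * sqrt (1 + x)) \<le> scale x / (2 * sqrt (1 + x))"
    using growth_const_stability_le[OF assms(1,3)] pos by (intro divide_right_mono) auto
  also have "\<dots> = 1 / (2 * sqrt (\<Phi>' x))" using pos by (simp add: scale_eq)
  finally have "1 / sqrt (\<Phi>' x) - 1 / sqrt (\<Phi>' y) \<le> 1 / (2 * sqrt (\<Phi>' x))"
    using inverse_sqrt_Phi'_diff_le[OF assms(1,2)] by simp
  then have "sqrt (\<Phi>' y) \<le> sqrt (4 * \<Phi>' x)"
    using pos by (simp add: field_simps real_sqrt_mult)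
  then show ?thesis by simp
qed

lemma Phi'_le_backward:
  assumes "0 \<le> y" "y \<le> x" "x - y \<le> stability_radius * scale x"
  shows "\<Phi>' x \<le> 4 * \<Phi>' y"
proof -
  have x: "x \<ge> 0" using assms by simp
  have pos: "sqrt (\<Phi>' x) > 0" "sqrt (\<Phi>' y) > 0" "sqrt (1 + x) > 0" "sqrt (1 + y) > 0"
    using assms Phi'_pos x by auto
  have "sqrt (1 + x) \<le> sqrt (2\<^sup>2 * (1 + y))"
    by (rule real_sqrt_le_mono) (use stability_radius_scale_le[OF x] assms in simp)
  then have sqrt_le: "sqrt (1 + x) \<le> 2 * sqrt (1 + y)" by (simp only: real_sqrt_mult real_sqrt_abs)
  have "growth_const * (x - y) / (2 * sqrt (1 + y)) \<le> scale x / (2 * sqrt (1 + y))"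
    using growth_const_stability_le[OF x assms(3)] pos by (intro divide_right_mono) auto
  also have "\<dots> \<le> 1 / sqrt (\<Phi>' x)" using pos sqrt_le by (simp add: scale_eq field_simps)
  finally have "1 / sqrt (\<Phi>' y) - 1 / sqrt (\<Phi>' x) \<le> 1 / sqrt (\<Phi>' x)"
    using inverse_sqrt_Phi'_diff_le[OF assms(1,2)] by simp
  then have "sqrt (\<Phi>' x) \<le> sqrt (4 * \<Phi>' y)"
    using pos by (simp add: field_simps real_sqrt_mult)
  then show ?thesis by simp
qed

definition scale_const :: real
  where "scale_const = sqrt (16 / stability_radius\<^sup>2 + \<Phi>' 1 / (\<Psi>' 0)\<^sup>2)"

lemma scale_const_pos: "scale_const > 0"
  using stability_radius_pos Psi'_0_pos Phi'_pos[of 1] by (simp add: scale_const_def add_pos_nonneg)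

lemma scale_const_squared: "scale_const\<^sup>2 = 16 / stability_radius\<^sup>2 + \<Phi>' 1 / (\<Psi>' 0)\<^sup>2"
  using Phi'_pos[of 1] by (simp add: scale_const_def)

text \<open>For \<open>x \<ge> 1\<close> the increment of \<open>\<Phi> x = x \<Psi>' x\<close> over one step of length comparable to \<open>scale x\<close> bounds \<open>\<Phi>'\<close>.\<close>
lemma stability_radius_Phi'_le:
  assumes "x \<ge> 1" shows "stability_radius / 4 * (scale x * \<Phi>' x) \<le> (1 + x) * \<Psi>' x"
proof -
  define y where "y = x - stability_radius * scale x"
  have x: "x \<ge> 0" using assms by simp
  have y: "0 \<le> y" "y \<le> x" "x - y = stability_radius * scale x"
    using stability_radius_scale_le[OF x] assms stability_radius_pos scale_pos[OF x] by (auto simp: y_def)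
  have "stability_radius / 4 * (scale x * \<Phi>' x) = (x - y) * (\<Phi>' x / 4)" by (simp add: y)
  also have "\<dots> \<le> (x - y) * \<Phi>' y"
    using Phi'_le_backward[of y x] y by (intro mult_left_mono) auto
  also have "\<dots> \<le> \<Phi> x - \<Phi> y" by (rule Phi_diff_ge) (use y in auto)
  also have "\<dots> \<le> (1 + x) * \<Psi>' x"
    using Phi_nonneg[of y] y Psi'_pos[OF x] by (simp add: \<Phi>_def algebra_simps)
  finally show ?thesis .
qed

lemma Phi'_le_Psi'_squared:
  assumes x: "x \<ge> 0" shows "\<Phi>' x \<le> scale_const\<^sup>2 * ((1 + x) * (\<Psi>' x)\<^sup>2)"
proof (cases "x \<ge> 1")
  case True
  have "(stability_radius / 4)\<^sup>2 * ((1 + x) * \<Phi>' x) = (stability_radius / 4 * (scale x * \<Phi>' x))\<^sup>2"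
    using Phi'_pos[OF x] scale_squared[OF x] by (simp only: power_mult_distrib) (simp add: power2_eq_square)
  also have "\<dots> \<le> ((1 + x) * \<Psi>' x)\<^sup>2"
    using stability_radius_Phi'_le[OF True] stability_radius_pos scale_pos[OF x] Phi'_pos[OF x]
    by (intro power_mono) auto
  finally have "(stability_radius / 4)\<^sup>2 * \<Phi>' x * (1 + x) \<le> ((1 + x) * (\<Psi>' x)\<^sup>2) * (1 + x)"
    by (simp add: power2_eq_square algebra_simps)
  then have "(stability_radius / 4)\<^sup>2 * \<Phi>' x \<le> (1 + x) * (\<Psi>' x)\<^sup>2"
    using x by (simp add: mult_le_cancel_right)
  then have "\<Phi>' x \<le> 16 / stability_radius\<^sup>2 * ((1 + x) * (\<Psi>' x)\<^sup>2)"
    using stability_radius_pos by (simp add: field_simps power2_eq_square)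
  also have "\<dots> \<le> scale_const\<^sup>2 * ((1 + x) * (\<Psi>' x)\<^sup>2)"
    using x Phi'_pos[of 1] by (intro mult_right_mono) (auto simp: scale_const_squared)
  finally show ?thesis .
next
  case False
  have "\<Phi>' x * 1 \<le> \<Phi>' 1 * ((1 + x) * (\<Psi>' x)\<^sup>2 / (\<Psi>' 0)\<^sup>2)"
  proof (rule mult_mono)
    show "\<Phi>' x \<le> \<Phi>' 1" using False x by (intro Phi'_mono) auto
    have "(\<Psi>' 0)\<^sup>2 \<le> (\<Psi>' x)\<^sup>2" using Psi'_ge[OF x] Psi'_0_pos by (intro power_mono) auto
    moreover have "1 * (\<Psi>' x)\<^sup>2 \<le> (1 + x) * (\<Psi>' x)\<^sup>2" using x by (intro mult_right_mono) auto
    ultimately show "1 \<le> (1 + x) * (\<Psi>' x)\<^sup>2 / (\<Psi>' 0)\<^sup>2" using Psi'_0_pos by (simp add: field_simps)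
  qed (use Phi'_pos[of 1] x in auto)
  also have "\<dots> \<le> scale_const\<^sup>2 * ((1 + x) * (\<Psi>' x)\<^sup>2)"
    using x stability_radius_pos Psi'_0_pos by (simp add: scale_const_squared distrib_right)
  finally show ?thesis by simp
qed

lemma inverse_Psi'_le_scale:
  assumes "x \<ge> 0" shows "1 / \<Psi>' x \<le> scale_const * scale x"
proof -
  have "sqrt (\<Phi>' x) \<le> sqrt (scale_const\<^sup>2 * ((1 + x) * (\<Psi>' x)\<^sup>2))"
    using Phi'_le_Psi'_squared[OF assms] by simp
  also have "\<dots> = scale_const * sqrt (1 + x) * \<Psi>' x"
    using Psi'_pos[OF assms] scale_const_pos by (simp add: real_sqrt_mult)
  finally show ?thesis
    using Psi'_pos[OF assms] Phi'_pos[OF assms] by (simp add: scale_eq field_simps)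
qed

definition Psi''_const :: real where "Psi''_const = 2 + 2 * \<Psi>'' 1 / \<Psi>' 0"

lemma Psi''_const_pos: "Psi''_const > 0"
  using Psi'_0_pos Psi''_nonneg[of 1] by (simp add: Psi''_const_def add_pos_nonneg)

lemma Psi''_le_Phi':
  assumes x: "x \<ge> 0" shows "(1 + x) * \<Psi>'' x \<le> Psi''_const * \<Phi>' x"
proof (cases "x \<ge> 1")
  case True
  have "(1 + x) * \<Psi>'' x \<le> 2 * (x * \<Psi>'' x)"
    using mult_right_mono[OF True Psi''_nonneg[OF x]] by (simp add: algebra_simps)
  also have "\<dots> \<le> 2 * \<Phi>' x" using Psi'_pos[OF x] by (simp add: Phi'_eq x)
  also have "\<dots> \<le> Psi''_const * \<Phi>' x"
    using Phi'_pos[OF x] Psi'_0_pos Psi''_nonneg[of 1] by (intro mult_right_mono) (auto simp: Psi''_const_def)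
  finally show ?thesis .
next
  case False
  have "(1 + x) * \<Psi>'' x \<le> 2 * \<Psi>'' 1"
    using False x Psi''_mono[of x 1] Psi''_nonneg[OF x] by (intro mult_mono) auto
  also have "\<dots> \<le> 2 * \<Psi>'' 1 / \<Psi>' 0 * \<Phi>' x"
    using mult_right_mono[OF Phi'_ge[OF x], of "\<Psi>'' 1"] Psi'_0_pos Psi''_nonneg[of 1] by (simp add: field_simps)
  also have "\<dots> \<le> Psi''_const * \<Phi>' x"
    using Phi'_pos[OF x] by (intro mult_right_mono) (auto simp: Psi''_const_def)
  finally show ?thesis .
qed

lemma Psi''_le_scale:
  assumes "x \<ge> 0" shows "\<Psi>'' x \<le> Psi''_const / (scale x)\<^sup>2"
  using Psi''_le_Phi'[OF assms] assms by (simp add: scale_squared[OF assms] field_simps)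

lemma Psi'_diff_le:
  assumes "x \<ge> 0" "y \<ge> 0" "\<bar>y - x\<bar> \<le> stability_radius * scale x"
  shows "\<bar>\<Psi>' y - \<Psi>' x\<bar> \<le> 4 * Psi''_const / (scale x)\<^sup>2 * \<bar>y - x\<bar>"
proof -
  obtain t where t: "min x y \<le> t" "t \<le> max x y" "\<Psi>' y - \<Psi>' x = \<Psi>'' t * (y - x)"
    using mvt_halfline[OF assms(1,2) Psi'_deriv] by blast
  have t_nonneg: "t \<ge> 0" using t assms by simp
  have "(1 + x) * \<Psi>'' t \<le> (1 + max x y) * \<Psi>'' (max x y)"
    using t assms Psi''_mono[OF t_nonneg t(2)] Psi''_nonneg[OF t_nonneg] by (intro mult_mono) auto
  also have "\<dots> \<le> Psi''_const * \<Phi>' (max x y)" using assms by (intro Psi''_le_Phi') simp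
  also have "\<dots> \<le> Psi''_const * (4 * \<Phi>' x)"
    using Phi'_le_forward[of x y] assms Psi''_const_pos Phi'_pos[OF assms(1)]
    by (intro mult_left_mono) (auto simp: max_def)
  finally have "\<Psi>'' t \<le> 4 * Psi''_const / (scale x)\<^sup>2"
    using assms by (simp add: scale_squared field_simps)
  moreover have "\<bar>\<Psi>' y - \<Psi>' x\<bar> = \<Psi>'' t * \<bar>y - x\<bar>"
    using t(3) Psi''_nonneg[OF t_nonneg] by (simp add: abs_mult)
  ultimately show ?thesis by (simp only: mult_right_mono abs_ge_zero)
qed

definition near_radius :: real
  where "near_radius = min stability_radius (1 / (8 * Psi''_const * scale_const))"

lemma near_radius_pos: "near_radius > 0" and near_radius_le: "near_radius \<le> stability_radius"
  using stability_radius_pos scale_const_pos Psi''_const_pos by (auto simp: near_radius_def)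

definition near :: "real \<Rightarrow> real \<Rightarrow> bool"
  where "near x y \<longleftrightarrow> 0 \<le> x \<and> 0 \<le> y \<and> \<bar>y - x\<bar> \<le> near_radius * scale x"

lemma nearD:
  assumes "near x y"
  shows "x \<ge> 0" "y \<ge> 0" "\<bar>y - x\<bar> \<le> near_radius * scale x" "\<bar>y - x\<bar> \<le> stability_radius * scale x"
proof -
  show "x \<ge> 0" "y \<ge> 0" "\<bar>y - x\<bar> \<le> near_radius * scale x" using assms by (auto simp: near_def)
  then show "\<bar>y - x\<bar> \<le> stability_radius * scale x"
    using near_radius_le scale_pos[of x] by (meson mult_right_mono order_trans less_imp_le)
qed

lemma near_Psi'_le:
  assumes "near x y"
  shows "\<Psi>' y \<le> 2 * \<Psi>' x" "\<Psi>' x \<le> 2 * \<Psi>' y"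
proof -
  note xy = nearD[OF assms]
  have scale: "scale x > 0" by (rule scale_pos[OF xy(1)])
  have "\<bar>y - x\<bar> \<le> 1 / (8 * Psi''_const * scale_const) * scale x"
    using scale by (intro order_trans[OF xy(3)] mult_right_mono) (auto simp: near_radius_def)
  then have "4 * Psi''_const / (scale x)\<^sup>2 * \<bar>y - x\<bar>
      \<le> 4 * Psi''_const / (scale x)\<^sup>2 * (1 / (8 * Psi''_const * scale_const) * scale x)"
    using Psi''_const_pos by (intro mult_left_mono) auto
  also have "\<dots> = 1 / (scale_const * scale x) / 2"
    using Psi''_const_pos scale by (simp add: power2_eq_square)
  also have "\<dots> \<le> \<Psi>' x / 2"
    using inverse_Psi'_le_scale[OF xy(1)] Psi'_pos[OF xy(1)] scale scale_const_pos by (simp add: field_simps)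
  finally have "\<bar>\<Psi>' y - \<Psi>' x\<bar> \<le> \<Psi>' x / 2" using Psi'_diff_le[OF xy(1,2,4)] by simp
  then show "\<Psi>' y \<le> 2 * \<Psi>' x" "\<Psi>' x \<le> 2 * \<Psi>' y" using Psi'_pos[OF xy(1)] by linarith+
qed

lemma near_Phi'_le:
  assumes "near x y"
  shows "\<Phi>' y \<le> 4 * \<Phi>' x" "\<Phi>' x \<le> 4 * \<Phi>' y"
  using Phi'_le_forward[of x y] Phi'_le_backward[of y x] Phi'_mono[of x y] Phi'_mono[of y x]
    nearD[OF assms] Phi'_pos[of x] Phi'_pos[of y]
  by (cases "x \<le> y"; simp)+

lemma near_one_plus_le:
  assumes "near x y"
  shows "1 + x \<le> 2 * (1 + y)"
  using nearD[OF assms] stability_radius_scale_le[of x] by auto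

lemma near_Psi''_le:
  assumes "near x y" shows "\<Psi>'' y \<le> 8 * Psi''_const / (scale x)\<^sup>2"
proof -
  note x = nearD(1)[OF assms] and y = nearD(2)[OF assms]
  have "\<Psi>'' y \<le> Psi''_const * \<Phi>' y / (1 + y)"
    using Psi''_le_Phi'[OF y] y by (simp add: pos_le_divide_eq mult.commute)
  also have "\<dots> \<le> (Psi''_const * (4 * \<Phi>' x)) / ((1 + x) / 2)"
    using near_Phi'_le[OF assms] near_one_plus_le[OF assms] Psi''_const_pos Phi'_pos[OF x] x
    by (intro frac_le mult_left_mono) (auto simp: add_pos_nonneg)
  also have "\<dots> = 8 * Psi''_const / (scale x)\<^sup>2" using Phi'_pos[OF x] by (simp add: scale_squared[OF x])
  finally show ?thesis .
qed

lemma near_Psi_le: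
  assumes "near x y"
  shows "\<Psi> y \<le> \<Psi> x + \<Psi>' x * (y - x) + 4 * Psi''_const * near_radius\<^sup>2"
proof -
  note xy = nearD[OF assms]
  have scale: "scale x > 0" by (rule scale_pos[OF xy(1)])
  obtain t where t: "min x y \<le> t" "t \<le> max x y" "\<Psi> y - \<Psi> x = \<Psi>' t * (y - x)"
    using mvt_halfline[OF xy(1,2) Psi_deriv] by blast
  then have t_near: "\<bar>t - x\<bar> \<le> \<bar>y - x\<bar>" "t \<ge> 0" using xy by auto
  have "\<Psi> y - \<Psi> x - \<Psi>' x * (y - x) = (\<Psi>' t - \<Psi>' x) * (y - x)" using t by (simp add: algebra_simps)
  also have "\<dots> \<le> \<bar>\<Psi>' t - \<Psi>' x\<bar> * \<bar>y - x\<bar>" by (simp add: abs_mult[symmetric])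
  also have "\<dots> \<le> (4 * Psi''_const / (scale x)\<^sup>2 * \<bar>t - x\<bar>) * \<bar>y - x\<bar>"
    by (intro mult_right_mono Psi'_diff_le) (use t_near xy in auto)
  also have "\<dots> \<le> (4 * Psi''_const / (scale x)\<^sup>2 * (near_radius * scale x)) * (near_radius * scale x)"
    using t_near xy Psi''_const_pos near_radius_pos scale by (intro mult_mono mult_left_mono) auto
  also have "\<dots> = 4 * Psi''_const * near_radius\<^sup>2"
    using scale by (simp add: power2_eq_square)
  finally show ?thesis by simp
qed

end

section \<open>Ellipsoids adapted to the weight\<close>

text \<open>An arbitrary but fixed coordinate, which the frame at \<open>z\<close> sends to the direction of \<open>z\<close>.\<close>
abbreviation radial_index :: "'n::finite"
  where "radial_index \<equiv> undefined"

definition radial_frame :: "complex ^ 'n \<Rightarrow> complex ^ 'n \<Rightarrow> complex ^ 'n"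
  where "radial_frame z = (SOME U. unitary U \<and>
    (\<exists>c. norm c = 1 \<and> z = (c * of_real (norm z)) *s U (axis radial_index 1)))"

lemma
  shows unitary_radial_frame: "unitary (radial_frame z)"
    and radial_frame_axis: "\<exists>c. norm c = 1 \<and> z = (c * of_real (norm z)) *s radial_frame z (axis radial_index 1)"
proof -
  have "\<exists>U. unitary U \<and> (\<exists>c. norm c = 1 \<and> z = (c * of_real (norm z)) *s U (axis radial_index 1))"
    using unitary_axis_to_direction[of z radial_index] by metis
  from someI_ex[OF this] show "unitary (radial_frame z)"
    "\<exists>c. norm c = 1 \<and> z = (c * of_real (norm z)) *s radial_frame z (axis radial_index 1)"
    unfolding radial_frame_def by auto
qed

definition tangential_sq :: "complex ^ 'n \<Rightarrow> real"
  where "tangential_sq u = (\<Sum>j\<in>UNIV - {radial_index}. (norm (u $ j))\<^sup>2)"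

lemma tangential_sq_nonneg: "tangential_sq u \<ge> 0"
  unfolding tangential_sq_def by (intro sum_nonneg) auto

lemma norm_squared_radial_tangential: "(norm u)\<^sup>2 = (norm (u $ radial_index))\<^sup>2 + tangential_sq u"
  unfolding tangential_sq_def by (rule norm_vec_squared_split)

text \<open>The parameter \<open>dim\<close> only fixes the type \<open>'n\<close>, so that constants may depend on the dimension.\<close>
locale fock_growth = growth \<Psi> \<Psi>' \<Psi>'' \<Phi>' \<Phi>'' growth_const
  for \<Psi> \<Psi>' \<Psi>'' \<Phi>' \<Phi>'' :: "real \<Rightarrow> real" and growth_const :: real +
  fixes dim :: "'n::finite itself"
begin

text \<open>By the estimates below, \<open>K(z,z) e\<^sup>-\<^sup>\<Psi>\<close> at \<open>x = |z|\<^sup>2\<close> is comparable to this function.\<close>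
definition kernel_density :: "real \<Rightarrow> real"
  where "kernel_density x = \<Phi>' x * \<Psi>' x ^ (CARD('n) - 1)"

lemma kernel_density_pos: "x \<ge> 0 \<Longrightarrow> kernel_density x > 0"
  by (simp add: kernel_density_def Phi'_pos Psi'_pos)

lemma kernel_density_continuous: "continuous_on {0..} kernel_density"
  unfolding kernel_density_def by (intro continuous_intros Psi'_continuous Phi'_continuous)

lemma kernel_density_le:
  assumes "x \<ge> 0" "\<Phi>' x \<le> a * \<Phi>' y" "\<Psi>' x \<le> b * \<Psi>' y"
  shows "kernel_density x \<le> a * b ^ (CARD('n) - 1) * kernel_density y"
proof -
  have "kernel_density x \<le> (a * \<Phi>' y) * (b * \<Psi>' y) ^ (CARD('n) - 1)"
    unfolding kernel_density_def using assms Phi'_pos[OF assms(1)] Psi'_pos[OF assms(1)]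
    by (intro mult_mono power_mono) auto
  then show ?thesis by (simp add: kernel_density_def power_mult_distrib mult_ac)
qed

definition near_density_const :: real
  where "near_density_const = 4 * 2 ^ (CARD('n) - 1)"

lemma near_density_const_pos: "near_density_const > 0"
  by (simp add: near_density_const_def)

lemma near_kernel_density_le:
  assumes "near x y" shows "kernel_density y \<le> near_density_const * kernel_density x"
  unfolding near_density_const_def
  using nearD(2)[OF assms] near_Phi'_le(1)[OF assms] near_Psi'_le(1)[OF assms] by (rule kernel_density_le)

definition ellipsoid_map :: "complex ^ 'n \<Rightarrow> complex ^ 'n \<Rightarrow> complex ^ 'n"
  where "ellipsoid_map z u = radial_frame z
    (diag_map radial_index (1 / sqrt (\<Phi>' ((norm z)\<^sup>2))) (1 / sqrt (\<Psi>' ((norm z)\<^sup>2))) u)"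

definition ellipsoid :: "complex ^ 'n \<Rightarrow> real \<Rightarrow> (complex ^ 'n) set"
  where "ellipsoid z r = (\<lambda>u. z + ellipsoid_map z u) ` ball 0 r"

definition ball_volume :: "real \<Rightarrow> real"
  where "ball_volume r = measure lborel (ball (0 :: complex ^ 'n) r)"

definition ellipsoid_volume :: "complex ^ 'n \<Rightarrow> real"
  where "ellipsoid_volume z = 1 / kernel_density ((norm z)\<^sup>2)"

lemma ball_volume_pos: "r > 0 \<Longrightarrow> ball_volume r > 0"
  by (simp add: ball_volume_def content_ball_pos)

lemma ball_volume_nonneg: "ball_volume r \<ge> 0"
  by (simp add: ball_volume_def)

lemma ellipsoid_volume_pos: "ellipsoid_volume z > 0"
  by (simp add: ellipsoid_volume_def kernel_density_pos)

lemma complex_linear_ellipsoid_map: "complex_linear (ellipsoid_map z)"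
  unfolding ellipsoid_map_def
  by (rule complex_linear_compose[OF complex_linear_diag_map])
    (use unitary_radial_frame[of z] in \<open>simp add: unitary_def\<close>)

lemma ellipsoid_map_measurable [measurable]: "ellipsoid_map z \<in> borel_measurable borel"
  by (rule complex_linear_measurable[OF complex_linear_ellipsoid_map])

lemma ellipsoid_map_0 [simp]: "ellipsoid_map z 0 = 0"
  by (rule linear_0[OF complex_linear_imp_linear[OF complex_linear_ellipsoid_map]])

lemma nn_integral_ellipsoid_map:
  fixes f :: "complex ^ 'n \<Rightarrow> ennreal"
  assumes [measurable]: "f \<in> borel_measurable borel"
  shows "(\<integral>\<^sup>+w. f w \<partial>lborel) = ennreal (ellipsoid_volume z) * (\<integral>\<^sup>+u. f (z + ellipsoid_map z u) \<partial>lborel)"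
proof -
  let ?a = "1 / sqrt (\<Phi>' ((norm z)\<^sup>2))" and ?b = "1 / sqrt (\<Psi>' ((norm z)\<^sup>2))"
  have [measurable]: "radial_frame z \<in> borel_measurable borel"
    using unitary_radial_frame by (auto simp: unitary_def intro: complex_linear_measurable)
  have "(\<integral>\<^sup>+w. f w \<partial>lborel) = (\<integral>\<^sup>+w. f (z + w) \<partial>lborel)"
    using nn_integral_lborel_affine[of f 1 z] by simp
  also have "\<dots> = (\<integral>\<^sup>+w. f (z + radial_frame z w) \<partial>lborel)"
    by (rule nn_integral_unitary[symmetric, of "\<lambda>w. f (z + w)"]) (auto simp: unitary_radial_frame)
  also have "\<dots> = ennreal (?a\<^sup>2 * (?b\<^sup>2) ^ (CARD('n) - 1))
      * (\<integral>\<^sup>+u. f (z + radial_frame z (diag_map radial_index ?a ?b u)) \<partial>lborel)"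
    by (rule nn_integral_diag_map) (auto simp: Phi'_pos Psi'_pos)
  also have "?a\<^sup>2 * (?b\<^sup>2) ^ (CARD('n) - 1) = ellipsoid_volume z"
    by (simp add: ellipsoid_volume_def kernel_density_def power_divide Phi'_pos Psi'_pos less_imp_le)
  finally show ?thesis
    by (simp add: ellipsoid_map_def)
qed

lemma norm_ellipsoid_map_squared:
  "(norm (ellipsoid_map z u))\<^sup>2
    = (norm (u $ radial_index))\<^sup>2 / \<Phi>' ((norm z)\<^sup>2) + tangential_sq u / \<Psi>' ((norm z)\<^sup>2)"
  by (simp add: ellipsoid_map_def norm_unitary[OF unitary_radial_frame] norm_diag_map_squared
      tangential_sq_def power_divide Phi'_pos Psi'_pos less_imp_le)

lemma norm_ellipsoid_map_squared_le:
  "(norm (ellipsoid_map z u))\<^sup>2 \<le> (norm u)\<^sup>2 / \<Psi>' ((norm z)\<^sup>2)"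
proof -
  let ?x = "(norm z)\<^sup>2"
  have "(norm (ellipsoid_map z u))\<^sup>2 \<le> (norm (u $ radial_index))\<^sup>2 / \<Psi>' ?x + tangential_sq u / \<Psi>' ?x"
    unfolding norm_ellipsoid_map_squared
    by (intro add_right_mono divide_left_mono) (auto simp: Psi'_le_Phi' Psi'_pos Phi'_pos)
  then show ?thesis
    by (simp add: norm_squared_radial_tangential[of u] add_divide_distrib)
qed

lemma norm_herm_ellipsoid_map:
  "norm (herm (ellipsoid_map z u) z) = norm z * norm (u $ radial_index) / sqrt (\<Phi>' ((norm z)\<^sup>2))"
proof -
  obtain c where c: "norm c = 1" "z = (c * of_real (norm z)) *s radial_frame z (axis radial_index 1)"
    using radial_frame_axis by blast
  define e where "e = radial_frame z (axis radial_index 1)"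
  let ?v = "diag_map radial_index (1 / sqrt (\<Phi>' ((norm z)\<^sup>2))) (1 / sqrt (\<Psi>' ((norm z)\<^sup>2))) u"
  have "herm (ellipsoid_map z u) e = herm ?v (axis radial_index 1)"
    using unitary_radial_frame[of z] by (simp add: ellipsoid_map_def e_def unitary_def)
  also have "\<dots> = ?v $ radial_index"
    by (metis cnj_herm complex_cnj_cnj herm_axis mult_1)
  also have "\<dots> = (1 / sqrt (\<Phi>' ((norm z)\<^sup>2))) *\<^sub>R u $ radial_index"
    by (simp add: diag_map_def)
  finally have radial_component:
    "herm (ellipsoid_map z u) e = (1 / sqrt (\<Phi>' ((norm z)\<^sup>2))) *\<^sub>R u $ radial_index" .
  have "herm (ellipsoid_map z u) z = herm (ellipsoid_map z u) ((c * of_real (norm z)) *s e)"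
    using c by (simp add: e_def)
  then show ?thesis
    using c by (simp add: herm_scale_right radial_component norm_mult Phi'_pos less_imp_le)
qed

lemma norm_herm_ellipsoid_map_le: "norm (herm (ellipsoid_map z u) z) \<le> scale ((norm z)\<^sup>2) * norm u"
proof -
  have "norm (herm (ellipsoid_map z u) z) = (norm z / sqrt (\<Phi>' ((norm z)\<^sup>2))) * norm (u $ radial_index)"
    by (simp add: norm_herm_ellipsoid_map)
  also have "\<dots> \<le> scale ((norm z)\<^sup>2) * norm u"
  proof (intro mult_mono)
    have "norm z \<le> sqrt (1 + (norm z)\<^sup>2)" by (rule real_le_rsqrt) simp
    then show "norm z / sqrt (\<Phi>' ((norm z)\<^sup>2)) \<le> scale ((norm z)\<^sup>2)"
      unfolding scale_eq by (intro divide_right_mono) (auto simp: Phi'_pos less_imp_le)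
    show "norm (u $ radial_index) \<le> norm u" by (rule Finite_Cartesian_Product.norm_nth_le)
  qed (auto simp: scale_pos less_imp_le)
  finally show ?thesis .
qed

lemma inj_ellipsoid_map: "inj (ellipsoid_map z)"
proof -
  have "u = 0" if "ellipsoid_map z u = 0" for u
  proof -
    have "norm (diag_map radial_index (1 / sqrt (\<Phi>' ((norm z)\<^sup>2))) (1 / sqrt (\<Psi>' ((norm z)\<^sup>2))) u) = 0"
      using that norm_unitary[OF unitary_radial_frame] by (metis ellipsoid_map_def norm_zero)
    then show "u = 0"
      by (auto simp: vec_eq_iff diag_map_def split: if_splits)
        (metis Phi'_pos Psi'_pos less_irrefl norm_ge_zero zero_le_power2)+
  qed
  then show ?thesis
    by (simp add: linear_injective_0[OF complex_linear_imp_linear[OF complex_linear_ellipsoid_map]])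
qed

lemma surj_ellipsoid_map: "surj (ellipsoid_map z)"
  using linear_injective_imp_surjective[OF complex_linear_imp_linear[OF complex_linear_ellipsoid_map]
      inj_ellipsoid_map] by simp

lemma open_ellipsoid: "open (ellipsoid z r)"
proof -
  have "ellipsoid z r = (+) z ` (ellipsoid_map z ` ball 0 r)" by (auto simp: ellipsoid_def image_image)
  moreover have "open (ellipsoid_map z ` ball 0 r)"
    by (rule open_surjective_linear_image[OF _ _ surj_ellipsoid_map])
      (auto intro: complex_linear_imp_linear[OF complex_linear_ellipsoid_map])
  ultimately show ?thesis by (simp add: open_translation)
qed

lemma ellipsoid_sets [measurable]: "ellipsoid z r \<in> sets borel"
  by (simp add: open_ellipsoid)

lemma mem_ellipsoid_iff: "z + ellipsoid_map z u \<in> ellipsoid z r \<longleftrightarrow> norm u < r"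
  using inj_ellipsoid_map[of z] by (auto simp: ellipsoid_def inj_def) metis

lemma ellipsoid_mono: "r \<le> s \<Longrightarrow> ellipsoid z r \<subseteq> ellipsoid z s"
  by (auto simp: ellipsoid_def)

lemma emeasure_ellipsoid: "emeasure lborel (ellipsoid z r) = ennreal (ellipsoid_volume z * ball_volume r)"
proof -
  have "emeasure lborel (ellipsoid z r) = (\<integral>\<^sup>+w. indicator (ellipsoid z r) w \<partial>lborel)" by simp
  also have "\<dots> = ennreal (ellipsoid_volume z) * (\<integral>\<^sup>+u. indicator (ellipsoid z r) (z + ellipsoid_map z u) \<partial>lborel)"
    by (rule nn_integral_ellipsoid_map) simp
  also have "(\<lambda>u. indicator (ellipsoid z r) (z + ellipsoid_map z u)) = (indicator (ball 0 r) :: _ \<Rightarrow> ennreal)"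
    by (auto simp: indicator_def mem_ellipsoid_iff fun_eq_iff)
  also have "(\<integral>\<^sup>+u. indicator (ball (0 :: complex ^ 'n) r) u \<partial>lborel) = ennreal (ball_volume r)"
    using emeasure_lborel_ball_finite[of "0 :: complex ^ 'n" r]
    by (simp add: emeasure_eq_ennreal_measure less_top[symmetric] ball_volume_def)
  finally show ?thesis by (simp add: ennreal_mult ellipsoid_volume_pos ball_volume_nonneg less_imp_le)
qed

lemma tangential_sq_le_of_displacement:
  assumes "(norm (ellipsoid_map z u))\<^sup>2 \<le> t\<^sup>2 / \<Psi>' ((norm z)\<^sup>2)"
  shows "tangential_sq u \<le> t\<^sup>2"
proof -
  have "tangential_sq u / \<Psi>' ((norm z)\<^sup>2) \<le> t\<^sup>2 / \<Psi>' ((norm z)\<^sup>2)"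
    using assms Phi'_pos[of "(norm z)\<^sup>2"] unfolding norm_ellipsoid_map_squared
    by (smt (verit) divide_nonneg_pos zero_le_power2)
  then show ?thesis using Psi'_pos[of "(norm z)\<^sup>2"] by (simp add: divide_le_cancel)
qed

text \<open>Away from the origin the component of the displacement along \<open>z\<close> controls the radial coordinate;
  near the origin \<open>\<Phi>'\<close> and \<open>\<Psi>'\<close> are comparable, and the length of the displacement suffices.\<close>
lemma radial_coordinate_le_of_displacement:
  assumes norm_le: "(norm (ellipsoid_map z u))\<^sup>2 \<le> t\<^sup>2 / \<Psi>' ((norm z)\<^sup>2)"
    and herm_le: "norm (herm (ellipsoid_map z u) z) \<le> t * scale ((norm z)\<^sup>2)"
  shows "(norm (u $ radial_index))\<^sup>2 \<le> (2 + 2 * scale_const\<^sup>2 * \<Psi>' 1) * t\<^sup>2"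
proof (cases "norm z \<ge> 1")
  case True
  let ?x = "(norm z)\<^sup>2"
  have "norm z * norm (u $ radial_index) \<le> t * sqrt (1 + ?x)"
    using herm_le Phi'_pos[of ?x] by (simp add: norm_herm_ellipsoid_map scale_eq field_simps)
  then have "(norm z * norm (u $ radial_index))\<^sup>2 \<le> (t * sqrt (1 + ?x))\<^sup>2" by (rule power_mono) simp
  then have "?x * (norm (u $ radial_index))\<^sup>2 \<le> t\<^sup>2 * (1 + ?x)" by (simp add: power_mult_distrib)
  also have "\<dots> \<le> t\<^sup>2 * (2 * ?x)" using True by (intro mult_left_mono) auto
  finally have "?x * (norm (u $ radial_index))\<^sup>2 \<le> ?x * (2 * t\<^sup>2)" by (simp add: algebra_simps)
  then have "(norm (u $ radial_index))\<^sup>2 \<le> 2 * t\<^sup>2" using True by (subst (asm) mult_le_cancel_left_pos) auto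
  also have "\<dots> \<le> (2 + 2 * scale_const\<^sup>2 * \<Psi>' 1) * t\<^sup>2"
    using Psi'_pos[of 1] by (intro mult_right_mono) auto
  finally show ?thesis .
next
  case False
  let ?x = "(norm z)\<^sup>2"
  have x_le_1: "?x \<le> 1" using False by (simp add: power_le_one)
  have "(norm (u $ radial_index))\<^sup>2 / \<Phi>' ?x \<le> t\<^sup>2 / \<Psi>' ?x"
    using norm_le tangential_sq_nonneg[of u] Psi'_pos[of ?x] unfolding norm_ellipsoid_map_squared
    by (smt (verit) divide_nonneg_pos zero_le_power2)
  then have "(norm (u $ radial_index))\<^sup>2 \<le> \<Phi>' ?x / \<Psi>' ?x * t\<^sup>2"
    using Psi'_pos[of ?x] Phi'_pos[of ?x] by (simp add: field_simps)
  also have "\<Phi>' ?x / \<Psi>' ?x \<le> scale_const\<^sup>2 * ((1 + ?x) * \<Psi>' ?x)"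
    using Phi'_le_Psi'_squared[of ?x] Psi'_pos[of ?x] by (simp add: field_simps power2_eq_square)
  also have "scale_const\<^sup>2 * ((1 + ?x) * \<Psi>' ?x) \<le> scale_const\<^sup>2 * (2 * \<Psi>' 1)"
    using x_le_1 Psi'_pos[of ?x] Psi'_mono[of ?x 1] by (intro mult_left_mono mult_mono) auto
  also have "\<dots> \<le> 2 + 2 * scale_const\<^sup>2 * \<Psi>' 1" by simp
  finally show ?thesis by (simp add: mult_right_mono)
qed

definition inclusion_const :: real
  where "inclusion_const = sqrt (3 + 2 * scale_const\<^sup>2 * \<Psi>' 1) + 1"

lemma inclusion_const_pos: "inclusion_const > 0"
  using Psi'_pos[of 1] by (auto simp: inclusion_const_def intro!: add_nonneg_pos)

lemma mem_ellipsoid_of_displacement: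
  assumes "norm (w - z) \<le> t / sqrt (\<Psi>' ((norm z)\<^sup>2))"
    and "norm (herm (w - z) z) \<le> t * scale ((norm z)\<^sup>2)" and "t > 0"
  shows "w \<in> ellipsoid z (inclusion_const * t)"
proof -
  obtain u where u: "w - z = ellipsoid_map z u" using surj_ellipsoid_map[of z] by auto
  have "(norm (w - z))\<^sup>2 \<le> (t / sqrt (\<Psi>' ((norm z)\<^sup>2)))\<^sup>2"
    using assms(1) by (rule power_mono) simp
  then have displacement: "(norm (ellipsoid_map z u))\<^sup>2 \<le> t\<^sup>2 / \<Psi>' ((norm z)\<^sup>2)"
    by (simp add: power_divide Psi'_pos less_imp_le flip: u)
  have "(norm u)\<^sup>2 \<le> (3 + 2 * scale_const\<^sup>2 * \<Psi>' 1) * t\<^sup>2"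
    using tangential_sq_le_of_displacement[OF displacement]
      radial_coordinate_le_of_displacement[OF displacement assms(2)[unfolded u]]
    by (simp add: norm_squared_radial_tangential[of u] algebra_simps)
  then have "norm u \<le> sqrt ((3 + 2 * scale_const\<^sup>2 * \<Psi>' 1) * t\<^sup>2)" by (rule real_le_rsqrt)
  also have "\<dots> < inclusion_const * t"
    using assms(3) by (simp add: inclusion_const_def real_sqrt_mult)
  finally have "z + ellipsoid_map z u \<in> ellipsoid z (inclusion_const * t)" by (simp add: mem_ellipsoid_iff)
  then show ?thesis by (simp flip: u)
qed

section \<open>The local mean value estimate\<close>

definition local_radius :: real
  where "local_radius = min 1 (near_radius / (2 + scale_const))"

lemma local_radius_bounds: "local_radius > 0" "local_radius \<le> 1" "local_radius * (2 + scale_const) \<le> near_radius"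
proof -
  have pos: "2 + scale_const > 0" using scale_const_pos by simp
  show "local_radius > 0" "local_radius \<le> 1" using near_radius_pos pos by (auto simp: local_radius_def)
  have "local_radius \<le> near_radius / (2 + scale_const)" by (simp add: local_radius_def)
  then show "local_radius * (2 + scale_const) \<le> near_radius" using pos by (simp add: field_simps)
qed

lemma near_ellipsoid_map:
  assumes u: "norm u \<le> local_radius"
  shows "near ((norm z)\<^sup>2) ((norm (z + ellipsoid_map z u))\<^sup>2)"
proof -
  let ?x = "(norm z)\<^sup>2" and ?d = "ellipsoid_map z u"
  have scale: "scale ?x > 0" by (simp add: scale_pos)
  have "(norm ?d)\<^sup>2 \<le> (norm u)\<^sup>2 * (1 / \<Psi>' ?x)" using norm_ellipsoid_map_squared_le[of z u] by simp
  also have "\<dots> \<le> (norm u * 1) * (scale_const * scale ?x)"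
    unfolding power2_eq_square[of "norm u"] using u local_radius_bounds(2) Psi'_pos[of ?x] scale scale_const_pos
    by (intro mult_mono inverse_Psi'_le_scale) (auto simp: less_imp_le)
  finally have quadratic: "(norm ?d)\<^sup>2 \<le> norm u * scale_const * scale ?x" by simp
  have "\<bar>(norm (z + ?d))\<^sup>2 - ?x\<bar> = \<bar>2 * Re (herm ?d z) + (norm ?d)\<^sup>2\<bar>"
    by (simp add: norm_add_herm)
  also have "\<dots> \<le> 2 * norm (herm ?d z) + (norm ?d)\<^sup>2"
    using abs_Re_le_cmod[of "herm ?d z"] zero_le_power2[of "norm ?d"] by linarith
  also have "\<dots> \<le> 2 * (scale ?x * norm u) + norm u * scale_const * scale ?x"
    by (intro add_mono mult_left_mono norm_herm_ellipsoid_map_le quadratic) auto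
  also have "\<dots> = norm u * (2 + scale_const) * scale ?x"
    by (simp add: algebra_simps)
  also have "\<dots> \<le> local_radius * (2 + scale_const) * scale ?x"
    using u scale_const_pos scale by (intro mult_right_mono) auto
  also have "\<dots> \<le> near_radius * scale ?x"
    using local_radius_bounds(3) scale by (intro mult_right_mono) auto
  finally show ?thesis by (simp add: near_def)
qed

definition oscillation :: real
  where "oscillation = 1 + 4 * Psi''_const * near_radius\<^sup>2"

lemma Psi_ellipsoid_map_le:
  assumes u: "norm u \<le> local_radius"
  shows "\<Psi> ((norm (z + ellipsoid_map z u))\<^sup>2)
    \<le> \<Psi> ((norm z)\<^sup>2) + 2 * Re (\<Psi>' ((norm z)\<^sup>2) * herm (ellipsoid_map z u) z) + oscillation"
proof -
  let ?x = "(norm z)\<^sup>2" and ?y = "(norm (z + ellipsoid_map z u))\<^sup>2"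
  have "\<Psi> ?y \<le> \<Psi> ?x + \<Psi>' ?x * (?y - ?x) + 4 * Psi''_const * near_radius\<^sup>2"
    by (rule near_Psi_le[OF near_ellipsoid_map[OF u]])
  also have "\<Psi>' ?x * (?y - ?x)
      = 2 * Re (\<Psi>' ?x * herm (ellipsoid_map z u) z) + \<Psi>' ?x * (norm (ellipsoid_map z u))\<^sup>2"
    by (simp add: norm_add_herm algebra_simps)
  also have "\<Psi>' ?x * (norm (ellipsoid_map z u))\<^sup>2 \<le> \<Psi>' ?x * ((norm u)\<^sup>2 / \<Psi>' ?x)"
    by (intro mult_left_mono norm_ellipsoid_map_squared_le) (simp add: Psi'_pos less_imp_le)
  also have "\<dots> = (norm u)\<^sup>2" using Psi'_pos[of ?x] by simp
  also have "(norm u)\<^sup>2 \<le> 1" using u local_radius_bounds by (simp add: power_le_one)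
  finally show ?thesis by (simp add: oscillation_def)
qed

lemma Psi_norm_measurable [measurable]: "(\<lambda>z :: complex ^ 'n. \<Psi> ((norm z)\<^sup>2)) \<in> borel_measurable borel"
  by (intro borel_measurable_continuous_onI continuous_on_compose2[OF Psi_continuous] continuous_intros) auto

definition weighted_sq :: "(complex ^ 'n \<Rightarrow> complex) \<Rightarrow> complex ^ 'n \<Rightarrow> real"
  where "weighted_sq f z = (norm (f z))\<^sup>2 * exp (- \<Psi> ((norm z)\<^sup>2))"

lemma weighted_sq_nonneg: "weighted_sq f z \<ge> 0"
  by (simp add: weighted_sq_def)

lemma weighted_sq_measurable [measurable]:
  assumes [measurable]: "f \<in> borel_measurable borel"
  shows "weighted_sq f \<in> borel_measurable borel"
  unfolding weighted_sq_def[abs_def] by measurable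

text \<open>The exponential factor is holomorphic in \<open>u\<close> and cancels the linear part of \<open>\<Psi>\<close> at \<open>|z|\<^sup>2\<close>.\<close>
definition twist :: "complex ^ 'n \<Rightarrow> (complex ^ 'n \<Rightarrow> complex) \<Rightarrow> complex ^ 'n \<Rightarrow> complex"
  where "twist z f u = f (z + ellipsoid_map z u) * exp (- (\<Psi>' ((norm z)\<^sup>2) * herm (ellipsoid_map z u) z))"

lemma entire_twist:
  assumes "entire f" shows "entire (twist z f)"
proof -
  have "entire (\<lambda>u. herm (0 + ellipsoid_map z u) z)"
    by (rule entire_compose_affine[OF entire_herm complex_linear_ellipsoid_map])
  then have "entire (\<lambda>u. (- of_real (\<Psi>' ((norm z)\<^sup>2))) * herm (ellipsoid_map z u) z)"
    by (intro entire_mult entire_const) simp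
  then have "entire (\<lambda>u. exp (- (\<Psi>' ((norm z)\<^sup>2) * herm (ellipsoid_map z u) z)))"
    using entire_exp by fastforce
  then show ?thesis
    unfolding twist_def by (intro entire_mult entire_compose_affine[OF assms complex_linear_ellipsoid_map])
qed

lemma twist_0 [simp]: "twist z f 0 = f z"
  by (simp add: twist_def)

lemma norm_twist_le:
  assumes "norm u \<le> local_radius"
  shows "(norm (twist z f u))\<^sup>2 \<le> exp (\<Psi> ((norm z)\<^sup>2) + oscillation) * weighted_sq f (z + ellipsoid_map z u)"
proof -
  let ?w = "z + ellipsoid_map z u"
  let ?linear = "2 * Re (\<Psi>' ((norm z)\<^sup>2) * herm (ellipsoid_map z u) z)"
  have "(norm (twist z f u))\<^sup>2 = (norm (f ?w))\<^sup>2 * exp (- ?linear)"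
    by (simp add: twist_def norm_mult power_mult_distrib exp_double[symmetric])
  also have "\<dots> \<le> (norm (f ?w))\<^sup>2 * exp (\<Psi> ((norm z)\<^sup>2) + oscillation + - \<Psi> ((norm ?w)\<^sup>2))"
    using Psi_ellipsoid_map_le[OF assms, of z] by (intro mult_left_mono) simp_all
  also have "\<dots> = exp (\<Psi> ((norm z)\<^sup>2) + oscillation) * weighted_sq f ?w"
    by (simp only: exp_add weighted_sq_def mult_ac)
  finally show ?thesis .
qed

lemma twist_mean_value:
  assumes f: "entire f" and r: "0 < r" "r \<le> local_radius"
  shows "ennreal ((norm (f z))\<^sup>2 * ball_volume r)
    \<le> ennreal (exp (\<Psi> ((norm z)\<^sup>2) + oscillation))
      * (\<integral>\<^sup>+u. ennreal (weighted_sq f (z + ellipsoid_map z u)) * indicator (ball 0 r) u \<partial>lborel)"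
proof -
  let ?B = "ball (0 :: complex ^ 'n) r" and ?c = "exp (\<Psi> ((norm z)\<^sup>2) + oscillation)"
  note [measurable] = entire_imp_borel_measurable[OF f]
  have [measurable]: "?B \<in> sets borel" by simp
  have "ennreal ((norm (f z))\<^sup>2 * ball_volume r)
      = ennreal ((norm (twist z f 0))\<^sup>2 * (\<integral>u. indicat_real ?B u \<partial>lborel))"
    by (simp add: ball_volume_def)
  also have "\<dots> \<le> (\<integral>\<^sup>+u. ennreal (indicat_real ?B u * (norm (twist z f u))\<^sup>2) \<partial>lborel)"
    by (rule entire_sub_mean_value_square[OF entire_twist[OF f]])
      (auto simp: norm_smult split: split_indicator intro!: borel_measurable_indicator)
  also have "\<dots> \<le> (\<integral>\<^sup>+u. ennreal ?c * (ennreal (weighted_sq f (z + ellipsoid_map z u)) * indicator ?B u) \<partial>lborel)"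
    using norm_twist_le[of _ z f] r
    by (intro nn_integral_mono) (auto simp: indicator_def weighted_sq_nonneg simp flip: ennreal_mult)
  also have "\<dots> = ennreal ?c * (\<integral>\<^sup>+u. ennreal (weighted_sq f (z + ellipsoid_map z u)) * indicator ?B u \<partial>lborel)"
    by (rule nn_integral_cmult) measurable
  finally show ?thesis .
qed

lemma local_mean_value:
  assumes f: "entire f" and r: "0 < r" "r \<le> local_radius"
  shows "ennreal (weighted_sq f z * (ellipsoid_volume z * ball_volume r))
    \<le> ennreal (exp oscillation) * (\<integral>\<^sup>+w. ennreal (weighted_sq f w) * indicator (ellipsoid z r) w \<partial>lborel)"
proof -
  let ?x = "(norm z)\<^sup>2" and ?v = "ellipsoid_volume z"
  let ?I = "\<integral>\<^sup>+u. ennreal (weighted_sq f (z + ellipsoid_map z u)) * indicator (ball 0 r) u \<partial>lborel"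
  note [measurable] = entire_imp_borel_measurable[OF f]
  have v: "?v > 0" by (rule ellipsoid_volume_pos)
  have "ennreal (weighted_sq f z * (?v * ball_volume r))
      = ennreal (?v * exp (- \<Psi> ?x)) * ennreal ((norm (f z))\<^sup>2 * ball_volume r)"
    using v ball_volume_pos[OF r(1)] by (subst ennreal_mult[symmetric]) (auto simp: weighted_sq_def mult_ac)
  also have "\<dots> \<le> ennreal (?v * exp (- \<Psi> ?x)) * (ennreal (exp (\<Psi> ?x + oscillation)) * ?I)"
    by (intro mult_left_mono twist_mean_value f r) simp
  also have "\<dots> = ennreal (?v * exp (- \<Psi> ?x) * exp (\<Psi> ?x + oscillation)) * ?I"
    using v by (simp add: ennreal_mult mult.assoc)
  also have "?v * exp (- \<Psi> ?x) * exp (\<Psi> ?x + oscillation) = exp oscillation * ?v"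
    by (simp add: exp_add exp_minus field_simps)
  also have "ennreal (exp oscillation * ?v) * ?I = ennreal (exp oscillation) * (ennreal ?v * ?I)"
    using v by (simp add: ennreal_mult mult.assoc)
  also have "?I = (\<integral>\<^sup>+u. ennreal (weighted_sq f (z + ellipsoid_map z u))
      * indicator (ellipsoid z r) (z + ellipsoid_map z u) \<partial>lborel)"
    by (intro nn_integral_cong) (simp add: indicator_def mem_ellipsoid_iff)
  also have "ennreal ?v * \<dots> = (\<integral>\<^sup>+w. ennreal (weighted_sq f w) * indicator (ellipsoid z r) w \<partial>lborel)"
    by (rule nn_integral_ellipsoid_map[symmetric]) measurable
  finally show ?thesis .
qed

end

section \<open>Integrals of homogeneous functions against radial weights\<close>

lemma nn_integral_exp_halfline:
  assumes "c > (0::real)"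
  shows "(\<integral>\<^sup>+x. ennreal (exp (- (c * x))) * indicator {0..} x \<partial>lborel) = ennreal (1 / c)"
proof -
  have "filterlim (\<lambda>x. - (c * x)) at_bot at_top"
    using assms
    by (simp add: filterlim_uminus_at_bot filterlim_tendsto_pos_mult_at_top[OF tendsto_const] filterlim_ident)
  then have "((\<lambda>x. exp (- (c * x))) \<longlongrightarrow> 0) at_top"
    by (rule filterlim_compose[OF exp_at_bot])
  from tendsto_divide[OF tendsto_minus[OF this] tendsto_const[of c]]
  have "((\<lambda>x. - exp (- (c * x)) / c) \<longlongrightarrow> 0) at_top"
    using assms by simp
  then have "(\<integral>\<^sup>+x. ennreal (exp (- (c * x))) * indicator {0..} x \<partial>lborel)
      = ennreal (0 - (- exp (- (c * 0)) / c))"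
    using assms by (intro nn_integral_FTC_atLeast) (auto intro!: derivative_eq_intros simp: field_simps)
  then show ?thesis by simp
qed

lemma nn_integral_exp_abs_le:
  assumes "c > (0::real)"
  shows "(\<integral>\<^sup>+x. ennreal (exp (- (c * \<bar>x\<bar>))) \<partial>lborel) \<le> ennreal (2 / c)"
proof -
  let ?e = "\<lambda>x. ennreal (exp (- (c * x))) * indicator {0..} x"
  have "(\<integral>\<^sup>+x. ennreal (exp (- (c * \<bar>x\<bar>))) \<partial>lborel) \<le> (\<integral>\<^sup>+x. ?e x + ?e (- x) \<partial>lborel)"
    by (rule nn_integral_mono) (auto simp: indicator_def abs_if)
  also have "\<dots> = (\<integral>\<^sup>+x. ?e x \<partial>lborel) + (\<integral>\<^sup>+x. ?e (- x) \<partial>lborel)"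
    by (rule nn_integral_add) auto
  also have "(\<integral>\<^sup>+x. ?e (- x) \<partial>lborel) = (\<integral>\<^sup>+x. ?e x \<partial>lborel)"
    using nn_integral_real_affine[of ?e "-1" 0] by simp
  finally show ?thesis
    using assms by (simp add: nn_integral_exp_halfline flip: ennreal_plus)
qed

lemma integrable_exp_abs:
  assumes "c > (0::real)" shows "integrable lborel (\<lambda>x. exp (- (c * \<bar>x\<bar>)))"
proof (rule integrableI_bounded)
  have "(\<integral>\<^sup>+x. ennreal (norm (exp (- (c * \<bar>x\<bar>)))) \<partial>lborel) \<le> ennreal (2 / c)"
    using nn_integral_exp_abs_le[OF assms] by simp
  also have "\<dots> < \<infinity>" by simp
  finally show "(\<integral>\<^sup>+x. ennreal (norm (exp (- (c * \<bar>x\<bar>)))) \<partial>lborel) < \<infinity>" .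
qed simp

lemma nn_integral_gaussian_real_finite:
  assumes "c > (0::real)"
  shows "(\<integral>\<^sup>+x. ennreal (exp (- (c * x\<^sup>2))) \<partial>lborel) < \<infinity>"
proof -
  have "exp (- (c * x\<^sup>2)) \<le> exp c * exp (- (2 * c * \<bar>x\<bar>))" for x :: real
  proof -
    have "0 \<le> c * (\<bar>x\<bar> - 1)\<^sup>2" using assms by simp
    then show ?thesis unfolding exp_add[symmetric] by (simp add: power2_diff algebra_simps)
  qed
  then have "(\<integral>\<^sup>+x. ennreal (exp (- (c * x\<^sup>2))) \<partial>lborel)
      \<le> (\<integral>\<^sup>+x. ennreal (exp c) * ennreal (exp (- (2 * c * \<bar>x\<bar>))) \<partial>lborel)"
    by (intro nn_integral_mono) (auto simp flip: ennreal_mult)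
  also have "\<dots> = ennreal (exp c) * (\<integral>\<^sup>+x. ennreal (exp (- (2 * c * \<bar>x\<bar>))) \<partial>lborel)"
    by (rule nn_integral_cmult) simp
  also have "\<dots> \<le> ennreal (exp c) * ennreal (2 / (2 * c))"
    using nn_integral_exp_abs_le[of "2 * c"] assms by (intro mult_left_mono) auto
  also have "\<dots> < \<infinity>" by (simp add: ennreal_mult_less_top)
  finally show ?thesis .
qed

lemma integrable_gaussian:
  assumes "c > (0::real)"
  shows "integrable lborel (\<lambda>z::'a::euclidean_space. exp (- (c * (norm z)\<^sup>2)))"
proof (rule integrableI_bounded)
  have product: "exp (- (c * (norm z)\<^sup>2)) = (\<Prod>b\<in>Basis. exp (- (c * (z \<bullet> b)\<^sup>2)))" for z :: 'a
  proof -
    have "(norm z)\<^sup>2 = (\<Sum>b\<in>Basis. (z \<bullet> b)\<^sup>2)"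
      unfolding power2_norm_eq_inner by (subst euclidean_inner) (simp add: power2_eq_square)
    then show ?thesis by (simp add: exp_sum sum_distrib_left flip: sum_negf)
  qed
  have "(\<integral>\<^sup>+z. ennreal (norm (exp (- (c * (norm z)\<^sup>2)))) \<partial>(lborel :: 'a measure))
     = (\<integral>\<^sup>+z. (\<Prod>b\<in>Basis. ennreal (exp (- (c * (z \<bullet> b)\<^sup>2)))) \<partial>(lborel :: 'a measure))"
    by (simp add: product prod_ennreal abs_prod)
  also have "\<dots> = (\<Prod>b\<in>(Basis::'a set). \<integral>\<^sup>+x. ennreal (exp (- (c * x\<^sup>2))) \<partial>lborel)"
    by (rule nn_integral_lborel_prod) auto
  also have "\<dots> < \<infinity>"
    using nn_integral_gaussian_real_finite[OF assms] by (simp add: power_less_top_ennreal)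
  finally show "(\<integral>\<^sup>+z. ennreal (norm (exp (- (c * (norm z)\<^sup>2)))) \<partial>(lborel :: 'a measure)) < \<infinity>" .
qed simp

lemma exp_partial_sum_le:
  assumes "0 \<le> (t::real)" shows "(\<Sum>i<m. t ^ i / fact i) \<le> exp t"
proof -
  have series: "(\<lambda>i. t ^ i /\<^sub>R fact i) sums exp t" by (rule exp_converges)
  have "(\<Sum>i<m. t ^ i /\<^sub>R fact i) \<le> (\<Sum>i. t ^ i /\<^sub>R fact i)"
    by (rule sum_le_suminf) (use series assms in \<open>auto simp: sums_iff\<close>)
  then show ?thesis using series by (simp add: sums_iff divide_inverse mult.commute)
qed

lemma power_le_fact_exp:
  assumes "0 \<le> (t::real)" shows "t ^ j \<le> fact j * exp t"
proof -
  have "t ^ j / fact j \<le> (\<Sum>i<Suc j. t ^ i / fact i)"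
    using assms by (simp add: sum_nonneg)
  also have "\<dots> \<le> exp t" by (rule exp_partial_sum_le[OF assms])
  finally show ?thesis by (simp add: field_simps)
qed

lemma power_exp_le_gaussian:
  assumes "c > 0" "(a::real) \<ge> 0"
  obtains A where "A > 0" "\<And>t. t \<ge> 0 \<Longrightarrow> t ^ j * exp (a * t) \<le> A * exp (c * t\<^sup>2)"
proof
  show "fact j * exp ((a + 1)\<^sup>2 / (4 * c)) > 0" by simp
  fix t :: real assume t: "t \<ge> 0"
  have "0 \<le> c * (t - (a + 1) / (2 * c))\<^sup>2" using assms by simp
  also have "c * (t - (a + 1) / (2 * c))\<^sup>2 = (a + 1)\<^sup>2 / (4 * c) + c * t\<^sup>2 - (t + a * t)"
    using assms by (simp add: power2_eq_square field_simps)
  finally have square: "t + a * t \<le> (a + 1)\<^sup>2 / (4 * c) + c * t\<^sup>2" by simp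
  have "t ^ j * exp (a * t) \<le> (fact j * exp t) * exp (a * t)"
    by (intro mult_right_mono power_le_fact_exp t) auto
  also have "\<dots> = fact j * exp (t + a * t)" by (simp add: exp_add)
  also have "\<dots> \<le> fact j * exp ((a + 1)\<^sup>2 / (4 * c) + c * t\<^sup>2)" using square by simp
  finally show "t ^ j * exp (a * t) \<le> fact j * exp ((a + 1)\<^sup>2 / (4 * c)) * exp (c * t\<^sup>2)"
    by (simp add: exp_add)
qed

lemma integrable_gaussian_bound:
  fixes f :: "'a::euclidean_space \<Rightarrow> 'b::{banach, second_countable_topology}"
  assumes [measurable]: "f \<in> borel_measurable borel" and "m > 0" "a \<ge> 0"
    and bound: "\<And>z. norm (f z) \<le> B * (norm z ^ j * exp (a * norm z) * exp (- (m * (norm z)\<^sup>2)))"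
  shows "integrable lborel f"
proof -
  obtain A where A: "A > 0" "\<And>t. t \<ge> 0 \<Longrightarrow> t ^ j * exp (a * t) \<le> A * exp (m / 2 * t\<^sup>2)"
    using power_exp_le_gaussian[of "m / 2" a j] assms by auto
  have dominated: "norm (f z) \<le> norm (\<bar>B\<bar> * A * exp (- (m / 2 * (norm z)\<^sup>2)))" for z
  proof -
    have "norm (f z) \<le> \<bar>B\<bar> * (norm z ^ j * exp (a * norm z) * exp (- (m * (norm z)\<^sup>2)))"
      by (intro order_trans[OF bound] mult_right_mono) auto
    also have "\<dots> \<le> \<bar>B\<bar> * ((A * exp (m / 2 * (norm z)\<^sup>2)) * exp (- (m * (norm z)\<^sup>2)))"
      by (intro mult_left_mono mult_right_mono A) auto
    also have "\<dots> = \<bar>B\<bar> * A * exp (- (m / 2 * (norm z)\<^sup>2))"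
      by (simp add: mult.assoc flip: exp_add)
    finally show ?thesis using A(1) by simp
  qed
  show ?thesis
  proof (rule Bochner_Integration.integrable_bound[OF _ _ AE_I2[OF dominated]])
    show "integrable lborel (\<lambda>z::'a. \<bar>B\<bar> * A * exp (- (m / 2 * (norm z)\<^sup>2)))"
      by (intro integrable_mult_right integrable_gaussian) (use \<open>m > 0\<close> in simp)
  qed measurable
qed

definition exp_decaying :: "(real \<Rightarrow> real) \<Rightarrow> bool"
  where "exp_decaying g \<longleftrightarrow> g \<in> borel_measurable borel \<and> (\<forall>x\<ge>0. g x \<ge> 0) \<and>
    (\<exists>m>0. \<exists>A. \<forall>x\<ge>0. g x \<le> A * exp (- (m * x)))"

lemma exp_decayingE:
  assumes "exp_decaying g"
  obtains m A where "m > 0" "A \<ge> 0" "\<And>x. x \<ge> 0 \<Longrightarrow> g x \<le> A * exp (- (m * x))"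
proof -
  obtain m A where "m > 0" and bound: "\<And>x. x \<ge> 0 \<Longrightarrow> g x \<le> A * exp (- (m * x))"
    using assms unfolding exp_decaying_def by blast
  moreover have "A \<ge> 0"
    using bound[of 0] assms unfolding exp_decaying_def by (auto intro: order_trans[of 0 "g 0" A])
  ultimately show ?thesis using that by blast
qed

lemma exp_decaying_measurable: "exp_decaying g \<Longrightarrow> g \<in> borel_measurable borel"
  by (simp add: exp_decaying_def)

lemma exp_decaying_nonneg: "exp_decaying g \<Longrightarrow> x \<ge> 0 \<Longrightarrow> g x \<ge> 0"
  by (simp add: exp_decaying_def)

lemma exp_decaying_exp: "exp_decaying (\<lambda>x. exp (- x))"
  unfolding exp_decaying_def by (auto intro!: exI[of _ "1::real"])

text \<open>With \<open>x = exp t\<close>, this is \<open>\<integral> x\<^sup>N\<^sup>-\<^sup>1 g x dx\<close> over the half line. In the variable \<open>t\<close>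
  dilations become translations.\<close>
definition radial_moment :: "(real \<Rightarrow> real) \<Rightarrow> nat \<Rightarrow> real"
  where "radial_moment g N = (\<integral>t. exp (t * N) * g (exp t) \<partial>lborel)"

lemma exp_power_decay:
  assumes "m > 0" "N \<ge> 1"
  obtains A where "A > 0" "\<And>t. exp (t * real N) * exp (- (m * exp t)) \<le> A * exp (- (1 * \<bar>t\<bar>))"
proof
  let ?A = "1 + fact (N + 1) / m ^ (N + 1)"
  show "?A > 0" using assms by (simp add: add_pos_nonneg)
  fix t :: real
  show "exp (t * real N) * exp (- (m * exp t)) \<le> ?A * exp (- (1 * \<bar>t\<bar>))"
  proof (cases "t \<le> 0")
    case True
    have "exp (t * real N) * exp (- (m * exp t)) \<le> exp t * 1"
    proof (rule mult_mono)
      show "exp (t * real N) \<le> exp t"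
        using True assms mult_left_mono_neg[of 1 "real N" t] by simp
    qed (use assms in auto)
    also have "\<dots> \<le> ?A * exp t" using assms by (simp add: algebra_simps)
    finally show ?thesis using True by simp
  next
    case False
    have "(m * exp t) ^ (N + 1) \<le> fact (N + 1) * exp (m * exp t)"
      by (rule power_le_fact_exp) (use assms in simp)
    moreover have "exp t ^ (N + 1) = exp t * exp (t * real N)"
      by (simp add: exp_of_nat2_mult)
    ultimately have "m ^ (N + 1) * (exp t * exp (t * real N)) \<le> fact (N + 1) * exp (m * exp t)"
      by (simp add: power_mult_distrib mult.assoc mult.left_commute)
    then have "exp (t * real N) * exp (- (m * exp t)) \<le> fact (N + 1) / m ^ (N + 1) * exp (- t)"
      using assms by (simp add: exp_minus field_simps)
    also have "\<dots> \<le> ?A * exp (- t)" by (intro mult_right_mono) auto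
    finally show ?thesis using False by simp
  qed
qed

lemma integrable_radial_moment:
  assumes g: "exp_decaying g" and "N \<ge> 1"
  shows "integrable lborel (\<lambda>t. exp (t * real N) * g (exp t))"
proof -
  note [measurable] = exp_decaying_measurable[OF g]
  obtain m A where "m > 0" and A: "A \<ge> 0" "\<And>x. x \<ge> 0 \<Longrightarrow> g x \<le> A * exp (- (m * x))"
    using exp_decayingE[OF g] by metis
  obtain B where B: "B > 0" "\<And>t. exp (t * real N) * exp (- (m * exp t)) \<le> B * exp (- (1 * \<bar>t\<bar>))"
    using exp_power_decay[OF \<open>m > 0\<close> \<open>N \<ge> 1\<close>] by blast
  have dominated: "norm (exp (t * real N) * g (exp t)) \<le> norm (A * B * exp (- (1 * \<bar>t\<bar>)))" for t
  proof -
    have "norm (exp (t * real N) * g (exp t)) = exp (t * real N) * g (exp t)"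
      using exp_decaying_nonneg[OF g, of "exp t"] by simp
    also have "\<dots> \<le> exp (t * real N) * (A * exp (- (m * exp t)))" by (intro mult_left_mono A) auto
    also have "\<dots> = A * (exp (t * real N) * exp (- (m * exp t)))" by simp
    also have "\<dots> \<le> A * (B * exp (- (1 * \<bar>t\<bar>)))" by (intro mult_left_mono B A)
    finally show ?thesis using A(1) B(1) by simp
  qed
  show ?thesis
  proof (rule Bochner_Integration.integrable_bound[OF _ _ AE_I2[OF dominated]])
    show "integrable lborel (\<lambda>t. A * B * exp (- (1 * \<bar>t\<bar>)))"
      by (intro integrable_mult_right integrable_exp_abs) simp
  qed measurable
qed

lemma integral_lborel_pos:
  fixes f :: "'a::euclidean_space \<Rightarrow> real"
  assumes integrable: "integrable lborel f" and pos: "\<And>x. f x > 0"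
  shows "(\<integral>x. f x \<partial>lborel) > 0"
proof -
  have "(\<integral>x. f x \<partial>lborel) \<noteq> 0"
  proof
    assume "(\<integral>x. f x \<partial>lborel) = 0"
    then have "AE x in lborel. f x = 0"
      using integral_nonneg_eq_0_iff_AE[OF integrable] pos by (simp add: less_imp_le)
    then have "AE x in (lborel :: 'a measure). \<not> True"
      by (rule eventually_mono) (metis pos less_irrefl)
    from emeasure_eq_0_AE[OF this] show False by simp
  qed
  moreover have "(\<integral>x. f x \<partial>lborel) \<ge> 0"
    using pos by (intro integral_nonneg_AE) (simp add: less_imp_le)
  ultimately show ?thesis by simp
qed

lemma radial_moment_pos:
  assumes "exp_decaying g" "N \<ge> 1" "\<And>x. x > 0 \<Longrightarrow> g x > 0"
  shows "radial_moment g N > 0"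
  unfolding radial_moment_def using integrable_radial_moment[OF assms(1,2)] assms(3)
  by (intro integral_lborel_pos) auto

lemma radial_moment_exp: "radial_moment (\<lambda>x. exp (- x)) (Suc N) = fact N"
proof -
  let ?f = "\<lambda>y::real. y ^ N * exp (- y)"
  have exp_Suc: "exp (t * real (Suc N)) * exp (- exp t) = ?f (exp t) * exp t" for t
    by (simp only: exp_of_nat2_mult) simp
  have "integrable lborel (\<lambda>t. ?f (exp t) * exp t)"
    using integrable_radial_moment[OF exp_decaying_exp, of "Suc N"] unfolding exp_Suc by simp
  then have integrable: "set_integrable lborel (einterval (-\<infinity>) \<infinity>) (\<lambda>t. ?f (exp t) * exp t)"
    by (simp add: set_integrable_def)
  note substitution = interval_integral_substitution_nonneg[where g = exp and g' = exp and A = 0 and B = \<infinity>,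
      OF _ _ _ _ _ _ _ _ integrable]
  have limits: "((ereal \<circ> exp \<circ> real_of_ereal) \<longlongrightarrow> 0) (at_right (-\<infinity>))"
    "((ereal \<circ> exp \<circ> real_of_ereal) \<longlongrightarrow> \<infinity>) (at_left \<infinity>)"
    using exp_at_bot exp_at_top by (simp_all add: ereal_tendsto_simps zero_ereal_def)
  have half_line: "einterval 0 \<infinity> = {0<..}"
    by (auto simp: einterval_def zero_ereal_def)
  have set_integrable: "set_integrable lborel {0<..} ?f"
    using substitution(1) limits by (simp add: half_line)
  have "radial_moment (\<lambda>x. exp (- x)) (Suc N) = (LBINT y=0..\<infinity>. ?f y)"
    unfolding radial_moment_def exp_Suc using substitution(2) limits
    by (simp add: half_line interval_lebesgue_integral_def set_lebesgue_integral_def)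
  also have "\<dots> = integral {0<..} ?f"
    using set_borel_integral_eq_integral(2)[OF set_integrable]
    by (simp add: interval_lebesgue_integral_def half_line)
  also have "\<dots> = fact N"
  proof (rule integral_unique)
    have "((\<lambda>t. t powr (real (Suc N) - 1) / exp t) has_integral Gamma (1 + real N)) {0..}"
      using Gamma_integral_real[of "real (Suc N)"] by (simp add: add.commute)
    then have "((\<lambda>t. if t \<in> {0<..} then ?f t else 0) has_integral fact N) {0..}"
      unfolding Gamma_fact
      by (rule has_integral_spike[of "{0}", rotated 2]) (auto simp: powr_realpow exp_minus divide_inverse)
    then show "(?f has_integral fact N) {0<..}" by (subst (asm) has_integral_restrict) auto
  qed
  finally show ?thesis .
qed

lemma homogeneous_bound:
  fixes H :: "'a::euclidean_space \<Rightarrow> 'b::real_normed_vector"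
  assumes "continuous_on UNIV H" and homogeneous: "\<And>t z. H (t *\<^sub>R z) = t ^ d *\<^sub>R H z"
  obtains M where "M \<ge> 0" "\<And>z. norm (H z) \<le> M * norm z ^ d"
proof -
  have "compact (H ` sphere 0 1)"
    by (intro compact_continuous_image continuous_on_subset[OF assms(1)]) auto
  from compact_imp_bounded[OF this] obtain M where "\<forall>y\<in>H ` sphere 0 1. norm y \<le> M"
    unfolding bounded_iff by blast
  then have M: "norm (H u) \<le> M" if "norm u = 1" for u
    using that by simp
  have "norm (H z) \<le> M * norm z ^ d" for z
  proof -
    obtain b :: 'a where "norm b = 1" using vector_choose_size[of 1] by auto
    define u where "u = (if z = 0 then b else z /\<^sub>R norm z)"
    have u: "norm u = 1" "z = norm z *\<^sub>R u" using \<open>norm b = 1\<close> by (auto simp: u_def)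
    then have "norm (H z) = norm z ^ d * norm (H u)"
      using homogeneous[of "norm z" u] by simp
    also have "\<dots> \<le> norm z ^ d * M" by (intro mult_left_mono M u) simp
    finally show ?thesis by (simp add: mult.commute)
  qed
  moreover have "M \<ge> 0"
    using vector_choose_size[of 1] M norm_ge_zero by (metis order_trans zero_le_one)
  ultimately show ?thesis using that by blast
qed

lemma integrable_radial_weight:
  fixes f :: "'a::euclidean_space \<Rightarrow> complex"
  assumes [measurable]: "f \<in> borel_measurable borel" and bound: "\<And>z. norm (f z) \<le> M * norm z ^ d"
    and g: "exp_decaying g"
  shows "integrable lborel (\<lambda>z. f z * of_real (g ((norm z)\<^sup>2)))"
proof -
  note [measurable] = exp_decaying_measurable[OF g]
  obtain m A where "m > 0" and A: "\<And>x. x \<ge> 0 \<Longrightarrow> g x \<le> A * exp (- (m * x))"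
    using exp_decayingE[OF g] by metis
  have "norm (f z * of_real (g ((norm z)\<^sup>2)))
      \<le> M * A * (norm z ^ d * exp (0 * norm z) * exp (- (m * (norm z)\<^sup>2)))" for z
  proof -
    have "norm (f z * of_real (g ((norm z)\<^sup>2))) = norm (f z) * g ((norm z)\<^sup>2)"
      using exp_decaying_nonneg[OF g, of "(norm z)\<^sup>2"] by (simp add: norm_mult)
    also have "\<dots> \<le> (M * norm z ^ d) * (A * exp (- (m * (norm z)\<^sup>2)))"
      using exp_decaying_nonneg[OF g] by (intro mult_mono bound A) (auto intro: order_trans[OF norm_ge_zero bound])
    finally show ?thesis by (simp add: algebra_simps)
  qed
  then show ?thesis
    by (intro integrable_gaussian_bound[OF _ \<open>m > 0\<close> order_refl]) measurable
qed

definition radial_pair ::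
    "nat \<Rightarrow> (complex ^ 'n \<Rightarrow> complex) \<Rightarrow> (real \<Rightarrow> real) \<Rightarrow> (real \<Rightarrow> real) \<Rightarrow> complex ^ 'n \<Rightarrow> real \<Rightarrow> complex"
  where "radial_pair N H g\<^sub>1 g\<^sub>2 z t
    = H z * of_real (g\<^sub>1 ((norm z)\<^sup>2) * ((exp t * (norm z)\<^sup>2) ^ N * g\<^sub>2 (exp t * (norm z)\<^sup>2)))"

lemma radial_pair_translate:
  assumes "z \<noteq> 0"
  shows "radial_pair N H g\<^sub>1 g\<^sub>2 z t = (H z * of_real (g\<^sub>1 ((norm z)\<^sup>2)))
    * of_real (exp ((ln ((norm z)\<^sup>2) + 1 * t) * real N) * g\<^sub>2 (exp (ln ((norm z)\<^sup>2) + 1 * t)))"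
proof -
  have "exp (ln ((norm z)\<^sup>2) + 1 * t) = exp t * (norm z)\<^sup>2"
    using assms by (simp add: exp_add mult.commute)
  then show ?thesis
    unfolding exp_of_nat2_mult by (simp add: radial_pair_def)
qed

lemma
  assumes "z \<noteq> 0" "exp_decaying g\<^sub>2" "N \<ge> 1"
  shows integrable_radial_pair_slice: "integrable lborel (\<lambda>t. radial_pair N H g\<^sub>1 g\<^sub>2 z t)"
    and integral_radial_pair_slice:
      "(\<integral>t. radial_pair N H g\<^sub>1 g\<^sub>2 z t \<partial>lborel) = H z * of_real (g\<^sub>1 ((norm z)\<^sup>2)) * of_real (radial_moment g\<^sub>2 N)"
    and integral_norm_radial_pair_slice:
      "(\<integral>t. norm (radial_pair N H g\<^sub>1 g\<^sub>2 z t) \<partial>lborel) = norm (H z * of_real (g\<^sub>1 ((norm z)\<^sup>2))) * radial_moment g\<^sub>2 N"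
proof -
  let ?F = "\<lambda>t. exp (t * real N) * g\<^sub>2 (exp t)"
  let ?s = "ln ((norm z)\<^sup>2)"
  have "integrable lborel (\<lambda>t. ?F (?s + 1 * t))"
    by (rule lborel_integrable_real_affine[OF integrable_radial_moment[OF assms(2,3)]]) simp
  then show "integrable lborel (\<lambda>t. radial_pair N H g\<^sub>1 g\<^sub>2 z t)"
    unfolding radial_pair_translate[OF assms(1)] by (intro integrable_mult_right integrable_of_real)
  have translation: "(\<integral>t. ?F (?s + 1 * t) \<partial>lborel) = radial_moment g\<^sub>2 N"
    using lborel_integral_real_affine[of 1 ?F ?s] by (simp add: radial_moment_def)
  show "(\<integral>t. radial_pair N H g\<^sub>1 g\<^sub>2 z t \<partial>lborel) = H z * of_real (g\<^sub>1 ((norm z)\<^sup>2)) * of_real (radial_moment g\<^sub>2 N)"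
    unfolding radial_pair_translate[OF assms(1)] translation[symmetric]
    by (simp only: integral_mult_right_zero integral_complex_of_real)
  have "norm (radial_pair N H g\<^sub>1 g\<^sub>2 z t) = norm (H z * of_real (g\<^sub>1 ((norm z)\<^sup>2))) * ?F (?s + 1 * t)" for t
    unfolding radial_pair_translate[OF assms(1)] norm_mult[of "H z * of_real (g\<^sub>1 ((norm z)\<^sup>2))"] norm_of_real
    using exp_decaying_nonneg[OF assms(2), of "exp (?s + 1 * t)"] by simp
  then show "(\<integral>t. norm (radial_pair N H g\<^sub>1 g\<^sub>2 z t) \<partial>lborel)
      = norm (H z * of_real (g\<^sub>1 ((norm z)\<^sup>2))) * radial_moment g\<^sub>2 N"
    by (simp only: integral_mult_right_zero translation)
qed

lemma radial_pair_measurable: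
  assumes [measurable]: "H \<in> borel_measurable borel" "g\<^sub>1 \<in> borel_measurable borel" "g\<^sub>2 \<in> borel_measurable borel"
  shows "(\<lambda>(z, t). radial_pair N H g\<^sub>1 g\<^sub>2 z t) \<in> borel_measurable (lborel \<Otimes>\<^sub>M lborel)"
  unfolding radial_pair_def case_prod_unfold by measurable

lemma
  fixes H :: "complex ^ 'n \<Rightarrow> complex"
  assumes H [measurable]: "H \<in> borel_measurable borel" and bound: "\<And>z. norm (H z) \<le> M * norm z ^ d"
    and g: "exp_decaying g\<^sub>1" "exp_decaying g\<^sub>2" and N: "N \<ge> 1"
  shows integrable_radial_pair: "integrable (lborel \<Otimes>\<^sub>M lborel) (\<lambda>(z, t). radial_pair N H g\<^sub>1 g\<^sub>2 z t)"
    and integral_radial_pair: "(\<integral>z. (\<integral>t. radial_pair N H g\<^sub>1 g\<^sub>2 z t \<partial>lborel) \<partial>lborel)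
      = (\<integral>z. H z * of_real (g\<^sub>1 ((norm z)\<^sup>2)) \<partial>lborel) * of_real (radial_moment g\<^sub>2 N)"
proof -
  note [measurable] = g[THEN exp_decaying_measurable]
  note pair_measurable = radial_pair_measurable[OF H g[THEN exp_decaying_measurable], of N]
  have nonzero: "AE z in (lborel :: (complex ^ 'n) measure). z \<noteq> 0" by (rule AE_lborel_singleton)
  have integrable: "integrable lborel (\<lambda>z. H z * of_real (g\<^sub>1 ((norm z)\<^sup>2)))"
    by (rule integrable_radial_weight[OF H bound g(1)])
  show "integrable (lborel \<Otimes>\<^sub>M lborel) (\<lambda>(z, t). radial_pair N H g\<^sub>1 g\<^sub>2 z t)"
  proof (rule lborel_pair.Fubini_integrable[OF pair_measurable])
    have "integrable lborel (\<lambda>z. norm (H z * of_real (g\<^sub>1 ((norm z)\<^sup>2))) * radial_moment g\<^sub>2 N)"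
      using integrable by (intro integrable_mult_left integrable_norm)
    then show "integrable lborel (\<lambda>z. \<integral>t. norm (case (z, t) of (z, t) \<Rightarrow> radial_pair N H g\<^sub>1 g\<^sub>2 z t) \<partial>lborel)"
    proof (rule integrable_cong_AE_imp)
      show "AE z in lborel. norm (H z * of_real (g\<^sub>1 ((norm z)\<^sup>2))) * radial_moment g\<^sub>2 N
          = (\<integral>t. norm (case (z, t) of (z, t) \<Rightarrow> radial_pair N H g\<^sub>1 g\<^sub>2 z t) \<partial>lborel)"
        unfolding case_prod_conv
        using nonzero by eventually_elim (rule integral_norm_radial_pair_slice[OF _ g(2) N, symmetric])
    qed (use pair_measurable in measurable)
    show "AE z in lborel. integrable lborel (\<lambda>t. case (z, t) of (z, t) \<Rightarrow> radial_pair N H g\<^sub>1 g\<^sub>2 z t)"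
      unfolding case_prod_conv using nonzero by eventually_elim (rule integrable_radial_pair_slice[OF _ g(2) N])
  qed
  have "(\<integral>z. (\<integral>t. radial_pair N H g\<^sub>1 g\<^sub>2 z t \<partial>lborel) \<partial>lborel)
      = (\<integral>z. H z * of_real (g\<^sub>1 ((norm z)\<^sup>2)) * of_real (radial_moment g\<^sub>2 N) \<partial>lborel)"
  proof (rule integral_cong_AE)
    show "AE z in lborel. (\<integral>t. radial_pair N H g\<^sub>1 g\<^sub>2 z t \<partial>lborel)
        = H z * of_real (g\<^sub>1 ((norm z)\<^sup>2)) * of_real (radial_moment g\<^sub>2 N)"
      using nonzero by eventually_elim (rule integral_radial_pair_slice[OF _ g(2) N])
    show "(\<lambda>z. \<integral>t. radial_pair N H g\<^sub>1 g\<^sub>2 z t \<partial>lborel) \<in> borel_measurable lborel"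
      using lborel.borel_measurable_lebesgue_integral[OF pair_measurable] by simp
  qed measurable
  then show "(\<integral>z. (\<integral>t. radial_pair N H g\<^sub>1 g\<^sub>2 z t \<partial>lborel) \<partial>lborel)
      = (\<integral>z. H z * of_real (g\<^sub>1 ((norm z)\<^sup>2)) \<partial>lborel) * of_real (radial_moment g\<^sub>2 N)"
    by simp
qed

text \<open>Dilate \<open>z\<close> by \<open>exp (- t / 2)\<close>.\<close>
lemma integral_radial_pair_swap:
  fixes H :: "complex ^ 'n \<Rightarrow> complex"
  assumes H [measurable]: "H \<in> borel_measurable borel"
    and homogeneous: "\<And>t z. H (t *\<^sub>R z) = t ^ (2 * k) *\<^sub>R H z"
    and g: "g\<^sub>1 \<in> borel_measurable borel" "g\<^sub>2 \<in> borel_measurable borel"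
  shows "(\<integral>z. radial_pair (CARD('n) + k) H g\<^sub>1 g\<^sub>2 z t \<partial>lborel)
    = (\<integral>z. radial_pair (CARD('n) + k) H g\<^sub>2 g\<^sub>1 z (- t) \<partial>lborel)"
proof -
  let ?N = "CARD('n) + k"
  define c where "c = exp (- t / 2)"
  have c: "c > 0" "c\<^sup>2 = exp (- t)" by (auto simp: c_def power2_eq_square simp flip: exp_add)
  have jacobian: "c ^ DIM(complex ^ 'n) * c ^ (2 * k) = exp (- t) ^ ?N"
    unfolding c(2)[symmetric] by (simp add: power_add mult.commute flip: power_mult)
  have dilate: "(c ^ DIM(complex ^ 'n)) *\<^sub>R radial_pair ?N H g\<^sub>1 g\<^sub>2 (c *\<^sub>R z) t = radial_pair ?N H g\<^sub>2 g\<^sub>1 z (- t)" for z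
  proof -
    have norm_dilate: "(norm (c *\<^sub>R z))\<^sup>2 = exp (- t) * (norm z)\<^sup>2" using c by (simp add: power_mult_distrib)
    have cancel: "exp t * (exp (- t) * (norm z)\<^sup>2) = (norm z)\<^sup>2" by (simp add: exp_minus field_simps)
    show ?thesis
      unfolding radial_pair_def norm_dilate cancel homogeneous power_mult_distrib jacobian[symmetric]
      by (simp add: scaleR_conv_of_real)
  qed
  have "(\<lambda>z. radial_pair ?N H g\<^sub>1 g\<^sub>2 z t) \<in> borel_measurable borel"
    unfolding radial_pair_def using g by measurable
  then have "(\<integral>z. radial_pair ?N H g\<^sub>1 g\<^sub>2 z t \<partial>lborel)
      = (c ^ DIM(complex ^ 'n)) *\<^sub>R (\<integral>z. radial_pair ?N H g\<^sub>1 g\<^sub>2 (c *\<^sub>R z) t \<partial>lborel)"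
    by (rule integral_lborel_scale) (use c in auto)
  also have "\<dots> = (\<integral>z. radial_pair ?N H g\<^sub>2 g\<^sub>1 z (- t) \<partial>lborel)"
    unfolding integral_scaleR_right[symmetric] by (simp only: dilate)
  finally show ?thesis .
qed

lemma radial_exchange:
  fixes H :: "complex ^ 'n \<Rightarrow> complex"
  assumes continuous: "continuous_on UNIV H" and homogeneous: "\<And>t z. H (t *\<^sub>R z) = t ^ (2 * k) *\<^sub>R H z"
    and g: "exp_decaying g\<^sub>1" "exp_decaying g\<^sub>2"
  shows "(\<integral>z. H z * of_real (g\<^sub>1 ((norm z)\<^sup>2)) \<partial>lborel) * of_real (radial_moment g\<^sub>2 (CARD('n) + k))
    = (\<integral>z. H z * of_real (g\<^sub>2 ((norm z)\<^sup>2)) \<partial>lborel) * of_real (radial_moment g\<^sub>1 (CARD('n) + k))"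
proof -
  let ?N = "CARD('n) + k"
  have N: "?N \<ge> 1" by (simp add: Suc_leI)
  obtain M where bound: "\<And>z. norm (H z) \<le> M * norm z ^ (2 * k)"
    using homogeneous_bound[OF continuous homogeneous] by blast
  have H: "H \<in> borel_measurable borel" by (rule borel_measurable_continuous_onI[OF continuous])
  note fubini = lborel_pair.Fubini_integral[OF integrable_radial_pair[OF H bound _ _ N]]
  have "(\<integral>z. H z * of_real (g\<^sub>1 ((norm z)\<^sup>2)) \<partial>lborel) * of_real (radial_moment g\<^sub>2 ?N)
      = (\<integral>t. (\<integral>z. radial_pair ?N H g\<^sub>1 g\<^sub>2 z t \<partial>lborel) \<partial>lborel)"
    by (simp only: fubini[OF g] integral_radial_pair[OF H bound g N])
  also have "\<dots> = (\<integral>t. (\<integral>z. radial_pair ?N H g\<^sub>2 g\<^sub>1 z (- t) \<partial>lborel) \<partial>lborel)"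
    by (simp only: integral_radial_pair_swap[OF H homogeneous g[THEN exp_decaying_measurable]])
  also have "\<dots> = (\<integral>t. (\<integral>z. radial_pair ?N H g\<^sub>2 g\<^sub>1 z t \<partial>lborel) \<partial>lborel)"
    using lborel_integral_real_affine[of "-1" "\<lambda>t. \<integral>z. radial_pair ?N H g\<^sub>2 g\<^sub>1 z t \<partial>lborel" 0] by simp
  also have "\<dots> = (\<integral>z. H z * of_real (g\<^sub>2 ((norm z)\<^sup>2)) \<partial>lborel) * of_real (radial_moment g\<^sub>1 ?N)"
    by (simp only: fubini[OF g(2,1)] integral_radial_pair[OF H bound g(2,1) N])
  finally show ?thesis .
qed

section \<open>Homogeneous polynomials\<close>

definition homogeneous_poly :: "nat \<Rightarrow> (complex ^ 'n \<Rightarrow> complex) \<Rightarrow> bool"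
  where "homogeneous_poly k p \<longleftrightarrow> entire p \<and> (\<forall>c z. p (c *s z) = c ^ k * p z)"

lemma homogeneous_poly_entire: "homogeneous_poly k p \<Longrightarrow> entire p"
  by (simp add: homogeneous_poly_def)

lemma homogeneous_poly_measurable: "homogeneous_poly k p \<Longrightarrow> p \<in> borel_measurable borel"
  by (simp add: homogeneous_poly_entire entire_imp_borel_measurable)

lemma homogeneous_poly_smult: "homogeneous_poly k p \<Longrightarrow> p (c *s z) = c ^ k * p z"
  by (simp add: homogeneous_poly_def)

lemma homogeneous_poly_bound:
  assumes p: "homogeneous_poly k p"
  obtains M where "M \<ge> 0" "\<And>z. norm (p z) \<le> M * norm z ^ k"
proof (rule homogeneous_bound[of p k])
  show "continuous_on UNIV p"
    by (rule entire_imp_continuous_on[OF homogeneous_poly_entire[OF p]])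
  show "p (t *\<^sub>R z) = t ^ k *\<^sub>R p z" for t z
    by (simp add: scaleR_eq_smult homogeneous_poly_smult[OF p] scaleR_conv_of_real)
qed (rule that)

lemma homogeneous_poly_monomial:
  "homogeneous_poly (\<Sum>j\<in>UNIV. \<alpha> j) (\<lambda>z. \<Prod>j\<in>UNIV. (z $ j) ^ \<alpha> j)"
  unfolding homogeneous_poly_def
  by (auto intro!: entire_prod entire_power entire_nth simp: power_mult_distrib prod.distrib power_sum)

lemma homogeneous_poly_herm_power: "homogeneous_poly k (\<lambda>z. herm z w ^ k)"
  unfolding homogeneous_poly_def
  by (auto intro!: entire_power entire_herm simp: herm_scale_left power_mult_distrib)

lemma homogeneous_poly_herm_bound:
  assumes "homogeneous_poly k p"
  obtains M where "\<And>z. norm (p z * cnj (herm z w) ^ m) \<le> M * norm z ^ (k + m)"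
proof -
  obtain M where M: "M \<ge> 0" "\<And>z. norm (p z) \<le> M * norm z ^ k"
    using homogeneous_poly_bound[OF assms] by blast
  have "norm (p z * cnj (herm z w) ^ m) \<le> M * norm w ^ m * norm z ^ (k + m)" for z
  proof -
    have "norm (p z * cnj (herm z w) ^ m) \<le> (M * norm z ^ k) * (norm z * norm w) ^ m"
      unfolding norm_mult norm_power complex_mod_cnj
      using M(1) by (intro mult_mono power_mono M norm_herm_le) auto
    then show ?thesis by (simp add: power_mult_distrib power_add mult_ac)
  qed
  then show ?thesis by (rule that)
qed

lemma ex_unit_power_eq_minus_1:
  assumes "m \<noteq> k"
  obtains c where "norm c = 1" "c ^ k * cnj c ^ m = - 1"
proof -
  have cis_powers: "cis t ^ a * cnj (cis t) ^ b = cis (t * (real a - real b))" for t a b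
    by (simp only: cis_cnj Complex.DeMoivre cis_mult) (rule arg_cong[where f = cis], simp add: algebra_simps)
  have "cis (pi / (real k - real m) * (real k - real m)) = - 1"
    using assms by simp
  then show ?thesis
    using cis_powers[of "pi / (real k - real m)" k m] that[of "cis (pi / (real k - real m))"] by simp
qed

lemma homogeneous_poly_orthogonal:
  fixes p :: "complex ^ 'n \<Rightarrow> complex"
  assumes p: "homogeneous_poly k p" and "m \<noteq> k"
    and [measurable]: "(\<lambda>z :: complex ^ 'n. g (norm z)) \<in> borel_measurable borel"
  shows "(\<integral>z. p z * cnj (herm z w) ^ m * of_real (g (norm z)) \<partial>lborel) = 0"
proof -
  note [measurable] = homogeneous_poly_measurable[OF p]
  define f where "f z = p z * cnj (herm z w) ^ m * of_real (g (norm z))" for z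
  have f_measurable: "f \<in> borel_measurable borel" unfolding f_def by measurable
  obtain c where c: "norm c = 1" "c ^ k * cnj c ^ m = - 1"
    using ex_unit_power_eq_minus_1[OF \<open>m \<noteq> k\<close>] by blast
  have "f (c *s z) = (c ^ k * cnj c ^ m) * f z" for z
    using c(1) by (simp add: f_def homogeneous_poly_smult[OF p] herm_scale_left norm_smult power_mult_distrib)
  then have "f (c *s z) = - f z" for z using c by simp
  then have "(\<integral>z. f z \<partial>lborel) = - (\<integral>z. f z \<partial>lborel)"
    using integral_rotation[OF f_measurable c(1)] by simp
  then show ?thesis by (simp add: f_def)
qed

definition gaussian_mass :: "'n::finite itself \<Rightarrow> real"
  where "gaussian_mass _ = (\<integral>z. exp (- (norm z)\<^sup>2) \<partial>(lborel :: (complex ^ 'n) measure))"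

lemma gaussian_mass_pos: "gaussian_mass TYPE('n::finite) > 0"
  unfolding gaussian_mass_def using integrable_gaussian[of 1] by (intro integral_lborel_pos) auto

lemma integrable_gaussian_poly_exp:
  fixes p :: "complex ^ 'n \<Rightarrow> complex"
  assumes p: "homogeneous_poly k p"
  shows "integrable lborel (\<lambda>z. norm (p z) * exp (norm z * norm w) * exp (- (norm z)\<^sup>2))"
proof -
  note [measurable] = homogeneous_poly_measurable[OF p]
  obtain M where M: "\<And>z. norm (p z) \<le> M * norm z ^ k"
    using homogeneous_poly_bound[OF p] by blast
  have "norm (norm (p z) * exp (norm z * norm w) * exp (- (norm z)\<^sup>2))
      \<le> M * (norm z ^ k * exp (norm w * norm z) * exp (- (1 * (norm z)\<^sup>2)))" for z
    using mult_right_mono[OF M[of z], of "exp (norm z * norm w) * exp (- (norm z)\<^sup>2)"]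
    by (simp add: norm_mult algebra_simps)
  then show ?thesis
    by (intro integrable_gaussian_bound[of _ 1 "norm w"]) auto
qed

lemma integrable_gaussian_poly_dominated:
  fixes p :: "complex ^ 'n \<Rightarrow> complex"
  assumes p: "homogeneous_poly k p" and [measurable]: "f \<in> borel_measurable borel"
    and dominated: "\<And>z. norm (f z) \<le> exp (norm z * norm w)"
  shows "integrable lborel (\<lambda>z. p z * f z * of_real (exp (- (norm z)\<^sup>2)))"
proof (rule Bochner_Integration.integrable_bound[OF integrable_gaussian_poly_exp[OF p, of w]])
  note [measurable] = homogeneous_poly_measurable[OF p]
  show "(\<lambda>z. p z * f z * of_real (exp (- (norm z)\<^sup>2))) \<in> borel_measurable lborel"
    by measurable
  show "AE z in lborel. norm (p z * f z * of_real (exp (- (norm z)\<^sup>2)))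
      \<le> norm (norm (p z) * exp (norm z * norm w) * exp (- (norm z)\<^sup>2))"
    using dominated by (intro AE_I2) (simp add: norm_mult mult_left_mono mult_right_mono)
qed

lemma norm_exp_herm_le: "norm (exp (herm w z)) \<le> exp (norm z * norm w)"
  using complex_Re_le_cmod[of "herm w z"] norm_herm_le[of w z] by (simp add: mult.commute)

lemma exp_herm_gaussian_translate:
  "exp (herm w (w + u)) * of_real (exp (- (norm (w + u))\<^sup>2)) = exp (- 1 * herm u w) * of_real (exp (- (norm u)\<^sup>2))"
proof -
  have "herm w u - 2 * complex_of_real (Re (herm u w)) = - herm u w"
    by (simp add: complex_eq_iff flip: cnj_herm[of u w])
  then have "herm w (w + u) - complex_of_real ((norm (w + u))\<^sup>2) = - herm u w - complex_of_real ((norm u)\<^sup>2)"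
    unfolding norm_add_herm by (simp add: herm_add_right herm_self algebra_simps)
  then have "exp (herm w (w + u) - complex_of_real ((norm (w + u))\<^sup>2))
      = exp (- herm u w - complex_of_real ((norm u)\<^sup>2))"
    by simp
  then show ?thesis
    by (simp add: exp_diff exp_minus field_simps exp_of_real[symmetric] del: exp_of_real)
qed

text \<open>The translation to \<open>w\<close> completes the square and leaves an entire function times a Gaussian, so that
  the integral is given by the mean value property.\<close>
lemma gaussian_reproducing_exp:
  fixes p :: "complex ^ 'n \<Rightarrow> complex"
  assumes p: "homogeneous_poly k p"
  shows "(\<integral>z. p z * exp (herm w z) * of_real (exp (- (norm z)\<^sup>2)) \<partial>lborel) = gaussian_mass TYPE('n) * p w"
proof -
  note [measurable] = homogeneous_poly_measurable[OF p]
  define f where "f z = p z * exp (herm w z) * of_real (exp (- (norm z)\<^sup>2))" for z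
  have f_measurable [measurable]: "f \<in> borel_measurable borel" unfolding f_def by measurable
  have f_integrable: "integrable lborel f"
    unfolding f_def by (rule integrable_gaussian_poly_dominated[OF p _ norm_exp_herm_le]) measurable
  define h where "h u = p (w + u) * exp (- 1 * herm u w)" for u
  have h: "entire h"
    unfolding h_def
    by (intro entire_mult entire_exp entire_const entire_herm
        entire_compose_affine[OF homogeneous_poly_entire[OF p] complex_linear_ident])
  have translate: "f (w + u) = exp (- (norm u)\<^sup>2) *\<^sub>R h u" for u
    unfolding f_def h_def scaleR_conv_of_real mult.assoc exp_herm_gaussian_translate by (simp add: mult_ac)
  have "(\<integral>z. f z \<partial>lborel) = (\<integral>u. f (w + u) \<partial>lborel)"
    by (subst lborel_distr_plus[of w, symmetric], subst integral_distr) auto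
  also have "\<dots> = (\<integral>u. exp (- (norm u)\<^sup>2) *\<^sub>R h u \<partial>lborel)" by (simp add: translate)
  also have "\<dots> = (\<integral>u. exp (- (norm u)\<^sup>2) \<partial>(lborel :: (complex ^ 'n) measure)) *\<^sub>R h 0"
  proof (rule entire_mean_value[OF h])
    have "integrable (distr lborel borel ((+) w)) f" using f_integrable by (simp add: lborel_distr_plus)
    then have "integrable lborel (\<lambda>u. f (w + u))" by (rule integrable_distr[rotated]) simp
    then show "integrable lborel (\<lambda>u. exp (- (norm u)\<^sup>2) *\<^sub>R h u)" by (simp add: translate)
  qed (auto simp: norm_smult)
  also have "\<dots> = gaussian_mass TYPE('n) * p w" by (simp add: h_def gaussian_mass_def scaleR_conv_of_real)
  finally show ?thesis
    by (simp add: f_def)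
qed

lemma norm_exp_herm_partial_sum_le:
  "norm (\<Sum>i<m. herm w z ^ i / fact i) \<le> exp (norm z * norm w)"
proof -
  have "norm (\<Sum>i<m. herm w z ^ i / fact i) \<le> (\<Sum>i<m. (norm z * norm w) ^ i / fact i)"
    using power_mono[OF norm_herm_le[of w z]]
    by (intro sum_norm_le) (simp add: norm_divide norm_power mult.commute divide_right_mono)
  also have "\<dots> \<le> exp (norm z * norm w)" by (rule exp_partial_sum_le) simp
  finally show ?thesis .
qed

lemma norm_herm_power_le_exp: "norm (herm w z ^ i / fact i) \<le> exp (norm z * norm w)"
proof -
  have "norm (herm w z ^ i / fact i) \<le> (norm z * norm w) ^ i / fact i"
    using power_mono[OF norm_herm_le[of w z], of i]
    by (simp add: norm_divide norm_power mult.commute divide_right_mono)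
  also have "\<dots> \<le> exp (norm z * norm w)"
    using power_le_fact_exp[of "norm z * norm w" i] by (simp add: field_simps)
  finally show ?thesis .
qed

text \<open>By orthogonality only the term of degree \<open>k\<close> of the exponential series contributes.\<close>
lemma gaussian_integral_exp_partial_sum:
  fixes p :: "complex ^ 'n \<Rightarrow> complex"
  assumes p: "homogeneous_poly k p" and "k < m"
  shows "(\<integral>z. p z * (\<Sum>i<m. herm w z ^ i / fact i) * of_real (exp (- (norm z)\<^sup>2)) \<partial>lborel)
    = (\<integral>z. p z * cnj (herm z w) ^ k * of_real (exp (- (norm z)\<^sup>2)) \<partial>lborel) / fact k"
proof -
  let ?I = "\<lambda>i. \<integral>z. p z * cnj (herm z w) ^ i * of_real (exp (- (norm z)\<^sup>2)) \<partial>lborel"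
  have integrable: "integrable lborel (\<lambda>z. p z * (herm w z ^ i / fact i) * of_real (exp (- (norm z)\<^sup>2)))" for i
    by (rule integrable_gaussian_poly_dominated[OF p _ norm_herm_power_le_exp]) measurable
  have "(\<integral>z. p z * (\<Sum>i<m. herm w z ^ i / fact i) * of_real (exp (- (norm z)\<^sup>2)) \<partial>lborel)
      = (\<Sum>i<m. \<integral>z. p z * (herm w z ^ i / fact i) * of_real (exp (- (norm z)\<^sup>2)) \<partial>lborel)"
    unfolding sum_distrib_left sum_distrib_right using integrable by (rule Bochner_Integration.integral_sum)
  also have "\<dots> = (\<Sum>i<m. ?I i / fact i)" by (simp add: cnj_herm)
  also have "\<dots> = (\<Sum>i\<in>{k}. ?I i / fact i)"
    using assms(2) homogeneous_poly_orthogonal[OF p, of _ "\<lambda>r. exp (- r\<^sup>2)"]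
    by (intro sum.mono_neutral_right) auto
  finally show ?thesis by simp
qed

lemma gaussian_reproducing:
  fixes p :: "complex ^ 'n \<Rightarrow> complex"
  assumes p: "homogeneous_poly k p"
  shows "(\<integral>z. p z * cnj (herm z w) ^ k * of_real (exp (- (norm z)\<^sup>2)) \<partial>lborel)
    = fact k * gaussian_mass TYPE('n) * p w"
proof -
  note [measurable] = homogeneous_poly_measurable[OF p]
  let ?partial = "\<lambda>m z. p z * (\<Sum>i<m. herm w z ^ i / fact i) * of_real (exp (- (norm z)\<^sup>2))"
  have "(\<lambda>m. \<integral>z. ?partial m z \<partial>lborel)
      \<longlonglongrightarrow> (\<integral>z. p z * exp (herm w z) * of_real (exp (- (norm z)\<^sup>2)) \<partial>lborel)"
  proof (rule integral_dominated_convergence[OF _ _ integrable_gaussian_poly_exp[OF p, of w]])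
    have "(\<lambda>i. herm w z ^ i / fact i) sums exp (herm w z)" for z
      using exp_converges[of "herm w z"] by (simp add: scaleR_conv_of_real divide_inverse mult.commute)
    then show "AE z in lborel. (\<lambda>m. ?partial m z) \<longlonglongrightarrow> p z * exp (herm w z) * of_real (exp (- (norm z)\<^sup>2))"
      unfolding sums_def by (intro AE_I2 tendsto_intros)
    show "AE z in lborel. norm (?partial m z) \<le> norm (p z) * exp (norm z * norm w) * exp (- (norm z)\<^sup>2)" for m
      unfolding norm_mult by (intro AE_I2 mult_mono norm_exp_herm_partial_sum_le) auto
  qed measurable
  moreover have "(\<lambda>m. \<integral>z. ?partial m z \<partial>lborel)
      \<longlonglongrightarrow> (\<integral>z. p z * cnj (herm z w) ^ k * of_real (exp (- (norm z)\<^sup>2)) \<partial>lborel) / fact k"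
    by (rule tendsto_eventually, rule eventually_mono[OF eventually_gt_at_top[of k]])
      (rule gaussian_integral_exp_partial_sum[OF p])
  ultimately have "gaussian_mass TYPE('n) * p w
      = (\<integral>z. p z * cnj (herm z w) ^ k * of_real (exp (- (norm z)\<^sup>2)) \<partial>lborel) / fact k"
    unfolding gaussian_reproducing_exp[OF p] by (rule LIMSEQ_unique)
  then show ?thesis by (simp add: field_simps)
qed

lemma radial_reproducing:
  fixes p :: "complex ^ 'n \<Rightarrow> complex"
  assumes p: "homogeneous_poly k p" and g: "exp_decaying g"
  shows "(\<integral>z. p z * cnj (herm z w) ^ k * of_real (g ((norm z)\<^sup>2)) \<partial>lborel)
    = (fact k * gaussian_mass TYPE('n) * radial_moment g (CARD('n) + k) / fact (CARD('n) + k - 1)) * p w"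
proof -
  let ?H = "\<lambda>z. p z * cnj (herm z w) ^ k"
  have factorial: "radial_moment (\<lambda>x. exp (- x)) (CARD('n) + k) = fact (CARD('n) + k - 1)"
    using radial_moment_exp[of "CARD('n) + k - 1"] by simp
  have "continuous_on UNIV ?H"
    by (intro continuous_intros entire_imp_continuous_on[OF homogeneous_poly_entire[OF p]])
  moreover have "?H (t *\<^sub>R z) = t ^ (2 * k) *\<^sub>R ?H z" for t z
    by (simp add: scaleR_eq_smult homogeneous_poly_smult[OF p] herm_scale_left power_mult_distrib mult_2
        power_add scaleR_conv_of_real)
  ultimately have "(\<integral>z. ?H z * of_real (g ((norm z)\<^sup>2)) \<partial>lborel) * of_real (fact (CARD('n) + k - 1))
      = (\<integral>z. ?H z * of_real (exp (- (norm z)\<^sup>2)) \<partial>lborel) * of_real (radial_moment g (CARD('n) + k))"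
    unfolding factorial[symmetric] by (rule radial_exchange[OF _ _ g exp_decaying_exp])
  also have "(\<integral>z. ?H z * of_real (exp (- (norm z)\<^sup>2)) \<partial>lborel) = fact k * gaussian_mass TYPE('n) * p w"
    by (rule gaussian_reproducing[OF p])
  finally show ?thesis
    by (simp add: field_simps)
qed

section \<open>Square integrable functions and polynomials\<close>

definition sq_integral :: "'a measure \<Rightarrow> ('a \<Rightarrow> complex) \<Rightarrow> ennreal"
  where "sq_integral M f = (\<integral>\<^sup>+x. ennreal ((norm (f x))\<^sup>2) \<partial>M)"

lemma L2_iff: "f \<in> L2 M \<longleftrightarrow> f \<in> borel_measurable M \<and> sq_integral M f < \<infinity>"
  by (simp add: L2_def sq_integral_def)

lemma L2_measurable: "f \<in> L2 M \<Longrightarrow> f \<in> borel_measurable M"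
  by (simp add: L2_iff)

lemma L2_diff:
  assumes "f \<in> L2 M" "g \<in> L2 M"
  shows "(\<lambda>x. f x - g x) \<in> L2 M"
  unfolding L2_iff
proof
  note [measurable] = assms[THEN L2_measurable]
  show "(\<lambda>x. f x - g x) \<in> borel_measurable M" by measurable
  have "(norm (f x - g x))\<^sup>2 \<le> 2 * (norm (f x))\<^sup>2 + 2 * (norm (g x))\<^sup>2" for x
    using power_mono[OF norm_triangle_ineq4[of "f x" "g x"], of 2] sum_squares_bound[of "norm (f x)" "norm (g x)"]
    by (simp add: power2_sum)
  then have "sq_integral M (\<lambda>x. f x - g x)
      \<le> (\<integral>\<^sup>+x. 2 * ennreal ((norm (f x))\<^sup>2) + 2 * ennreal ((norm (g x))\<^sup>2) \<partial>M)"
    unfolding sq_integral_def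
    by (intro nn_integral_mono) (simp add: ennreal_leI flip: ennreal_plus ennreal_numeral ennreal_mult)
  also have "\<dots> = 2 * sq_integral M f + 2 * sq_integral M g"
    by (simp add: nn_integral_add nn_integral_cmult sq_integral_def)
  also have "\<dots> < \<infinity>" using assms by (simp add: L2_iff ennreal_mult_less_top)
  finally show "sq_integral M (\<lambda>x. f x - g x) < \<infinity>" .
qed

lemma
  assumes f: "f \<in> L2 M" and g: "g \<in> L2 M"
  shows L2_integrable_mult: "integrable M (\<lambda>x. f x * cnj (g x))"
    and L2_Cauchy_Schwarz: "ennreal ((norm (\<integral>x. f x * cnj (g x) \<partial>M))\<^sup>2) \<le> sq_integral M f * sq_integral M g"
proof -
  note [measurable] = f[THEN L2_measurable] g[THEN L2_measurable]
  let ?I = "\<integral>\<^sup>+x. ennreal (norm (f x)) * ennreal (norm (g x)) \<partial>M"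
  have Cauchy_Schwarz: "?I\<^sup>2 \<le> sq_integral M f * sq_integral M g"
    using Cauchy_Schwarz_nn_integral[of "\<lambda>x. ennreal (norm (f x))" M "\<lambda>x. ennreal (norm (g x))"]
    by (simp add: sq_integral_def ennreal_power)
  also have "\<dots> < \<infinity>" using f g by (simp add: L2_iff ennreal_mult_less_top)
  finally have finite: "?I < \<infinity>" by (simp add: power_less_top_ennreal)
  have norm_integral: "(\<integral>\<^sup>+x. ennreal (norm (f x * cnj (g x))) \<partial>M) = ?I"
    by (simp add: norm_mult ennreal_mult)
  show integrable: "integrable M (\<lambda>x. f x * cnj (g x))"
    by (rule integrableI_bounded) (use finite norm_integral in auto)
  have "ennreal (norm (\<integral>x. f x * cnj (g x) \<partial>M)) \<le> ?I"
    using integral_norm_bound_ennreal[OF integrable] norm_integral by simp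
  then have "ennreal (norm (\<integral>x. f x * cnj (g x) \<partial>M)) ^ 2 \<le> ?I ^ 2" by (rule power_mono) simp
  with Cauchy_Schwarz show "ennreal ((norm (\<integral>x. f x * cnj (g x) \<partial>M))\<^sup>2) \<le> sq_integral M f * sq_integral M g"
    by (simp add: ennreal_power)
qed

lemma L2_integral_diff_left:
  assumes "f \<in> L2 M" "g \<in> L2 M" "h \<in> L2 M"
  shows "(\<integral>x. (f x - g x) * cnj (h x) \<partial>M) = (\<integral>x. f x * cnj (h x) \<partial>M) - (\<integral>x. g x * cnj (h x) \<partial>M)"
  using assms by (simp add: left_diff_distrib L2_integrable_mult)

lemma L2_integral_diff_right:
  assumes "f \<in> L2 M" "g \<in> L2 M" "h \<in> L2 M"
  shows "(\<integral>x. f x * cnj (g x - h x) \<partial>M) = (\<integral>x. f x * cnj (g x) \<partial>M) - (\<integral>x. f x * cnj (h x) \<partial>M)"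
  using assms by (simp add: right_diff_distrib L2_integrable_mult)

lemma sq_integral_eq_integral:
  assumes f: "integrable M (\<lambda>x. f x * cnj (f x))" and integral: "(\<integral>x. f x * cnj (f x) \<partial>M) = of_real v"
  shows "sq_integral M f = ennreal v"
proof -
  have square: "f x * cnj (f x) = of_real ((norm (f x))\<^sup>2)" for x
    by (rule complex_norm_square[symmetric])
  have "integrable M (\<lambda>x. (norm (f x))\<^sup>2)"
    using f unfolding square by (simp only: complex_of_real_integrable_eq)
  moreover have "(\<integral>x. (norm (f x))\<^sup>2 \<partial>M) = v"
    using integral unfolding square integral_complex_of_real of_real_eq_iff .
  ultimately show ?thesis
    unfolding sq_integral_def by (simp add: nn_integral_eq_integral)
qed

definition monomial :: "('n \<Rightarrow> nat) \<Rightarrow> complex ^ 'n \<Rightarrow> complex"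
  where "monomial \<alpha> z = (\<Prod>j\<in>UNIV. (z $ j) ^ \<alpha> j)"

lemma holomorphic_polynomialsI:
  "finite A \<Longrightarrow> p = (\<lambda>z. \<Sum>\<alpha>\<in>A. c \<alpha> * monomial \<alpha> z) \<Longrightarrow> p \<in> holomorphic_polynomials"
  unfolding holomorphic_polynomials_def monomial_def by blast

lemma holomorphic_polynomialsE:
  assumes "p \<in> holomorphic_polynomials"
  obtains A c where "finite A" "p = (\<lambda>z. \<Sum>\<alpha>\<in>A. c \<alpha> * monomial \<alpha> z)"
  using assms unfolding holomorphic_polynomials_def monomial_def by blast

lemma monomial_add: "monomial (\<lambda>j. \<alpha> j + \<beta> j) z = monomial \<alpha> z * monomial \<beta> z"
  by (simp add: monomial_def power_add prod.distrib)

lemma holomorphic_polynomials_monomial: "(\<lambda>z. a * monomial \<alpha> z) \<in> holomorphic_polynomials"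
  by (rule holomorphic_polynomialsI[of "{\<alpha>}" _ "\<lambda>_. a"]) auto

lemma holomorphic_polynomials_const: "(\<lambda>z. a) \<in> holomorphic_polynomials"
  using holomorphic_polynomials_monomial[of a "\<lambda>_. 0"] by (simp add: monomial_def)

lemma holomorphic_polynomials_nth: "(\<lambda>z. z $ k) \<in> holomorphic_polynomials"
proof -
  have "monomial (\<lambda>j. if j = k then 1 else 0) z = z $ k" for z :: "complex ^ 'a"
  proof -
    have "monomial (\<lambda>j. if j = k then 1 else 0) z = (\<Prod>j\<in>{k}. (z $ j) ^ (if j = k then 1 else 0))"
      unfolding monomial_def by (rule prod.mono_neutral_right) auto
    then show ?thesis by simp
  qed
  then show ?thesis
    using holomorphic_polynomials_monomial[of 1 "\<lambda>j. if j = k then 1 else 0"] by simp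
qed

lemma holomorphic_polynomials_add:
  assumes "p \<in> holomorphic_polynomials" "q \<in> holomorphic_polynomials"
  shows "(\<lambda>z. p z + q z) \<in> holomorphic_polynomials"
proof -
  obtain A c where p: "finite A" "p = (\<lambda>z. \<Sum>\<alpha>\<in>A. c \<alpha> * monomial \<alpha> z)"
    using holomorphic_polynomialsE[OF assms(1)] .
  obtain B d where q: "finite B" "q = (\<lambda>z. \<Sum>\<alpha>\<in>B. d \<alpha> * monomial \<alpha> z)"
    using holomorphic_polynomialsE[OF assms(2)] .
  let ?c = "\<lambda>\<alpha>. if \<alpha> \<in> A then c \<alpha> else 0" and ?d = "\<lambda>\<alpha>. if \<alpha> \<in> B then d \<alpha> else 0"
  have "p z = (\<Sum>\<alpha>\<in>A \<union> B. ?c \<alpha> * monomial \<alpha> z)" for z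
    unfolding p(2) by (rule sum.mono_neutral_cong_left) (use p q in auto)
  moreover have "q z = (\<Sum>\<alpha>\<in>A \<union> B. ?d \<alpha> * monomial \<alpha> z)" for z
    unfolding q(2) by (rule sum.mono_neutral_cong_left) (use p q in auto)
  ultimately have "(\<lambda>z. p z + q z) = (\<lambda>z. \<Sum>\<alpha>\<in>A \<union> B. (?c \<alpha> + ?d \<alpha>) * monomial \<alpha> z)"
    by (simp add: distrib_right sum.distrib)
  then show ?thesis
    using p(1) q(1) by (intro holomorphic_polynomialsI) auto
qed

lemma holomorphic_polynomials_sum:
  "(\<And>i. i \<in> I \<Longrightarrow> f i \<in> holomorphic_polynomials) \<Longrightarrow> (\<lambda>z. \<Sum>i\<in>I. f i z) \<in> holomorphic_polynomials"
  by (induction I rule: infinite_finite_induct)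
    (auto intro: holomorphic_polynomials_const holomorphic_polynomials_add)

lemma holomorphic_polynomials_mult:
  assumes "p \<in> holomorphic_polynomials" "q \<in> holomorphic_polynomials"
  shows "(\<lambda>z. p z * q z) \<in> holomorphic_polynomials"
proof -
  obtain A c where p: "p = (\<lambda>z. \<Sum>\<alpha>\<in>A. c \<alpha> * monomial \<alpha> z)"
    using holomorphic_polynomialsE[OF assms(1)] .
  obtain B d where q: "q = (\<lambda>z. \<Sum>\<beta>\<in>B. d \<beta> * monomial \<beta> z)"
    using holomorphic_polynomialsE[OF assms(2)] .
  have product: "(\<lambda>z. p z * q z) = (\<lambda>z. \<Sum>\<alpha>\<in>A. \<Sum>\<beta>\<in>B. (c \<alpha> * d \<beta>) * monomial (\<lambda>j. \<alpha> j + \<beta> j) z)"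
    by (simp add: p q sum_product monomial_add mult_ac)
  show ?thesis
    unfolding product by (intro holomorphic_polynomials_sum holomorphic_polynomials_monomial)
qed

lemma holomorphic_polynomials_herm_power: "(\<lambda>z. a * herm z w ^ k) \<in> holomorphic_polynomials"
proof -
  have herm: "(\<lambda>z. herm z w) \<in> holomorphic_polynomials"
    unfolding herm_def
    by (intro holomorphic_polynomials_sum holomorphic_polynomials_mult holomorphic_polynomials_nth
        holomorphic_polynomials_const)
  have "(\<lambda>z. herm z w ^ k) \<in> holomorphic_polynomials"
    by (induction k) (auto intro: holomorphic_polynomials_const holomorphic_polynomials_mult[OF herm])
  then show ?thesis by (intro holomorphic_polynomials_mult holomorphic_polynomials_const)
qed

lemma holomorphic_polynomials_entire: "q \<in> holomorphic_polynomials \<Longrightarrow> entire q"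
  by (erule holomorphic_polynomialsE)
    (auto simp: monomial_def intro!: entire_sum entire_mult entire_const entire_prod entire_power entire_nth)

section \<open>The reproducing kernel\<close>

context fock_growth
begin

abbreviation \<mu> :: "(complex ^ 'n) measure" where "\<mu> \<equiv> fock_measure \<Psi>"

lemma sets_mu [measurable_cong, simp]: "sets \<mu> = sets borel"
  by (simp add: fock_measure_def)

lemma space_mu [simp]: "space \<mu> = UNIV"
  by (simp add: fock_measure_def)

lemma measurable_mu_iff: "f \<in> borel_measurable \<mu> \<longleftrightarrow> f \<in> borel_measurable borel"
  by (simp cong: measurable_cong_sets)

lemma sq_integral_mu:
  assumes [measurable]: "f \<in> borel_measurable borel"
  shows "sq_integral \<mu> f = (\<integral>\<^sup>+z. ennreal (weighted_sq f z) \<partial>lborel)"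
  unfolding sq_integral_def fock_measure_def
  by (subst nn_integral_density) (auto simp: weighted_sq_def ennreal_mult mult.commute)

text \<open>The absolute value extends \<open>\<Psi>\<close> continuously to the whole line, which makes the weight measurable.\<close>
definition radial_weight :: "real \<Rightarrow> real" where "radial_weight x = exp (- \<Psi> \<bar>x\<bar>)"

lemma radial_weight_norm: "radial_weight ((norm z)\<^sup>2) = exp (- \<Psi> ((norm z)\<^sup>2))"
  by (simp add: radial_weight_def)

lemma exp_decaying_radial_weight: "exp_decaying radial_weight"
  unfolding exp_decaying_def
proof (intro conjI)
  have "continuous_on UNIV (\<lambda>x. \<Psi> \<bar>x\<bar>)"
    by (rule continuous_on_compose2[OF Psi_continuous]) (auto intro!: continuous_intros)
  then show "radial_weight \<in> borel_measurable borel"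
    unfolding radial_weight_def by (intro borel_measurable_continuous_onI continuous_intros)
  have "radial_weight x \<le> exp (- \<Psi> 0) * exp (- (\<Psi>' 0 * x))" if "x \<ge> 0" for x
    using Psi_ge[OF that] that by (simp add: radial_weight_def flip: exp_add)
  then show "\<exists>m>0. \<exists>A. \<forall>x\<ge>0. radial_weight x \<le> A * exp (- (m * x))"
    using Psi'_0_pos by blast
qed (simp add: radial_weight_def)

lemma
  fixes f :: "complex ^ 'n \<Rightarrow> complex"
  assumes [measurable]: "f \<in> borel_measurable borel"
  shows integral_mu: "(\<integral>z. f z \<partial>\<mu>) = (\<integral>z. f z * of_real (radial_weight ((norm z)\<^sup>2)) \<partial>lborel)"
    and integrable_mu_iff: "integrable \<mu> f \<longleftrightarrow> integrable lborel (\<lambda>z. f z * of_real (radial_weight ((norm z)\<^sup>2)))"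
  unfolding fock_measure_def
  by (subst integral_density integrable_density; force simp: radial_weight_norm scaleR_conv_of_real mult.commute)+

lemma integrable_mu_of_bound:
  fixes f :: "complex ^ 'n \<Rightarrow> complex"
  assumes "f \<in> borel_measurable borel" "\<And>z. norm (f z) \<le> B * norm z ^ j"
  shows "integrable \<mu> f"
  unfolding integrable_mu_iff[OF assms(1)]
  by (rule integrable_radial_weight[OF assms exp_decaying_radial_weight])

lemma homogeneous_poly_integrable:
  fixes p :: "complex ^ 'n \<Rightarrow> complex"
  assumes p: "homogeneous_poly k p" shows "integrable \<mu> (\<lambda>z. p z * cnj (herm z w) ^ m)"
proof -
  note [measurable] = homogeneous_poly_measurable[OF p]
  obtain M where "\<And>z. norm (p z * cnj (herm z w) ^ m) \<le> M * norm z ^ (k + m)"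
    using homogeneous_poly_herm_bound[OF p] by blast
  then show ?thesis by (intro integrable_mu_of_bound) measurable
qed

lemma homogeneous_poly_L2:
  fixes p :: "complex ^ 'n \<Rightarrow> complex"
  assumes p: "homogeneous_poly k p" shows "p \<in> L2 \<mu>"
  unfolding L2_iff
proof
  note [measurable] = homogeneous_poly_measurable[OF p]
  show "p \<in> borel_measurable \<mu>" by measurable
  obtain M where M: "\<And>z. norm (p z) \<le> M * norm z ^ k" using homogeneous_poly_bound[OF p] by blast
  have "integrable \<mu> (\<lambda>z. (p z)\<^sup>2)"
  proof (rule integrable_mu_of_bound)
    show "norm ((p z)\<^sup>2) \<le> M\<^sup>2 * norm z ^ (2 * k)" for z
      using power_mono[OF M[of z], of 2]
      by (simp add: norm_power power_mult_distrib mult.commute flip: power_mult)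
  qed measurable
  then show "sq_integral \<mu> p < \<infinity>" by (simp add: integrable_iff_bounded sq_integral_def norm_power)
qed

text \<open>
  By the exchange of radial weights, the reproducing property for homogeneous polynomials of degree
  \<open>k\<close> is that of the Gaussian, corrected by a quotient of moments.
\<close>
definition kernel_coeff :: "nat \<Rightarrow> real"
  where "kernel_coeff k = fact (CARD('n) + k - 1)
    / (fact k * gaussian_mass TYPE('n) * radial_moment radial_weight (CARD('n) + k))"

lemma radial_moment_weight_pos: "N \<ge> 1 \<Longrightarrow> radial_moment radial_weight N > 0"
  by (rule radial_moment_pos[OF exp_decaying_radial_weight]) (auto simp: radial_weight_def)

lemma kernel_coeff_pos: "kernel_coeff k > 0"
  unfolding kernel_coeff_def
  by (intro divide_pos_pos mult_pos_pos radial_moment_weight_pos gaussian_mass_pos) (auto simp: Suc_leI)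

lemma kernel_coeff_nonneg: "kernel_coeff k \<ge> 0"
  by (rule less_imp_le[OF kernel_coeff_pos])

lemma homogeneous_poly_reproducing:
  fixes p :: "complex ^ 'n \<Rightarrow> complex"
  assumes p: "homogeneous_poly k p"
  shows "(\<integral>z. p z * cnj (herm z w) ^ m \<partial>\<mu>) = (if m = k then p w / kernel_coeff k else 0)"
proof -
  note [measurable] = homogeneous_poly_measurable[OF p]
  have lebesgue: "(\<integral>z. p z * cnj (herm z w) ^ m \<partial>\<mu>)
      = (\<integral>z. p z * cnj (herm z w) ^ m * of_real (radial_weight ((norm z)\<^sup>2)) \<partial>lborel)"
    by (rule integral_mu) measurable
  show ?thesis
  proof (cases "m = k")
    case True
    then show ?thesis
      using lebesgue radial_reproducing[OF p exp_decaying_radial_weight, of w]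
      by (simp add: kernel_coeff_def field_simps)
  next
    case False
    have [measurable]: "radial_weight \<in> borel_measurable borel"
      by (rule exp_decaying_measurable[OF exp_decaying_radial_weight])
    show ?thesis
      using False lebesgue homogeneous_poly_orthogonal[OF p False, of "\<lambda>r. radial_weight (r\<^sup>2)"] by simp
  qed
qed

definition evaluation_const :: real
  where "evaluation_const = exp oscillation / ball_volume local_radius"

lemma evaluation_const_pos: "evaluation_const > 0"
  using ball_volume_pos[OF local_radius_bounds(1)] by (simp add: evaluation_const_def)

definition diag_bound :: "real \<Rightarrow> real"
  where "diag_bound x = evaluation_const * exp (\<Psi> x) * kernel_density x"

lemma diag_bound_pos: "x \<ge> 0 \<Longrightarrow> diag_bound x > 0"
  by (simp add: diag_bound_def evaluation_const_pos kernel_density_pos)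

lemma point_evaluation:
  assumes f: "entire f"
  shows "ennreal ((norm (f z))\<^sup>2) \<le> ennreal (diag_bound ((norm z)\<^sup>2)) * sq_integral \<mu> f"
proof -
  let ?x = "(norm z)\<^sup>2"
  define a where "a = exp (- \<Psi> ?x) * (ellipsoid_volume z * ball_volume local_radius)"
  have a: "a > 0" using ellipsoid_volume_pos[of z] ball_volume_pos[OF local_radius_bounds(1)] by (simp add: a_def)
  note [measurable] = entire_imp_borel_measurable[OF f]
  have "ennreal ((norm (f z))\<^sup>2 * a) \<le> ennreal (exp oscillation)
      * (\<integral>\<^sup>+w. ennreal (weighted_sq f w) * indicator (ellipsoid z local_radius) w \<partial>lborel)"
    using local_mean_value[OF f local_radius_bounds(1) order_refl, of z] by (simp add: a_def weighted_sq_def mult.assoc)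
  also have "\<dots> \<le> ennreal (exp oscillation) * sq_integral \<mu> f"
    unfolding sq_integral_mu[OF entire_imp_borel_measurable[OF f]]
    by (intro mult_left_mono nn_integral_mono) (auto simp: indicator_def)
  finally have "ennreal (1 / a) * ennreal ((norm (f z))\<^sup>2 * a)
      \<le> ennreal (1 / a) * (ennreal (exp oscillation) * sq_integral \<mu> f)"
    by (intro mult_left_mono) simp_all
  moreover have "ennreal (1 / a) * ennreal ((norm (f z))\<^sup>2 * a) = ennreal ((norm (f z))\<^sup>2)"
    using a by (subst ennreal_mult[symmetric]) auto
  moreover have "ennreal (1 / a) * (ennreal (exp oscillation) * sq_integral \<mu> f)
      = ennreal (1 / a * exp oscillation) * sq_integral \<mu> f"
    unfolding mult.assoc[symmetric] using a by (subst ennreal_mult) auto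
  moreover have "1 / a * exp oscillation = diag_bound ?x"
    using ball_volume_pos[OF local_radius_bounds(1)] kernel_density_pos[of ?x]
    by (simp add: a_def diag_bound_def evaluation_const_def ellipsoid_volume_def exp_minus field_simps)
  ultimately show ?thesis by simp
qed

text \<open>As a function of \<open>z\<close>, this is the part of \<open>K(z,w)\<close> of degrees in \<open>I\<close>.\<close>
definition partial_kernel :: "nat set \<Rightarrow> complex ^ 'n \<Rightarrow> complex ^ 'n \<Rightarrow> complex"
  where "partial_kernel I w z = (\<Sum>k\<in>I. of_real (kernel_coeff k) * herm z w ^ k)"

lemma partial_kernel_polynomial: "partial_kernel I w \<in> holomorphic_polynomials"
  unfolding partial_kernel_def by (intro holomorphic_polynomials_sum holomorphic_polynomials_herm_power)

lemma partial_kernel_entire: "entire (partial_kernel I w)"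
  by (rule holomorphic_polynomials_entire[OF partial_kernel_polynomial])

lemma partial_kernel_measurable [measurable]: "partial_kernel I w \<in> borel_measurable borel"
  by (rule entire_imp_borel_measurable[OF partial_kernel_entire])

lemma partial_kernel_diag: "partial_kernel I w w = of_real (\<Sum>k\<in>I. kernel_coeff k * ((norm w)\<^sup>2) ^ k)"
  by (simp add: partial_kernel_def herm_self)

lemma
  assumes p: "homogeneous_poly k p" and "finite I"
  shows homogeneous_poly_partial_kernel_integrable: "integrable \<mu> (\<lambda>z. p z * cnj (partial_kernel I w z))"
    and homogeneous_poly_partial_kernel:
      "(\<integral>z. p z * cnj (partial_kernel I w z) \<partial>\<mu>) = (if k \<in> I then p w else 0)"
proof -
  have expand: "(\<lambda>z. p z * cnj (partial_kernel I w z))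
      = (\<lambda>z. \<Sum>m\<in>I. of_real (kernel_coeff m) * (p z * cnj (herm z w) ^ m))"
    by (simp add: partial_kernel_def sum_distrib_left mult_ac)
  note integrable = homogeneous_poly_integrable[OF p]
  show "integrable \<mu> (\<lambda>z. p z * cnj (partial_kernel I w z))"
    unfolding expand by (intro Bochner_Integration.integrable_sum integrable_mult_right integrable)
  have "(\<integral>z. p z * cnj (partial_kernel I w z) \<partial>\<mu>)
      = (\<Sum>m\<in>I. \<integral>z. of_real (kernel_coeff m) * (p z * cnj (herm z w) ^ m) \<partial>\<mu>)"
    unfolding expand by (intro Bochner_Integration.integral_sum integrable_mult_right integrable)
  also have "\<dots> = (\<Sum>m\<in>I. of_real (kernel_coeff m) * (if m = k then p w / kernel_coeff k else 0))"
    by (simp add: homogeneous_poly_reproducing[OF p])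
  also have "\<dots> = (\<Sum>m\<in>I. if m = k then p w else 0)"
    by (intro sum.cong) (use kernel_coeff_pos[of k] in auto)
  finally show "(\<integral>z. p z * cnj (partial_kernel I w z) \<partial>\<mu>) = (if k \<in> I then p w else 0)"
    using \<open>finite I\<close> by simp
qed

lemma sq_integral_partial_kernel:
  assumes "finite I"
  shows "sq_integral \<mu> (partial_kernel I w) = ennreal (\<Sum>k\<in>I. kernel_coeff k * ((norm w)\<^sup>2) ^ k)"
proof (rule sq_integral_eq_integral)
  have expand: "(\<lambda>z. partial_kernel I w z * cnj (partial_kernel I w z))
      = (\<lambda>z. \<Sum>k\<in>I. of_real (kernel_coeff k) * (herm z w ^ k * cnj (partial_kernel I w z)))"
    by (simp add: partial_kernel_def sum_distrib_right mult.assoc)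
  note integrable = homogeneous_poly_partial_kernel_integrable[OF homogeneous_poly_herm_power assms]
  show "integrable \<mu> (\<lambda>z. partial_kernel I w z * cnj (partial_kernel I w z))"
    unfolding expand by (intro Bochner_Integration.integrable_sum integrable_mult_right integrable)
  have "(\<integral>z. partial_kernel I w z * cnj (partial_kernel I w z) \<partial>\<mu>)
      = (\<Sum>k\<in>I. \<integral>z. of_real (kernel_coeff k) * (herm z w ^ k * cnj (partial_kernel I w z)) \<partial>\<mu>)"
    unfolding expand by (intro Bochner_Integration.integral_sum integrable_mult_right integrable)
  also have "\<dots> = (\<Sum>k\<in>I. of_real (kernel_coeff k) * herm w w ^ k)"
    by (intro sum.cong) (auto simp: homogeneous_poly_partial_kernel[OF homogeneous_poly_herm_power assms])
  finally show "(\<integral>z. partial_kernel I w z * cnj (partial_kernel I w z) \<partial>\<mu>)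
      = of_real (\<Sum>k\<in>I. kernel_coeff k * ((norm w)\<^sup>2) ^ k)"
    by (simp add: herm_self)
qed

text \<open>Evaluating \<open>K\<^sub>I(\<cdot>,w)\<close> at \<open>w\<close>, where its value is the square of its norm.\<close>
lemma partial_kernel_diag_le:
  assumes "finite I" and x: "x \<ge> 0"
  shows "(\<Sum>k\<in>I. kernel_coeff k * x ^ k) \<le> diag_bound x"
proof -
  obtain w :: "complex ^ 'n" where "norm w = sqrt x"
    using vector_choose_size[of "sqrt x"] x by auto
  then have w: "(norm w)\<^sup>2 = x" using x by simp
  define S where "S = (\<Sum>k\<in>I. kernel_coeff k * x ^ k)"
  have S: "S \<ge> 0" unfolding S_def using x by (intro sum_nonneg mult_nonneg_nonneg kernel_coeff_nonneg) auto
  have "ennreal (S\<^sup>2) \<le> ennreal (diag_bound x) * ennreal S"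
    using point_evaluation[OF partial_kernel_entire[of I w], of w] sq_integral_partial_kernel[OF assms(1), of w] S
    by (simp add: partial_kernel_diag w S_def[symmetric] del: of_real_sum of_real_mult of_real_power)
  also have "\<dots> = ennreal (diag_bound x * S)"
    using S diag_bound_pos[OF x] by (simp add: ennreal_mult)
  finally have "S\<^sup>2 \<le> diag_bound x * S"
    using S diag_bound_pos[OF x] by (subst (asm) ennreal_le_iff) auto
  then show ?thesis
    using S diag_bound_pos[OF x] by (cases "S = 0") (auto simp: S_def[symmetric] power2_eq_square)
qed

lemma summable_of_real_kernel_coeff:
  fixes s :: "'b::{real_normed_algebra_1, banach}"
  shows "summable (\<lambda>k. of_real (kernel_coeff k) * s ^ k)"
proof (rule summable_comparison_test'[of _ 0])
  show "summable (\<lambda>k. kernel_coeff k * norm s ^ k)"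
    by (rule summableI_nonneg_bounded[where x = "diag_bound (norm s)"])
      (auto simp: kernel_coeff_nonneg intro: partial_kernel_diag_le)
  have "norm (of_real (kernel_coeff k) * s ^ k) \<le> kernel_coeff k * norm (s ^ k)" for k
    using norm_mult_ineq[of "of_real (kernel_coeff k)" "s ^ k"] kernel_coeff_nonneg[of k] by simp
  then show "norm (of_real (kernel_coeff k) * s ^ k) \<le> kernel_coeff k * norm s ^ k" for k
    by (rule order_trans) (intro mult_left_mono norm_power_ineq kernel_coeff_nonneg)
qed

lemma summable_kernel_coeff: "summable (\<lambda>k. kernel_coeff k * x ^ k)"
  using summable_of_real_kernel_coeff[of x] by simp

definition kernel_diag :: "real \<Rightarrow> real"
  where "kernel_diag x = (\<Sum>k. kernel_coeff k * x ^ k)"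

definition kernel_series :: "complex \<Rightarrow> complex"
  where "kernel_series s = (\<Sum>k. of_real (kernel_coeff k) * s ^ k)"

lemma kernel_diag_le: "x \<ge> 0 \<Longrightarrow> kernel_diag x \<le> diag_bound x"
  unfolding kernel_diag_def
  by (rule suminf_le_const[OF summable_kernel_coeff]) (auto intro: partial_kernel_diag_le)

lemma partial_sum_le_kernel_diag:
  "x \<ge> 0 \<Longrightarrow> finite I \<Longrightarrow> (\<Sum>k\<in>I. kernel_coeff k * x ^ k) \<le> kernel_diag x"
  unfolding kernel_diag_def
  by (rule sum_le_suminf[OF summable_kernel_coeff]) (auto simp: kernel_coeff_nonneg)

lemma kernel_diag_pos: "x \<ge> 0 \<Longrightarrow> kernel_diag x > 0"
  using partial_sum_le_kernel_diag[of x "{0}"] kernel_coeff_pos[of 0] by simp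

lemma kernel_series_of_real: "kernel_series (of_real x) = of_real (kernel_diag x)"
  using suminf_of_real[OF summable_kernel_coeff, of x, where 'a = complex]
  by (simp add: kernel_series_def kernel_diag_def)

lemma kernel_series_holomorphic: "kernel_series holomorphic_on UNIV"
proof -
  have "(kernel_series has_field_derivative (\<Sum>k. diffs (\<lambda>k. of_real (kernel_coeff k)) k * s ^ k)) (at s)" for s
    unfolding kernel_series_def[abs_def]
    by (rule termdiffs_strong_converges_everywhere) (rule summable_of_real_kernel_coeff)
  then show ?thesis
    by (auto simp: holomorphic_on_def field_differentiable_def intro: has_field_derivative_at_within)
qed

text \<open>\<open>kernel_at w z\<close> will turn out to be \<open>K(z,w)\<close>: the pole comes first.\<close>
definition kernel_at :: "complex ^ 'n \<Rightarrow> complex ^ 'n \<Rightarrow> complex"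
  where "kernel_at w z = kernel_series (herm z w)"

lemma kernel_at_entire: "entire (kernel_at w)"
  unfolding kernel_at_def by (rule entire_compose_holomorphic[OF kernel_series_holomorphic entire_herm])

lemma kernel_at_measurable [measurable]: "kernel_at w \<in> borel_measurable borel"
  by (rule entire_imp_borel_measurable[OF kernel_at_entire])

lemma kernel_at_same: "kernel_at w w = of_real (kernel_diag ((norm w)\<^sup>2))"
  unfolding kernel_at_def herm_self by (rule kernel_series_of_real)

definition kernel_tail :: "complex ^ 'n \<Rightarrow> nat \<Rightarrow> real"
  where "kernel_tail w m = kernel_diag ((norm w)\<^sup>2) - (\<Sum>k<m. kernel_coeff k * ((norm w)\<^sup>2) ^ k)"

lemma partial_kernel_tendsto:
  "(\<lambda>M. partial_kernel {m..<M} w z) \<longlonglongrightarrow> kernel_at w z - partial_kernel {..<m} w z"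
proof -
  have "(\<lambda>M. partial_kernel {..<M} w z) \<longlonglongrightarrow> kernel_at w z"
    unfolding partial_kernel_def kernel_at_def kernel_series_def
    by (rule summable_LIMSEQ[OF summable_of_real_kernel_coeff])
  then have "(\<lambda>M. partial_kernel {..<M} w z - partial_kernel {..<m} w z)
      \<longlonglongrightarrow> kernel_at w z - partial_kernel {..<m} w z"
    by (intro tendsto_intros)
  moreover have "\<forall>\<^sub>F M in sequentially.
      partial_kernel {..<M} w z - partial_kernel {..<m} w z = partial_kernel {m..<M} w z"
    using eventually_ge_at_top[of m]
  proof eventually_elim
    case (elim M)
    then have "{..<M} = {..<m} \<union> {m..<M}" by auto
    then have "partial_kernel {..<M} w z = partial_kernel {..<m} w z + partial_kernel {m..<M} w z"
      unfolding partial_kernel_def by (simp add: sum.union_disjoint ivl_disj_int)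
    then show ?case by simp
  qed
  ultimately show ?thesis
    by (rule Lim_transform_eventually)
qed

lemma sq_integral_partial_kernel_le_tail: "sq_integral \<mu> (partial_kernel {m..<M} w) \<le> ennreal (kernel_tail w m)"
proof -
  let ?t = "\<lambda>k. kernel_coeff k * ((norm w)\<^sup>2) ^ k"
  have "sum ?t {m..<M} + sum ?t {..<m} = sum ?t ({..<m} \<union> {m..<M})"
    by (subst sum.union_disjoint) (auto simp: ivl_disj_int)
  also have "\<dots> \<le> kernel_diag ((norm w)\<^sup>2)" by (rule partial_sum_le_kernel_diag) auto
  finally show ?thesis
    by (simp add: sq_integral_partial_kernel kernel_tail_def ennreal_leI)
qed

lemma sq_integral_kernel_at_tail_le:
  "sq_integral \<mu> (\<lambda>z. kernel_at w z - partial_kernel {..<m} w z) \<le> ennreal (kernel_tail w m)"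
proof -
  have limit: "(\<lambda>M. ennreal ((norm (partial_kernel {m..<M} w z))\<^sup>2))
      \<longlonglongrightarrow> ennreal ((norm (kernel_at w z - partial_kernel {..<m} w z))\<^sup>2)" for z
    by (intro tendsto_ennrealI tendsto_intros partial_kernel_tendsto)
  have "sq_integral \<mu> (\<lambda>z. kernel_at w z - partial_kernel {..<m} w z)
      = (\<integral>\<^sup>+z. liminf (\<lambda>M. ennreal ((norm (partial_kernel {m..<M} w z))\<^sup>2)) \<partial>\<mu>)"
    unfolding sq_integral_def by (intro nn_integral_cong) (simp add: lim_imp_Liminf[OF _ limit])
  also have "\<dots> \<le> liminf (\<lambda>M. sq_integral \<mu> (partial_kernel {m..<M} w))"
    unfolding sq_integral_def by (rule nn_integral_liminf) simp
  also have "\<dots> \<le> ennreal (kernel_tail w m)"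
    by (rule Liminf_le) (auto intro: always_eventually sq_integral_partial_kernel_le_tail)
  finally show ?thesis .
qed

lemma sq_integral_kernel_at_le: "sq_integral \<mu> (kernel_at w) \<le> ennreal (kernel_diag ((norm w)\<^sup>2))"
  using sq_integral_kernel_at_tail_le[of w 0] by (simp add: partial_kernel_def kernel_tail_def)

lemma kernel_at_L2: "kernel_at w \<in> L2 \<mu>"
  using sq_integral_kernel_at_le[of w] by (simp add: L2_iff measurable_mu_iff le_less_trans)

lemma partial_kernel_L2: "finite I \<Longrightarrow> partial_kernel I w \<in> L2 \<mu>"
  by (simp add: L2_iff measurable_mu_iff sq_integral_partial_kernel)

lemma kernel_tail_tendsto: "(\<lambda>m. ennreal (kernel_tail w m)) \<longlonglongrightarrow> 0"
proof -
  have "(\<lambda>m. kernel_tail w m) \<longlonglongrightarrow> kernel_diag ((norm w)\<^sup>2) - kernel_diag ((norm w)\<^sup>2)"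
    unfolding kernel_tail_def kernel_diag_def by (intro tendsto_intros summable_LIMSEQ summable_kernel_coeff)
  from tendsto_ennrealI[OF this] show ?thesis by simp
qed

lemma kernel_at_in_fock_space: "kernel_at w \<in> fock_space \<Psi>"
  unfolding fock_space_def
proof (intro CollectI conjI allI impI)
  show "kernel_at w \<in> L2 \<mu>" by (rule kernel_at_L2)
  show "entire (kernel_at w)" by (rule kernel_at_entire)
  fix \<epsilon> :: real assume "\<epsilon> > 0"
  then have "\<forall>\<^sub>F m in sequentially. ennreal (kernel_tail w m) < ennreal \<epsilon>"
    by (intro order_tendstoD(2)[OF kernel_tail_tendsto]) simp
  then obtain m where "ennreal (kernel_tail w m) < ennreal \<epsilon>"
    using eventually_happens' sequentially_bot by blast
  with sq_integral_kernel_at_tail_le[of w m]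
  have "sq_integral \<mu> (\<lambda>z. kernel_at w z - partial_kernel {..<m} w z) < ennreal \<epsilon>"
    by (rule le_less_trans)
  then show "\<exists>p\<in>holomorphic_polynomials. (\<integral>\<^sup>+z. ennreal ((norm (kernel_at w z - p z))\<^sup>2) \<partial>\<mu>) < ennreal \<epsilon>"
    using partial_kernel_polynomial[of "{..<m}" w] by (auto simp: sq_integral_def)
qed

lemma homogeneous_poly_kernel:
  assumes p: "homogeneous_poly k p"
  shows "(\<integral>z. p z * cnj (kernel_at w z) \<partial>\<mu>) = p w"
proof -
  note p_L2 = homogeneous_poly_L2[OF p]
  let ?defect = "(\<integral>z. p z * cnj (kernel_at w z) \<partial>\<mu>) - p w"
  have "ennreal ((norm ?defect)\<^sup>2) \<le> sq_integral \<mu> p * ennreal (kernel_tail w m)" if "m > k" for m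
  proof -
    let ?K = "partial_kernel {..<m} w"
    have "?defect = (\<integral>z. p z * cnj (kernel_at w z - ?K z) \<partial>\<mu>)"
      using that by (simp add: L2_integral_diff_right[OF p_L2 kernel_at_L2 partial_kernel_L2]
          homogeneous_poly_partial_kernel[OF p] del: complex_cnj_diff)
    then have "ennreal ((norm ?defect)\<^sup>2) \<le> sq_integral \<mu> p * sq_integral \<mu> (\<lambda>z. kernel_at w z - ?K z)"
      using L2_Cauchy_Schwarz[OF p_L2 L2_diff[OF kernel_at_L2 partial_kernel_L2[OF finite_lessThan]]] by simp
    also have "\<dots> \<le> sq_integral \<mu> p * ennreal (kernel_tail w m)"
      by (intro mult_left_mono sq_integral_kernel_at_tail_le) simp
    finally show ?thesis .
  qed
  moreover have "(\<lambda>m. sq_integral \<mu> p * ennreal (kernel_tail w m)) \<longlonglongrightarrow> sq_integral \<mu> p * 0"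
    using p_L2 by (intro ennreal_tendsto_cmult kernel_tail_tendsto) (simp add: L2_iff)
  ultimately have "ennreal ((norm ?defect)\<^sup>2) \<le> 0"
    by (intro LIMSEQ_le_const[of "\<lambda>m. sq_integral \<mu> p * ennreal (kernel_tail w m)"])
      (auto intro: exI[of _ "Suc k"])
  then show ?thesis by simp
qed

lemma polynomial_kernel:
  assumes "q \<in> holomorphic_polynomials"
  shows "integrable \<mu> (\<lambda>z. q z * cnj (kernel_at w z))" "(\<integral>z. q z * cnj (kernel_at w z) \<partial>\<mu>) = q w"
proof -
  obtain A c where q: "q = (\<lambda>z. \<Sum>\<alpha>\<in>A. c \<alpha> * monomial \<alpha> z)"
    using holomorphic_polynomialsE[OF assms] .
  have homogeneous: "homogeneous_poly (\<Sum>j\<in>UNIV. \<alpha> j) (monomial \<alpha>)" for \<alpha> :: "'n \<Rightarrow> nat"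
    unfolding monomial_def[abs_def] by (rule homogeneous_poly_monomial)
  have expand: "(\<lambda>z. q z * cnj (kernel_at w z)) = (\<lambda>z. \<Sum>\<alpha>\<in>A. c \<alpha> * (monomial \<alpha> z * cnj (kernel_at w z)))"
    by (simp add: q sum_distrib_right mult.assoc)
  note integrable = L2_integrable_mult[OF homogeneous_poly_L2[OF homogeneous] kernel_at_L2]
  show "integrable \<mu> (\<lambda>z. q z * cnj (kernel_at w z))"
    unfolding expand by (intro Bochner_Integration.integrable_sum integrable_mult_right integrable)
  have "(\<integral>z. q z * cnj (kernel_at w z) \<partial>\<mu>) = (\<Sum>\<alpha>\<in>A. \<integral>z. c \<alpha> * (monomial \<alpha> z * cnj (kernel_at w z)) \<partial>\<mu>)"
    unfolding expand by (intro Bochner_Integration.integral_sum integrable_mult_right integrable)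
  also have "\<dots> = q w" by (simp add: homogeneous_poly_kernel[OF homogeneous] q)
  finally show "(\<integral>z. q z * cnj (kernel_at w z) \<partial>\<mu>) = q w" .
qed

lemma fock_space_entire: "f \<in> fock_space \<Psi> \<Longrightarrow> entire f"
  by (simp add: fock_space_def)

lemma fock_space_L2: "f \<in> fock_space \<Psi> \<Longrightarrow> f \<in> L2 \<mu>"
  by (simp add: fock_space_def)

lemma reproducing_defect_le:
  assumes g: "entire g" and small: "sq_integral \<mu> g < ennreal \<epsilon>"
  shows "(norm (g w - (\<integral>z. g z * cnj (kernel_at w z) \<partial>\<mu>)))\<^sup>2
    \<le> 2 * (diag_bound ((norm w)\<^sup>2) + kernel_diag ((norm w)\<^sup>2)) * \<epsilon>"
proof -
  let ?B = "diag_bound ((norm w)\<^sup>2)" and ?F = "kernel_diag ((norm w)\<^sup>2)"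
  let ?I = "\<integral>z. g z * cnj (kernel_at w z) \<partial>\<mu>"
  have pos: "?B > 0" "?F > 0" by (auto simp: diag_bound_pos kernel_diag_pos)
  have \<epsilon>: "\<epsilon> > 0" using small by (metis ennreal_less_zero_iff le_less_trans zero_le)
  have g_L2: "g \<in> L2 \<mu>"
    using small by (auto simp: L2_iff measurable_mu_iff entire_imp_borel_measurable[OF g] intro: less_trans)
  have "ennreal ((norm (g w))\<^sup>2) \<le> ennreal ?B * ennreal \<epsilon>"
    using small by (intro order_trans[OF point_evaluation[OF g]] mult_left_mono) auto
  then have "ennreal ((norm (g w))\<^sup>2) \<le> ennreal (?B * \<epsilon>)"
    using pos \<epsilon> by (simp add: ennreal_mult)
  then have evaluation: "(norm (g w))\<^sup>2 \<le> ?B * \<epsilon>"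
    using pos \<epsilon> by simp
  have "ennreal ((norm ?I)\<^sup>2) \<le> ennreal \<epsilon> * ennreal ?F"
    using small sq_integral_kernel_at_le[of w]
    by (intro order_trans[OF L2_Cauchy_Schwarz[OF g_L2 kernel_at_L2]] mult_mono) auto
  then have "ennreal ((norm ?I)\<^sup>2) \<le> ennreal (?F * \<epsilon>)"
    using pos \<epsilon> by (simp add: ennreal_mult mult.commute)
  then have integral: "(norm ?I)\<^sup>2 \<le> ?F * \<epsilon>"
    using pos \<epsilon> by simp
  have "(norm (g w - ?I))\<^sup>2 \<le> (norm (g w) + norm ?I)\<^sup>2"
    by (intro power_mono norm_triangle_ineq4) auto
  also have "\<dots> \<le> 2 * (norm (g w))\<^sup>2 + 2 * (norm ?I)\<^sup>2"
    using sum_squares_bound[of "norm (g w)" "norm ?I"] by (simp add: power2_sum)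
  also have "\<dots> \<le> 2 * (?B + ?F) * \<epsilon>" using evaluation integral by (simp add: algebra_simps)
  finally show ?thesis .
qed

lemma fock_reproducing:
  assumes f: "f \<in> fock_space \<Psi>"
  shows "f w = (\<integral>z. f z * cnj (kernel_at w z) \<partial>\<mu>)"
proof -
  define defect where "defect = f w - (\<integral>z. f z * cnj (kernel_at w z) \<partial>\<mu>)"
  define C where "C = 2 * (diag_bound ((norm w)\<^sup>2) + kernel_diag ((norm w)\<^sup>2))"
  have C: "C > 0" unfolding C_def using diag_bound_pos kernel_diag_pos by (simp add: add_pos_pos)
  have "(norm defect)\<^sup>2 \<le> C * \<epsilon>" if "\<epsilon> > 0" for \<epsilon>
  proof -
    obtain q where q: "q \<in> holomorphic_polynomials" "sq_integral \<mu> (\<lambda>z. f z - q z) < ennreal \<epsilon>"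
      using f \<open>\<epsilon> > 0\<close> by (auto simp: fock_space_def sq_integral_def)
    have "(\<integral>z. (f z - q z) * cnj (kernel_at w z) \<partial>\<mu>) = (\<integral>z. f z * cnj (kernel_at w z) \<partial>\<mu>) - q w"
      using L2_integrable_mult[OF fock_space_L2[OF f] kernel_at_L2] polynomial_kernel[OF q(1), of w]
      by (simp add: left_diff_distrib)
    then have "defect = (f w - q w) - (\<integral>z. (f z - q z) * cnj (kernel_at w z) \<partial>\<mu>)"
      by (simp add: defect_def)
    then show ?thesis
      using reproducing_defect_le[OF entire_diff[OF fock_space_entire[OF f] holomorphic_polynomials_entire[OF q(1)]] q(2)]
      by (simp add: C_def)
  qed
  from this[of "(norm defect)\<^sup>2 / (2 * C)"] have "defect = 0"
    using C by (cases "defect = 0") auto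
  then show ?thesis by (simp add: defect_def)
qed

lemma reproducing_kernel_unique:
  assumes g: "g \<in> fock_space \<Psi>" and reproducing: "\<And>f. f \<in> fock_space \<Psi> \<Longrightarrow> f w = (\<integral>u. f u * cnj (g u) \<partial>\<mu>)"
  shows "g = kernel_at w"
proof -
  define h where "h u = g u - kernel_at w u" for u
  have h: "entire h" unfolding h_def by (intro entire_diff fock_space_entire[OF g] kernel_at_entire)
  note g_L2 = fock_space_L2[OF g]
  have h_L2: "h \<in> L2 \<mu>" unfolding h_def by (rule L2_diff[OF g_L2 kernel_at_L2])
  have orthogonal: "(\<integral>u. f u * cnj (h u) \<partial>\<mu>) = 0" if "f \<in> fock_space \<Psi>" for f
    unfolding h_def L2_integral_diff_right[OF fock_space_L2[OF that] g_L2 kernel_at_L2]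
    using reproducing[OF that] fock_reproducing[OF that, of w] by simp
  have "(\<integral>u. h u * cnj (h u) \<partial>\<mu>) = (\<integral>u. g u * cnj (h u) \<partial>\<mu>) - (\<integral>u. kernel_at w u * cnj (h u) \<partial>\<mu>)"
    using L2_integral_diff_left[OF g_L2 kernel_at_L2 h_L2] by (simp add: h_def)
  then have "(\<integral>u. h u * cnj (h u) \<partial>\<mu>) = of_real 0"
    using orthogonal[OF g] orthogonal[OF kernel_at_in_fock_space] by simp
  from sq_integral_eq_integral[OF L2_integrable_mult[OF h_L2 h_L2] this] have "sq_integral \<mu> h = 0"
    by simp
  then have "ennreal ((norm (h u))\<^sup>2) \<le> 0" for u
    using point_evaluation[OF h, of u] by simp
  then have "h u = 0" for u by simp
  then show ?thesis by (auto simp: h_def)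
qed

lemma fock_kernel_eq: "fock_kernel \<Psi> z w = kernel_at w z"
proof -
  have "(THE g. g \<in> fock_space \<Psi> \<and> (\<forall>f\<in>fock_space \<Psi>. f w = (\<integral>u. f u * cnj (g u) \<partial>\<mu>))) = kernel_at w"
    using kernel_at_in_fock_space fock_reproducing reproducing_kernel_unique by (intro the_equality) blast+
  then show ?thesis by (simp add: fock_kernel_def)
qed

lemma kernel_at_Cauchy_Schwarz: "(norm (kernel_at w z))\<^sup>2 \<le> kernel_diag ((norm w)\<^sup>2) * kernel_diag ((norm z)\<^sup>2)"
proof -
  have pos: "kernel_diag ((norm u)\<^sup>2) \<ge> 0" for u :: "complex ^ 'n"
    by (simp add: kernel_diag_pos less_imp_le)
  have "ennreal ((norm (kernel_at w z))\<^sup>2) \<le> sq_integral \<mu> (kernel_at w) * sq_integral \<mu> (kernel_at z)"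
    unfolding fock_reproducing[OF kernel_at_in_fock_space, of w z] by (rule L2_Cauchy_Schwarz[OF kernel_at_L2 kernel_at_L2])
  also have "\<dots> \<le> ennreal (kernel_diag ((norm w)\<^sup>2)) * ennreal (kernel_diag ((norm z)\<^sup>2))"
    by (intro mult_mono sq_integral_kernel_at_le) auto
  also have "\<dots> = ennreal (kernel_diag ((norm w)\<^sup>2) * kernel_diag ((norm z)\<^sup>2))"
    using pos by (simp add: ennreal_mult)
  finally show ?thesis using pos by (subst (asm) ennreal_le_iff) auto
qed

end

section \<open>Upper bounds for the moments\<close>

lemma increment_le_of_nonincreasing_deriv:
  fixes H h :: "real \<Rightarrow> real"
  assumes "\<And>s. (H has_real_derivative h s) (at s)" "\<And>s u. s \<le> u \<Longrightarrow> h u \<le> h s" "a \<le> b"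
  shows "H b - H a \<le> h a * (b - a)"
proof (cases "a = b")
  case False
  then obtain c where c: "a < c" "c < b" "H b - H a = (b - a) * h c"
    using MVT2[of a b H h] assms by force
  have "(b - a) * h c \<le> (b - a) * h a"
    using assms(2)[of a c] c by (intro mult_left_mono) auto
  then show ?thesis using c(3) by (simp add: mult.commute)
qed simp

lemma concave_le_tent_right:
  fixes H h :: "real \<Rightarrow> real"
  assumes deriv: "\<And>s. (H has_real_derivative h s) (at s)" and nonincreasing: "\<And>s u. s \<le> u \<Longrightarrow> h u \<le> h s"
    and slopes: "h s\<^sub>0 \<le> c" "h (s\<^sub>0 + t) \<le> - c" and "c \<ge> 0" "t \<ge> 0" "c * t \<le> 1 / 2" and s: "s\<^sub>0 \<le> s"
  shows "H s - H s\<^sub>0 \<le> 1 - c * (s - s\<^sub>0)"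
proof (cases "s \<le> s\<^sub>0 + t")
  case True
  have "H s - H s\<^sub>0 \<le> h s\<^sub>0 * (s - s\<^sub>0)"
    by (rule increment_le_of_nonincreasing_deriv[OF deriv nonincreasing s])
  also have "\<dots> \<le> c * (s - s\<^sub>0)" using slopes s by (intro mult_right_mono) auto
  finally have "H s - H s\<^sub>0 \<le> c * (s - s\<^sub>0)" .
  moreover have "c * (s - s\<^sub>0) \<le> c * t" using True \<open>c \<ge> 0\<close> by (intro mult_left_mono) auto
  ultimately show ?thesis using \<open>c * t \<le> 1 / 2\<close> by linarith
next
  case False
  have "H (s\<^sub>0 + t) - H s\<^sub>0 \<le> h s\<^sub>0 * (s\<^sub>0 + t - s\<^sub>0)"
    by (rule increment_le_of_nonincreasing_deriv[OF deriv nonincreasing]) (use \<open>t \<ge> 0\<close> in auto)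
  also have "\<dots> \<le> c * t" using slopes \<open>t \<ge> 0\<close> by (simp add: mult_right_mono)
  finally have first: "H (s\<^sub>0 + t) - H s\<^sub>0 \<le> c * t" .
  have "H s - H (s\<^sub>0 + t) \<le> h (s\<^sub>0 + t) * (s - (s\<^sub>0 + t))"
    by (rule increment_le_of_nonincreasing_deriv[OF deriv nonincreasing]) (use False in auto)
  also have "\<dots> \<le> - c * (s - (s\<^sub>0 + t))" using slopes False by (intro mult_right_mono) auto
  also have "\<dots> = - (c * (s - s\<^sub>0)) + c * t" by (simp add: algebra_simps)
  finally show ?thesis using first \<open>c * t \<le> 1 / 2\<close> by linarith
qed

lemma concave_le_tent:
  fixes H h :: "real \<Rightarrow> real"
  assumes deriv: "\<And>s. (H has_real_derivative h s) (at s)" and nonincreasing: "\<And>s u. s \<le> u \<Longrightarrow> h u \<le> h s"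
    and slopes: "\<bar>h s\<^sub>0\<bar> \<le> c" "h (s\<^sub>0 + t) \<le> - c" "h (s\<^sub>0 - t) \<ge> c" and t: "t \<ge> 0" "c * t \<le> 1 / 2"
  shows "H s \<le> H s\<^sub>0 + 1 - c * \<bar>s - s\<^sub>0\<bar>"
proof (cases "s\<^sub>0 \<le> s")
  case True
  have "H s - H s\<^sub>0 \<le> 1 - c * (s - s\<^sub>0)"
    by (rule concave_le_tent_right[OF deriv nonincreasing _ slopes(2) _ t True]) (use slopes in auto)
  then show ?thesis using True by simp
next
  case False
  have "((\<lambda>s. H (- s)) has_real_derivative - h (- s)) (at s)" for s
    using DERIV_chain2[OF deriv DERIV_minus[OF DERIV_ident], of s UNIV] by simp
  then have "H (- (- s)) - H (- (- s\<^sub>0)) \<le> 1 - c * (- s - - s\<^sub>0)"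
    by (rule concave_le_tent_right[where h = "\<lambda>s. - h (- s)" and t = t])
      (use nonincreasing slopes t False in auto)
  then show ?thesis using False by simp
qed

lemma nn_integral_exp_tent_le:
  fixes H :: "real \<Rightarrow> real"
  assumes tent: "\<And>s. H s \<le> b - c * \<bar>s - s\<^sub>0\<bar>" and c: "c > 0"
  shows "(\<integral>\<^sup>+s. ennreal (exp (H s)) \<partial>lborel) \<le> ennreal (exp b * (2 / c))"
proof -
  have "(\<integral>\<^sup>+s. ennreal (exp (H s)) \<partial>lborel) \<le> (\<integral>\<^sup>+s. ennreal (exp b) * ennreal (exp (- (c * \<bar>s - s\<^sub>0\<bar>))) \<partial>lborel)"
    using tent by (intro nn_integral_mono) (simp flip: ennreal_mult exp_add)
  also have "\<dots> = ennreal (exp b) * (\<integral>\<^sup>+s. ennreal (exp (- (c * \<bar>s - s\<^sub>0\<bar>))) \<partial>lborel)"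
    by (rule nn_integral_cmult) simp
  also have "(\<integral>\<^sup>+s. ennreal (exp (- (c * \<bar>s - s\<^sub>0\<bar>))) \<partial>lborel) = (\<integral>\<^sup>+s. ennreal (exp (- (c * \<bar>s\<bar>))) \<partial>lborel)"
    using nn_integral_real_affine[of "\<lambda>s. ennreal (exp (- (c * \<bar>s\<bar>)))" 1 "- s\<^sub>0"] by simp
  also have "ennreal (exp b) * \<dots> \<le> ennreal (exp b) * ennreal (2 / c)"
    by (intro mult_left_mono nn_integral_exp_abs_le c) simp
  also have "\<dots> = ennreal (exp b * (2 / c))" using c by (subst ennreal_mult) auto
  finally show ?thesis .
qed

context fock_growth
begin

text \<open>The order of magnitude of the standard deviation of the distribution of degrees at \<open>x\<close>.\<close>
definition spread :: "real \<Rightarrow> real" where "spread x = sqrt ((1 + x) * \<Phi>' x)"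

lemma spread_pos: "x \<ge> 0 \<Longrightarrow> spread x > 0"
  using Phi'_pos[of x] by (simp add: spread_def)

lemma spread_squared: "x \<ge> 0 \<Longrightarrow> (spread x)\<^sup>2 = (1 + x) * \<Phi>' x"
  using Phi'_pos[of x] by (simp add: spread_def)

lemma one_plus_div_spread:
  assumes x: "x \<ge> 0" shows "(1 + x) / spread x = scale x"
proof -
  have "sqrt (1 + x) * sqrt (1 + x) = 1 + x" "sqrt (1 + x) > 0" "sqrt (\<Phi>' x) > 0"
    using x Phi'_pos[OF x] by auto
  then show ?thesis
    unfolding spread_def scale_eq real_sqrt_mult by (simp add: field_simps)
qed

lemma Phi'_div_spread:
  assumes x: "x \<ge> 0" shows "\<Phi>' x / spread x = spread x / (1 + x)"
  using spread_squared[OF x] spread_pos[OF x] x by (simp add: field_simps power2_eq_square)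

lemma spread_ge: "x \<ge> 0 \<Longrightarrow> spread x \<ge> sqrt (\<Psi>' 0)"
  unfolding spread_def using Phi'_ge[of x] Psi'_0_pos
  by (intro real_sqrt_le_mono) (smt (verit) mult_le_cancel_right1)

lemma spread_ge_sqrt: "x \<ge> 0 \<Longrightarrow> spread x \<ge> sqrt (\<Psi>' 0 * x)"
  unfolding spread_def using Phi'_ge[of x] Psi'_0_pos
  by (intro real_sqrt_le_mono) (smt (verit) mult.commute mult_mono)

lemma spread_le_Phi:
  assumes x: "x \<ge> 1" shows "spread x \<le> 2 * scale_const * \<Phi> x"
proof (rule power2_le_imp_le)
  have "(spread x)\<^sup>2 \<le> (1 + x) * (scale_const\<^sup>2 * ((1 + x) * (\<Psi>' x)\<^sup>2))"
    using x Phi'_le_Psi'_squared[of x] by (simp add: spread_squared mult_left_mono)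
  also have "\<dots> = scale_const\<^sup>2 * ((1 + x) * \<Psi>' x)\<^sup>2" by (simp add: power2_eq_square)
  also have "\<dots> \<le> scale_const\<^sup>2 * ((2 * x) * \<Psi>' x)\<^sup>2"
    using x Psi'_pos[of x] by (intro mult_left_mono power_mono mult_right_mono) auto
  also have "\<dots> = (2 * scale_const * \<Phi> x)\<^sup>2" by (simp add: \<Phi>_def power_mult_distrib)
  finally show "(spread x)\<^sup>2 \<le> (2 * scale_const * \<Phi> x)\<^sup>2" .
  show "0 \<le> 2 * scale_const * \<Phi> x" using x scale_const_pos Phi_nonneg[of x] by simp
qed

definition step_const :: real
  where "step_const = min 1 (min (sqrt (\<Psi>' 0)) (near_radius / 2))"

lemma step_const_bounds: "step_const > 0" "step_const \<le> 1" "step_const \<le> sqrt (\<Psi>' 0)" "step_const \<le> near_radius / 2"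
  using Psi'_0_pos near_radius_pos by (auto simp: step_const_def)

text \<open>A step in \<open>ln x\<close> along which \<open>\<Phi>\<close> moves by a multiple of \<open>spread x\<close> while \<open>x\<close> stays in the
  region where the weight is controlled.\<close>
definition log_step :: "real \<Rightarrow> real" where "log_step x = step_const / spread x"

lemma log_step_spread: "x \<ge> 0 \<Longrightarrow> log_step x * spread x = step_const"
  using spread_pos[of x] by (simp add: log_step_def)

lemma log_step_bounds:
  assumes x: "x \<ge> 0" shows "0 < log_step x" "log_step x \<le> 1"
proof -
  have "step_const \<le> spread x" using step_const_bounds(3) spread_ge[OF x] by simp
  then show "0 < log_step x" "log_step x \<le> 1"
    using step_const_bounds(1) spread_pos[OF x] by (simp_all add: log_step_def)
qed

lemma mult_log_step_le:
  assumes x: "x \<ge> 0" shows "x * log_step x \<le> step_const * scale x"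
proof -
  have "x * log_step x \<le> (1 + x) * log_step x" using log_step_bounds(1)[OF x] by simp
  also have "\<dots> = step_const * scale x" by (simp add: log_step_def flip: one_plus_div_spread[OF x])
  finally show ?thesis .
qed

lemma near_exp_log_step:
  assumes x: "x \<ge> 0"
  shows "near x (x * exp (log_step x))" "near x (x * exp (- log_step x))"
proof -
  let ?t = "log_step x"
  have t: "0 < ?t" "?t \<le> 1" by (fact log_step_bounds[OF x])+
  have radius: "2 * (x * ?t) \<le> near_radius * scale x"
    using mult_log_step_le[OF x] mult_right_mono[OF step_const_bounds(4), of "scale x"] scale_pos[OF x]
    by linarith
  have "exp ?t \<le> 1 + ?t + ?t\<^sup>2" using exp_bound[of ?t] t by simp
  moreover have "?t\<^sup>2 \<le> ?t" using t by (simp add: power2_eq_square mult_left_le)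
  ultimately have "x * (exp ?t - 1) \<le> x * (2 * ?t)" using x by (intro mult_left_mono) auto
  moreover have "\<bar>x * exp ?t - x\<bar> = x * (exp ?t - 1)"
    using t mult_left_mono[of 1 "exp ?t" x] x by (simp add: algebra_simps)
  ultimately show "near x (x * exp ?t)" using radius x by (simp add: near_def)
  have "1 - exp (- ?t) \<le> 2 * ?t" using exp_ge_add_one_self[of "- ?t"] t by linarith
  then have "x * (1 - exp (- ?t)) \<le> x * (2 * ?t)" using x by (rule mult_left_mono)
  moreover have "\<bar>x * exp (- ?t) - x\<bar> = x * (1 - exp (- ?t))"
    using t mult_left_mono[of "exp (- ?t)" 1 x] x by (simp add: algebra_simps)
  ultimately show "near x (x * exp (- ?t))" using radius x by (simp add: near_def)
qed

lemma Phi_log_step_squared_le: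
  assumes x: "x \<ge> 0" shows "\<Phi> x * (log_step x)\<^sup>2 \<le> 1"
proof -
  have "\<Phi> x * (log_step x)\<^sup>2 = step_const\<^sup>2 * (x * \<Psi>' x / ((1 + x) * \<Phi>' x))"
    using spread_squared[OF x] by (simp add: log_step_def power_divide \<Phi>_def)
  also have "\<dots> \<le> 1 * 1"
  proof (rule mult_mono)
    show "step_const\<^sup>2 \<le> 1" using step_const_bounds by (simp add: power_le_one)
    have "x * \<Psi>' x \<le> (1 + x) * \<Phi>' x" using x Psi'_le_Phi'[OF x] Psi'_pos[OF x] by (intro mult_mono) auto
    then show "x * \<Psi>' x / ((1 + x) * \<Phi>' x) \<le> 1" using x Phi'_pos[OF x] by (simp add: divide_le_eq)
  qed (use x Psi'_pos[OF x] Phi'_pos[OF x] in auto)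
  finally show ?thesis by simp
qed

lemma mult_Phi'_log_step_ge:
  assumes x: "x \<ge> 1" shows "x * \<Phi>' x * log_step x \<ge> step_const * spread x / 2"
proof -
  have "(spread x)\<^sup>2 \<le> 2 * (x * \<Phi>' x)" using x Phi'_pos[of x] by (simp add: spread_squared algebra_simps)
  then have "(spread x)\<^sup>2 * log_step x \<le> 2 * (x * \<Phi>' x) * log_step x"
    using log_step_bounds(1)[of x] x by (intro mult_right_mono) auto
  moreover have "(spread x)\<^sup>2 * log_step x = step_const * spread x"
    using log_step_spread[of x] x by (simp add: power2_eq_square mult.commute mult.left_commute)
  ultimately show ?thesis by simp
qed

lemma Phi_forward_ge:
  assumes x: "x \<ge> 1" shows "\<Phi> (x * exp (log_step x)) \<ge> \<Phi> x + step_const * spread x / 2"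
proof -
  let ?t = "log_step x"
  have x0: "x \<ge> 0" using x by simp
  have t: "0 < ?t" by (rule log_step_bounds[OF x0])
  have "x * \<Phi>' x * ?t \<le> x * \<Phi>' x * (exp ?t - 1)"
    using exp_ge_add_one_self[of ?t] x0 Phi'_pos[OF x0]
    by (intro mult_left_mono) (auto simp del: exp_ge_add_one_self)
  also have "\<dots> = (x * exp ?t - x) * \<Phi>' x" by (simp add: algebra_simps)
  also have "\<dots> \<le> \<Phi> (x * exp ?t) - \<Phi> x" by (rule Phi_diff_ge) (use x0 t in \<open>simp_all add: mult_le_cancel_left1\<close>)
  finally show ?thesis using mult_Phi'_log_step_ge[OF x] by simp
qed

lemma Phi_backward_le:
  assumes x: "x \<ge> 1" shows "\<Phi> (x * exp (- log_step x)) \<le> \<Phi> x - step_const * spread x / 16"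
proof -
  let ?t = "log_step x" and ?y = "x * exp (- log_step x)"
  have x0: "x \<ge> 0" using x by simp
  have t: "0 < ?t" "?t \<le> 1" by (fact log_step_bounds[OF x0])+
  have "exp (- ?t) \<le> 1 / (1 + ?t)"
    using exp_ge_add_one_self[of ?t] t by (simp add: exp_minus field_simps)
  also have "\<dots> \<le> 1 - ?t / 2" using t by (simp add: field_simps power2_eq_square)
  finally have "?t / 2 \<le> 1 - exp (- ?t)" by simp
  moreover have "\<Phi>' x \<le> 4 * \<Phi>' ?y" by (rule near_Phi'_le(2)[OF near_exp_log_step(2)[OF x0]])
  ultimately have "x * (?t / 2) * (\<Phi>' x / 4) \<le> x * (1 - exp (- ?t)) * \<Phi>' ?y"
    using x0 t Phi'_pos[OF x0] by (intro mult_mono mult_left_mono) auto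
  also have "\<dots> = (x - ?y) * \<Phi>' ?y" by (simp add: algebra_simps)
  also have "\<dots> \<le> \<Phi> x - \<Phi> ?y" by (rule Phi_diff_ge) (use x0 t in \<open>auto intro: mult_left_le\<close>)
  finally show ?thesis using mult_Phi'_log_step_ge[OF x] by (simp add: algebra_simps)
qed

text \<open>With \<open>y = exp s\<close>, the moment of order \<open>N\<close> is the integral of the exponential of this concave function.\<close>
definition moment_exponent :: "nat \<Rightarrow> real \<Rightarrow> real"
  where "moment_exponent N s = real N * s - \<Psi> (exp s)"

lemma moment_exponent_deriv:
  "(moment_exponent N has_real_derivative (real N - \<Phi> (exp s))) (at s)"
proof -
  have "(\<Psi> has_real_derivative \<Psi>' (exp s)) (at (exp s) within {0<..})"
    by (rule DERIV_subset[OF Psi_deriv]) auto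
  then have "(\<Psi> has_real_derivative \<Psi>' (exp s)) (at (exp s))"
    by (simp only: at_within_open[of "exp s" "{0<..}"] open_greaterThan greaterThan_iff exp_gt_zero)
  then have "((\<lambda>s. \<Psi> (exp s)) has_real_derivative \<Psi>' (exp s) * exp s) (at s)"
    by (rule DERIV_chain2) (auto intro!: derivative_eq_intros)
  then show ?thesis
    unfolding moment_exponent_def[abs_def] by (auto intro!: derivative_eq_intros simp: \<Phi>_def)
qed

lemma moment_exponent_le_tent:
  assumes x: "x \<ge> 1" and N: "\<bar>real N - \<Phi> x\<bar> \<le> step_const * spread x / 32"
  shows "moment_exponent N s \<le> moment_exponent N (ln x) + 1 - step_const * spread x / 32 * \<bar>s - ln x\<bar>"
proof (rule concave_le_tent[OF moment_exponent_deriv])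
  let ?c = "step_const * spread x / 32" and ?t = "log_step x"
  have x0: "x \<ge> 0" "x > 0" using x by auto
  have c: "?c > 0" using step_const_bounds(1) spread_pos[OF x0(1)] by simp
  have exp_ln_shift: "exp (ln x + ?t) = x * exp ?t" "exp (ln x - ?t) = x * exp (- ?t)"
    using x0 by (simp_all add: exp_add exp_diff exp_minus field_simps)
  show "real N - \<Phi> (exp u) \<le> real N - \<Phi> (exp s)" if "s \<le> u" for s u
    using that by (simp add: Phi_mono)
  show "\<bar>real N - \<Phi> (exp (ln x))\<bar> \<le> ?c" using N x0 by simp
  show "real N - \<Phi> (exp (ln x + ?t)) \<le> - ?c"
    using Phi_forward_ge[OF x] N c unfolding exp_ln_shift by linarith
  show "real N - \<Phi> (exp (ln x - ?t)) \<ge> ?c"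
    using Phi_backward_le[OF x] N c unfolding exp_ln_shift by linarith
  show "?t \<ge> 0" using log_step_bounds(1)[OF x0(1)] by simp
  have "?c * ?t = step_const * (?t * spread x) / 32" by simp
  also have "\<dots> = step_const * step_const / 32" by (simp add: log_step_spread[OF x0(1)])
  also have "\<dots> \<le> 1 / 2" using mult_le_one[OF step_const_bounds(2) _ step_const_bounds(2)] step_const_bounds(1) by simp
  finally show "?c * ?t \<le> 1 / 2" .
qed

lemma radial_moment_le:
  assumes x: "x \<ge> 1" and N: "\<bar>real N - \<Phi> x\<bar> \<le> step_const * spread x / 32"
  shows "radial_moment radial_weight N \<le> 64 * exp 1 / (step_const * spread x) * (x ^ N * exp (- \<Psi> x))"
proof -
  let ?c = "step_const * spread x / 32"
  have c: "?c > 0" using step_const_bounds(1) spread_pos[of x] x by simp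
  have "\<Phi> (x * exp (- log_step x)) \<ge> 0" using x by (intro Phi_nonneg) simp
  then have "real N > 0" using Phi_backward_le[OF x] N c by linarith
  then have integrable: "integrable lborel (\<lambda>s. exp (s * real N) * radial_weight (exp s))"
    by (intro integrable_radial_moment exp_decaying_radial_weight) simp
  have integrand: "exp (s * real N) * radial_weight (exp s) = exp (moment_exponent N s)" for s
    by (simp add: moment_exponent_def radial_weight_def exp_diff exp_minus field_simps)
  have "ennreal (radial_moment radial_weight N) = (\<integral>\<^sup>+s. ennreal (exp (moment_exponent N s)) \<partial>lborel)"
    using integrable unfolding radial_moment_def integrand by (simp add: nn_integral_eq_integral)
  also have "\<dots> \<le> ennreal (exp (moment_exponent N (ln x) + 1) * (2 / ?c))"
    by (rule nn_integral_exp_tent_le[OF moment_exponent_le_tent[OF x N] c])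
  finally have "radial_moment radial_weight N \<le> exp (moment_exponent N (ln x) + 1) * (2 / ?c)"
    using c by (subst (asm) ennreal_le_iff) auto
  also have "exp (moment_exponent N (ln x) + 1) = exp 1 * (x ^ N * exp (- \<Psi> x))"
  proof -
    have "exp (real N * ln x) = x ^ N" using x by (simp add: exp_of_nat_mult)
    then show ?thesis using x by (simp add: moment_exponent_def exp_add exp_diff exp_minus field_simps)
  qed
  finally show ?thesis by (simp add: field_simps)
qed

end

section \<open>Lower bounds for the coefficients of the kernel\<close>

lemma power_mult_fact_le: "(real k + 1) ^ m * fact k \<le> fact (m + k)"
proof (induction m)
  case (Suc m)
  have "(real k + 1) ^ Suc m * fact k = (real k + 1) * ((real k + 1) ^ m * fact k)" by simp
  also have "\<dots> \<le> (real (Suc (m + k))) * fact (m + k)"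
    by (rule mult_mono[OF _ Suc]) auto
  finally show ?case by simp
qed simp

lemma fact_degree_ge:
  fixes a :: real
  assumes n: "n \<ge> 1" and a: "a \<ge> 0" "a \<le> real (n + k)"
  shows "(a / real n) ^ (n - 1) * fact k \<le> fact (n + k - 1)"
proof -
  have "real k * 1 \<le> real k * real n" using n by (intro mult_left_mono) auto
  then have "a \<le> real n * (real k + 1)" using a(2) by (simp add: algebra_simps)
  then have "a / real n \<le> real k + 1" using n by (simp add: field_simps)
  then have "(a / real n) ^ (n - 1) * fact k \<le> (real k + 1) ^ (n - 1) * fact k"
    using a(1) by (intro mult_right_mono power_mono) auto
  also have "\<dots> \<le> fact (n - 1 + k)" by (rule power_mult_fact_le)
  finally show ?thesis using n by simp
qed

lemma card_nat_window:
  fixes a b :: real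
  assumes "b - a \<ge> 2" "a \<ge> real n"
  shows "finite {k::nat. a \<le> real (n + k) \<and> real (n + k) \<le> b}"
    and "real (card {k::nat. a \<le> real (n + k) \<and> real (n + k) \<le> b}) \<ge> (b - a) / 2"
proof -
  let ?K = "{k::nat. a \<le> real (n + k) \<and> real (n + k) \<le> b}"
  have "?K \<subseteq> {..nat \<lceil>b\<rceil>}" by (auto simp: le_nat_iff) linarith
  then show fin: "finite ?K" by (rule finite_subset) simp
  define lo where "lo = nat (\<lceil>a\<rceil> - int n)"
  define hi where "hi = nat (\<lfloor>b\<rfloor> - int n)"
  have lo: "real lo = of_int \<lceil>a\<rceil> - real n" using assms(2) by (simp add: lo_def) linarith
  have hi: "real hi = of_int \<lfloor>b\<rfloor> - real n" using assms by (simp add: hi_def) linarith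
  have "card {lo..hi} \<le> card ?K"
  proof (intro card_mono[OF fin] subsetI)
    fix k assume "k \<in> {lo..hi}"
    then have "real lo \<le> real k" "real k \<le> real hi" by auto
    then show "k \<in> ?K" using lo hi by (auto; linarith)
  qed
  then have "real (hi + 1 - lo) \<le> real (card ?K)" by simp
  moreover have "real (hi + 1 - lo) \<ge> real hi + 1 - real lo" by linarith
  moreover have "real hi + 1 - real lo \<ge> (b - a) / 2"
    unfolding lo hi using assms floor_correct[of b] ceiling_correct[of a] by (simp add: field_simps)
  ultimately show "real (card ?K) \<ge> (b - a) / 2" by linarith
qed

context fock_growth
begin

definition window_ratio :: real
  where "window_ratio = min (step_const / 32) (1 / (4 * scale_const))"

definition window :: "real \<Rightarrow> real" where "window x = window_ratio * spread x"

lemma window_ratio_pos: "window_ratio > 0"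
  using step_const_bounds(1) scale_const_pos by (simp add: window_ratio_def)

lemma window_le_step: "x \<ge> 0 \<Longrightarrow> window x \<le> step_const * spread x / 32"
  using mult_right_mono[of window_ratio "step_const / 32" "spread x"] spread_pos[of x]
  by (simp add: window_def window_ratio_def)

lemma window_le_Phi:
  assumes x: "x \<ge> 1" shows "window x \<le> \<Phi> x / 2"
proof -
  have "window x \<le> 1 / (4 * scale_const) * (2 * scale_const * \<Phi> x)"
    unfolding window_def
    using spread_le_Phi[OF x] spread_pos[of x] x scale_const_pos by (intro mult_mono) (auto simp: window_ratio_def)
  also have "\<dots> = \<Phi> x / 2" using scale_const_pos by simp
  finally show ?thesis .
qed

definition coeff_const :: real
  where "coeff_const = step_const / (gaussian_mass TYPE('n) * (64 * exp 1) * (2 * real CARD('n)) ^ (CARD('n) - 1))"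

lemma coeff_const_pos: "coeff_const > 0"
  unfolding coeff_const_def using step_const_bounds(1) gaussian_mass_pos[where 'n='n] by simp

definition term_bound :: "real \<Rightarrow> real"
  where "term_bound x = coeff_const * (kernel_density x / spread x) * exp (\<Psi> x)"

lemma term_bound_pos: "x \<ge> 0 \<Longrightarrow> term_bound x > 0"
  by (simp add: term_bound_def coeff_const_pos kernel_density_pos spread_pos)

lemma term_bound_le:
  assumes x: "x \<ge> 1"
  shows "term_bound x \<le> ((\<Phi> x / 2 / real CARD('n)) ^ (CARD('n) - 1) * fact k) * x ^ k
    / (fact k * gaussian_mass TYPE('n)
        * (64 * exp 1 / (step_const * spread x) * (x ^ (CARD('n) + k) * exp (- \<Psi> x))))"
proof -
  let ?n = "CARD('n)"
  have x0: "x \<ge> 0" "x > 0" using x by auto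
  have spread: "spread x > 0" by (rule spread_pos[OF x0(1)])
  have power: "x ^ (?n + k) = x ^ k * (x * x ^ (?n - 1))"
    using power_Suc[of x "?n - 1"] by (simp add: power_add Suc_leI)
  have "term_bound x = coeff_const * \<Psi>' x ^ (?n - 1) * (spread x / (1 + x)) * exp (\<Psi> x)"
    by (simp add: term_bound_def kernel_density_def flip: Phi'_div_spread[OF x0(1)])
  also have "\<dots> \<le> coeff_const * \<Psi>' x ^ (?n - 1) * (spread x / x) * exp (\<Psi> x)"
    using coeff_const_pos Psi'_pos[OF x0(1)] spread x0
    by (intro mult_right_mono mult_left_mono divide_left_mono) auto
  also have "\<dots> = ((\<Phi> x / 2 / real ?n) ^ (?n - 1) * fact k) * x ^ k
      / (fact k * gaussian_mass TYPE('n) * (64 * exp 1 / (step_const * spread x) * (x ^ (?n + k) * exp (- \<Psi> x))))"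
    unfolding power coeff_const_def \<Phi>_def power_divide power_mult_distrib
    using x0 spread step_const_bounds(1) gaussian_mass_pos[where 'n='n] by (simp add: field_simps exp_minus)
  finally show ?thesis .
qed

lemma kernel_coeff_ge:
  assumes x: "x \<ge> 1" and k: "\<bar>real (CARD('n) + k) - \<Phi> x\<bar> \<le> window x"
  shows "term_bound x \<le> kernel_coeff k * x ^ k"
proof -
  let ?N = "CARD('n) + k"
  have x0: "x \<ge> 0" using x by simp
  have moment: "radial_moment radial_weight ?N \<le> 64 * exp 1 / (step_const * spread x) * (x ^ ?N * exp (- \<Psi> x))"
    using k window_le_step[OF x0] by (intro radial_moment_le[OF x]) linarith
  have moment_pos: "radial_moment radial_weight ?N > 0"
    by (rule radial_moment_weight_pos) (simp add: Suc_leI)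
  have "\<Phi> x / 2 \<le> real ?N" using k window_le_Phi[OF x] by linarith
  then have factorial: "(\<Phi> x / 2 / real CARD('n)) ^ (CARD('n) - 1) * fact k \<le> fact (?N - 1)"
    using Phi_nonneg[OF x0] by (intro fact_degree_ge) (simp_all add: Suc_leI)
  note term_bound_le[OF x, of k]
  also have "((\<Phi> x / 2 / real CARD('n)) ^ (CARD('n) - 1) * fact k) * x ^ k
      / (fact k * gaussian_mass TYPE('n) * (64 * exp 1 / (step_const * spread x) * (x ^ ?N * exp (- \<Psi> x))))
    \<le> fact (?N - 1) * x ^ k / (fact k * gaussian_mass TYPE('n) * radial_moment radial_weight ?N)"
    using factorial moment moment_pos gaussian_mass_pos[where 'n='n] x0
    by (intro frac_le mult_right_mono mult_left_mono) auto
  also have "\<dots> = kernel_coeff k * x ^ k" by (simp add: kernel_coeff_def)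
  finally show ?thesis .
qed

definition large :: "real \<Rightarrow> bool"
  where "large x \<longleftrightarrow> x \<ge> 1 \<and> window x \<ge> 4 \<and> \<Phi> x - window x \<ge> real CARD('n)"

lemma large_beyond:
  obtains X where "X \<ge> 1" "\<And>x. x \<ge> X \<Longrightarrow> large x"
proof
  let ?X = "max 1 (max ((4 / window_ratio)\<^sup>2 / \<Psi>' 0) (2 * real CARD('n) / \<Psi>' 0))"
  show "?X \<ge> 1" by simp
  fix x assume "x \<ge> ?X"
  then have x: "x \<ge> 1" "(4 / window_ratio)\<^sup>2 / \<Psi>' 0 \<le> x" "2 * real CARD('n) / \<Psi>' 0 \<le> x" by auto
  have "(4 / window_ratio)\<^sup>2 \<le> \<Psi>' 0 * x"
    using mult_right_mono[OF x(2), of "\<Psi>' 0"] Psi'_0_pos by (simp add: mult.commute)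
  then have "4 / window_ratio \<le> sqrt (\<Psi>' 0 * x)" by (rule real_le_rsqrt)
  also have "\<dots> \<le> spread x" using x by (intro spread_ge_sqrt) auto
  finally have "window x \<ge> 4" using window_ratio_pos by (simp add: window_def field_simps)
  moreover have "2 * real CARD('n) \<le> \<Psi>' 0 * x" using x(3) Psi'_0_pos by (simp add: field_simps)
  moreover have "\<Psi>' 0 * x \<le> \<Phi> x"
    unfolding \<Phi>_def using Psi'_ge[of x] x by (simp add: mult.commute mult_left_mono)
  ultimately show "large x" using window_le_Phi[OF x(1)] x(1) by (simp add: large_def)
qed

text \<open>The window lies on the side of \<open>\<Phi> x\<close> away from \<open>a\<close>.\<close>
lemma degree_window:
  assumes "large x"
  obtains I where "finite I" "real (card I) \<ge> window x / 4"
    "\<And>k. k \<in> I \<Longrightarrow> term_bound x \<le> kernel_coeff k * x ^ k"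
    "\<And>k. k \<in> I \<Longrightarrow> (window x / 2)\<^sup>2 \<le> (real k - a)\<^sup>2"
proof -
  let ?n = "CARD('n)" and ?w = "window x"
  have w: "?w \<ge> 4" "\<Phi> x - ?w \<ge> real ?n" and x: "x \<ge> 1" using assms by (auto simp: large_def)
  define start where "start = (if a + real ?n \<le> \<Phi> x then \<Phi> x + ?w / 2 else \<Phi> x - ?w)"
  have start: "start + ?w / 2 - start \<ge> 2" "start \<ge> real ?n" using w by (auto simp: start_def)
  define I where "I = {k::nat. start \<le> real (?n + k) \<and> real (?n + k) \<le> start + ?w / 2}"
  have I: "\<bar>real (?n + k) - \<Phi> x\<bar> \<le> ?w \<and> \<bar>real k - a\<bar> \<ge> ?w / 2" if "k \<in> I" for k
    using that w unfolding I_def start_def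
    by (cases "a + real ?n \<le> \<Phi> x"; simp; linarith)
  have "(?w / 2)\<^sup>2 \<le> (real k - a)\<^sup>2" if "k \<in> I" for k
  proof -
    have "(?w / 2)\<^sup>2 \<le> \<bar>real k - a\<bar>\<^sup>2" using I[OF that] w by (intro power_mono) auto
    then show ?thesis by simp
  qed
  moreover have "term_bound x \<le> kernel_coeff k * x ^ k" if "k \<in> I" for k
    using I[OF that] by (intro kernel_coeff_ge[OF x]) simp
  ultimately show ?thesis
    using that[of I] card_nat_window[OF start] by (simp add: I_def)
qed

end

section \<open>Mean and variance of the degree\<close>

context fock_growth
begin

definition kernel_diag' :: "real \<Rightarrow> real" where "kernel_diag' x = (\<Sum>k. diffs kernel_coeff k * x ^ k)"
definition kernel_diag'' :: "real \<Rightarrow> real" where "kernel_diag'' x = (\<Sum>k. diffs (diffs kernel_coeff) k * x ^ k)"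

lemma summable_diffs: "summable (\<lambda>k. diffs kernel_coeff k * x ^ k)" for x :: real
  by (rule termdiff_converges_all) (rule summable_kernel_coeff)

lemma summable_diffs_diffs: "summable (\<lambda>k. diffs (diffs kernel_coeff) k * x ^ k)" for x :: real
  by (rule termdiff_converges_all) (rule summable_diffs)

lemma kernel_diag_deriv: "(kernel_diag has_real_derivative kernel_diag' x) (at x)"
  unfolding kernel_diag_def[abs_def] kernel_diag'_def
  by (rule termdiffs_strong_converges_everywhere) (rule summable_kernel_coeff)

lemma kernel_diag'_deriv: "(kernel_diag' has_real_derivative kernel_diag'' x) (at x)"
  unfolding kernel_diag'_def[abs_def] kernel_diag''_def
  by (rule termdiffs_strong_converges_everywhere) (rule summable_diffs)

lemma isCont_kernel_diag: "isCont kernel_diag x" and isCont_kernel_diag': "isCont kernel_diag' x"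
  using kernel_diag_deriv kernel_diag'_deriv DERIV_isCont by blast+

lemma isCont_kernel_diag'': "isCont kernel_diag'' x"
proof -
  have "(kernel_diag'' has_real_derivative (\<Sum>k. diffs (diffs (diffs kernel_coeff)) k * x ^ k)) (at x)"
    unfolding kernel_diag''_def[abs_def]
    by (rule termdiffs_strong_converges_everywhere) (rule summable_diffs_diffs)
  then show ?thesis by (rule DERIV_isCont)
qed

text \<open>At \<open>x\<close>, the degrees \<open>k\<close> are distributed with weights \<open>kernel_coeff k * x ^ k / kernel_diag x\<close>; the
  variance of this distribution is \<open>x * mean_degree' x\<close>.\<close>
definition log_diag' :: "real \<Rightarrow> real" where "log_diag' x = kernel_diag' x / kernel_diag x"
definition log_diag'' :: "real \<Rightarrow> real"
  where "log_diag'' x = kernel_diag'' x / kernel_diag x - (log_diag' x)\<^sup>2"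
definition mean_degree :: "real \<Rightarrow> real" where "mean_degree x = x * log_diag' x"
definition mean_degree' :: "real \<Rightarrow> real" where "mean_degree' x = log_diag' x + x * log_diag'' x"

lemma log_diag_deriv: "x \<ge> 0 \<Longrightarrow> ((\<lambda>x. ln (kernel_diag x)) has_real_derivative log_diag' x) (at x)"
  unfolding log_diag'_def using kernel_diag_pos[of x]
  by (auto intro!: derivative_eq_intros kernel_diag_deriv)

lemma log_diag'_deriv: "x \<ge> 0 \<Longrightarrow> (log_diag' has_real_derivative log_diag'' x) (at x)"
  unfolding log_diag'_def[abs_def] log_diag''_def log_diag'_def using kernel_diag_pos[of x]
  by (auto intro!: derivative_eq_intros kernel_diag_deriv kernel_diag'_deriv
      simp: field_simps power2_eq_square)

lemma mean_degree_deriv: "x \<ge> 0 \<Longrightarrow> (mean_degree has_real_derivative mean_degree' x) (at x)"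
  unfolding mean_degree_def[abs_def] mean_degree'_def
  by (auto intro!: derivative_eq_intros log_diag'_deriv)

lemma log_diag'_continuous: "continuous_on {0..} log_diag'"
  using log_diag'_deriv DERIV_isCont by (auto intro!: continuous_at_imp_continuous_on)

lemma log_diag''_continuous: "continuous_on {0..} log_diag''"
proof -
  have "isCont log_diag'' x" if "x \<ge> 0" for x
    unfolding log_diag''_def log_diag'_def using kernel_diag_pos[OF that]
    by (intro continuous_intros isCont_kernel_diag isCont_kernel_diag' isCont_kernel_diag'') auto
  then show ?thesis by (simp add: continuous_at_imp_continuous_on)
qed

lemma mean_degree'_continuous: "continuous_on {0..} mean_degree'"
  unfolding mean_degree'_def by (intro continuous_intros log_diag'_continuous log_diag''_continuous)

definition degree_second_moment :: "real \<Rightarrow> real \<Rightarrow> real"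
  where "degree_second_moment a x
    = x\<^sup>2 * kernel_diag'' x + x * kernel_diag' x - 2 * a * (x * kernel_diag' x) + a\<^sup>2 * kernel_diag x"

lemma kernel_diag_sums: "(\<lambda>k. kernel_coeff k * x ^ k) sums kernel_diag x"
  unfolding kernel_diag_def by (rule summable_sums[OF summable_kernel_coeff])

lemma first_moment_sums: "(\<lambda>k. real k * (kernel_coeff k * x ^ k)) sums (x * kernel_diag' x)"
proof -
  have "(\<lambda>k. real k * kernel_coeff k * x ^ (k - Suc 0)) sums kernel_diag' x"
    unfolding kernel_diag'_def by (rule diffs_equiv[OF summable_diffs])
  then have "(\<lambda>k. x * (real k * kernel_coeff k * x ^ (k - Suc 0))) sums (x * kernel_diag' x)"
    by (rule sums_mult)
  moreover have "x * (real k * kernel_coeff k * x ^ (k - Suc 0)) = real k * (kernel_coeff k * x ^ k)" for k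
    by (cases k) auto
  ultimately show ?thesis by simp
qed

lemma factorial_moment_sums:
  "(\<lambda>k. (real k - 1) * real k * (kernel_coeff k * x ^ k)) sums (x\<^sup>2 * kernel_diag'' x)"
proof -
  have "(\<lambda>k. real k * diffs kernel_coeff k * x ^ (k - Suc 0)) sums kernel_diag'' x"
    unfolding kernel_diag''_def by (rule diffs_equiv[OF summable_diffs_diffs])
  then have "(\<lambda>k. x\<^sup>2 * (real k * diffs kernel_coeff k * x ^ (k - Suc 0))) sums (x\<^sup>2 * kernel_diag'' x)"
    by (rule sums_mult)
  moreover have "x\<^sup>2 * (real k * diffs kernel_coeff k * x ^ (k - Suc 0))
      = (real (Suc k) - 1) * real (Suc k) * (kernel_coeff (Suc k) * x ^ Suc k)" for k
    by (cases k) (auto simp: diffs_def power2_eq_square)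
  ultimately have "(\<lambda>k. (real (Suc k) - 1) * real (Suc k) * (kernel_coeff (Suc k) * x ^ Suc k))
      sums (x\<^sup>2 * kernel_diag'' x)"
    by simp
  then show ?thesis by (subst (asm) sums_Suc_iff) simp
qed

lemma degree_second_moment_sums:
  "(\<lambda>k. (real k - a)\<^sup>2 * (kernel_coeff k * x ^ k)) sums degree_second_moment a x"
proof -
  have "(\<lambda>k. (real k - 1) * real k * (kernel_coeff k * x ^ k) + real k * (kernel_coeff k * x ^ k)
      - 2 * a * (real k * (kernel_coeff k * x ^ k)) + a\<^sup>2 * (kernel_coeff k * x ^ k))
    sums degree_second_moment a x"
    unfolding degree_second_moment_def
    by (intro sums_add sums_diff sums_mult kernel_diag_sums first_moment_sums factorial_moment_sums)
  then show ?thesis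
    by (rule sums_cong[THEN iffD1, rotated]) (simp add: power2_eq_square algebra_simps)
qed

lemma degree_second_moment_eq:
  assumes "x \<ge> 0"
  shows "degree_second_moment a x = x * mean_degree' x * kernel_diag x + (a - mean_degree x)\<^sup>2 * kernel_diag x"
  using kernel_diag_pos[OF assms]
  by (simp add: degree_second_moment_def mean_degree'_def mean_degree_def log_diag'_def log_diag''_def
      power2_eq_square field_simps)

lemma variance_le_degree_second_moment:
  "x \<ge> 0 \<Longrightarrow> x * mean_degree' x * kernel_diag x \<le> degree_second_moment a x"
  using kernel_diag_pos[of x] by (simp add: degree_second_moment_eq)

lemma variance_ge_partial_sum:
  assumes "x \<ge> 0" "finite I"
  shows "(\<Sum>k\<in>I. (real k - mean_degree x)\<^sup>2 * (kernel_coeff k * x ^ k)) \<le> x * mean_degree' x * kernel_diag x"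
proof -
  have sums: "(\<lambda>k. (real k - mean_degree x)\<^sup>2 * (kernel_coeff k * x ^ k)) sums (x * mean_degree' x * kernel_diag x)"
    using degree_second_moment_sums[of "mean_degree x" x] by (simp add: degree_second_moment_eq[OF assms(1)])
  have "(\<Sum>k\<in>I. (real k - mean_degree x)\<^sup>2 * (kernel_coeff k * x ^ k))
      \<le> (\<Sum>k. (real k - mean_degree x)\<^sup>2 * (kernel_coeff k * x ^ k))"
    using sums_summable[OF sums] assms kernel_coeff_nonneg by (intro sum_le_suminf) auto
  then show ?thesis using sums_unique[OF sums] by simp
qed

lemma mean_degree'_pos: assumes "x \<ge> 0" shows "mean_degree' x > 0"
proof (cases "x = 0")
  case True
  have "(\<lambda>k. diffs kernel_coeff k * 0 ^ k) sums (diffs kernel_coeff 0)" by (rule powser_sums_zero)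
  then have "kernel_diag' 0 = kernel_coeff 1" by (simp add: kernel_diag'_def sums_iff diffs_def)
  then show ?thesis
    using True kernel_coeff_pos[of 1] kernel_diag_pos[of 0] by (simp add: mean_degree'_def log_diag'_def)
next
  case False
  then have x: "x > 0" using assms by simp
  have "0 < (\<Sum>k\<in>{0, 1}. (real k - mean_degree x)\<^sup>2 * (kernel_coeff k * x ^ k))"
    using kernel_coeff_pos[of 0] kernel_coeff_pos[of 1] x
    by (cases "mean_degree x = 0") (auto intro: add_pos_nonneg)
  also have "\<dots> \<le> x * mean_degree' x * kernel_diag x" by (rule variance_ge_partial_sum[OF assms]) simp
  finally show ?thesis using x kernel_diag_pos[OF assms] by (simp add: zero_less_mult_iff)
qed

end

section \<open>Asymptotics of the kernel on the diagonal\<close>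

lemma continuous_halfline_lower_bound:
  fixes f :: "real \<Rightarrow> real"
  assumes cont: "continuous_on {0..} f" and pos: "\<And>x. x \<ge> 0 \<Longrightarrow> f x > 0"
    and tail: "\<And>x. x \<ge> X \<Longrightarrow> c \<le> f x" and "c > 0"
  shows "\<exists>b>0. \<forall>x\<ge>0. b \<le> f x"
proof -
  have "continuous_on {0..max 0 X} f" using cont by (rule continuous_on_subset) auto
  then obtain y where y: "y \<in> {0..max 0 X}" "\<forall>x\<in>{0..max 0 X}. f y \<le> f x"
    using continuous_attains_inf[of "{0..max 0 X}" f] by auto
  have "min c (f y) \<le> f x" if "x \<ge> 0" for x
    using y(2) tail[of x] that by (cases "x \<le> X") (auto simp: min_le_iff_disj)
  moreover have "min c (f y) > 0" using \<open>c > 0\<close> pos y(1) by simp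
  ultimately show ?thesis by blast
qed

lemma exp_minus_le_quadratic:
  fixes t :: real
  assumes "0 \<le> t" shows "exp (- t) \<le> 1 - t + t\<^sup>2"
proof -
  have "exp (- t) \<le> 1 / (1 + t)"
    using exp_ge_add_one_self[of t] assms by (simp add: exp_minus field_simps)
  also have "\<dots> \<le> 1 - t + t\<^sup>2" using assms by (simp add: field_simps power2_eq_square power3_eq_cube)
  finally show ?thesis .
qed

lemma square_le_exp_sum: "s\<^sup>2 \<le> 2 * (exp s + exp (- s))" for s :: real
proof -
  have "s\<^sup>2 \<le> 2 * exp s" if "s \<ge> 0" for s :: real
    using exp_lower_Taylor_quadratic[OF that] that by simp
  from this[of s] this[of "- s"] show ?thesis
    by (cases "s \<ge> 0") (auto simp: add_increasing2 add_increasing)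
qed

context fock_growth
begin

lemma kernel_diag_ge_large:
  assumes "large x"
  shows "window_ratio * coeff_const / 4 * (kernel_density x * exp (\<Psi> x)) \<le> kernel_diag x"
proof -
  have x: "x \<ge> 0" using assms by (simp add: large_def)
  obtain I where I: "finite I" "real (card I) \<ge> window x / 4" "\<And>k. k \<in> I \<Longrightarrow> term_bound x \<le> kernel_coeff k * x ^ k"
    by (rule degree_window[OF assms, of 0]) blast
  have "window_ratio * coeff_const / 4 * (kernel_density x * exp (\<Psi> x)) = window x / 4 * term_bound x"
    using spread_pos[OF x] by (simp add: window_def term_bound_def)
  also have "\<dots> \<le> real (card I) * term_bound x"
    using I(2) term_bound_pos[OF x] by (intro mult_right_mono) auto
  also have "\<dots> = (\<Sum>k\<in>I. term_bound x)" by simp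
  also have "\<dots> \<le> (\<Sum>k\<in>I. kernel_coeff k * x ^ k)" using I(3) by (rule sum_mono)
  also have "\<dots> \<le> kernel_diag x" by (rule partial_sum_le_kernel_diag[OF x I(1)])
  finally show ?thesis .
qed

lemma kernel_diag_lower_bound:
  obtains c where "c > 0" "\<And>x. x \<ge> 0 \<Longrightarrow> c * (kernel_density x * exp (\<Psi> x)) \<le> kernel_diag x"
proof -
  obtain X where X: "\<And>x. x \<ge> X \<Longrightarrow> large x" and "X \<ge> 1" using large_beyond by blast
  let ?ratio = "\<lambda>x. kernel_diag x / (kernel_density x * exp (\<Psi> x))"
  have pos: "kernel_density x * exp (\<Psi> x) > 0" if "x \<ge> 0" for x using kernel_density_pos[OF that] by simp
  have "continuous_on {0..} kernel_diag"
    using isCont_kernel_diag by (simp add: continuous_at_imp_continuous_on)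
  then have "continuous_on {0..} ?ratio"
    using kernel_density_pos
    by (intro continuous_intros kernel_density_continuous Psi_continuous) (auto simp: less_le)
  moreover have "?ratio x > 0" if "x \<ge> 0" for x
    using kernel_diag_pos[OF that] pos[OF that] by simp
  moreover have "window_ratio * coeff_const / 4 \<le> ?ratio x" if "x \<ge> X" for x
    using kernel_diag_ge_large[OF X[OF that]] pos[of x] that \<open>X \<ge> 1\<close> by (simp add: pos_le_divide_eq)
  moreover have "window_ratio * coeff_const / 4 > 0" using window_ratio_pos coeff_const_pos by simp
  ultimately have "\<exists>b>0. \<forall>x\<ge>0. b \<le> ?ratio x"
    by (rule continuous_halfline_lower_bound)
  then obtain b where b: "b > 0" "\<And>x. x \<ge> 0 \<Longrightarrow> b \<le> ?ratio x" by blast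
  have "b * (kernel_density x * exp (\<Psi> x)) \<le> kernel_diag x" if "x \<ge> 0" for x
    using b(2)[OF that] pos[OF that] by (simp add: pos_le_divide_eq)
  then show ?thesis using that b(1) by blast
qed

definition tilt_const :: real
  where "tilt_const = evaluation_const * near_density_const * exp oscillation"

lemma tilt_const_pos: "tilt_const > 0"
  using evaluation_const_pos near_density_const_pos by (simp add: tilt_const_def)

lemma tilted_kernel_diag_le:
  assumes near: "near x (x * exp s)" and s: "exp s - 1 - s \<le> (log_step x)\<^sup>2"
  shows "exp (- (s * \<Phi> x)) * kernel_diag (x * exp s) \<le> tilt_const * (kernel_density x * exp (\<Psi> x))"
proof -
  let ?y = "x * exp s"
  note x = nearD(1)[OF near] and y = nearD(2)[OF near]
  have "\<Psi> ?y \<le> \<Psi> x + \<Psi>' x * (?y - x) + 4 * Psi''_const * near_radius\<^sup>2" by (rule near_Psi_le[OF near])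
  also have "\<Psi>' x * (?y - x) = \<Phi> x * (exp s - 1 - s) + s * \<Phi> x" by (simp add: \<Phi>_def algebra_simps)
  also have "\<Phi> x * (exp s - 1 - s) \<le> \<Phi> x * (log_step x)\<^sup>2"
    using s Phi_nonneg[OF x] by (rule mult_left_mono)
  also have "\<dots> \<le> 1" by (rule Phi_log_step_squared_le[OF x])
  finally have exponent: "- (s * \<Phi> x) + \<Psi> ?y \<le> \<Psi> x + oscillation" by (simp add: oscillation_def)
  have "exp (- (s * \<Phi> x)) * kernel_diag ?y \<le> exp (- (s * \<Phi> x)) * (evaluation_const * exp (\<Psi> ?y) * kernel_density ?y)"
    using kernel_diag_le[OF y] by (simp add: diag_bound_def)
  also have "\<dots> = evaluation_const * kernel_density ?y * exp (- (s * \<Phi> x) + \<Psi> ?y)"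
    by (simp only: exp_add mult_ac)
  also have "\<dots> \<le> evaluation_const * (near_density_const * kernel_density x) * exp (\<Psi> x + oscillation)"
    using exponent evaluation_const_pos near_density_const_pos near_kernel_density_le[OF near]
      kernel_density_pos[OF y] kernel_density_pos[OF x]
    by (intro mult_mono mult_left_mono) auto
  also have "\<dots> = tilt_const * (kernel_density x * exp (\<Psi> x))"
    by (simp add: tilt_const_def exp_add algebra_simps)
  finally show ?thesis .
qed

text \<open>A Chernoff bound, based on \<open>s\<^sup>2 \<le> 2 (e\<^sup>s + e\<^sup>-\<^sup>s)\<close>.\<close>
lemma degree_second_moment_le_tilted:
  assumes x: "x \<ge> 0" and t: "t > 0"
  shows "degree_second_moment a x
    \<le> (2 / t\<^sup>2) * (exp (- (t * a)) * kernel_diag (x * exp t) + exp (- (- t * a)) * kernel_diag (x * exp (- t)))"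
proof -
  have tilted: "(\<lambda>k. exp (- (s * a)) * (kernel_coeff k * (x * exp s) ^ k)) sums (exp (- (s * a)) * kernel_diag (x * exp s))"
    for s by (intro sums_mult kernel_diag_sums)
  have tilted_term: "exp (- (s * a)) * (kernel_coeff k * (x * exp s) ^ k)
      = exp (s * (real k - a)) * (kernel_coeff k * x ^ k)" for s k
  proof -
    have "exp (s * (real k - a)) = exp (- (s * a)) * exp (s * real k)"
      by (simp add: algebra_simps flip: exp_add)
    then show ?thesis by (simp add: power_mult_distrib exp_of_nat2_mult)
  qed
  show ?thesis
  proof (rule sums_le[OF _ degree_second_moment_sums sums_mult[OF sums_add[OF tilted tilted]]])
    fix k
    have "(real k - a)\<^sup>2 = (1 / t\<^sup>2) * (t * (real k - a))\<^sup>2" using t by (simp add: power_mult_distrib)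
    also have "\<dots> \<le> (1 / t\<^sup>2) * (2 * (exp (t * (real k - a)) + exp (- t * (real k - a))))"
      using square_le_exp_sum[of "t * (real k - a)"] by (intro mult_left_mono) auto
    finally have "(real k - a)\<^sup>2 * (kernel_coeff k * x ^ k)
        \<le> (1 / t\<^sup>2) * (2 * (exp (t * (real k - a)) + exp (- t * (real k - a)))) * (kernel_coeff k * x ^ k)"
      using kernel_coeff_nonneg[of k] x by (intro mult_right_mono) auto
    then show "(real k - a)\<^sup>2 * (kernel_coeff k * x ^ k)
        \<le> (2 / t\<^sup>2) * (exp (- (t * a)) * (kernel_coeff k * (x * exp t) ^ k)
          + exp (- (- t * a)) * (kernel_coeff k * (x * exp (- t)) ^ k))"
      unfolding tilted_term by (simp add: algebra_simps)
  qed
qed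

lemma degree_second_moment_le:
  assumes x: "x \<ge> 0"
  shows "degree_second_moment (\<Phi> x) x \<le> 4 / (log_step x)\<^sup>2 * (tilt_const * (kernel_density x * exp (\<Psi> x)))"
proof -
  let ?t = "log_step x" and ?b = "tilt_const * (kernel_density x * exp (\<Psi> x))"
  have t: "0 < ?t" "?t \<le> 1" by (fact log_step_bounds[OF x])+
  have forward: "exp (- (?t * \<Phi> x)) * kernel_diag (x * exp ?t) \<le> ?b"
    using exp_bound[of ?t] t by (intro tilted_kernel_diag_le near_exp_log_step[OF x]) simp
  have backward: "exp (- (- ?t * \<Phi> x)) * kernel_diag (x * exp (- ?t)) \<le> ?b"
    using exp_minus_le_quadratic[of ?t] t by (intro tilted_kernel_diag_le near_exp_log_step[OF x]) simp
  note degree_second_moment_le_tilted[OF x t(1), of "\<Phi> x"]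
  also have "(2 / ?t\<^sup>2) * (exp (- (?t * \<Phi> x)) * kernel_diag (x * exp ?t)
      + exp (- (- ?t * \<Phi> x)) * kernel_diag (x * exp (- ?t))) \<le> (2 / ?t\<^sup>2) * (?b + ?b)"
    by (intro mult_left_mono add_mono forward backward) simp
  finally show ?thesis by (simp add: mult_ac)
qed

lemma variance_upper_bound:
  obtains C where "C > 0" "\<And>x. x \<ge> 0 \<Longrightarrow> x * mean_degree' x \<le> C * ((1 + x) * \<Phi>' x)"
proof -
  obtain c where c: "c > 0" "\<And>x. x \<ge> 0 \<Longrightarrow> c * (kernel_density x * exp (\<Psi> x)) \<le> kernel_diag x"
    using kernel_diag_lower_bound by blast
  let ?C = "4 / step_const\<^sup>2 * (tilt_const / c)"
  have "x * mean_degree' x \<le> ?C * ((1 + x) * \<Phi>' x)" if x: "x \<ge> 0" for x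
  proof -
    have "x * mean_degree' x * kernel_diag x \<le> degree_second_moment (\<Phi> x) x"
      by (rule variance_le_degree_second_moment[OF x])
    also have "\<dots> \<le> 4 / (log_step x)\<^sup>2 * (tilt_const * (kernel_density x * exp (\<Psi> x)))"
      by (rule degree_second_moment_le[OF x])
    also have "\<dots> = 4 / (log_step x)\<^sup>2 * (tilt_const / c) * (c * (kernel_density x * exp (\<Psi> x)))"
      using c(1) by simp
    also have "\<dots> \<le> 4 / (log_step x)\<^sup>2 * (tilt_const / c) * kernel_diag x"
      using c x tilt_const_pos by (intro mult_left_mono) auto
    also have "4 / (log_step x)\<^sup>2 * (tilt_const / c) = ?C * ((1 + x) * \<Phi>' x)"
      unfolding spread_squared[OF x, symmetric] by (simp add: log_step_def power_divide)
    finally show ?thesis using kernel_diag_pos[OF x] by (rule mult_right_le_imp_le)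
  qed
  moreover have "?C > 0" using step_const_bounds(1) tilt_const_pos c(1) by simp
  ultimately show ?thesis using that by blast
qed

definition variance_const :: real
  where "variance_const = window_ratio * (window_ratio / 2)\<^sup>2 * coeff_const / (4 * evaluation_const)"

lemma variance_const_pos: "variance_const > 0"
  using window_ratio_pos coeff_const_pos evaluation_const_pos by (simp add: variance_const_def)

lemma variance_ge_large:
  assumes "large x" shows "variance_const * ((1 + x) * \<Phi>' x) \<le> x * mean_degree' x"
proof -
  have x: "x \<ge> 0" using assms by (simp add: large_def)
  obtain I where I: "finite I" "real (card I) \<ge> window x / 4"
    "\<And>k. k \<in> I \<Longrightarrow> term_bound x \<le> kernel_coeff k * x ^ k"
    "\<And>k. k \<in> I \<Longrightarrow> (window x / 2)\<^sup>2 \<le> (real k - mean_degree x)\<^sup>2"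
    by (rule degree_window[OF assms, of "mean_degree x"]) blast
  let ?b = "(window x / 2)\<^sup>2 * term_bound x"
  have b: "?b \<ge> 0" using term_bound_pos[OF x] by simp
  have "variance_const * (spread x)\<^sup>2 * kernel_diag x
      \<le> variance_const * (spread x)\<^sup>2 * (evaluation_const * exp (\<Psi> x) * kernel_density x)"
    using variance_const_pos kernel_diag_le[OF x] by (intro mult_left_mono) (auto simp: diag_bound_def)
  also have "\<dots> = (window x / 4) * ?b"
    using spread_pos[OF x] evaluation_const_pos
    by (simp add: variance_const_def window_def term_bound_def power2_eq_square)
  also have "\<dots> \<le> real (card I) * ?b" using I(2) b by (rule mult_right_mono)
  also have "\<dots> = (\<Sum>k\<in>I. ?b)" by simp
  also have "\<dots> \<le> (\<Sum>k\<in>I. (real k - mean_degree x)\<^sup>2 * (kernel_coeff k * x ^ k))"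
    using term_bound_pos[OF x] by (intro sum_mono mult_mono I) auto
  also have "\<dots> \<le> x * mean_degree' x * kernel_diag x" by (rule variance_ge_partial_sum[OF x I(1)])
  finally have "variance_const * (spread x)\<^sup>2 \<le> x * mean_degree' x"
    using kernel_diag_pos[OF x] by (rule mult_right_le_imp_le)
  then show ?thesis by (simp add: spread_squared[OF x])
qed

lemma mean_degree'_lower_bound:
  obtains c where "c > 0" "\<And>x. x \<ge> 0 \<Longrightarrow> c * \<Phi>' x \<le> mean_degree' x"
proof -
  obtain X where X: "\<And>x. x \<ge> X \<Longrightarrow> large x" using large_beyond by blast
  have "continuous_on {0..} (\<lambda>x. mean_degree' x / \<Phi>' x)"
    using Phi'_pos by (intro continuous_intros mean_degree'_continuous Phi'_continuous) (auto simp: less_le)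
  moreover have "mean_degree' x / \<Phi>' x > 0" if "x \<ge> 0" for x
    using mean_degree'_pos[OF that] Phi'_pos[OF that] by simp
  moreover have "variance_const \<le> mean_degree' x / \<Phi>' x" if "x \<ge> X" for x
  proof -
    have x: "x > 0" using X[OF that] by (simp add: large_def)
    have "x * (variance_const * \<Phi>' x) \<le> variance_const * ((1 + x) * \<Phi>' x)"
      using variance_const_pos Phi'_pos[of x] x by (simp add: algebra_simps)
    also have "\<dots> \<le> x * mean_degree' x" by (rule variance_ge_large[OF X[OF that]])
    finally show ?thesis using x Phi'_pos[of x] by (simp add: pos_le_divide_eq)
  qed
  ultimately have "\<exists>b>0. \<forall>x\<ge>0. b \<le> mean_degree' x / \<Phi>' x"
    using variance_const_pos by (rule continuous_halfline_lower_bound)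
  then obtain b where b: "b > 0" "\<And>x. x \<ge> 0 \<Longrightarrow> b \<le> mean_degree' x / \<Phi>' x" by blast
  have "b * \<Phi>' x \<le> mean_degree' x" if "x \<ge> 0" for x
    using b(2)[OF that] Phi'_pos[OF that] by (simp add: pos_le_divide_eq)
  then show ?thesis using that b(1) by blast
qed

lemma mean_degree'_upper_bound:
  obtains C where "C > 0" "\<And>x. x \<ge> 0 \<Longrightarrow> mean_degree' x \<le> C * \<Phi>' x"
proof -
  obtain C where C: "C > 0" "\<And>x. x \<ge> 0 \<Longrightarrow> x * mean_degree' x \<le> C * ((1 + x) * \<Phi>' x)"
    using variance_upper_bound by blast
  have "continuous_on {0..} (\<lambda>x. \<Phi>' x / mean_degree' x)"
    using mean_degree'_pos by (intro continuous_intros mean_degree'_continuous Phi'_continuous) (auto simp: less_le)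
  moreover have "\<Phi>' x / mean_degree' x > 0" if "x \<ge> 0" for x
    using mean_degree'_pos[OF that] Phi'_pos[OF that] by simp
  moreover have "1 / (2 * C) \<le> \<Phi>' x / mean_degree' x" if "x \<ge> 1" for x
  proof -
    have "x * mean_degree' x \<le> C * ((1 + x) * \<Phi>' x)" using that by (intro C(2)) simp
    also have "\<dots> \<le> C * ((2 * x) * \<Phi>' x)"
      using that C(1) Phi'_pos[of x] by (intro mult_left_mono mult_right_mono) auto
    finally have "mean_degree' x \<le> 2 * C * \<Phi>' x" using that by (simp add: mult_le_cancel_left)
    then show ?thesis using mean_degree'_pos[of x] that C(1) by (simp add: field_simps)
  qed
  moreover have "1 / (2 * C) > 0" using C(1) by simp
  ultimately have "\<exists>b>0. \<forall>x\<ge>0. b \<le> \<Phi>' x / mean_degree' x"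
    by (rule continuous_halfline_lower_bound)
  then obtain b where b: "b > 0" "\<And>x. x \<ge> 0 \<Longrightarrow> b \<le> \<Phi>' x / mean_degree' x" by blast
  have "mean_degree' x \<le> 1 / b * \<Phi>' x" if "x \<ge> 0" for x
    using b(2)[OF that] b(1) mean_degree'_pos[OF that] by (simp add: field_simps)
  then show ?thesis using that[of "1 / b"] b(1) by simp
qed

text \<open>Integrate the comparison between the derivatives of \<open>mean_degree\<close> and \<open>\<Phi>\<close>.\<close>
lemma log_diag'_ge:
  assumes lower: "\<And>x. x \<ge> 0 \<Longrightarrow> c * \<Phi>' x \<le> mean_degree' x" and x: "x \<ge> 0"
  shows "c * \<Psi>' x \<le> log_diag' x"
proof (cases "x = 0")
  case True
  then show ?thesis using lower[of 0] by (simp add: mean_degree'_def Phi'_eq)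
next
  case False
  have "mean_degree 0 - c * \<Phi> 0 \<le> mean_degree x - c * \<Phi> x"
  proof (rule nondecreasing_halfline[where f = "\<lambda>x. mean_degree x - c * \<Phi> x"])
    show "((\<lambda>x. mean_degree x - c * \<Phi> x) has_real_derivative mean_degree' t - c * \<Phi>' t) (at t within {0..})"
      if "t \<ge> 0" for t
      by (intro DERIV_diff DERIV_cmult Phi_deriv has_field_derivative_at_within[OF mean_degree_deriv] that)
  qed (use lower x in auto)
  then have "x * (c * \<Psi>' x) \<le> x * log_diag' x" by (simp add: mean_degree_def \<Phi>_def mult.left_commute)
  then show ?thesis using False x by (simp add: mult_le_cancel_left)
qed

lemma log_diag'_le:
  assumes upper: "\<And>x. x \<ge> 0 \<Longrightarrow> mean_degree' x \<le> C * \<Phi>' x" and x: "x \<ge> 0"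
  shows "log_diag' x \<le> C * \<Psi>' x"
proof (cases "x = 0")
  case True
  then show ?thesis using upper[of 0] by (simp add: mean_degree'_def Phi'_eq)
next
  case False
  have "C * \<Phi> 0 - mean_degree 0 \<le> C * \<Phi> x - mean_degree x"
  proof (rule nondecreasing_halfline[where f = "\<lambda>x. C * \<Phi> x - mean_degree x"])
    show "((\<lambda>x. C * \<Phi> x - mean_degree x) has_real_derivative C * \<Phi>' t - mean_degree' t) (at t within {0..})"
      if "t \<ge> 0" for t
      by (intro DERIV_diff DERIV_cmult Phi_deriv has_field_derivative_at_within[OF mean_degree_deriv] that)
  qed (use upper x in auto)
  then have "x * log_diag' x \<le> x * (C * \<Psi>' x)" by (simp add: mean_degree_def \<Phi>_def mult.left_commute)
  then show ?thesis using False x by (simp add: mult_le_cancel_left)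
qed

end

section \<open>The Bergman metric\<close>

lemma norm_squared_curve_derivative:
  fixes \<gamma> :: "real \<Rightarrow> complex ^ 'n"
  assumes "(\<gamma> has_vector_derivative v) (at t)"
  shows "((\<lambda>s. (norm (\<gamma> s))\<^sup>2) has_real_derivative (2 * Re (herm v (\<gamma> t)))) (at t)"
proof -
  have "((\<lambda>s. \<gamma> s \<bullet> \<gamma> s) has_derivative (\<lambda>h. \<gamma> t \<bullet> (h *\<^sub>R v) + (h *\<^sub>R v) \<bullet> \<gamma> t)) (at t)"
    using assms unfolding has_vector_derivative_def by (intro has_derivative_inner)
  then have "((\<lambda>s. (norm (\<gamma> s))\<^sup>2) has_derivative (\<lambda>h. (2 * Re (herm v (\<gamma> t))) * h)) (at t)"
    by (simp add: power2_norm_eq_inner Re_herm inner_commute algebra_simps)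
  then show ?thesis by (simp add: has_field_derivative_def)
qed

lemma radial_curve_derivative:
  fixes \<gamma> :: "real \<Rightarrow> complex ^ 'n"
  assumes "(\<gamma> has_vector_derivative v) (at t)" "(G has_real_derivative g) (at ((norm (\<gamma> t))\<^sup>2) within {0..})"
  shows "((\<lambda>s. G ((norm (\<gamma> s))\<^sup>2)) has_real_derivative (g * (2 * Re (herm v (\<gamma> t))))) (at t)"
proof -
  have "(G has_real_derivative g) (at ((norm (\<gamma> t))\<^sup>2) within (\<lambda>s. (norm (\<gamma> s))\<^sup>2) ` UNIV)"
    by (rule DERIV_subset[OF assms(2)]) auto
  from DERIV_image_chain[OF this norm_squared_curve_derivative[OF assms(1)]]
  show ?thesis by (simp add: o_def)
qed

lemma radial_line_derivative:
  fixes z v :: "complex ^ 'n"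
  assumes "(G has_real_derivative g) (at ((norm z)\<^sup>2))"
  shows "((\<lambda>t. complex_of_real (G ((norm (z + t *\<^sub>R v))\<^sup>2))) has_vector_derivative
    complex_of_real (g * (2 * Re (herm v z)))) (at 0)"
proof -
  have "((\<lambda>t. z + t *\<^sub>R v) has_vector_derivative v) (at 0)" by (auto intro!: derivative_eq_intros)
  moreover have "(G has_real_derivative g) (at ((norm (z + 0 *\<^sub>R v))\<^sup>2) within {0..})"
    using assms by (simp add: has_field_derivative_at_within)
  ultimately show ?thesis
    using has_vector_derivative_of_real[OF radial_curve_derivative] by fastforce
qed

lemma wirtinger_bar_radial:
  fixes z :: "complex ^ 'n"
  assumes "(G has_real_derivative g) (at ((norm z)\<^sup>2))"
  shows "wirtinger_bar k (\<lambda>w. complex_of_real (G ((norm w)\<^sup>2))) z = complex_of_real g * z $ k"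
proof -
  have "real_partial v (\<lambda>w. complex_of_real (G ((norm w)\<^sup>2))) z = complex_of_real (g * (2 * Re (herm v z)))" for v
    unfolding real_partial_def by (rule vector_derivative_at[OF radial_line_derivative[OF assms]])
  then show ?thesis
    unfolding wirtinger_bar_def by (simp add: herm_axis complex_eq_iff)
qed

lemma wirtinger_radial_mult_nth:
  fixes z :: "complex ^ 'n"
  assumes "(G has_real_derivative g) (at ((norm z)\<^sup>2))"
  shows "wirtinger j (\<lambda>w. complex_of_real (G ((norm w)\<^sup>2)) * w $ k) z
    = complex_of_real g * (cnj (z $ j) * z $ k) + (if j = k then complex_of_real (G ((norm z)\<^sup>2)) else 0)"
proof -
  have partial: "real_partial v (\<lambda>w. complex_of_real (G ((norm w)\<^sup>2)) * w $ k) z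
     = complex_of_real (G ((norm z)\<^sup>2)) * v $ k + complex_of_real (g * (2 * Re (herm v z))) * z $ k" for v
  proof -
    have "((\<lambda>t. (z + t *\<^sub>R v) $ k) has_vector_derivative v $ k) (at 0)"
      by (auto intro!: derivative_eq_intros simp: vector_add_component vector_scaleR_component)
    from has_vector_derivative_mult[OF radial_line_derivative[OF assms, of v] this]
    show ?thesis
      unfolding real_partial_def by (intro vector_derivative_at) simp
  qed
  show ?thesis
    unfolding wirtinger_def partial herm_axis by (auto simp: complex_eq_iff axis_def field_simps)
qed

lemma radial_hermitian_form:
  fixes z \<xi> :: "complex ^ 'n"
  shows "(\<Sum>j\<in>UNIV. \<Sum>k\<in>UNIV.
      (complex_of_real b * (cnj (z $ j) * z $ k) + (if j = k then complex_of_real a else 0)) * \<xi> $ j * cnj (\<xi> $ k))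
    = complex_of_real (a * (norm \<xi>)\<^sup>2 + b * (norm (herm \<xi> z))\<^sup>2)"
proof -
  have "(\<Sum>j\<in>UNIV. \<Sum>k\<in>UNIV.
      (complex_of_real b * (cnj (z $ j) * z $ k) + (if j = k then complex_of_real a else 0)) * \<xi> $ j * cnj (\<xi> $ k))
    = (\<Sum>j\<in>UNIV. \<Sum>k\<in>UNIV. complex_of_real b * ((\<xi> $ j * cnj (z $ j)) * (z $ k * cnj (\<xi> $ k))))
      + (\<Sum>j\<in>UNIV. \<Sum>k\<in>UNIV. if j = k then complex_of_real a * (\<xi> $ j * cnj (\<xi> $ k)) else 0)"
    unfolding sum.distrib[symmetric] by (intro sum.cong) (auto simp: algebra_simps)
  also have "(\<Sum>j\<in>UNIV. \<Sum>k\<in>UNIV. complex_of_real b * ((\<xi> $ j * cnj (z $ j)) * (z $ k * cnj (\<xi> $ k))))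
      = complex_of_real b * (herm \<xi> z * herm z \<xi>)"
    unfolding herm_def sum_product by (simp add: sum_distrib_left)
  also have "herm \<xi> z * herm z \<xi> = complex_of_real ((norm (herm \<xi> z))\<^sup>2)"
    unfolding complex_norm_square by (simp add: cnj_herm)
  also have "(\<Sum>j\<in>UNIV. \<Sum>k\<in>UNIV. if j = k then complex_of_real a * (\<xi> $ j * cnj (\<xi> $ k)) else 0)
      = complex_of_real a * herm \<xi> \<xi>"
    by (simp add: herm_def sum_distrib_left)
  finally show ?thesis by (simp add: herm_self)
qed

lemma radial_form_decomposition:
  fixes z \<xi> :: "complex ^ 'n"
  assumes "z \<noteq> 0" and radial: "c = a + (norm z)\<^sup>2 * b"
  shows "a * (norm \<xi>)\<^sup>2 + b * (norm (herm \<xi> z))\<^sup>2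
    = a * ((norm \<xi>)\<^sup>2 - (norm (herm \<xi> z))\<^sup>2 / (norm z)\<^sup>2) + c * ((norm (herm \<xi> z))\<^sup>2 / (norm z)\<^sup>2)"
  using assms(1) unfolding radial by (simp add: field_simps)

lemma herm_squared_le: "(norm (herm \<xi> z))\<^sup>2 / (norm z)\<^sup>2 \<le> (norm \<xi>)\<^sup>2" for z \<xi> :: "complex ^ 'n"
proof (cases "z = 0")
  case False
  have "(norm (herm \<xi> z))\<^sup>2 \<le> (norm \<xi> * norm z)\<^sup>2" by (intro power_mono norm_herm_le) auto
  then show ?thesis using False by (simp add: power_mult_distrib divide_le_eq)
qed auto

lemma radial_form_mono:
  fixes z \<xi> :: "complex ^ 'n"
  assumes tangential: "a\<^sub>1 \<le> a\<^sub>2" and radial: "a\<^sub>1 + (norm z)\<^sup>2 * b\<^sub>1 \<le> a\<^sub>2 + (norm z)\<^sup>2 * b\<^sub>2"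
  shows "a\<^sub>1 * (norm \<xi>)\<^sup>2 + b\<^sub>1 * (norm (herm \<xi> z))\<^sup>2 \<le> a\<^sub>2 * (norm \<xi>)\<^sup>2 + b\<^sub>2 * (norm (herm \<xi> z))\<^sup>2"
proof (cases "z = 0")
  case False
  show ?thesis
    unfolding radial_form_decomposition[OF False refl]
    using tangential radial herm_squared_le[of \<xi> z]
    by (intro add_mono[OF mult_right_mono mult_right_mono]) auto
qed (use tangential in \<open>simp add: mult_right_mono\<close>)

locale fock_metric = fock_growth \<Psi> \<Psi>' \<Psi>'' \<Phi>' \<Phi>'' growth_const dim
  for \<Psi> \<Psi>' \<Psi>'' \<Phi>' \<Phi>'' :: "real \<Rightarrow> real" and growth_const :: real and dim :: "'n::finite itself" +
  fixes metric_lower metric_upper diag_lower :: real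
  assumes metric_lower_pos: "metric_lower > 0" and metric_upper_pos: "metric_upper > 0"
    and diag_lower_pos: "diag_lower > 0"
    and mean_degree'_ge: "\<And>x. x \<ge> 0 \<Longrightarrow> metric_lower * \<Phi>' x \<le> mean_degree' x"
    and mean_degree'_le: "\<And>x. x \<ge> 0 \<Longrightarrow> mean_degree' x \<le> metric_upper * \<Phi>' x"
    and kernel_diag_ge: "\<And>x. x \<ge> 0 \<Longrightarrow> diag_lower * (kernel_density x * exp (\<Psi> x)) \<le> kernel_diag x"

lemma (in fock_growth) ex_fock_metric:
  "\<exists>metric_lower metric_upper diag_lower.
    fock_metric TYPE('n) \<Psi> \<Psi>' \<Psi>'' \<Phi>' \<Phi>'' growth_const metric_lower metric_upper diag_lower"
proof -
  obtain a where "a > 0" "\<And>x. x \<ge> 0 \<Longrightarrow> a * \<Phi>' x \<le> mean_degree' x"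
    using mean_degree'_lower_bound by blast
  moreover obtain b where "b > 0" "\<And>x. x \<ge> 0 \<Longrightarrow> mean_degree' x \<le> b * \<Phi>' x"
    using mean_degree'_upper_bound by blast
  moreover obtain c where "c > 0" "\<And>x. x \<ge> 0 \<Longrightarrow> c * (kernel_density x * exp (\<Psi> x)) \<le> kernel_diag x"
    using kernel_diag_lower_bound by blast
  ultimately have "fock_metric TYPE('n) \<Psi> \<Psi>' \<Psi>'' \<Phi>' \<Phi>'' growth_const a b c"
    by unfold_locales auto
  then show ?thesis by blast
qed

context fock_metric
begin

abbreviation bmetric :: "complex ^ 'n \<Rightarrow> complex ^ 'n \<Rightarrow> real" where "bmetric \<equiv> bergman_metric \<Psi>"
abbreviation bdist :: "complex ^ 'n \<Rightarrow> complex ^ 'n \<Rightarrow> ennreal" where "bdist \<equiv> bergman_dist \<Psi>"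
abbreviation bball :: "complex ^ 'n \<Rightarrow> real \<Rightarrow> (complex ^ 'n) set" where "bball \<equiv> bergman_ball \<Psi>"

lemma bergman_metric_eq:
  "bmetric z \<xi> = sqrt (log_diag' ((norm z)\<^sup>2) * (norm \<xi>)\<^sup>2 + log_diag'' ((norm z)\<^sup>2) * (norm (herm \<xi> z))\<^sup>2)"
proof -
  have "(\<lambda>w :: complex ^ 'n. complex_of_real (ln (Re (fock_kernel \<Psi> w w))))
      = (\<lambda>w. complex_of_real (ln (kernel_diag ((norm w)\<^sup>2))))"
    by (simp add: fock_kernel_eq kernel_at_same)
  moreover have "wirtinger_bar k (\<lambda>w. complex_of_real (ln (kernel_diag ((norm w)\<^sup>2))))
      = (\<lambda>w :: complex ^ 'n. complex_of_real (log_diag' ((norm w)\<^sup>2)) * w $ k)" for k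
    by (rule ext, rule wirtinger_bar_radial[OF log_diag_deriv]) simp
  ultimately have "wirtinger j (wirtinger_bar k (\<lambda>w. complex_of_real (ln (Re (fock_kernel \<Psi> w w))))) z
      = complex_of_real (log_diag'' ((norm z)\<^sup>2)) * (cnj (z $ j) * z $ k)
        + (if j = k then complex_of_real (log_diag' ((norm z)\<^sup>2)) else 0)" for j k
    using wirtinger_radial_mult_nth[OF log_diag'_deriv, of z j k] by simp
  then show ?thesis
    unfolding bergman_metric_def by (simp add: radial_hermitian_form)
qed

definition model_metric :: "complex ^ 'n \<Rightarrow> complex ^ 'n \<Rightarrow> real"
  where "model_metric z \<xi> = sqrt (\<Psi>' ((norm z)\<^sup>2) * (norm \<xi>)\<^sup>2 + \<Psi>'' ((norm z)\<^sup>2) * (norm (herm \<xi> z))\<^sup>2)"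

lemma model_metric_squared:
  "(model_metric z \<xi>)\<^sup>2 = \<Psi>' ((norm z)\<^sup>2) * (norm \<xi>)\<^sup>2 + \<Psi>'' ((norm z)\<^sup>2) * (norm (herm \<xi> z))\<^sup>2"
  unfolding model_metric_def using Psi'_pos[of "(norm z)\<^sup>2"] Psi''_nonneg[of "(norm z)\<^sup>2"]
  by (simp add: less_imp_le)

lemma model_metric_nonneg: "model_metric z \<xi> \<ge> 0"
  unfolding model_metric_def using Psi'_pos[of "(norm z)\<^sup>2"] Psi''_nonneg[of "(norm z)\<^sup>2"]
  by (simp add: less_imp_le)

lemma model_metric_le_bergman_metric: "model_metric z \<xi> \<le> bmetric z \<xi> / sqrt metric_lower"
proof -
  let ?x = "(norm z)\<^sup>2"
  have "metric_lower * \<Psi>' ?x \<le> log_diag' ?x" by (rule log_diag'_ge[OF mean_degree'_ge]) simp_all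
  moreover have "metric_lower * \<Phi>' ?x \<le> mean_degree' ?x" by (rule mean_degree'_ge) simp
  ultimately have "metric_lower * \<Psi>' ?x * (norm \<xi>)\<^sup>2 + metric_lower * \<Psi>'' ?x * (norm (herm \<xi> z))\<^sup>2
      \<le> log_diag' ?x * (norm \<xi>)\<^sup>2 + log_diag'' ?x * (norm (herm \<xi> z))\<^sup>2"
    by (intro radial_form_mono) (simp_all add: Phi'_eq mean_degree'_def algebra_simps)
  then have "sqrt (metric_lower * (model_metric z \<xi>)\<^sup>2) \<le> bmetric z \<xi>"
    unfolding bergman_metric_eq model_metric_squared by (intro real_sqrt_le_mono) (simp add: algebra_simps)
  then show ?thesis
    using metric_lower_pos model_metric_nonneg[of z \<xi>] by (simp add: real_sqrt_mult field_simps)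
qed

lemma bergman_metric_le_model_metric: "bmetric z \<xi> \<le> sqrt metric_upper * model_metric z \<xi>"
proof -
  let ?x = "(norm z)\<^sup>2"
  have "log_diag' ?x \<le> metric_upper * \<Psi>' ?x" by (rule log_diag'_le[OF mean_degree'_le]) simp_all
  moreover have "mean_degree' ?x \<le> metric_upper * \<Phi>' ?x" by (rule mean_degree'_le) simp
  ultimately have "log_diag' ?x * (norm \<xi>)\<^sup>2 + log_diag'' ?x * (norm (herm \<xi> z))\<^sup>2
      \<le> metric_upper * \<Psi>' ?x * (norm \<xi>)\<^sup>2 + metric_upper * \<Psi>'' ?x * (norm (herm \<xi> z))\<^sup>2"
    by (intro radial_form_mono) (simp_all add: Phi'_eq mean_degree'_def algebra_simps)
  then have "bmetric z \<xi> \<le> sqrt (metric_upper * (model_metric z \<xi>)\<^sup>2)"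
    unfolding bergman_metric_eq model_metric_squared by (intro real_sqrt_le_mono) (simp add: algebra_simps)
  then show ?thesis using model_metric_nonneg[of z \<xi>] by (simp add: real_sqrt_mult)
qed

lemma bergman_metric_nonneg: "bmetric z \<xi> \<ge> 0"
proof -
  have "0 \<le> bmetric z \<xi> / sqrt metric_lower"
    by (rule order_trans[OF model_metric_nonneg model_metric_le_bergman_metric])
  then show ?thesis using metric_lower_pos by (simp add: zero_le_divide_iff)
qed

lemma bergman_metric_scaleR: "bmetric z (r *\<^sub>R \<xi>) = \<bar>r\<bar> * bmetric z \<xi>"
proof -
  have "log_diag' ((norm z)\<^sup>2) * (norm (r *\<^sub>R \<xi>))\<^sup>2 + log_diag'' ((norm z)\<^sup>2) * (norm (herm (r *\<^sub>R \<xi>) z))\<^sup>2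
    = r\<^sup>2 * (log_diag' ((norm z)\<^sup>2) * (norm \<xi>)\<^sup>2 + log_diag'' ((norm z)\<^sup>2) * (norm (herm \<xi> z))\<^sup>2)"
    by (simp add: herm_scaleR_left norm_mult power_mult_distrib algebra_simps)
  then show ?thesis unfolding bergman_metric_eq by (simp add: real_sqrt_mult)
qed

lemma bergman_metric_continuous:
  assumes "continuous_on S f" "continuous_on S g"
  shows "continuous_on S (\<lambda>t. bmetric (f t) (g t))"
proof -
  have "continuous_on S (\<lambda>t. (norm (f t))\<^sup>2)" by (intro continuous_intros assms)
  then have "continuous_on S (\<lambda>t. log_diag' ((norm (f t))\<^sup>2))" "continuous_on S (\<lambda>t. log_diag'' ((norm (f t))\<^sup>2))"
    by (auto intro: continuous_on_compose2[OF log_diag'_continuous] continuous_on_compose2[OF log_diag''_continuous])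
  then show ?thesis unfolding bergman_metric_eq by (intro continuous_intros assms)
qed

lemma norm_le_model_metric: "norm \<xi> \<le> model_metric z \<xi> / sqrt (\<Psi>' ((norm z)\<^sup>2))"
proof -
  have "\<Psi>' ((norm z)\<^sup>2) * (norm \<xi>)\<^sup>2 \<le> (model_metric z \<xi>)\<^sup>2"
    unfolding model_metric_squared using Psi''_nonneg[of "(norm z)\<^sup>2"] by simp
  then have "sqrt (\<Psi>' ((norm z)\<^sup>2) * (norm \<xi>)\<^sup>2) \<le> model_metric z \<xi>"
    using model_metric_nonneg by (simp add: real_le_lsqrt)
  then show ?thesis using Psi'_pos[of "(norm z)\<^sup>2"] by (simp add: real_sqrt_mult field_simps)
qed

lemma herm_le_model_metric: "norm (herm \<xi> z) \<le> scale ((norm z)\<^sup>2) * model_metric z \<xi>"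
proof -
  let ?x = "(norm z)\<^sup>2" and ?h = "(norm (herm \<xi> z))\<^sup>2"
  have "?h \<le> ?x * (norm \<xi>)\<^sup>2"
    using power_mono[OF norm_herm_le[of \<xi> z], of 2] by (simp add: power_mult_distrib mult.commute)
  then have "\<Phi>' ?x * ?h \<le> \<Psi>' ?x * (?x * (norm \<xi>)\<^sup>2) + ?x * (\<Psi>'' ?x * ?h)"
    using Psi'_pos[of ?x] by (simp add: Phi'_eq distrib_right mult.assoc)
  also have "\<dots> = ?x * (model_metric z \<xi>)\<^sup>2" by (simp add: model_metric_squared algebra_simps)
  also have "\<dots> \<le> (1 + ?x) * (model_metric z \<xi>)\<^sup>2" by (intro mult_right_mono) auto
  finally have "?h \<le> (1 + ?x) / \<Phi>' ?x * (model_metric z \<xi>)\<^sup>2"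
    using Phi'_pos[of ?x] by (simp add: field_simps)
  also have "\<dots> = (scale ?x * model_metric z \<xi>)\<^sup>2" by (simp add: scale_squared power_mult_distrib)
  finally show ?thesis
    by (rule power2_le_imp_le) (use scale_pos[of ?x] model_metric_nonneg in \<open>simp add: less_imp_le\<close>)
qed

end

section \<open>Lengths of curves\<close>

lemma norm_increment_le_nn_integral:
  fixes f f' :: "real \<Rightarrow> 'a::euclidean_space" and \<phi> :: "real \<Rightarrow> real"
  assumes "finite S" "0 \<le> T" and cont: "continuous_on {0..T} f"
    and deriv: "\<And>t. t \<in> {0<..<T} - S \<Longrightarrow> (f has_vector_derivative f' t) (at t)"
    and [measurable]: "\<phi> \<in> borel_measurable borel" and \<phi>_nonneg: "\<And>t. \<phi> t \<ge> 0"
    and speed: "\<And>t. t \<in> {0<..<T} - S \<Longrightarrow> norm (f' t) \<le> K * \<phi> t" and "K \<ge> 0"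
    and length: "(\<integral>\<^sup>+t. ennreal (\<phi> t) \<partial>lborel) \<le> ennreal A" and "A \<ge> 0"
  shows "norm (f T - f 0) \<le> K * A"
proof -
  obtain r where r: "(\<integral>\<^sup>+t. ennreal (\<phi> t) \<partial>lborel) = ennreal r" "r \<ge> 0"
    using length le_less_trans[of _ "ennreal A" \<infinity>] by (cases "\<integral>\<^sup>+t. ennreal (\<phi> t) \<partial>lborel") auto
  then have "r \<le> A" using length \<open>A \<ge> 0\<close> by simp
  have line: "(\<phi> has_integral r) UNIV"
    by (rule nn_integral_has_integral) (use r \<phi>_nonneg in auto)
  then have integrable: "\<phi> integrable_on {0..T}"
    using \<phi>_nonneg by (meson has_integral_integrable integrable_on_subinterval subset_UNIV)
  have "integral {0..T} \<phi> \<le> r"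
    using integral_subset_le[of "{0..T}" UNIV \<phi>] integrable line \<phi>_nonneg
    by (auto simp: integral_unique has_integral_integrable)
  then have "integral {0..T} \<phi> \<le> A" using \<open>r \<le> A\<close> by simp
  define g where "g t = (if t \<in> {0<..<T} - S then f' t else 0)" for t
  have "(g has_integral (f T - f 0)) {0..T}"
    by (rule fundamental_theorem_of_calculus_interior_strong[OF \<open>finite S\<close> \<open>0 \<le> T\<close>])
      (use deriv cont in \<open>auto simp: g_def\<close>)
  then have "norm (f T - f 0) = norm (integral {0..T} g)" "g integrable_on {0..T}"
    by (auto simp: integral_unique)
  moreover have "norm (integral {0..T} g) \<le> integral {0..T} (\<lambda>t. K * \<phi> t)"
  proof (rule integral_norm_bound_integral)
    show "g integrable_on {0..T}" by fact
    show "(\<lambda>t. K * \<phi> t) integrable_on {0..T}" using integrable by (rule integrable_on_mult_right)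
    show "norm (g t) \<le> K * \<phi> t" if "t \<in> {0..T}" for t
      using speed \<open>K \<ge> 0\<close> \<phi>_nonneg by (auto simp: g_def)
  qed
  moreover have "K * integral {0..T} \<phi> \<le> K * A"
    using \<open>integral {0..T} \<phi> \<le> A\<close> \<open>K \<ge> 0\<close> by (rule mult_left_mono)
  ultimately show ?thesis by simp
qed

lemma piecewise_C1_differentiable_exceptions:
  fixes \<gamma> :: "real \<Rightarrow> 'a::real_normed_vector"
  assumes "\<gamma> piecewise_C1_differentiable_on {0..1}"
  obtains S where "finite S" "{0, 1} \<subseteq> S" "\<forall>t\<in>{0..1} - S. \<gamma> differentiable (at t)"
    "continuous_on ({0..1} - S) (\<lambda>t. vector_derivative \<gamma> (at t))"
proof -
  obtain S where S: "finite S" "\<gamma> C1_differentiable_on ({0..1} - S)"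
    using assms by (auto simp: piecewise_C1_differentiable_on_def)
  then have "\<gamma> differentiable (at t)" if "t \<in> {0..1} - S \<union> {0, 1}" "t \<notin> {0, 1}" for t
    using that by (auto simp: C1_differentiable_on_eq)
  moreover have "continuous_on ({0..1} - (S \<union> {0, 1})) (\<lambda>t. vector_derivative \<gamma> (at t))"
    using S(2) unfolding C1_differentiable_on_eq by (auto intro: continuous_on_subset)
  ultimately show ?thesis using that[of "S \<union> {0, 1}"] S(1) by auto
qed

lemma AE_differentiable_affine:
  fixes \<gamma> :: "real \<Rightarrow> 'a::real_normed_vector"
  assumes "\<gamma> piecewise_C1_differentiable_on {0..1}" and "c \<noteq> 0"
  shows "AE t in lborel. b + c * t \<in> {0..1} \<longrightarrow> \<gamma> differentiable (at (b + c * t))"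
proof -
  obtain S where S: "finite S" "\<forall>t\<in>{0..1} - S. \<gamma> differentiable (at t)"
    using assms(1) by (rule piecewise_C1_differentiable_exceptions) blast
  have "inj (\<lambda>t. b + c * t)" using \<open>c \<noteq> 0\<close> by (auto intro: injI)
  then have "finite ((\<lambda>t. b + c * t) -` S)" by (intro finite_vimageI S)
  then have "AE t in lborel. t \<notin> (\<lambda>t. b + c * t) -` S"
    by (intro AE_not_in finite_imp_null_set_lborel)
  then show ?thesis by eventually_elim (use S(2) in auto)
qed

context fock_metric
begin

definition speed :: "(real \<Rightarrow> complex ^ 'n) \<Rightarrow> real \<Rightarrow> real"
  where "speed \<gamma> t = (if t \<in> {0..1} then bmetric (\<gamma> t) (vector_derivative \<gamma> (at t)) else 0)"

definition bergman_length :: "(real \<Rightarrow> complex ^ 'n) \<Rightarrow> ennreal"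
  where "bergman_length \<gamma> = (\<integral>\<^sup>+t. ennreal (speed \<gamma> t) \<partial>lborel)"

lemma bergman_dist_eq:
  "bdist z w = (INF \<gamma>\<in>{\<gamma>. \<gamma> piecewise_C1_differentiable_on {0..1} \<and> \<gamma> 0 = z \<and> \<gamma> 1 = w}. bergman_length \<gamma>)"
  unfolding bergman_dist_def bergman_length_def speed_def
  by (intro INF_cong refl nn_integral_cong) (simp add: indicator_def)

lemma speed_nonneg: "speed \<gamma> t \<ge> 0"
  by (simp add: speed_def bergman_metric_nonneg)

lemma speed_measurable:
  assumes "\<gamma> piecewise_C1_differentiable_on {0..1}"
  shows "speed \<gamma> \<in> borel_measurable borel"
proof -
  obtain S where S: "finite S" "{0, 1} \<subseteq> S" "continuous_on ({0..1} - S) (\<lambda>t. vector_derivative \<gamma> (at t))"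
    using assms by (rule piecewise_C1_differentiable_exceptions) blast
  let ?U = "{0..1} - S"
  have U: "?U = {0<..<1} - S" using S(2) by (auto simp: less_le)
  have "continuous_on ?U \<gamma>"
    using assms unfolding piecewise_C1_differentiable_on_def by (auto intro: continuous_on_subset)
  then have "continuous_on ?U (\<lambda>t. bmetric (\<gamma> t) (vector_derivative \<gamma> (at t)))"
    using S(3) by (rule bergman_metric_continuous)
  moreover have "open ?U" unfolding U using S(1) by (intro open_Diff finite_imp_closed) auto
  ultimately have "(\<lambda>t. if t \<in> ?U then bmetric (\<gamma> t) (vector_derivative \<gamma> (at t)) else 0) \<in> borel_measurable borel"
    by (intro borel_measurable_continuous_on_if) auto
  then show ?thesis
    by (rule measurable_discrete_difference[where X = S]) (use S(1) in \<open>auto simp: speed_def countable_finite\<close>)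
qed

definition short_curve :: "(real \<Rightarrow> complex ^ 'n) \<Rightarrow> real \<Rightarrow> bool"
  where "short_curve \<gamma> A \<longleftrightarrow> \<gamma> piecewise_C1_differentiable_on {0..1} \<and> bergman_length \<gamma> \<le> ennreal A \<and> A \<ge> 0"

lemma short_curve_continuous: "short_curve \<gamma> A \<Longrightarrow> continuous_on {0..1} \<gamma>"
  by (simp add: short_curve_def piecewise_C1_differentiable_on_def)

lemma short_curve_nonneg: "short_curve \<gamma> A \<Longrightarrow> A \<ge> 0"
  by (simp add: short_curve_def)

lemma bergman_dist_less_iff:
  "bdist z w < ennreal A \<longleftrightarrow>
    (\<exists>\<gamma>. \<gamma> piecewise_C1_differentiable_on {0..1} \<and> \<gamma> 0 = z \<and> \<gamma> 1 = w \<and> bergman_length \<gamma> < ennreal A)"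
  unfolding bergman_dist_eq by (auto simp: INF_less_iff)

lemma bergman_ball_short_curve:
  assumes "w \<in> bball z A"
  obtains \<gamma> where "\<gamma> 0 = z" "\<gamma> 1 = w" "short_curve \<gamma> A"
proof -
  have "bdist z w < ennreal A" using assms by (simp add: bergman_ball_def)
  moreover from this have "A > 0" by (metis ennreal_less_zero_iff le_less_trans zero_le)
  ultimately show ?thesis
    using that unfolding bergman_dist_less_iff short_curve_def by (auto simp: less_imp_le)
qed

lemma norm_increment_le_length:
  fixes f :: "real \<Rightarrow> 'a::euclidean_space"
  assumes \<gamma>: "short_curve \<gamma> A" and T: "0 \<le> T" "T \<le> 1" and cont: "continuous_on {0..1} f"
    and deriv: "\<And>t v. t \<in> {0<..<1} \<Longrightarrow> (\<gamma> has_vector_derivative v) (at t) \<Longrightarrow> (f has_vector_derivative f' t v) (at t)"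
    and bound: "\<And>t v. t \<in> {0<..<1} \<Longrightarrow> norm (f' t v) \<le> K * bmetric (\<gamma> t) v" and "K \<ge> 0"
  shows "norm (f T - f 0) \<le> K * A"
proof -
  have C1: "\<gamma> piecewise_C1_differentiable_on {0..1}" and length: "bergman_length \<gamma> \<le> ennreal A" and "A \<ge> 0"
    using \<gamma> by (auto simp: short_curve_def)
  obtain S where S: "finite S" "\<forall>t\<in>{0..1} - S. \<gamma> differentiable (at t)"
    using C1 by (rule piecewise_C1_differentiable_exceptions) blast
  show ?thesis
  proof (rule norm_increment_le_nn_integral[OF S(1) T(1)])
    show "continuous_on {0..T} f" by (rule continuous_on_subset[OF cont]) (use T in auto)
    show "speed \<gamma> \<in> borel_measurable borel" by (rule speed_measurable[OF C1])
    show "(\<integral>\<^sup>+t. ennreal (speed \<gamma> t) \<partial>lborel) \<le> ennreal A" using length by (simp add: bergman_length_def)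
    fix t assume t: "t \<in> {0<..<T} - S"
    then have "(\<gamma> has_vector_derivative vector_derivative \<gamma> (at t)) (at t)"
      using S(2) T by (simp add: vector_derivative_works)
    then show "(f has_vector_derivative f' t (vector_derivative \<gamma> (at t))) (at t)"
      using deriv t T by auto
    show "norm (f' t (vector_derivative \<gamma> (at t))) \<le> K * speed \<gamma> t"
      using bound[of t] t T by (simp add: speed_def)
  qed (use speed_nonneg \<open>K \<ge> 0\<close> \<open>A \<ge> 0\<close> in auto)
qed

section \<open>The weight along curves\<close>

definition log_derivative_const :: real
  where "log_derivative_const = growth_const + Psi''_const * scale_const + 1 / sqrt (\<Psi>' 0)"

definition log_lipschitz :: real
  where "log_lipschitz = 2 * log_derivative_const / sqrt metric_lower"

definition distortion :: "real \<Rightarrow> real" where "distortion A = exp (log_lipschitz * A)"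

definition comparable :: "real \<Rightarrow> real \<Rightarrow> real \<Rightarrow> bool"
  where "comparable A a b \<longleftrightarrow> a \<le> distortion A * b \<and> b \<le> distortion A * a"

lemma log_derivative_const_ge:
  "growth_const \<le> log_derivative_const" "Psi''_const * scale_const \<le> log_derivative_const"
  "1 / sqrt (\<Psi>' 0) \<le> log_derivative_const"
proof -
  have "growth_const > 0" "Psi''_const * scale_const > 0" "1 / sqrt (\<Psi>' 0) > 0"
    using growth_const_pos Psi''_const_pos scale_const_pos Psi'_0_pos by auto
  then show "growth_const \<le> log_derivative_const" "Psi''_const * scale_const \<le> log_derivative_const"
    "1 / sqrt (\<Psi>' 0) \<le> log_derivative_const"
    unfolding log_derivative_const_def by linarith+
qed

lemma log_lipschitz_pos: "log_lipschitz > 0"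
  unfolding log_lipschitz_def using log_derivative_const_ge(1) growth_const_pos metric_lower_pos by simp

lemma distortion_ge_1: "A \<ge> 0 \<Longrightarrow> distortion A \<ge> 1"
  using log_lipschitz_pos by (simp add: distortion_def)

lemma distortion_mono: "A \<le> B \<Longrightarrow> distortion A \<le> distortion B"
  using log_lipschitz_pos by (simp add: distortion_def)

lemma radial_derivative_le:
  assumes k: "k \<ge> 0" "k * scale ((norm z)\<^sup>2) \<le> log_derivative_const"
  shows "\<bar>k * (2 * Re (herm v z))\<bar> \<le> log_lipschitz * bmetric z v"
proof -
  have "\<bar>k * (2 * Re (herm v z))\<bar> = k * (2 * \<bar>Re (herm v z)\<bar>)" using k(1) by (simp add: abs_mult)
  also have "\<dots> \<le> k * (2 * (scale ((norm z)\<^sup>2) * model_metric z v))"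
    using k(1) abs_Re_le_cmod[of "herm v z"] herm_le_model_metric[of v z] by (intro mult_left_mono) auto
  also have "\<dots> = 2 * (k * scale ((norm z)\<^sup>2)) * model_metric z v" by simp
  also have "\<dots> \<le> 2 * log_derivative_const * (bmetric z v / sqrt metric_lower)"
    using k log_derivative_const_ge(1) growth_const_pos scale_pos[of "(norm z)\<^sup>2"]
    by (intro mult_mono model_metric_le_bergman_metric model_metric_nonneg) auto
  finally show ?thesis by (simp add: log_lipschitz_def)
qed

lemma Phi''_div_Phi'_scale_le:
  assumes x: "x \<ge> 0" shows "\<Phi>'' x / \<Phi>' x * scale x \<le> log_derivative_const"
proof -
  have "\<Phi>'' x / \<Phi>' x * scale x = sqrt (1 + x) * \<Phi>'' x / (\<Phi>' x * sqrt (\<Phi>' x))" by (simp add: scale_eq)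
  also have "\<dots> \<le> growth_const" using Phi''_le[OF x] Phi'_pos[OF x] by (simp add: divide_le_eq)
  finally show ?thesis using log_derivative_const_ge(1) by simp
qed

lemma Psi''_div_Psi'_scale_le:
  assumes x: "x \<ge> 0" shows "\<Psi>'' x / \<Psi>' x * scale x \<le> log_derivative_const"
proof -
  have "\<Psi>'' x / \<Psi>' x * scale x = \<Psi>'' x * scale x * (1 / \<Psi>' x)" by simp
  also have "\<dots> \<le> \<Psi>'' x * scale x * (scale_const * scale x)"
    using inverse_Psi'_le_scale[OF x] Psi''_nonneg[OF x] scale_pos[OF x] by (intro mult_left_mono) auto
  also have "\<dots> = \<Psi>'' x * (scale x)\<^sup>2 * scale_const" by (simp add: power2_eq_square)
  also have "\<dots> \<le> Psi''_const * scale_const"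
    using Psi''_le_scale[OF x] scale_pos[OF x] scale_const_pos by (intro mult_right_mono) (simp_all add: field_simps)
  finally show ?thesis using log_derivative_const_ge(2) by simp
qed

lemma inverse_one_plus_scale_le:
  assumes x: "x \<ge> 0" shows "1 / (1 + x) * scale x \<le> log_derivative_const"
proof -
  have "1 / (1 + x) * scale x = 1 / spread x" unfolding one_plus_div_spread[OF x, symmetric] using x by simp
  also have "\<dots> \<le> 1 / sqrt (\<Psi>' 0)"
    using spread_ge[OF x] Psi'_0_pos spread_pos[OF x] by (intro divide_left_mono) auto
  finally show ?thesis using log_derivative_const_ge(3) by simp
qed

lemma comparableI:
  assumes "a > 0" "b > 0" "\<bar>ln a - ln b\<bar> \<le> log_lipschitz * A" shows "comparable A a b"
proof -
  have "exp (ln a) \<le> exp (log_lipschitz * A + ln b)" "exp (ln b) \<le> exp (log_lipschitz * A + ln a)"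
    using assms(3) by auto
  then show ?thesis using assms(1,2) by (simp add: exp_add comparable_def distortion_def)
qed

lemma comparable_along_curve:
  assumes \<gamma>: "short_curve \<gamma> A" and T: "0 \<le> T" "T \<le> 1"
    and pos: "\<And>s. s \<ge> 0 \<Longrightarrow> G s > 0"
    and deriv: "\<And>s. s \<ge> 0 \<Longrightarrow> (G has_real_derivative G' s) (at s within {0..})"
    and nonneg: "\<And>s. s \<ge> 0 \<Longrightarrow> G' s \<ge> 0"
    and bound: "\<And>s. s \<ge> 0 \<Longrightarrow> G' s / G s * scale s \<le> log_derivative_const"
  shows "comparable A (G ((norm (\<gamma> T))\<^sup>2)) (G ((norm (\<gamma> 0))\<^sup>2))"
proof (rule comparableI)
  let ?f = "\<lambda>t. ln (G ((norm (\<gamma> t))\<^sup>2))"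
  have ln_deriv: "((\<lambda>s. ln (G s)) has_real_derivative G' s / G s) (at s within {0..})" if "s \<ge> 0" for s
    using pos[OF that] deriv[OF that] by (auto intro!: derivative_eq_intros)
  then have ln_continuous: "continuous_on {0..} (\<lambda>s. ln (G s))"
    by (intro DERIV_continuous_on) auto
  have "norm (?f T - ?f 0) \<le> log_lipschitz * A"
  proof (rule norm_increment_le_length[OF \<gamma> T])
    show "continuous_on {0..1} ?f"
      by (intro continuous_on_compose2[OF ln_continuous] continuous_intros short_curve_continuous[OF \<gamma>]) auto
    fix t v assume "(\<gamma> has_vector_derivative v) (at t)"
    then show "(?f has_vector_derivative G' ((norm (\<gamma> t))\<^sup>2) / G ((norm (\<gamma> t))\<^sup>2) * (2 * Re (herm v (\<gamma> t)))) (at t)"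
      unfolding has_real_derivative_iff_has_vector_derivative[symmetric]
      by (rule radial_curve_derivative[OF _ ln_deriv]) simp
  next
    fix t v
    show "norm (G' ((norm (\<gamma> t))\<^sup>2) / G ((norm (\<gamma> t))\<^sup>2) * (2 * Re (herm v (\<gamma> t)))) \<le> log_lipschitz * bmetric (\<gamma> t) v"
      unfolding real_norm_def
      using bound[of "(norm (\<gamma> t))\<^sup>2"] nonneg[of "(norm (\<gamma> t))\<^sup>2"] pos[of "(norm (\<gamma> t))\<^sup>2"]
      by (intro radial_derivative_le) auto
  qed (use log_lipschitz_pos in simp)
  then show "\<bar>ln (G ((norm (\<gamma> T))\<^sup>2)) - ln (G ((norm (\<gamma> 0))\<^sup>2))\<bar> \<le> log_lipschitz * A" by simp
qed (use pos in auto)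

lemma
  assumes "short_curve \<gamma> A" "0 \<le> T" "T \<le> 1"
  shows Phi'_along_curve: "comparable A (\<Phi>' ((norm (\<gamma> T))\<^sup>2)) (\<Phi>' ((norm (\<gamma> 0))\<^sup>2))"
    and Psi'_along_curve: "comparable A (\<Psi>' ((norm (\<gamma> T))\<^sup>2)) (\<Psi>' ((norm (\<gamma> 0))\<^sup>2))"
    and one_plus_along_curve: "comparable A (1 + (norm (\<gamma> T))\<^sup>2) (1 + (norm (\<gamma> 0))\<^sup>2)"
proof -
  show "comparable A (\<Phi>' ((norm (\<gamma> T))\<^sup>2)) (\<Phi>' ((norm (\<gamma> 0))\<^sup>2))"
    by (rule comparable_along_curve[OF assms Phi'_pos Phi'_deriv Phi''_nonneg Phi''_div_Phi'_scale_le])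
  show "comparable A (\<Psi>' ((norm (\<gamma> T))\<^sup>2)) (\<Psi>' ((norm (\<gamma> 0))\<^sup>2))"
    by (rule comparable_along_curve[OF assms Psi'_pos Psi'_deriv Psi''_nonneg Psi''_div_Psi'_scale_le])
  show "comparable A (1 + (norm (\<gamma> T))\<^sup>2) (1 + (norm (\<gamma> 0))\<^sup>2)"
    by (rule comparable_along_curve[OF assms, where G = "\<lambda>s. 1 + s" and G' = "\<lambda>_. 1"])
      (use inverse_one_plus_scale_le in \<open>auto intro!: derivative_eq_intros\<close>)
qed

lemma inverse_sqrt_Psi'_along_curve:
  assumes \<gamma>: "short_curve \<gamma> A" and "0 \<le> t" "t \<le> 1"
  shows "1 / sqrt (\<Psi>' ((norm (\<gamma> t))\<^sup>2)) \<le> distortion A / sqrt (\<Psi>' ((norm (\<gamma> 0))\<^sup>2))"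
proof -
  let ?x = "(norm (\<gamma> 0))\<^sup>2" and ?y = "(norm (\<gamma> t))\<^sup>2"
  have D: "distortion A \<ge> 1" by (rule distortion_ge_1[OF short_curve_nonneg[OF \<gamma>]])
  have pos: "\<Psi>' ?x > 0" "\<Psi>' ?y > 0" by (auto simp: Psi'_pos)
  have "\<Psi>' ?x \<le> distortion A * \<Psi>' ?y" using Psi'_along_curve[OF assms] by (simp add: comparable_def)
  also have "\<dots> \<le> (distortion A)\<^sup>2 * \<Psi>' ?y" using D pos by (simp add: power2_eq_square)
  finally have "sqrt (\<Psi>' ?x) \<le> distortion A * sqrt (\<Psi>' ?y)"
    using D real_sqrt_le_mono[of "\<Psi>' ?x"] by (fastforce simp: real_sqrt_mult)
  then show ?thesis using pos by (simp add: field_simps)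
qed

lemma scale_along_curve:
  assumes \<gamma>: "short_curve \<gamma> A" and "0 \<le> t" "t \<le> 1"
  shows "scale ((norm (\<gamma> t))\<^sup>2) \<le> distortion A * scale ((norm (\<gamma> 0))\<^sup>2)"
proof -
  let ?x = "(norm (\<gamma> 0))\<^sup>2" and ?y = "(norm (\<gamma> t))\<^sup>2"
  have D: "distortion A \<ge> 1" by (rule distortion_ge_1[OF short_curve_nonneg[OF \<gamma>]])
  have "(1 + ?y) / \<Phi>' ?y \<le> (distortion A * (1 + ?x)) / (\<Phi>' ?x / distortion A)"
    using Phi'_along_curve[OF assms] one_plus_along_curve[OF assms] D Phi'_pos[of ?x] Phi'_pos[of ?y]
    by (intro frac_le) (auto simp: comparable_def field_simps)
  also have "\<dots> = (distortion A)\<^sup>2 * ((1 + ?x) / \<Phi>' ?x)" by (simp add: power2_eq_square)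
  finally have "scale ?y \<le> sqrt ((distortion A)\<^sup>2 * ((1 + ?x) / \<Phi>' ?x))"
    unfolding scale_def by (rule real_sqrt_le_mono)
  also have "\<dots> = distortion A * scale ?x"
    unfolding real_sqrt_mult scale_def real_sqrt_abs using D by simp
  finally show ?thesis .
qed

definition chord_const :: "real \<Rightarrow> complex ^ 'n \<Rightarrow> real"
  where "chord_const A z = distortion A / sqrt (\<Psi>' ((norm z)\<^sup>2)) / sqrt metric_lower"

lemma chord_const_nonneg: "chord_const A z \<ge> 0"
  using Psi'_pos[of "(norm z)\<^sup>2"] metric_lower_pos by (simp add: chord_const_def distortion_def)

lemma norm_le_along_curve:
  assumes "short_curve \<gamma> A" "0 \<le> t" "t \<le> 1"
  shows "norm v \<le> chord_const A (\<gamma> 0) * bmetric (\<gamma> t) v"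
proof -
  have "norm v \<le> model_metric (\<gamma> t) v * (1 / sqrt (\<Psi>' ((norm (\<gamma> t))\<^sup>2)))"
    using norm_le_model_metric[of v "\<gamma> t"] by simp
  also have "\<dots> \<le> (bmetric (\<gamma> t) v / sqrt metric_lower) * (distortion A / sqrt (\<Psi>' ((norm (\<gamma> 0))\<^sup>2)))"
    using Psi'_pos[of "(norm (\<gamma> t))\<^sup>2"] metric_lower_pos bergman_metric_nonneg
    by (intro mult_mono model_metric_le_bergman_metric inverse_sqrt_Psi'_along_curve assms)
      (auto simp: less_imp_le)
  finally show ?thesis by (simp add: chord_const_def mult.commute)
qed

lemma chord_le:
  assumes \<gamma>: "short_curve \<gamma> A" and T: "0 \<le> T" "T \<le> 1"
  shows "norm (\<gamma> T - \<gamma> 0) \<le> chord_const A (\<gamma> 0) * A"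
  by (rule norm_increment_le_length[OF \<gamma> T short_curve_continuous[OF \<gamma>], where f' = "\<lambda>t v. v"])
    (auto intro: norm_le_along_curve[OF \<gamma>] chord_const_nonneg)

definition radial_chord_const :: "real \<Rightarrow> real"
  where "radial_chord_const A = distortion A + (distortion A)\<^sup>2 * A * scale_const / sqrt metric_lower"

lemma radial_chord_const_ge: "A \<ge> 0 \<Longrightarrow> distortion A \<le> radial_chord_const A"
  unfolding radial_chord_const_def using scale_const_pos metric_lower_pos by simp

lemma radial_chord_const_pos: "A \<ge> 0 \<Longrightarrow> radial_chord_const A > 0"
  using radial_chord_const_ge[of A] distortion_ge_1[of A] by simp

lemma chord_const_squared_le:
  assumes "A \<ge> 0"
  shows "(chord_const A z)\<^sup>2 * A
    \<le> (distortion A)\<^sup>2 * A * scale_const / sqrt metric_lower * (scale ((norm z)\<^sup>2) / sqrt metric_lower)"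
proof -
  let ?x = "(norm z)\<^sup>2"
  have "(chord_const A z)\<^sup>2 * A = (distortion A)\<^sup>2 * A / metric_lower * (1 / \<Psi>' ?x)"
    using Psi'_pos[of ?x] metric_lower_pos by (simp add: chord_const_def power_divide power_mult_distrib)
  also have "\<dots> \<le> (distortion A)\<^sup>2 * A / metric_lower * (scale_const * scale ?x)"
    using assms metric_lower_pos by (intro mult_left_mono inverse_Psi'_le_scale) auto
  also have "\<dots> = (distortion A)\<^sup>2 * A * scale_const / sqrt metric_lower * (scale ?x / sqrt metric_lower)"
    using metric_lower_pos by simp
  finally show ?thesis .
qed

lemma herm_le_along_curve:
  assumes \<gamma>: "short_curve \<gamma> A" and t: "0 \<le> t" "t \<le> 1"
  shows "norm (herm v (\<gamma> 0)) \<le> radial_chord_const A * (scale ((norm (\<gamma> 0))\<^sup>2) / sqrt metric_lower) * bmetric (\<gamma> t) v"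
proof -
  let ?s = "scale ((norm (\<gamma> 0))\<^sup>2)" and ?b = "bmetric (\<gamma> t) v" and ?k = "chord_const A (\<gamma> 0)"
  have A: "A \<ge> 0" by (rule short_curve_nonneg[OF \<gamma>])
  have "norm (herm v (\<gamma> t)) \<le> scale ((norm (\<gamma> t))\<^sup>2) * model_metric (\<gamma> t) v" by (rule herm_le_model_metric)
  also have "\<dots> \<le> (distortion A * ?s) * (?b / sqrt metric_lower)"
    using distortion_ge_1[OF A] scale_pos[of "(norm (\<gamma> 0))\<^sup>2"]
    by (intro mult_mono scale_along_curve[OF \<gamma> t] model_metric_le_bergman_metric model_metric_nonneg) auto
  finally have at_t: "norm (herm v (\<gamma> t)) \<le> distortion A * (?s / sqrt metric_lower) * ?b" by simp
  have "norm (herm v (\<gamma> t - \<gamma> 0)) \<le> norm v * norm (\<gamma> t - \<gamma> 0)" by (rule norm_herm_le)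
  also have "\<dots> \<le> (?k * ?b) * (?k * A)"
    by (intro mult_mono norm_le_along_curve chord_le \<gamma> t mult_nonneg_nonneg chord_const_nonneg
        bergman_metric_nonneg) simp
  also have "\<dots> = ?k\<^sup>2 * A * ?b" by (simp add: power2_eq_square)
  also have "\<dots> \<le> (distortion A)\<^sup>2 * A * scale_const / sqrt metric_lower * (?s / sqrt metric_lower) * ?b"
    by (intro mult_right_mono chord_const_squared_le A bergman_metric_nonneg)
  finally have difference: "norm (herm v (\<gamma> t - \<gamma> 0)) \<le> \<dots>" .
  have "herm v (\<gamma> 0) = herm v (\<gamma> t) - herm v (\<gamma> t - \<gamma> 0)" by (simp add: herm_diff_right)
  then have "norm (herm v (\<gamma> 0)) \<le> norm (herm v (\<gamma> t)) + norm (herm v (\<gamma> t - \<gamma> 0))"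
    by (simp add: norm_triangle_ineq4)
  then show ?thesis
    using add_mono[OF at_t difference] unfolding radial_chord_const_def distrib_right by linarith
qed

definition displacement_bound :: "real \<Rightarrow> real"
  where "displacement_bound A = A / sqrt metric_lower * radial_chord_const A"

lemma displacement_bound_pos: "A > 0 \<Longrightarrow> displacement_bound A > 0"
  unfolding displacement_bound_def using metric_lower_pos radial_chord_const_pos[of A] by simp

lemma curve_displacement:
  assumes \<gamma>: "short_curve \<gamma> A"
  shows "norm (\<gamma> 1 - \<gamma> 0) \<le> displacement_bound A / sqrt (\<Psi>' ((norm (\<gamma> 0))\<^sup>2))"
    and "norm (herm (\<gamma> 1 - \<gamma> 0) (\<gamma> 0)) \<le> displacement_bound A * scale ((norm (\<gamma> 0))\<^sup>2)"
proof -
  let ?x = "(norm (\<gamma> 0))\<^sup>2"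
  have A: "A \<ge> 0" by (rule short_curve_nonneg[OF \<gamma>])
  have "norm (\<gamma> 1 - \<gamma> 0) \<le> chord_const A (\<gamma> 0) * A" by (rule chord_le[OF \<gamma>]) auto
  also have "\<dots> = A / sqrt metric_lower * distortion A / sqrt (\<Psi>' ?x)" by (simp add: chord_const_def mult_ac)
  also have "\<dots> \<le> displacement_bound A / sqrt (\<Psi>' ?x)"
    unfolding displacement_bound_def using A metric_lower_pos Psi'_pos[of ?x]
    by (intro divide_right_mono mult_left_mono radial_chord_const_ge) auto
  finally show "norm (\<gamma> 1 - \<gamma> 0) \<le> displacement_bound A / sqrt (\<Psi>' ?x)" .
  let ?K = "radial_chord_const A * (scale ?x / sqrt metric_lower)"
  have "norm (herm (\<gamma> 1 - \<gamma> 0) (\<gamma> 0) - herm (\<gamma> 0 - \<gamma> 0) (\<gamma> 0)) \<le> ?K * A"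
  proof (rule norm_increment_le_length[OF \<gamma>, where f' = "\<lambda>t v. herm v (\<gamma> 0)"])
    show "continuous_on {0..1} (\<lambda>t. herm (\<gamma> t - \<gamma> 0) (\<gamma> 0))"
      by (intro continuous_intros short_curve_continuous[OF \<gamma>])
    fix t v assume "(\<gamma> has_vector_derivative v) (at t)"
    then have "((\<lambda>t. \<gamma> t - \<gamma> 0) has_vector_derivative v) (at t)" by (auto intro!: derivative_eq_intros)
    then show "((\<lambda>t. herm (\<gamma> t - \<gamma> 0) (\<gamma> 0)) has_vector_derivative herm v (\<gamma> 0)) (at t)"
      by (rule bounded_linear.has_vector_derivative[OF bounded_linear_herm])
  next
    show "?K \<ge> 0" using radial_chord_const_pos[OF A] scale_pos[of ?x] metric_lower_pos by simp
    show "norm (herm v (\<gamma> 0)) \<le> ?K * bmetric (\<gamma> t) v" if "t \<in> {0<..<1}" for t v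
      by (rule herm_le_along_curve[OF \<gamma>]) (use that in auto)
  qed simp_all
  then show "norm (herm (\<gamma> 1 - \<gamma> 0) (\<gamma> 0)) \<le> displacement_bound A * scale ?x"
    by (simp add: displacement_bound_def mult_ac)
qed

end

section \<open>Metric properties of Bergman balls\<close>

lemma ennreal_add_less_add:
  assumes "a < ennreal r" "b < ennreal s" shows "a + b < ennreal (r + s)"
proof -
  obtain x where x: "a = ennreal x" "x \<ge> 0" using assms(1) by (cases a) auto
  obtain y where y: "b = ennreal y" "y \<ge> 0" using assms(2) by (cases b) auto
  have "x < r" "y < s" using assms x y by (auto simp: ennreal_less_iff)
  then show ?thesis using x y by (simp add: ennreal_less_iff flip: ennreal_plus)
qed

lemma has_vector_derivative_affine_reparametrization:
  fixes \<gamma> \<delta> :: "real \<Rightarrow> 'a::real_normed_vector"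
  assumes "\<gamma> differentiable (at (b + c * t))"
    and agree: "open U" "t \<in> U" "\<And>s. s \<in> U \<Longrightarrow> \<delta> s = \<gamma> (b + c * s)"
  shows "(\<delta> has_vector_derivative c *\<^sub>R vector_derivative \<gamma> (at (b + c * t))) (at t)"
proof (rule has_vector_derivative_transform_within_open[OF _ agree(1,2)])
  have "((\<lambda>s. b + c * s) has_vector_derivative c) (at t)" by (auto intro!: derivative_eq_intros)
  moreover have "(\<gamma> has_vector_derivative vector_derivative \<gamma> (at (b + c * t))) (at (b + c * t))"
    using assms(1) by (simp add: vector_derivative_works)
  ultimately show "((\<lambda>s. \<gamma> (b + c * s)) has_vector_derivative c *\<^sub>R vector_derivative \<gamma> (at (b + c * t))) (at t)"
    using vector_diff_chain_at[of "\<lambda>s. b + c * s"] by (simp add: o_def)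
qed (use agree(3) in simp)

context fock_metric
begin

lemma speed_affine_reparametrization:
  assumes "\<gamma> differentiable (at (b + c * t))" "b + c * t \<in> {0..1}" "t \<in> {0..1}"
    and "open U" "t \<in> U" "\<And>s. s \<in> U \<Longrightarrow> \<delta> s = \<gamma> (b + c * s)"
  shows "speed \<delta> t = \<bar>c\<bar> * speed \<gamma> (b + c * t)"
proof -
  have "vector_derivative \<delta> (at t) = c *\<^sub>R vector_derivative \<gamma> (at (b + c * t))"
    by (intro vector_derivative_at has_vector_derivative_affine_reparametrization[where U = U] assms)
  then show ?thesis using assms by (simp add: speed_def bergman_metric_scaleR)
qed

lemma nn_integral_speed_affine:
  assumes "\<gamma> piecewise_C1_differentiable_on {0..1}" "c \<noteq> 0"
  shows "(\<integral>\<^sup>+t. ennreal (\<bar>c\<bar> * speed \<gamma> (b + c * t)) \<partial>lborel) = bergman_length \<gamma>"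
proof -
  note [measurable] = speed_measurable[OF assms(1)]
  have "bergman_length \<gamma> = ennreal \<bar>c\<bar> * (\<integral>\<^sup>+t. ennreal (speed \<gamma> (b + c * t)) \<partial>lborel)"
    unfolding bergman_length_def using \<open>c \<noteq> 0\<close> by (intro nn_integral_real_affine) auto
  also have "\<dots> = (\<integral>\<^sup>+t. ennreal \<bar>c\<bar> * ennreal (speed \<gamma> (b + c * t)) \<partial>lborel)"
    by (rule nn_integral_cmult[symmetric]) measurable
  finally show ?thesis by (simp add: speed_nonneg ennreal_mult)
qed

lemma bergman_length_reversepath_le:
  assumes \<gamma>: "\<gamma> piecewise_C1_differentiable_on {0..1}"
  shows "bergman_length (reversepath \<gamma>) \<le> bergman_length \<gamma>"
proof -
  have "AE t in lborel. 1 + (-1) * t \<in> {0..1} \<longrightarrow> \<gamma> differentiable (at (1 + (-1) * t))"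
    by (rule AE_differentiable_affine[OF \<gamma>]) simp
  then have "AE t in lborel. speed (reversepath \<gamma>) t \<le> \<bar>-1\<bar> * speed \<gamma> (1 + (-1) * t)"
  proof eventually_elim
    case (elim t)
    show ?case
    proof (cases "t \<in> {0..1}")
      case True
      then have "speed (reversepath \<gamma>) t = \<bar>-1\<bar> * speed \<gamma> (1 + (-1) * t)"
        by (intro speed_affine_reparametrization[where U = UNIV]) (use elim in \<open>auto simp: reversepath_def\<close>)
      then show ?thesis by simp
    qed (auto simp: speed_def)
  qed
  then have "bergman_length (reversepath \<gamma>) \<le> (\<integral>\<^sup>+t. ennreal (\<bar>-1\<bar> * speed \<gamma> (1 + (-1) * t)) \<partial>lborel)"
    unfolding bergman_length_def by (intro nn_integral_mono_AE) (auto elim: eventually_mono intro: ennreal_leI)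
  also have "\<dots> = bergman_length \<gamma>" by (rule nn_integral_speed_affine[OF \<gamma>]) simp
  finally show ?thesis .
qed

lemma AE_speed_joinpaths_le:
  assumes \<gamma>: "\<gamma> piecewise_C1_differentiable_on {0..1}" and \<delta>: "\<delta> piecewise_C1_differentiable_on {0..1}"
  shows "AE t in lborel. speed (\<gamma> +++ \<delta>) t \<le> \<bar>2\<bar> * speed \<gamma> (0 + 2 * t) + \<bar>2\<bar> * speed \<delta> (- 1 + 2 * t)"
proof -
  have "AE t in lborel. 0 + 2 * t \<in> {0..1} \<longrightarrow> \<gamma> differentiable (at (0 + 2 * t))"
    and "AE t in lborel. - 1 + 2 * t \<in> {0..1} \<longrightarrow> \<delta> differentiable (at (- 1 + 2 * t))"
    by (rule AE_differentiable_affine[OF \<gamma>] AE_differentiable_affine[OF \<delta>]; simp)+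
  moreover have "AE t in lborel. t \<noteq> (1 / 2 :: real)" by (rule AE_lborel_singleton)
  ultimately show ?thesis
  proof eventually_elim
    case (elim t)
    consider "t \<notin> {0..1}" | "t \<in> {0..1}" "t < 1 / 2" | "t \<in> {0..1}" "t > 1 / 2" using elim(3) by force
    then show ?case
    proof cases
      case 1
      then have "speed (\<gamma> +++ \<delta>) t = 0" by (auto simp: speed_def)
      then show ?thesis by (simp add: speed_nonneg)
    next
      case 2
      then have "speed (\<gamma> +++ \<delta>) t = \<bar>2\<bar> * speed \<gamma> (0 + 2 * t)"
        by (intro speed_affine_reparametrization[where U = "{..<1 / 2}"]) (use elim in \<open>auto simp: joinpaths_def\<close>)
      then show ?thesis using speed_nonneg[of \<delta> "- 1 + 2 * t"] by simp
    next
      case 3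
      then have "speed (\<gamma> +++ \<delta>) t = \<bar>2\<bar> * speed \<delta> (- 1 + 2 * t)"
        by (intro speed_affine_reparametrization[where U = "{1 / 2<..}"])
          (use elim in \<open>auto simp: joinpaths_def algebra_simps\<close>)
      then show ?thesis using speed_nonneg[of \<gamma> "0 + 2 * t"] by simp
    qed
  qed
qed

lemma bergman_length_joinpaths_le:
  assumes \<gamma>: "\<gamma> piecewise_C1_differentiable_on {0..1}" and \<delta>: "\<delta> piecewise_C1_differentiable_on {0..1}"
  shows "bergman_length (\<gamma> +++ \<delta>) \<le> bergman_length \<gamma> + bergman_length \<delta>"
proof -
  note [measurable] = speed_measurable[OF \<gamma>] speed_measurable[OF \<delta>]
  have "bergman_length (\<gamma> +++ \<delta>)
      \<le> (\<integral>\<^sup>+t. ennreal (\<bar>2\<bar> * speed \<gamma> (0 + 2 * t)) + ennreal (\<bar>2\<bar> * speed \<delta> (- 1 + 2 * t)) \<partial>lborel)"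
    unfolding bergman_length_def
  proof (rule nn_integral_mono_AE)
    show "AE t in lborel. ennreal (speed (\<gamma> +++ \<delta>) t)
        \<le> ennreal (\<bar>2\<bar> * speed \<gamma> (0 + 2 * t)) + ennreal (\<bar>2\<bar> * speed \<delta> (- 1 + 2 * t))"
      using AE_speed_joinpaths_le[OF assms]
      by eventually_elim (simp add: speed_nonneg ennreal_leI flip: ennreal_plus)
  qed
  also have "\<dots> = (\<integral>\<^sup>+t. ennreal (\<bar>2\<bar> * speed \<gamma> (0 + 2 * t)) \<partial>lborel)
      + (\<integral>\<^sup>+t. ennreal (\<bar>2\<bar> * speed \<delta> (- 1 + 2 * t)) \<partial>lborel)"
    by (rule nn_integral_add) measurable
  also have "\<dots> = bergman_length \<gamma> + bergman_length \<delta>"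
    using nn_integral_speed_affine[OF \<gamma>, of 2 0] nn_integral_speed_affine[OF \<delta>, of 2 "- 1"] by simp
  finally show ?thesis .
qed

lemma mem_bergman_ball_iff_curve:
  "w \<in> bball z a \<longleftrightarrow>
    (\<exists>\<gamma>. \<gamma> piecewise_C1_differentiable_on {0..1} \<and> \<gamma> 0 = z \<and> \<gamma> 1 = w \<and> bergman_length \<gamma> < ennreal a)"
  unfolding bergman_ball_def by (simp add: bergman_dist_less_iff)

lemma bergman_ball_sym:
  assumes "w \<in> bball z a" shows "z \<in> bball w a"
proof -
  obtain \<gamma> where \<gamma>: "\<gamma> piecewise_C1_differentiable_on {0..1}" "\<gamma> 0 = z" "\<gamma> 1 = w" "bergman_length \<gamma> < ennreal a"
    using assms unfolding mem_bergman_ball_iff_curve by blast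
  have "reversepath \<gamma> piecewise_C1_differentiable_on {0..1}"
    using valid_path_imp_reverse[of \<gamma>] \<gamma>(1) by (simp add: valid_path_def)
  moreover have "reversepath \<gamma> 0 = w" "reversepath \<gamma> 1 = z" using \<gamma> by (auto simp: reversepath_def)
  moreover have "bergman_length (reversepath \<gamma>) < ennreal a"
    using bergman_length_reversepath_le[OF \<gamma>(1)] \<gamma>(4) by (rule le_less_trans)
  ultimately show ?thesis unfolding mem_bergman_ball_iff_curve by blast
qed

lemma bergman_ball_triangle:
  assumes "w \<in> bball z a" "v \<in> bball w b" shows "v \<in> bball z (a + b)"
proof -
  obtain \<gamma> where \<gamma>: "\<gamma> piecewise_C1_differentiable_on {0..1}" "\<gamma> 0 = z" "\<gamma> 1 = w" "bergman_length \<gamma> < ennreal a"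
    using assms(1) unfolding mem_bergman_ball_iff_curve by blast
  obtain \<delta> where \<delta>: "\<delta> piecewise_C1_differentiable_on {0..1}" "\<delta> 0 = w" "\<delta> 1 = v" "bergman_length \<delta> < ennreal b"
    using assms(2) unfolding mem_bergman_ball_iff_curve by blast
  have "(\<gamma> +++ \<delta>) piecewise_C1_differentiable_on {0..1}"
    using valid_path_join[of \<gamma> \<delta>] \<gamma> \<delta> by (simp add: valid_path_def pathfinish_def pathstart_def)
  moreover have "(\<gamma> +++ \<delta>) 0 = z" "(\<gamma> +++ \<delta>) 1 = v" using \<gamma> \<delta> by (auto simp: joinpaths_def)
  moreover have "bergman_length (\<gamma> +++ \<delta>) < ennreal (a + b)"
    by (rule le_less_trans[OF bergman_length_joinpaths_le[OF \<gamma>(1) \<delta>(1)] ennreal_add_less_add[OF \<gamma>(4) \<delta>(4)]])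
  ultimately show ?thesis unfolding mem_bergman_ball_iff_curve by blast
qed

lemma bergman_ball_mono: "a \<le> b \<Longrightarrow> bball z a \<subseteq> bball z b"
  by (auto simp: bergman_ball_def intro: order.strict_trans2 ennreal_leI)

lemma bergman_dist_le_segment:
  assumes bound: "\<And>t. 0 \<le> t \<Longrightarrow> t \<le> 1 \<Longrightarrow> bmetric (z + t *\<^sub>R d) d \<le> B"
  shows "bdist z (z + d) \<le> ennreal B"
proof -
  define \<gamma> where "\<gamma> t = z + t *\<^sub>R d" for t :: real
  have deriv: "(\<gamma> has_vector_derivative d) (at t)" for t
    unfolding \<gamma>_def by (auto intro!: derivative_eq_intros)
  then have "\<gamma> C1_differentiable_on {0..1}"
    unfolding C1_differentiable_on_def by (intro exI[of _ "\<lambda>_. d"]) auto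
  then have "bdist z (z + d) \<le> bergman_length \<gamma>"
    unfolding bergman_dist_eq by (intro INF_lower) (simp add: C1_differentiable_imp_piecewise \<gamma>_def)
  also have "\<dots> \<le> (\<integral>\<^sup>+t. ennreal B * indicator {0..1::real} t \<partial>lborel)"
    unfolding bergman_length_def using bound vector_derivative_at[OF deriv]
    by (intro nn_integral_mono) (auto simp: speed_def \<gamma>_def intro!: ennreal_leI)
  also have "\<dots> = ennreal B" by (subst nn_integral_cmult_indicator) auto
  finally show ?thesis .
qed

lemma bergman_dist_finite: "bdist z w < \<infinity>"
proof -
  have "continuous_on {0..1::real} (\<lambda>t. bmetric (z + t *\<^sub>R (w - z)) (w - z))"
    by (intro bergman_metric_continuous continuous_intros)
  then have "bounded ((\<lambda>t. bmetric (z + t *\<^sub>R (w - z)) (w - z)) ` {0..1})"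
    by (intro compact_imp_bounded compact_continuous_image) auto
  then obtain B where "\<forall>t\<in>{0..1}. norm (bmetric (z + t *\<^sub>R (w - z)) (w - z)) \<le> B"
    unfolding bounded_iff by blast
  then have "bmetric (z + t *\<^sub>R (w - z)) (w - z) \<le> B" if "0 \<le> t" "t \<le> 1" for t
    using that by (fastforce simp: abs_le_iff)
  then have "bdist z (z + (w - z)) \<le> ennreal B" by (rule bergman_dist_le_segment)
  then show ?thesis using le_less_trans[of "bdist z w" "ennreal B" \<infinity>] by simp
qed

lemma center_mem_bergman_ball: assumes "a > 0" shows "z \<in> bball z a"
proof -
  have "bmetric z 0 = 0" using bergman_metric_scaleR[of z 0 0] by simp
  then have "bdist z (z + 0) \<le> ennreal 0" by (intro bergman_dist_le_segment) simp
  then show ?thesis using assms by (simp add: bergman_ball_def)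
qed

lemma bergman_ball_shrink:
  assumes "w \<in> bball z a" obtains d where "d > 0" "w \<in> bball z (a - d)"
proof -
  obtain r where r: "bdist z w = ennreal r" "r \<ge> 0"
    using bergman_dist_finite[of z w] by (cases "bdist z w") auto
  then have "r < a" using assms by (simp add: bergman_ball_def ennreal_less_iff)
  then show ?thesis
    using that[of "(a - r) / 2"] r by (simp add: bergman_ball_def ennreal_less_iff field_simps)
qed

section \<open>Bergman balls and ellipsoids\<close>

definition outer_radius :: "real \<Rightarrow> real"
  where "outer_radius A = inclusion_const * displacement_bound A"

lemma outer_radius_pos: "A > 0 \<Longrightarrow> outer_radius A > 0"
  by (simp add: outer_radius_def inclusion_const_pos displacement_bound_pos)

lemma bergman_ball_subset_ellipsoid:
  assumes "A > 0" shows "bball z A \<subseteq> ellipsoid z (outer_radius A)"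
proof
  fix w assume "w \<in> bball z A"
  then obtain \<gamma> where "\<gamma> 0 = z" "\<gamma> 1 = w" "short_curve \<gamma> A" by (rule bergman_ball_short_curve)
  then show "w \<in> ellipsoid z (outer_radius A)"
    unfolding outer_radius_def using curve_displacement[of \<gamma> A] displacement_bound_pos[OF assms]
    by (intro mem_ellipsoid_of_displacement) auto
qed

lemma norm_herm_ellipsoid_segment_le:
  assumes u: "norm u \<le> 1" and t: "0 \<le> t" "t \<le> 1"
  shows "norm (herm (ellipsoid_map z u) (z + t *\<^sub>R ellipsoid_map z u)) \<le> (1 + scale_const) * scale ((norm z)\<^sup>2) * norm u"
proof -
  let ?x = "(norm z)\<^sup>2" and ?d = "ellipsoid_map z u"
  have x: "?x \<ge> 0" by simp
  have "norm (herm ?d (t *\<^sub>R ?d)) = t * (norm ?d)\<^sup>2"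
    using t by (simp add: herm_scaleR_right herm_self norm_mult norm_power)
  also have "\<dots> \<le> 1 * ((norm u)\<^sup>2 / \<Psi>' ?x)" using t by (intro mult_mono norm_ellipsoid_map_squared_le) auto
  also have "\<dots> = (norm u * norm u) * (1 / \<Psi>' ?x)" by (simp add: power2_eq_square)
  also have "\<dots> \<le> (norm u * 1) * (scale_const * scale ?x)"
    using u Psi'_pos[OF x] by (intro mult_mono mult_left_mono inverse_Psi'_le_scale x) (auto simp: less_imp_le)
  finally have "norm (herm ?d (t *\<^sub>R ?d)) \<le> norm u * (scale_const * scale ?x)" by simp
  moreover have "norm (herm ?d z) \<le> scale ?x * norm u" by (rule norm_herm_ellipsoid_map_le)
  moreover have "norm (herm ?d (z + t *\<^sub>R ?d)) \<le> norm (herm ?d z) + norm (herm ?d (t *\<^sub>R ?d))"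
    unfolding herm_add_right by (rule norm_triangle_ineq)
  ultimately show ?thesis by (simp add: algebra_simps)
qed

definition segment_const :: real
  where "segment_const = sqrt metric_upper * sqrt (2 + 8 * Psi''_const * (1 + scale_const)\<^sup>2)"

lemma segment_const_pos: "segment_const > 0"
  unfolding segment_const_def using metric_upper_pos Psi''_const_pos by (simp add: add_pos_nonneg)

lemma model_metric_ellipsoid_segment_squared_le:
  assumes u: "norm u \<le> local_radius" and t: "0 \<le> t" "t \<le> 1"
  shows "(model_metric (z + t *\<^sub>R ellipsoid_map z u) (ellipsoid_map z u))\<^sup>2
    \<le> (2 + 8 * Psi''_const * (1 + scale_const)\<^sup>2) * (norm u)\<^sup>2"
proof -
  let ?x = "(norm z)\<^sup>2" and ?d = "ellipsoid_map z u" and ?y = "(norm (z + t *\<^sub>R ellipsoid_map z u))\<^sup>2"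
  have "t *\<^sub>R ?d = ellipsoid_map z (t *\<^sub>R u)"
    by (simp add: linear_cmul[OF complex_linear_imp_linear[OF complex_linear_ellipsoid_map]])
  moreover have "norm (t *\<^sub>R u) \<le> local_radius"
    using u t local_radius_bounds(1) mult_mono[of t 1 "norm u" local_radius] by simp
  ultimately have near: "near ?x ?y" using near_ellipsoid_map by metis
  have x: "?x \<ge> 0" and y: "?y \<ge> 0" by auto
  have "\<Psi>' ?y * (norm ?d)\<^sup>2 \<le> (2 * \<Psi>' ?x) * ((norm u)\<^sup>2 / \<Psi>' ?x)"
    using near_Psi'_le(1)[OF near] Psi'_pos[OF x] by (intro mult_mono norm_ellipsoid_map_squared_le) auto
  also have "\<dots> = 2 * (norm u)\<^sup>2" using Psi'_pos[OF x] by simp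
  finally have euclidean: "\<Psi>' ?y * (norm ?d)\<^sup>2 \<le> 2 * (norm u)\<^sup>2" .
  have "\<Psi>'' ?y * (norm (herm ?d (z + t *\<^sub>R ?d)))\<^sup>2
      \<le> (8 * Psi''_const / (scale ?x)\<^sup>2) * ((1 + scale_const) * scale ?x * norm u)\<^sup>2"
    using near_Psi''_le[OF near] Psi''_nonneg[OF y] Psi''_const_pos u t local_radius_bounds(2)
    by (intro mult_mono power_mono norm_herm_ellipsoid_segment_le) auto
  also have "\<dots> = 8 * Psi''_const * (1 + scale_const)\<^sup>2 * (norm u)\<^sup>2"
    using scale_pos[OF x] by (simp add: power_mult_distrib)
  finally show ?thesis unfolding model_metric_squared using euclidean by (simp add: algebra_simps)
qed

lemma bergman_dist_ellipsoid_map_le: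
  assumes u: "norm u \<le> local_radius"
  shows "bdist z (z + ellipsoid_map z u) \<le> ennreal (segment_const * norm u)"
proof (rule bergman_dist_le_segment)
  fix t :: real assume t: "0 \<le> t" "t \<le> 1"
  let ?m = "model_metric (z + t *\<^sub>R ellipsoid_map z u) (ellipsoid_map z u)"
  have "?m \<le> sqrt ((2 + 8 * Psi''_const * (1 + scale_const)\<^sup>2) * (norm u)\<^sup>2)"
    by (rule real_le_rsqrt[OF model_metric_ellipsoid_segment_squared_le[OF u t]])
  then have "sqrt metric_upper * ?m \<le> segment_const * norm u"
    unfolding segment_const_def using metric_upper_pos by (simp add: real_sqrt_mult mult.assoc mult_left_mono)
  then show "bmetric (z + t *\<^sub>R ellipsoid_map z u) (ellipsoid_map z u) \<le> segment_const * norm u"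
    using bergman_metric_le_model_metric order_trans by blast
qed

definition inner_radius :: "real \<Rightarrow> real"
  where "inner_radius A = min local_radius (A / segment_const)"

lemma inner_radius_pos: "A > 0 \<Longrightarrow> inner_radius A > 0"
  using local_radius_bounds(1) segment_const_pos by (simp add: inner_radius_def)

lemma inner_radius_le: "inner_radius A \<le> local_radius"
  by (simp add: inner_radius_def)

lemma ellipsoid_subset_bergman_ball:
  assumes "A > 0" shows "ellipsoid z (inner_radius A) \<subseteq> bball z A"
proof
  fix w assume "w \<in> ellipsoid z (inner_radius A)"
  then obtain u where u: "w = z + ellipsoid_map z u" "norm u < inner_radius A"
    by (auto simp: ellipsoid_def)
  then have "segment_const * norm u < A"
    using segment_const_pos by (simp add: inner_radius_def pos_less_divide_eq mult.commute)
  moreover have "bdist z w \<le> ennreal (segment_const * norm u)"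
    unfolding u(1) by (rule bergman_dist_ellipsoid_map_le) (use u(2) in \<open>simp add: inner_radius_def\<close>)
  ultimately show "w \<in> bball z A"
    using assms by (auto simp: bergman_ball_def intro: le_less_trans ennreal_lessI)
qed

lemma open_bergman_ball: "open (bball z a)"
proof (rule openI)
  fix w assume "w \<in> bball z a"
  then obtain d where d: "d > 0" "w \<in> bball z (a - d)" by (rule bergman_ball_shrink)
  have "ellipsoid w (inner_radius d) \<subseteq> bball w d" by (rule ellipsoid_subset_bergman_ball[OF d(1)])
  also have "\<dots> \<subseteq> bball z a" using bergman_ball_triangle[OF d(2), of _ d] by auto
  finally have "ellipsoid w (inner_radius d) \<subseteq> bball z a" .
  moreover have "w \<in> ellipsoid w (inner_radius d)"
    using mem_ellipsoid_iff[of w 0] inner_radius_pos[OF d(1)] by simp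
  ultimately show "\<exists>e>0. ball w e \<subseteq> bball z a"
    using open_ellipsoid[of w "inner_radius d"] by (meson openE order_trans)
qed

lemma bergman_ball_sets [measurable]: "bball z a \<in> sets borel"
  by (simp add: open_bergman_ball)

section \<open>Volumes and packing\<close>

lemma ellipsoid_volume_le_of_mem_bergman_ball:
  assumes "w \<in> bball z A"
  shows "ellipsoid_volume w \<le> distortion A ^ CARD('n) * ellipsoid_volume z"
proof -
  obtain \<gamma> where \<gamma>: "\<gamma> 0 = z" "\<gamma> 1 = w" "short_curve \<gamma> A" using assms by (rule bergman_ball_short_curve)
  have power: "distortion A * distortion A ^ (CARD('n) - 1) = distortion A ^ CARD('n)"
    by (metis One_nat_def Suc_pred power_Suc zero_less_card_finite)
  have "kernel_density ((norm z)\<^sup>2) \<le> distortion A * distortion A ^ (CARD('n) - 1) * kernel_density ((norm w)\<^sup>2)"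
    using Phi'_along_curve[OF \<gamma>(3), of 1] Psi'_along_curve[OF \<gamma>(3), of 1] \<gamma>(1,2)
    by (intro kernel_density_le) (auto simp: comparable_def)
  then show ?thesis
    unfolding power using kernel_density_pos[of "(norm z)\<^sup>2"] kernel_density_pos[of "(norm w)\<^sup>2"]
    by (simp add: ellipsoid_volume_def field_simps)
qed

lemma bergman_ball_volume_ge:
  assumes "A > 0"
  shows "ennreal (ellipsoid_volume z * ball_volume (inner_radius A)) \<le> emeasure lborel (bball z A)"
  unfolding emeasure_ellipsoid[symmetric]
  by (rule emeasure_mono[OF ellipsoid_subset_bergman_ball[OF assms]]) simp

lemma bergman_ball_volume_le:
  assumes "A > 0"
  shows "emeasure lborel (bball z A) \<le> ennreal (ellipsoid_volume z * ball_volume (outer_radius A))"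
  unfolding emeasure_ellipsoid[symmetric]
  by (rule emeasure_mono[OF bergman_ball_subset_ellipsoid[OF assms]]) simp

definition separated :: "real \<Rightarrow> (complex ^ 'n) set \<Rightarrow> bool"
  where "separated d S \<longleftrightarrow> disjoint_family_on (\<lambda>s. bball s (d / 2)) S"

lemma separated_subset: "separated d S \<Longrightarrow> T \<subseteq> S \<Longrightarrow> separated d T"
  by (auto simp: separated_def intro: disjoint_family_on_mono)

definition packing_bound :: "real \<Rightarrow> real \<Rightarrow> real"
  where "packing_bound r d = distortion r ^ CARD('n) * ball_volume (outer_radius (r + d / 2))
    / ball_volume (inner_radius (d / 2))"

lemma packing_bound_pos: "r > 0 \<Longrightarrow> d > 0 \<Longrightarrow> packing_bound r d > 0"
  by (simp add: packing_bound_def distortion_def ball_volume_pos outer_radius_pos inner_radius_pos)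

lemma card_finite_separated_le:
  assumes F: "finite F" "F \<subseteq> bball z r" "separated d F" and "r > 0" "d > 0"
  shows "real (card F) \<le> packing_bound r d"
proof -
  let ?v = "ellipsoid_volume z" and ?D = "distortion r ^ CARD('n)"
    and ?in = "ball_volume (inner_radius (d / 2))" and ?out = "ball_volume (outer_radius (r + d / 2))"
  have pos: "?v > 0" "?D > 0" "?in > 0" "?out > 0"
    using assms by (auto simp: ellipsoid_volume_pos distortion_def ball_volume_pos inner_radius_pos outer_radius_pos)
  have "ennreal (real (card F) * (?v / ?D * ?in)) = (\<Sum>s\<in>F. ennreal (?v / ?D * ?in))"
    using pos by (simp only: sum_constant ennreal_of_nat_eq_real_of_nat) (intro ennreal_mult; simp)
  also have "\<dots> \<le> (\<Sum>s\<in>F. emeasure lborel (bball s (d / 2)))"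
  proof (rule sum_mono)
    fix s assume "s \<in> F"
    then have "?v \<le> ?D * ellipsoid_volume s"
      using F(2) by (intro ellipsoid_volume_le_of_mem_bergman_ball[OF bergman_ball_sym]) auto
    then have "?v / ?D * ?in \<le> ellipsoid_volume s * ?in" using pos by (intro mult_right_mono) (auto simp: field_simps)
    then show "ennreal (?v / ?D * ?in) \<le> emeasure lborel (bball s (d / 2))"
      using bergman_ball_volume_ge[of "d / 2" s] \<open>d > 0\<close> by (auto intro: order_trans ennreal_leI)
  qed
  also have "\<dots> = emeasure lborel (\<Union>s\<in>F. bball s (d / 2))"
    by (rule sum_emeasure) (use F in \<open>auto simp: separated_def\<close>)
  also have "\<dots> \<le> emeasure lborel (bball z (r + d / 2))"
    using F(2) bergman_ball_triangle by (intro emeasure_mono) (blast, simp)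
  also have "\<dots> \<le> ennreal (?v * ?out)" by (rule bergman_ball_volume_le) (use assms in simp)
  finally have "?v * (real (card F) * (?in / ?D)) \<le> ?v * ?out"
    using pos by (subst (asm) ennreal_le_iff) (auto simp: mult_ac)
  then have "real (card F) * (?in / ?D) \<le> ?out" using pos(1) by (rule mult_left_le_imp_le)
  then show ?thesis using pos by (simp add: packing_bound_def field_simps)
qed

lemma
  assumes S: "S \<subseteq> bball z r" "separated d S" and pos: "r > 0" "d > 0"
  shows finite_separated: "finite S" and card_separated_le: "real (card S) \<le> packing_bound r d"
proof -
  show "finite S"
  proof (rule ccontr)
    assume "infinite S"
    then obtain F where F: "finite F" "card F = nat \<lceil>packing_bound r d\<rceil> + 1" "F \<subseteq> S"
      using infinite_arbitrarily_large by blast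
    then have "real (card F) \<le> packing_bound r d"
      using S pos by (intro card_finite_separated_le separated_subset[OF S(2)]) auto
    then show False using F(2) by linarith
  qed
  then show "real (card S) \<le> packing_bound r d" using S pos by (rule card_finite_separated_le)
qed

lemma ex_maximal_separated:
  "\<exists>M. M \<subseteq> G \<and> separated d M \<and> (\<forall>X. X \<subseteq> G \<longrightarrow> separated d X \<longrightarrow> M \<subseteq> X \<longrightarrow> X = M)"
proof -
  define \<S> where "\<S> = {S. S \<subseteq> G \<and> separated d S}"
  have "\<exists>M\<in>\<S>. \<forall>X\<in>\<S>. M \<subseteq> X \<longrightarrow> X = M"
  proof (rule subset_Zorn')
    fix C assume "subset.chain \<S> C"
    then have C: "C \<subseteq> \<S>" and chain: "\<And>X Y. X \<in> C \<Longrightarrow> Y \<in> C \<Longrightarrow> X \<subseteq> Y \<or> Y \<subseteq> X"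
      by (auto simp: subset_chain_def)
    have "bball s (d / 2) \<inter> bball t (d / 2) = {}" if distinct: "s \<in> \<Union> C" "t \<in> \<Union> C" "s \<noteq> t" for s t
    proof -
      obtain X where "X \<in> C" "s \<in> X" "t \<in> X" using distinct(1,2) chain by blast
      then have "disjoint_family_on (\<lambda>s. bball s (d / 2)) X" using C by (auto simp: \<S>_def separated_def)
      then show ?thesis using \<open>s \<in> X\<close> \<open>t \<in> X\<close> distinct(3) by (rule disjoint_family_onD)
    qed
    moreover have "\<Union> C \<subseteq> G" using C by (auto simp: \<S>_def)
    ultimately show "\<Union> C \<in> \<S>" by (auto simp: \<S>_def separated_def disjoint_family_on_def)
  qed
  then obtain M where "M \<in> \<S>" "\<forall>X\<in>\<S>. M \<subseteq> X \<longrightarrow> X = M" by blast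
  then show ?thesis unfolding \<S>_def by (intro exI[of _ M]) simp
qed

lemma maximal_separated_covers:
  assumes "d > 0"
  obtains S where "S \<subseteq> G" "separated d S" "G \<subseteq> (\<Union>s\<in>S. bball s d)"
proof -
  obtain M where M: "M \<subseteq> G" "separated d M" "\<And>X. X \<subseteq> G \<Longrightarrow> separated d X \<Longrightarrow> M \<subseteq> X \<Longrightarrow> X = M"
    using ex_maximal_separated[of G d] by blast
  have "w \<in> (\<Union>s\<in>M. bball s d)" if w: "w \<in> G" for w
  proof (cases "w \<in> M")
    case True
    then show ?thesis using center_mem_bergman_ball[OF assms] by blast
  next
    case False
    then have "\<not> separated d (insert w M)" using M(1) M(3)[of "insert w M"] w by blast
    then obtain s where s: "s \<in> M" "bball w (d / 2) \<inter> bball s (d / 2) \<noteq> {}"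
      using M(2) False unfolding separated_def disjoint_family_on_def by blast
    then obtain v where "v \<in> bball w (d / 2)" "v \<in> bball s (d / 2)" by blast
    then have "w \<in> bball s (d / 2 + d / 2)" using bergman_ball_triangle bergman_ball_sym by blast
    then show ?thesis using s by auto
  qed
  then have "G \<subseteq> (\<Union>s\<in>M. bball s d)" by blast
  then show ?thesis using that M(1,2) by blast
qed

end

section \<open>Lower bound for the kernel near the diagonal\<close>

context fock_metric
begin

definition twist_bound :: real where "twist_bound = sqrt (tilt_const / diag_lower)"

lemma twist_bound_pos: "twist_bound > 0"
  unfolding twist_bound_def using tilt_const_pos diag_lower_pos by simp

lemma twist_bound_squared: "twist_bound\<^sup>2 = tilt_const / diag_lower"
  using tilt_const_pos diag_lower_pos by (simp add: twist_bound_def)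

lemma norm_twist_kernel_le:
  assumes u: "norm u \<le> local_radius"
  shows "norm (twist z (kernel_at z) u) \<le> twist_bound * kernel_diag ((norm z)\<^sup>2)"
proof -
  let ?w = "z + ellipsoid_map z u" and ?x = "(norm z)\<^sup>2"
  let ?y = "(norm ?w)\<^sup>2"
  have x: "?x \<ge> 0" and y: "?y \<ge> 0" by auto
  note diag_pos = kernel_diag_pos[OF x]
  have "(norm (kernel_at z ?w))\<^sup>2 \<le> kernel_diag ?x * diag_bound ?y"
    using kernel_at_Cauchy_Schwarz[of z ?w] kernel_diag_le[OF y] diag_pos
    by (auto intro: order_trans mult_left_mono)
  then have "weighted_sq (kernel_at z) ?w \<le> kernel_diag ?x * diag_bound ?y * exp (- \<Psi> ?y)"
    unfolding weighted_sq_def by (rule mult_right_mono) simp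
  also have "\<dots> = evaluation_const * kernel_diag ?x * kernel_density ?y"
    by (simp add: diag_bound_def exp_minus field_simps)
  also have "\<dots> \<le> evaluation_const * kernel_diag ?x * (near_density_const * kernel_density ?x)"
    using near_kernel_density_le[OF near_ellipsoid_map[OF u]] evaluation_const_pos diag_pos
    by (intro mult_left_mono) auto
  finally have "exp (\<Psi> ?x + oscillation) * weighted_sq (kernel_at z) ?w
      \<le> exp (\<Psi> ?x + oscillation) * (evaluation_const * kernel_diag ?x * (near_density_const * kernel_density ?x))"
    by (rule mult_left_mono) simp
  then have "(norm (twist z (kernel_at z) u))\<^sup>2
      \<le> exp (\<Psi> ?x + oscillation) * (evaluation_const * kernel_diag ?x * (near_density_const * kernel_density ?x))"
    by (rule order_trans[OF norm_twist_le[OF u]])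
  also have "\<dots> = tilt_const * kernel_diag ?x * (kernel_density ?x * exp (\<Psi> ?x))"
    by (simp add: tilt_const_def exp_add mult_ac)
  also have "\<dots> \<le> tilt_const * kernel_diag ?x * (kernel_diag ?x / diag_lower)"
    using kernel_diag_ge[OF x] diag_lower_pos tilt_const_pos diag_pos
    by (intro mult_left_mono) (auto simp: field_simps)
  also have "\<dots> = (twist_bound * kernel_diag ?x)\<^sup>2"
    by (simp add: power_mult_distrib twist_bound_squared) (simp add: power2_eq_square)
  finally show ?thesis
    by (rule power2_le_imp_le) (use twist_bound_pos diag_pos in simp)
qed

definition kernel_radius :: real
  where "kernel_radius = min (local_radius / 2) (local_radius / (4 * twist_bound))"

lemma kernel_radius_pos: "kernel_radius > 0"
  using local_radius_bounds(1) twist_bound_pos by (simp add: kernel_radius_def)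

lemma kernel_diag_half_le_norm_twist:
  assumes u: "norm u < kernel_radius"
  shows "kernel_diag ((norm z)\<^sup>2) / 2 \<le> norm (twist z (kernel_at z) u)"
proof -
  let ?F = "kernel_diag ((norm z)\<^sup>2)" and ?g = "twist z (kernel_at z)"
  have F: "?F > 0" by (rule kernel_diag_pos) simp
  have small: "norm u \<le> local_radius / 2" using u by (simp add: kernel_radius_def)
  have "norm (?g u - ?g 0) \<le> 2 * (twist_bound * ?F) * norm u / local_radius"
    by (rule entire_Lipschitz_at_0[OF entire_twist[OF kernel_at_entire] norm_twist_kernel_le small local_radius_bounds(1)])
  also have "\<dots> = ?F * (2 * (twist_bound * norm u) / local_radius)" by simp
  also have "\<dots> \<le> ?F * (1 / 2)"
  proof (rule mult_left_mono)
    have "norm u < local_radius / (4 * twist_bound)" using u by (simp add: kernel_radius_def)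
    then show "2 * (twist_bound * norm u) / local_radius \<le> 1 / 2"
      using local_radius_bounds(1) twist_bound_pos by (simp add: field_simps)
  qed (use F in simp)
  finally have "norm (?g u - ?g 0) \<le> ?F / 2" by simp
  moreover have "norm (?g 0) = ?F" using F by (simp add: kernel_at_same)
  ultimately show ?thesis using norm_triangle_ineq2[of "?g 0" "?g u"] by (simp add: norm_minus_commute)
qed

definition kernel_lower_const :: real
  where "kernel_lower_const = diag_lower * exp (- oscillation) / 4"

lemma kernel_lower_const_pos: "kernel_lower_const > 0"
  using diag_lower_pos by (simp add: kernel_lower_const_def)

lemma weighted_sq_kernel_ge:
  assumes "w \<in> ellipsoid z kernel_radius"
  shows "kernel_lower_const / ellipsoid_volume z \<le> weighted_sq (kernel_at z) w / kernel_diag ((norm z)\<^sup>2)"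
proof -
  let ?x = "(norm z)\<^sup>2"
  let ?F = "kernel_diag ?x"
  obtain u where u: "w = z + ellipsoid_map z u" "norm u < kernel_radius"
    using assms by (auto simp: ellipsoid_def)
  have F: "?F > 0" by (rule kernel_diag_pos) simp
  have "diag_lower * (kernel_density ?x * exp (\<Psi> ?x)) * ?F \<le> ?F * ?F"
    using F by (intro mult_right_mono kernel_diag_ge) auto
  then have "exp (\<Psi> ?x + oscillation) * (kernel_lower_const / ellipsoid_volume z * ?F) \<le> (?F / 2)\<^sup>2"
    using kernel_density_pos[of ?x]
    by (simp add: ellipsoid_volume_def kernel_lower_const_def power2_eq_square exp_minus exp_add field_simps)
  also have "\<dots> \<le> (norm (twist z (kernel_at z) u))\<^sup>2"
    using F by (intro power_mono kernel_diag_half_le_norm_twist u) auto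
  also have "\<dots> \<le> exp (\<Psi> ?x + oscillation) * weighted_sq (kernel_at z) w"
    unfolding u(1) by (rule norm_twist_le) (use u(2) local_radius_bounds(1) in \<open>simp add: kernel_radius_def\<close>)
  finally have "kernel_lower_const / ellipsoid_volume z * ?F \<le> weighted_sq (kernel_at z) w"
    by (rule mult_left_le_imp_le) simp
  then show ?thesis using F by (simp add: pos_le_divide_eq)
qed

lemma outer_radius_le:
  assumes A: "0 < A" "A \<le> 1" shows "outer_radius A \<le> A * outer_radius 1"
proof -
  have D: "distortion A \<le> distortion 1" by (rule distortion_mono[OF A(2)])
  moreover have "0 \<le> distortion A" by (simp add: distortion_def)
  ultimately have "(distortion A)\<^sup>2 * A * scale_const / sqrt metric_lower
      \<le> (distortion 1)\<^sup>2 * 1 * scale_const / sqrt metric_lower"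
    using A scale_const_pos metric_lower_pos
    by (intro divide_right_mono mult_right_mono mult_mono power_mono) auto
  then have "radial_chord_const A \<le> radial_chord_const 1" using D by (simp add: radial_chord_const_def)
  then have "A / sqrt metric_lower * radial_chord_const A \<le> A / sqrt metric_lower * radial_chord_const 1"
    using A metric_lower_pos by (intro mult_left_mono) auto
  then have "displacement_bound A \<le> A * displacement_bound 1" by (simp add: displacement_bound_def)
  then have "inclusion_const * displacement_bound A \<le> inclusion_const * (A * displacement_bound 1)"
    using inclusion_const_pos by (intro mult_left_mono) auto
  then show ?thesis by (simp add: outer_radius_def mult.left_commute)
qed

definition test_radius :: real where "test_radius = min 1 (kernel_radius / outer_radius 1)"

lemma test_radius_pos: "test_radius > 0"
  using kernel_radius_pos outer_radius_pos[of 1] by (simp add: test_radius_def)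

lemma bergman_ball_test_radius_subset: "bball z test_radius \<subseteq> ellipsoid z kernel_radius"
proof -
  have "outer_radius test_radius \<le> test_radius * outer_radius 1"
    by (rule outer_radius_le[OF test_radius_pos]) (simp add: test_radius_def)
  also have "\<dots> \<le> kernel_radius"
    using outer_radius_pos[of 1] by (simp add: test_radius_def flip: pos_le_divide_eq)
  finally have "ellipsoid z (outer_radius test_radius) \<subseteq> ellipsoid z kernel_radius" by (rule ellipsoid_mono)
  then show ?thesis using bergman_ball_subset_ellipsoid[OF test_radius_pos] by blast
qed

end

section \<open>From the Carleson property to bounds on balls\<close>

lemma emeasure_le_of_nn_integral_le:
  assumes A: "A \<in> sets M" and c: "c > 0" and "C \<ge> 0" and lower: "\<And>x. x \<in> A \<Longrightarrow> c \<le> f x"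
    and integral: "(\<integral>\<^sup>+x. ennreal (f x) \<partial>M) \<le> ennreal C"
  shows "emeasure M A \<le> ennreal (C / c)"
proof -
  have "ennreal c * emeasure M A = (\<integral>\<^sup>+x. ennreal c * indicator A x \<partial>M)"
    by (rule nn_integral_cmult_indicator[symmetric, OF A])
  also have "\<dots> \<le> (\<integral>\<^sup>+x. ennreal (f x) \<partial>M)"
    using lower by (intro nn_integral_mono) (auto simp: indicator_def intro: ennreal_leI)
  also note integral
  finally have "ennreal (1 / c) * (ennreal c * emeasure M A) \<le> ennreal (1 / c) * ennreal C"
    by (rule mult_left_mono) simp
  then show ?thesis
    using c \<open>C \<ge> 0\<close> by (simp add: mult.assoc[symmetric] ennreal_mult[symmetric])
qed

context fock_metric
begin

lemma carleson_measure_iff: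
  "carleson_measure \<Psi> \<nu> \<longleftrightarrow>
    (\<exists>C>0. \<forall>f\<in>fock_space \<Psi>. (\<integral>\<^sup>+z. ennreal (weighted_sq f z) \<partial>\<nu>) \<le> ennreal C * sq_integral \<mu> f)"
  for \<nu> :: "(complex ^ 'n) measure"
  by (simp add: carleson_measure_def weighted_sq_def sq_integral_def)

definition berezin :: "(complex ^ 'n) measure \<Rightarrow> complex ^ 'n \<Rightarrow> ennreal"
  where "berezin \<nu> z = (\<integral>\<^sup>+w. ennreal (weighted_sq (kernel_at z) w / kernel_diag ((norm z)\<^sup>2)) \<partial>\<nu>)"

lemma berezin_eq:
  "berezin \<nu> z = (\<integral>\<^sup>+w. ennreal ((norm (fock_kernel \<Psi> w z))\<^sup>2 / Re (fock_kernel \<Psi> z z)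
    * exp (- \<Psi> ((norm w)\<^sup>2))) \<partial>\<nu>)"
  by (simp add: berezin_def fock_kernel_eq kernel_at_same weighted_sq_def)

lemma carleson_imp_berezin_bounded:
  assumes [measurable_cong]: "sets \<nu> = sets borel" and "carleson_measure \<Psi> \<nu>"
  shows "\<exists>C>0. \<forall>z. berezin \<nu> z \<le> ennreal C"
proof -
  obtain C where C: "C > 0"
    "\<And>f. f \<in> fock_space \<Psi> \<Longrightarrow> (\<integral>\<^sup>+z. ennreal (weighted_sq f z) \<partial>\<nu>) \<le> ennreal C * sq_integral \<mu> f"
    using assms(2) unfolding carleson_measure_iff by blast
  have "berezin \<nu> z \<le> ennreal C" for z
  proof -
    let ?F = "kernel_diag ((norm z)\<^sup>2)"
    have F: "?F > 0" by (rule kernel_diag_pos) simp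
    have "berezin \<nu> z = (\<integral>\<^sup>+w. ennreal (1 / ?F) * ennreal (weighted_sq (kernel_at z) w) \<partial>\<nu>)"
      unfolding berezin_def using F
      by (intro nn_integral_cong) (simp add: ennreal_mult[symmetric] weighted_sq_nonneg)
    also have "\<dots> = ennreal (1 / ?F) * (\<integral>\<^sup>+w. ennreal (weighted_sq (kernel_at z) w) \<partial>\<nu>)"
      by (rule nn_integral_cmult) measurable
    also have "\<dots> \<le> ennreal (1 / ?F) * (ennreal C * ennreal ?F)"
      by (intro mult_left_mono order_trans[OF C(2)[OF kernel_at_in_fock_space]] sq_integral_kernel_at_le) auto
    also have "\<dots> = ennreal C" using F C(1) by (simp add: ennreal_mult[symmetric])
    finally show ?thesis .
  qed
  then show ?thesis using C(1) by blast
qed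

lemma berezin_bounded_imp_test_balls:
  assumes sets: "sets \<nu> = sets borel" and "C > 0" "berezin \<nu> z \<le> ennreal C"
  shows "emeasure \<nu> (bball z test_radius) \<le> ennreal (C / kernel_lower_const * ellipsoid_volume z)"
proof -
  have "emeasure \<nu> (bball z test_radius) \<le> ennreal (C / (kernel_lower_const / ellipsoid_volume z))"
  proof (rule emeasure_le_of_nn_integral_le)
    show "kernel_lower_const / ellipsoid_volume z > 0" using kernel_lower_const_pos ellipsoid_volume_pos by simp
    show "kernel_lower_const / ellipsoid_volume z \<le> weighted_sq (kernel_at z) w / kernel_diag ((norm z)\<^sup>2)"
      if "w \<in> bball z test_radius" for w
      using that bergman_ball_test_radius_subset by (intro weighted_sq_kernel_ge) blast
  qed (use assms in \<open>simp_all add: berezin_def\<close>)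
  then show ?thesis by simp
qed

lemma small_balls_imp_all_balls:
  assumes sets: "sets \<nu> = sets borel" and "C > 0" "d > 0" "r > 0"
    and small: "\<And>z. emeasure \<nu> (bball z d) \<le> ennreal (C * ellipsoid_volume z)"
  shows "emeasure \<nu> (bball z r)
    \<le> ennreal (packing_bound r d * C * distortion r ^ CARD('n) / ball_volume (inner_radius r)) * emeasure lborel (bball z r)"
proof -
  let ?v = "ellipsoid_volume z" and ?D = "distortion r ^ CARD('n)" and ?N = "packing_bound r d"
    and ?in = "ball_volume (inner_radius r)"
  have pos: "?v > 0" "?D > 0" "?in > 0" "?N > 0"
    using assms by (simp_all add: ellipsoid_volume_pos distortion_def ball_volume_pos inner_radius_pos packing_bound_pos)
  obtain S where S: "S \<subseteq> bball z r" "separated d S" "bball z r \<subseteq> (\<Union>s\<in>S. bball s d)"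
    using maximal_separated_covers[OF \<open>d > 0\<close>] by blast
  have fin: "finite S" and card: "real (card S) \<le> ?N"
    using S \<open>r > 0\<close> \<open>d > 0\<close> by (auto intro: finite_separated card_separated_le)
  have "emeasure \<nu> (bball z r) \<le> emeasure \<nu> (\<Union>s\<in>S. bball s d)"
    by (rule emeasure_mono[OF S(3)]) (use fin in \<open>auto simp: sets intro!: sets.finite_UN\<close>)
  also have "\<dots> \<le> (\<Sum>s\<in>S. emeasure \<nu> (bball s d))"
    by (rule emeasure_subadditive_finite[OF fin]) (auto simp: sets)
  also have "\<dots> \<le> (\<Sum>s\<in>S. ennreal (C * (?D * ?v)))"
  proof (rule sum_mono)
    fix s assume "s \<in> S"
    then have "ellipsoid_volume s \<le> ?D * ?v" using S(1) by (intro ellipsoid_volume_le_of_mem_bergman_ball) auto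
    then show "emeasure \<nu> (bball s d) \<le> ennreal (C * (?D * ?v))"
      using \<open>C > 0\<close> by (intro order_trans[OF small] ennreal_leI mult_left_mono) auto
  qed
  also have "\<dots> = ennreal (real (card S) * (C * (?D * ?v)))"
    by (simp only: sum_constant ennreal_of_nat_eq_real_of_nat) (use pos \<open>C > 0\<close> in \<open>simp add: ennreal_mult\<close>)
  also have "\<dots> \<le> ennreal (?N * (C * (?D * ?v)))"
    using card pos \<open>C > 0\<close> by (intro ennreal_leI mult_right_mono) auto
  also have "\<dots> = ennreal (?N * C * ?D / ?in) * ennreal (?v * ?in)"
    using pos \<open>C > 0\<close> by (simp flip: ennreal_mult)
  also have "\<dots> \<le> ennreal (?N * C * ?D / ?in) * emeasure lborel (bball z r)"
    by (rule mult_left_mono[OF bergman_ball_volume_ge[OF \<open>r > 0\<close>]]) simp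
  finally show ?thesis .
qed

lemma berezin_bounded_imp_balls:
  assumes sets: "sets \<nu> = sets borel" and berezin: "\<exists>C>0. \<forall>z. berezin \<nu> z \<le> ennreal C" and "r > 0"
  shows "\<exists>C>0. \<forall>z. emeasure \<nu> (bball z r) \<le> ennreal C * emeasure lborel (bball z r)"
proof -
  obtain C where C: "C > 0" "\<And>z. berezin \<nu> z \<le> ennreal C" using berezin by blast
  let ?C = "C / kernel_lower_const"
  let ?K = "packing_bound r test_radius * ?C * distortion r ^ CARD('n) / ball_volume (inner_radius r)"
  have "?C > 0" using C(1) kernel_lower_const_pos by simp
  then have "emeasure \<nu> (bball z r) \<le> ennreal ?K * emeasure lborel (bball z r)" for z
    using test_radius_pos \<open>r > 0\<close> berezin_bounded_imp_test_balls[OF sets C(1) C(2)]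
    by (rule small_balls_imp_all_balls[OF sets])
  moreover have "?K > 0"
    using C(1) kernel_lower_const_pos \<open>r > 0\<close> test_radius_pos
    by (simp add: packing_bound_pos ball_volume_pos inner_radius_pos distortion_def)
  ultimately show ?thesis by blast
qed

section \<open>Lattices\<close>

lemma covering_radius_separated:
  assumes "covering_radius \<Psi> a r" shows "separated r (range a)"
proof -
  have "disjoint_family (\<lambda>k. bball (a k) (r / 2))" using assms by (simp add: covering_radius_def)
  then show ?thesis
    unfolding separated_def disjoint_family_on_def by (intro ballI impI) (elim imageE, simp, metis)
qed

lemma covering_radiusI:
  assumes "r > 0" "inj a" "separated r (range a)" "UNIV \<subseteq> (\<Union>s\<in>range a. bball s r)"
  shows "covering_radius \<Psi> a r"
  unfolding covering_radius_def
proof (intro conjI)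
  show "disjoint_family (\<lambda>k. bball (a k) (r / 2))"
    using assms(2,3) unfolding separated_def disjoint_family_on_def by (auto simp: inj_eq)
qed (use assms in auto)

lemma covering_radius_le_max:
  fixes a :: "nat \<Rightarrow> complex ^ 'n"
  assumes "covering_radius \<Psi> a r"
  shows "r \<le> max_covering_radius \<Psi> a"
  unfolding max_covering_radius_def
proof (rule cSup_upper)
  show "r \<in> {r. covering_radius \<Psi> a r}" using assms by simp
  obtain D where D: "bdist (a 0) (a 1) = ennreal D" "D \<ge> 0"
    using bergman_dist_finite[of "a 0" "a 1"] by (cases "bdist (a 0) (a 1)") auto
  have "s \<le> 2 * D" if s: "covering_radius \<Psi> a s" for s
  proof (rule ccontr)
    assume "\<not> s \<le> 2 * D"
    then have "a 1 \<in> bball (a 0) (s / 2)" using D by (simp add: bergman_ball_def ennreal_less_iff)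
    moreover have "a 1 \<in> bball (a 1) (s / 2)"
      using s by (intro center_mem_bergman_ball) (simp add: covering_radius_def)
    moreover have "bball (a 0) (s / 2) \<inter> bball (a 1) (s / 2) = {}"
      using s unfolding covering_radius_def disjoint_family_on_def by simp
    ultimately show False by blast
  qed
  then show "bdd_above {r. covering_radius \<Psi> a r}" by (intro bdd_aboveI) auto
qed

lemma countable_separated:
  assumes "separated d S" "d > 0" shows "countable S"
proof -
  have disjoint: "bball s (d / 2) \<inter> bball t (d / 2) = {}" if "s \<in> S" "t \<in> S" "s \<noteq> t" for s t
    using assms(1) that unfolding separated_def by (rule disjoint_family_onD)
  have center: "s \<in> bball s (d / 2)" for s using \<open>d > 0\<close> by (simp add: center_mem_bergman_ball)
  have "countable ((\<lambda>s. bball s (d / 2)) ` S)"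
  proof (rule countable_disjoint_open_subsets)
    show "pairwise disjnt ((\<lambda>s. bball s (d / 2)) ` S)"
      using disjoint by (intro pairwiseI) (auto simp: disjnt_def)
  qed (auto simp: open_bergman_ball)
  moreover have "inj_on (\<lambda>s. bball s (d / 2)) S"
    using disjoint center by (intro inj_onI) blast
  ultimately show ?thesis by (rule countable_image_inj_on)
qed

lemma infinite_covering_centers:
  assumes cover: "UNIV \<subseteq> (\<Union>s\<in>S. bball s d)" and "d > 0" shows "infinite S"
proof
  assume fin: "finite S"
  have "emeasure lborel (bball s d) < \<infinity>" for s
    using bergman_ball_volume_le[OF \<open>d > 0\<close>, of s] by (simp add: le_less_trans)
  then have "(\<Sum>s\<in>S. emeasure lborel (bball s d)) < \<infinity>" using fin by (simp add: less_top)
  moreover have "emeasure lborel (\<Union>s\<in>S. bball s d) \<le> (\<Sum>s\<in>S. emeasure lborel (bball s d))"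
    by (rule emeasure_subadditive_finite[OF fin]) auto
  ultimately show False using cover by (simp add: top.extremum_unique emeasure_lborel_UNIV)
qed

lemma lattice_exists: "\<exists>a :: nat \<Rightarrow> complex ^ 'n. lattice_seq \<Psi> a"
proof -
  obtain S :: "(complex ^ 'n) set" where S: "separated 1 S" "UNIV \<subseteq> (\<Union>s\<in>S. bball s 1)"
    using maximal_separated_covers[of 1 UNIV] by auto
  have "bij_betw (from_nat_into S) UNIV S"
    using countable_separated[OF S(1)] infinite_covering_centers[OF S(2)] by (intro bij_betw_from_nat_into) auto
  then have "inj (from_nat_into S)" "range (from_nat_into S) = S" by (auto simp: bij_betw_def)
  then have "covering_radius \<Psi> (from_nat_into S) 1" using S by (intro covering_radiusI) auto
  then show ?thesis using \<open>inj (from_nat_into S)\<close> unfolding lattice_seq_def by blast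
qed

lemma lattice_overlap_le:
  fixes a :: "nat \<Rightarrow> complex ^ 'n"
  assumes a: "inj a" "covering_radius \<Psi> a r" and "R > 0"
  shows "(\<Sum>k. indicator (bball (a k) R) w) \<le> ennreal (packing_bound R r)"
proof (rule suminf_le_const[OF summableI])
  fix n :: nat
  let ?I = "{k \<in> {..<n}. w \<in> bball (a k) R}"
  have "(\<Sum>k<n. indicator (bball (a k) R) w :: ennreal) = of_nat (card ?I)"
    by (simp add: indicator_def sum.If_cases Int_def)
  also have "\<dots> = ennreal (real (card (a ` ?I)))"
    using a(1) by (simp add: ennreal_of_nat_eq_real_of_nat card_image inj_on_subset)
  also have "\<dots> \<le> ennreal (packing_bound R r)"
  proof (intro ennreal_leI card_separated_le)
    show "a ` ?I \<subseteq> bball w R" using bergman_ball_sym by auto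
    show "separated r (a ` ?I)" by (rule separated_subset[OF covering_radius_separated[OF a(2)]]) auto
  qed (use a(2) \<open>R > 0\<close> in \<open>auto simp: covering_radius_def\<close>)
  finally show "(\<Sum>k<n. indicator (bball (a k) R) w) \<le> ennreal (packing_bound R r)" .
qed

end

section \<open>From bounds on a lattice to the Carleson property\<close>

lemma nn_integral_le_suminf_cover:
  assumes [measurable]: "f \<in> borel_measurable M" "\<And>k. A k \<in> sets M" and cover: "(\<Union>k. A k) = UNIV"
  shows "(\<integral>\<^sup>+x. f x \<partial>M) \<le> (\<Sum>k::nat. \<integral>\<^sup>+x. f x * indicator (A k) x \<partial>M)"
proof -
  have "(\<integral>\<^sup>+x. f x \<partial>M) \<le> (\<integral>\<^sup>+x. (\<Sum>k. f x * indicator (A k) x) \<partial>M)"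
  proof (rule nn_integral_mono)
    fix x
    obtain k where k: "x \<in> A k" using cover by blast
    have "(\<Sum>k\<in>{k}. f x * indicator (A k) x) \<le> (\<Sum>k. f x * indicator (A k) x)"
      by (rule sum_le_suminf[OF summableI]) auto
    then show "f x \<le> (\<Sum>k. f x * indicator (A k) x)" using k by simp
  qed
  also have "\<dots> = (\<Sum>k. \<integral>\<^sup>+x. f x * indicator (A k) x \<partial>M)"
    by (rule nn_integral_suminf) measurable
  finally show ?thesis .
qed

lemma suminf_nn_integral_le_overlap:
  assumes [measurable]: "f \<in> borel_measurable M" "\<And>k. A k \<in> sets M"
    and overlap: "\<And>x. (\<Sum>k::nat. indicator (A k) x) \<le> N"
  shows "(\<Sum>k. \<integral>\<^sup>+x. f x * indicator (A k) x \<partial>M) \<le> N * (\<integral>\<^sup>+x. f x \<partial>M)"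
proof -
  have "(\<Sum>k. \<integral>\<^sup>+x. f x * indicator (A k) x \<partial>M) = (\<integral>\<^sup>+x. (\<Sum>k. f x * indicator (A k) x) \<partial>M)"
    by (rule nn_integral_suminf[symmetric]) measurable
  also have "\<dots> \<le> (\<integral>\<^sup>+x. N * f x \<partial>M)"
    unfolding ennreal_suminf_cmult using overlap
    by (intro nn_integral_mono) (simp add: mult_left_mono mult.commute[of N])
  also have "\<dots> = N * (\<integral>\<^sup>+x. f x \<partial>M)" by (rule nn_integral_cmult) measurable
  finally show ?thesis .
qed

context fock_metric
begin

definition pointwise_const :: "real \<Rightarrow> real"
  where "pointwise_const R = distortion R ^ CARD('n) * exp oscillation / ball_volume (inner_radius 1)"

lemma pointwise_const_pos: "pointwise_const R > 0"
  by (simp add: pointwise_const_def distortion_def ball_volume_pos inner_radius_pos)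

lemma weighted_sq_le_ball_average:
  assumes f: "entire f" and w: "w \<in> bball z R"
  shows "ennreal (weighted_sq f w) \<le> ennreal (pointwise_const R / ellipsoid_volume z)
    * (\<integral>\<^sup>+u. ennreal (weighted_sq f u) * indicator (bball z (R + 1)) u \<partial>lborel)"
proof -
  let ?J = "\<integral>\<^sup>+u. ennreal (weighted_sq f u) * indicator (bball z (R + 1)) u \<partial>lborel"
  let ?v = "ellipsoid_volume w * ball_volume (inner_radius 1)"
  have pos: "ellipsoid_volume w > 0" "ellipsoid_volume z > 0" "ball_volume (inner_radius 1) > 0"
    by (auto simp: ellipsoid_volume_pos ball_volume_pos inner_radius_pos)
  then have v: "?v > 0" by simp
  have "ellipsoid w (inner_radius 1) \<subseteq> bball z (R + 1)"
    using ellipsoid_subset_bergman_ball[of 1 w] bergman_ball_triangle[OF w] by auto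
  then have "(\<integral>\<^sup>+u. ennreal (weighted_sq f u) * indicator (ellipsoid w (inner_radius 1)) u \<partial>lborel) \<le> ?J"
    by (intro nn_integral_mono) (auto simp: indicator_def)
  then have average: "ennreal (weighted_sq f w * ?v) \<le> ennreal (exp oscillation) * ?J"
    using inner_radius_pos[of 1] inner_radius_le
    by (intro order_trans[OF local_mean_value[OF f]] mult_left_mono) auto
  have "ennreal (weighted_sq f w) = ennreal (1 / ?v) * ennreal (weighted_sq f w * ?v)"
    using pos by (subst ennreal_mult[symmetric]) (auto simp: weighted_sq_nonneg)
  also have "\<dots> \<le> ennreal (1 / ?v) * (ennreal (exp oscillation) * ?J)"
    using average by (rule mult_left_mono) simp
  also have "\<dots> = ennreal (1 / ?v * exp oscillation) * ?J"
    using v by (subst ennreal_mult) (auto simp: mult.assoc)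
  also have "\<dots> \<le> ennreal (pointwise_const R / ellipsoid_volume z) * ?J"
  proof (intro mult_right_mono ennreal_leI)
    show "1 / ?v * exp oscillation \<le> pointwise_const R / ellipsoid_volume z"
      using ellipsoid_volume_le_of_mem_bergman_ball[OF bergman_ball_sym[OF w]] pos
      by (simp add: pointwise_const_def field_simps)
  qed simp
  finally show ?thesis .
qed

definition ball_carleson_const :: "real \<Rightarrow> real"
  where "ball_carleson_const R = pointwise_const R * ball_volume (outer_radius R)"

lemma ball_carleson_const_pos: "R > 0 \<Longrightarrow> ball_carleson_const R > 0"
  by (simp add: ball_carleson_const_def pointwise_const_pos ball_volume_pos outer_radius_pos)

lemma ball_carleson_estimate:
  assumes sets: "sets \<nu> = sets borel" and f: "entire f" and pos: "R > 0" "C > 0"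
    and bound: "emeasure \<nu> (bball z R) \<le> ennreal C * emeasure lborel (bball z R)"
  shows "(\<integral>\<^sup>+w. ennreal (weighted_sq f w) * indicator (bball z R) w \<partial>\<nu>)
    \<le> ennreal (C * ball_carleson_const R)
      * (\<integral>\<^sup>+w. ennreal (weighted_sq f w) * indicator (bball z (R + 1)) w \<partial>lborel)"
proof -
  let ?J = "\<integral>\<^sup>+w. ennreal (weighted_sq f w) * indicator (bball z (R + 1)) w \<partial>lborel"
  let ?k = "pointwise_const R / ellipsoid_volume z" and ?v = "ellipsoid_volume z * ball_volume (outer_radius R)"
  have nonneg: "?k \<ge> 0" "?v \<ge> 0"
    using pointwise_const_pos ellipsoid_volume_pos ball_volume_nonneg by (simp_all add: less_imp_le)
  have "(\<integral>\<^sup>+w. ennreal (weighted_sq f w) * indicator (bball z R) w \<partial>\<nu>)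
      \<le> (\<integral>\<^sup>+w. (ennreal ?k * ?J) * indicator (bball z R) w \<partial>\<nu>)"
    using weighted_sq_le_ball_average[OF f] by (intro nn_integral_mono) (auto simp: indicator_def)
  also have "\<dots> = (ennreal ?k * ?J) * emeasure \<nu> (bball z R)"
    by (rule nn_integral_cmult_indicator) (simp add: sets)
  also have "\<dots> \<le> (ennreal ?k * ?J) * (ennreal C * ennreal ?v)"
    by (intro mult_left_mono order_trans[OF bound] bergman_ball_volume_le pos) auto
  also have "\<dots> = ennreal (?k * (C * ?v)) * ?J"
  proof -
    have "ennreal (?k * (C * ?v)) = ennreal ?k * (ennreal C * ennreal ?v)"
      using nonneg pos by (subst ennreal_mult, simp, simp, subst ennreal_mult) auto
    then show ?thesis by (simp only: mult_ac)
  qed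
  also have "?k * (C * ?v) = C * ball_carleson_const R"
    using ellipsoid_volume_pos[of z] by (simp add: ball_carleson_const_def)
  finally show ?thesis .
qed

lemma covering_bound_imp_carleson:
  fixes a :: "nat \<Rightarrow> complex ^ 'n"
  assumes sets [measurable_cong]: "sets \<nu> = sets borel" and a: "inj a" "covering_radius \<Psi> a r"
    and R: "r \<le> R" and "C > 0"
    and bound: "\<And>k. emeasure \<nu> (bball (a k) R) \<le> ennreal C * emeasure lborel (bball (a k) R)"
  shows "carleson_measure \<Psi> \<nu>"
  unfolding carleson_measure_iff
proof (intro exI conjI ballI)
  let ?K = "C * ball_carleson_const R" and ?N = "packing_bound (R + 1) r"
  have "r > 0" using a(2) by (simp add: covering_radius_def)
  then have "R > 0" using R by simp
  have pos: "?K > 0" "?N > 0"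
    using \<open>r > 0\<close> \<open>R > 0\<close> \<open>C > 0\<close> by (simp_all add: ball_carleson_const_pos packing_bound_pos)
  then show "?K * ?N > 0" by simp
  have cover: "(\<Union>k. bball (a k) R) = UNIV"
    using a(2) bergman_ball_mono[OF R] unfolding covering_radius_def by blast
  fix f :: "complex ^ 'n \<Rightarrow> complex" assume "f \<in> fock_space \<Psi>"
  then have f: "entire f" by (rule fock_space_entire)
  have [measurable]: "f \<in> borel_measurable borel" by (rule entire_imp_borel_measurable[OF f])
  have "(\<integral>\<^sup>+w. ennreal (weighted_sq f w) \<partial>\<nu>) \<le> (\<Sum>k. \<integral>\<^sup>+w. ennreal (weighted_sq f w) * indicator (bball (a k) R) w \<partial>\<nu>)"
    by (rule nn_integral_le_suminf_cover[OF _ _ cover]) measurable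
  also have "\<dots> \<le> (\<Sum>k. ennreal ?K * (\<integral>\<^sup>+w. ennreal (weighted_sq f w) * indicator (bball (a k) (R + 1)) w \<partial>lborel))"
    using \<open>R > 0\<close> \<open>C > 0\<close> by (intro suminf_le ball_carleson_estimate[OF sets f] bound summableI) auto
  also have "\<dots> = ennreal ?K * (\<Sum>k. \<integral>\<^sup>+w. ennreal (weighted_sq f w) * indicator (bball (a k) (R + 1)) w \<partial>lborel)"
    by simp
  also have "\<dots> \<le> ennreal ?K * (ennreal ?N * (\<integral>\<^sup>+w. ennreal (weighted_sq f w) \<partial>lborel))"
    using lattice_overlap_le[OF a] \<open>R > 0\<close> by (intro mult_left_mono suminf_nn_integral_le_overlap) auto
  also have "\<dots> = ennreal (?K * ?N) * sq_integral \<mu> f"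
    using pos by (subst ennreal_mult[of ?K ?N]) (auto simp: sq_integral_mu mult.assoc)
  finally show "(\<integral>\<^sup>+w. ennreal (weighted_sq f w) \<partial>\<nu>) \<le> ennreal (?K * ?N) * sq_integral \<mu> f" .
qed

lemma lattice_bound_imp_carleson:
  fixes a :: "nat \<Rightarrow> complex ^ 'n"
  assumes "sets \<nu> = sets borel" "lattice_seq \<Psi> a" "C > 0"
    and "\<And>k. emeasure \<nu> (bball (a k) (max_covering_radius \<Psi> a))
      \<le> ennreal C * emeasure lborel (bball (a k) (max_covering_radius \<Psi> a))"
  shows "carleson_measure \<Psi> \<nu>"
proof -
  obtain r where "inj a" "covering_radius \<Psi> a r" using assms(2) unfolding lattice_seq_def by blast
  then show ?thesis
    using assms covering_radius_le_max
    by (intro covering_bound_imp_carleson[of \<nu> a r "max_covering_radius \<Psi> a"]) auto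
qed

lemma balls_imp_lattice_bound:
  assumes balls: "\<forall>r>0. \<exists>C>0. \<forall>z. emeasure \<nu> (bball z r) \<le> ennreal C * emeasure lborel (bball z r)"
  shows "\<exists>a. lattice_seq \<Psi> a \<and> (\<exists>C>0. \<forall>k. emeasure \<nu> (bball (a k) (max_covering_radius \<Psi> a))
    \<le> ennreal C * emeasure lborel (bball (a k) (max_covering_radius \<Psi> a)))"
proof -
  obtain a :: "nat \<Rightarrow> complex ^ 'n" where a: "lattice_seq \<Psi> a" using lattice_exists by blast
  then obtain r where r: "covering_radius \<Psi> a r" unfolding lattice_seq_def by blast
  then have "max_covering_radius \<Psi> a > 0" using covering_radius_le_max[OF r] by (simp add: covering_radius_def)
  then show ?thesis using balls a by blast
qed

theorem carleson_characterisation: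
  fixes \<nu> :: "(complex ^ 'n) measure"
  assumes sets: "sets \<nu> = sets borel"
  shows "(carleson_measure \<Psi> \<nu> \<longleftrightarrow> (\<exists>C>0. \<forall>z. berezin \<nu> z \<le> ennreal C))
    \<and> (carleson_measure \<Psi> \<nu> \<longleftrightarrow>
      (\<forall>r>0. \<exists>C>0. \<forall>z. emeasure \<nu> (bball z r) \<le> ennreal C * emeasure lborel (bball z r)))
    \<and> (carleson_measure \<Psi> \<nu> \<longleftrightarrow>
      (\<exists>a. lattice_seq \<Psi> a \<and>
        (\<exists>C>0. \<forall>k. emeasure \<nu> (bball (a k) (max_covering_radius \<Psi> a))
                \<le> ennreal C * emeasure lborel (bball (a k) (max_covering_radius \<Psi> a)))))"
    (is "(?carleson \<longleftrightarrow> ?berezin) \<and> (?carleson \<longleftrightarrow> ?balls) \<and> (?carleson \<longleftrightarrow> ?lattice)")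
proof -
  have "?carleson \<Longrightarrow> ?berezin" by (rule carleson_imp_berezin_bounded[OF sets])
  moreover have "?berezin \<Longrightarrow> ?balls" using berezin_bounded_imp_balls[OF sets] by blast
  moreover have "?balls \<Longrightarrow> ?lattice" by (rule balls_imp_lattice_bound)
  moreover have "?lattice \<Longrightarrow> ?carleson" using lattice_bound_imp_carleson[OF sets] by blast
  ultimately show ?thesis by blast
qed

end

section \<open>Logarithmic growth functions\<close>

lemma deriv0_eqI:
  assumes "x \<ge> 0" "(f has_real_derivative d) (at x within {0..})"
  shows "deriv0 f x = d"
  unfolding deriv0_def
proof (rule vector_derivative_within)
  have "at_right x \<le> at x within {0..}" using assms(1) by (intro at_le) auto
  then show "at x within {0..} \<noteq> bot" using trivial_limit_at_right_real[of x] by (auto simp: bot_unique)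
  show "(f has_vector_derivative d) (at x within {0..})"
    using assms(2) by (simp add: has_real_derivative_iff_has_vector_derivative)
qed

lemma has_real_derivative_deriv0:
  assumes "f differentiable_on {0..}" "x \<ge> 0"
  shows "(f has_real_derivative deriv0 f x) (at x within {0..})"
proof -
  have "f differentiable (at x within {0..})" using assms by (simp add: differentiable_on_def)
  then obtain d where "(f has_real_derivative d) (at x within {0..})" by (auto simp: real_differentiable_def)
  then show ?thesis using deriv0_eqI[OF assms(2)] by simp
qed

lemma
  assumes "log_growth \<Psi>" "x \<ge> 0"
  shows log_growth_deriv0: "(\<Psi> has_real_derivative deriv0 \<Psi> x) (at x within {0..})"
    and log_growth_deriv0_deriv0: "(deriv0 \<Psi> has_real_derivative deriv0 (deriv0 \<Psi>) x) (at x within {0..})"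
    and log_growth_deriv0_deriv0_deriv0:
      "(deriv0 (deriv0 \<Psi>) has_real_derivative deriv0 (deriv0 (deriv0 \<Psi>)) x) (at x within {0..})"
  using assms unfolding log_growth_def by (auto intro: has_real_derivative_deriv0)

lemma
  assumes "log_growth \<Psi>" "x \<ge> 0"
  shows log_growth_deriv0_pos: "deriv0 \<Psi> x > 0"
    and log_growth_deriv0_deriv0_nonneg: "deriv0 (deriv0 \<Psi>) x \<ge> 0"
    and log_growth_deriv0_deriv0_deriv0_nonneg: "deriv0 (deriv0 (deriv0 \<Psi>)) x \<ge> 0"
  using assms unfolding log_growth_def by auto

lemma Phi_has_real_derivative:
  assumes "log_growth \<Psi>" "x \<ge> 0"
  shows "(Phi \<Psi> has_real_derivative deriv0 \<Psi> x + x * deriv0 (deriv0 \<Psi>) x) (at x within {0..})"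
  unfolding Phi_def[abs_def]
  by (auto intro!: derivative_eq_intros log_growth_deriv0_deriv0[OF assms])

lemma deriv0_Phi:
  assumes "log_growth \<Psi>" "x \<ge> 0"
  shows "deriv0 (Phi \<Psi>) x = deriv0 \<Psi> x + x * deriv0 (deriv0 \<Psi>) x"
  by (rule deriv0_eqI[OF assms(2) Phi_has_real_derivative[OF assms]])

lemma deriv0_Phi_has_real_derivative:
  assumes "log_growth \<Psi>" "x \<ge> 0"
  shows "(deriv0 (Phi \<Psi>) has_real_derivative 2 * deriv0 (deriv0 \<Psi>) x + x * deriv0 (deriv0 (deriv0 \<Psi>)) x)
    (at x within {0..})"
proof (rule has_field_derivative_transform_within[of _ _ _ _ 1])
  show "((\<lambda>x. deriv0 \<Psi> x + x * deriv0 (deriv0 \<Psi>) x) has_real_derivative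
      2 * deriv0 (deriv0 \<Psi>) x + x * deriv0 (deriv0 (deriv0 \<Psi>)) x) (at x within {0..})"
    by (auto intro!: derivative_eq_intros log_growth_deriv0_deriv0[OF assms] log_growth_deriv0_deriv0_deriv0[OF assms])
qed (use assms in \<open>auto simp: deriv0_Phi\<close>)

lemma deriv0_deriv0_Phi:
  assumes "log_growth \<Psi>" "x \<ge> 0"
  shows "deriv0 (deriv0 (Phi \<Psi>)) x = 2 * deriv0 (deriv0 \<Psi>) x + x * deriv0 (deriv0 (deriv0 \<Psi>)) x"
  by (rule deriv0_eqI[OF assms(2) deriv0_Phi_has_real_derivative[OF assms]])

lemma deriv0_deriv0_Phi_continuous:
  assumes "log_growth \<Psi>" shows "continuous_on {0..} (deriv0 (deriv0 (Phi \<Psi>)))"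
proof -
  have "continuous_on {0..} (deriv0 (deriv0 \<Psi>))"
    by (rule DERIV_continuous_on) (use log_growth_deriv0_deriv0_deriv0[OF assms] in auto)
  moreover have "continuous_on {0..} (deriv0 (deriv0 (deriv0 \<Psi>)))" using assms by (simp add: log_growth_def)
  ultimately have "continuous_on {0..} (\<lambda>x. 2 * deriv0 (deriv0 \<Psi>) x + x * deriv0 (deriv0 (deriv0 \<Psi>)) x)"
    by (intro continuous_intros)
  then show ?thesis by (rule continuous_on_eq) (simp add: deriv0_deriv0_Phi[OF assms])
qed

lemma deriv0_Phi_ge:
  assumes "log_growth \<Psi>" "x \<ge> 0" shows "deriv0 \<Psi> 0 \<le> deriv0 (Phi \<Psi>) x"
proof -
  have "deriv0 \<Psi> 0 \<le> deriv0 \<Psi> x"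
    by (rule nondecreasing_halfline[OF order_refl assms(2) log_growth_deriv0_deriv0[OF assms(1)]
          log_growth_deriv0_deriv0_nonneg[OF assms(1)]])
  then show ?thesis
    using assms log_growth_deriv0_deriv0_nonneg[OF assms] by (simp add: deriv0_Phi add_increasing2)
qed

lemma powr_growth_le:
  fixes g t :: real
  assumes \<eta>: "\<eta> \<le> 1 / 2" and t: "t \<ge> 1" and m: "0 < m" "m \<le> g"
  shows "sqrt (1 + t) * (t powr (-1/2) * g powr (1 + \<eta>)) \<le> 2 * m powr (\<eta> - 1 / 2) * (g * sqrt g)"
proof -
  have "sqrt (1 + t) \<le> sqrt (4 * t)" using t by (intro real_sqrt_le_mono) simp
  also have "\<dots> = 2 * sqrt t" by (simp add: real_sqrt_mult)
  finally have "sqrt (1 + t) / sqrt t \<le> 2" using t by (simp add: divide_le_eq)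
  moreover have "t powr (-1/2) = 1 / sqrt t"
    using t powr_minus_divide[of t "1 / 2"] by (simp add: powr_half_sqrt)
  ultimately have "sqrt (1 + t) * t powr (-1/2) \<le> 2" by simp
  moreover have "g powr (1 + \<eta>) \<le> g * sqrt g * m powr (\<eta> - 1 / 2)"
  proof -
    have "g powr (1 + \<eta>) = g powr (1 + 1 / 2 + (\<eta> - 1 / 2))" by (simp add: algebra_simps)
    also have "\<dots> = g * sqrt g * g powr (\<eta> - 1 / 2)"
      unfolding powr_add using m by (simp add: powr_half_sqrt)
    also have "\<dots> \<le> g * sqrt g * m powr (\<eta> - 1 / 2)"
      using m \<eta> by (intro mult_left_mono powr_mono2') auto
    finally show ?thesis .
  qed
  ultimately have "(sqrt (1 + t) * t powr (-1/2)) * g powr (1 + \<eta>) \<le> 2 * (g * sqrt g * m powr (\<eta> - 1 / 2))"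
    by (intro mult_mono) auto
  then show ?thesis by (simp add: mult_ac)
qed

lemma bigo_powr_growth_eventually_le:
  fixes f g :: "real \<Rightarrow> real"
  assumes \<eta>: "\<eta> \<le> 1 / 2" and m: "m > 0" "\<And>x. x \<ge> 0 \<Longrightarrow> m \<le> g x"
    and bigo: "f \<in> O[at_top](\<lambda>t. t powr (-1/2) * (g t) powr (1 + \<eta>))"
  shows "\<exists>C\<ge>0. \<exists>X. \<forall>x\<ge>X. sqrt (1 + x) * f x \<le> C * (g x * sqrt (g x))"
proof -
  obtain c where c: "c > 0"
    and "eventually (\<lambda>t. norm (f t) \<le> c * norm (t powr (-1/2) * (g t) powr (1 + \<eta>))) at_top"
    using bigo by (rule landau_o.bigE)
  then obtain X where X: "\<And>t. t \<ge> X \<Longrightarrow> norm (f t) \<le> c * norm (t powr (-1/2) * (g t) powr (1 + \<eta>))"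
    unfolding eventually_at_top_linorder by blast
  let ?C = "c * (2 * m powr (\<eta> - 1 / 2))"
  have "sqrt (1 + x) * f x \<le> ?C * (g x * sqrt (g x))" if "x \<ge> max X 1" for x
  proof -
    have x: "x \<ge> X" "x \<ge> 1" using that by auto
    have "f x \<le> c * (x powr (-1/2) * g x powr (1 + \<eta>))" using X[OF x(1)] by simp
    then have "sqrt (1 + x) * f x \<le> sqrt (1 + x) * (c * (x powr (-1/2) * g x powr (1 + \<eta>)))"
      using x by (intro mult_left_mono) auto
    also have "\<dots> = c * (sqrt (1 + x) * (x powr (-1/2) * g x powr (1 + \<eta>)))" by (rule mult.left_commute)
    also have "\<dots> \<le> c * (2 * m powr (\<eta> - 1 / 2) * (g x * sqrt (g x)))"
      using c x m(2)[of x] by (intro mult_left_mono powr_growth_le[OF \<eta> x(2) m(1)]) auto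
    finally show ?thesis by (simp add: mult.assoc)
  qed
  moreover have "?C \<ge> 0" using c by simp
  ultimately show ?thesis by blast
qed

lemma continuous_growth_le:
  fixes f g :: "real \<Rightarrow> real"
  assumes cont: "continuous_on {0..} f" and m: "m > 0" "\<And>x. x \<ge> 0 \<Longrightarrow> m \<le> g x"
  shows "\<exists>C\<ge>0. \<forall>x\<in>{0..X}. sqrt (1 + x) * f x \<le> C * (g x * sqrt (g x))"
proof -
  have "continuous_on {0..X} (\<lambda>x. sqrt (1 + x) * f x)"
    by (intro continuous_intros continuous_on_subset[OF cont]) auto
  then have "bounded ((\<lambda>x. sqrt (1 + x) * f x) ` {0..X})"
    by (intro compact_imp_bounded compact_continuous_image) auto
  then obtain M where M: "\<forall>x\<in>{0..X}. norm (sqrt (1 + x) * f x) \<le> M" unfolding bounded_iff by blast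
  let ?C = "\<bar>M\<bar> / (m * sqrt m)"
  have "sqrt (1 + x) * f x \<le> ?C * (g x * sqrt (g x))" if "x \<in> {0..X}" for x
  proof -
    have "norm (sqrt (1 + x) * f x) \<le> M" using M that by blast
    then have "sqrt (1 + x) * f x \<le> \<bar>M\<bar>" by (auto simp only: real_norm_def)
    also have "\<dots> = ?C * (m * sqrt m)" using m(1) by simp
    also have "\<dots> \<le> ?C * (g x * sqrt (g x))"
      using m(1) m(2)[of x] that by (intro mult_left_mono[OF mult_mono]) auto
    finally show ?thesis .
  qed
  moreover have "?C \<ge> 0" using m(1) by simp
  ultimately show ?thesis by blast
qed

lemma bigo_powr_growth_le:
  fixes f g :: "real \<Rightarrow> real"
  assumes "\<eta> \<le> 1 / 2" and cont: "continuous_on {0..} f" and m: "m > 0" "\<And>x. x \<ge> 0 \<Longrightarrow> m \<le> g x"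
    and "f \<in> O[at_top](\<lambda>t. t powr (-1/2) * (g t) powr (1 + \<eta>))"
  shows "\<exists>C>0. \<forall>x\<ge>0. sqrt (1 + x) * f x \<le> C * (g x * sqrt (g x))"
proof -
  have "\<exists>C\<ge>0. \<exists>X. \<forall>x\<ge>X. sqrt (1 + x) * f x \<le> C * (g x * sqrt (g x))"
    by (rule bigo_powr_growth_eventually_le[OF assms(1) m assms(5)])
  then obtain C\<^sub>1 X where large: "C\<^sub>1 \<ge> 0" "\<forall>x\<ge>X. sqrt (1 + x) * f x \<le> C\<^sub>1 * (g x * sqrt (g x))"
    by blast
  have "\<exists>C\<ge>0. \<forall>x\<in>{0..X}. sqrt (1 + x) * f x \<le> C * (g x * sqrt (g x))"
    by (rule continuous_growth_le[OF cont m])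
  then obtain C\<^sub>2 where small: "C\<^sub>2 \<ge> 0" "\<forall>x\<in>{0..X}. sqrt (1 + x) * f x \<le> C\<^sub>2 * (g x * sqrt (g x))"
    by blast
  have "sqrt (1 + x) * f x \<le> (C\<^sub>1 + C\<^sub>2 + 1) * (g x * sqrt (g x))" if x: "x \<ge> 0" for x
  proof -
    have g: "g x * sqrt (g x) \<ge> 0" using m(1) m(2)[OF x] by simp
    then have "C\<^sub>1 * (g x * sqrt (g x)) \<ge> 0" "C\<^sub>2 * (g x * sqrt (g x)) \<ge> 0" using large(1) small(1) by simp_all
    moreover have "sqrt (1 + x) * f x \<le> C\<^sub>1 * (g x * sqrt (g x)) \<or> sqrt (1 + x) * f x \<le> C\<^sub>2 * (g x * sqrt (g x))"
      using large(2) small(2) x by (cases "x \<ge> X") auto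
    ultimately show ?thesis using g unfolding distrib_right by linarith
  qed
  moreover have "C\<^sub>1 + C\<^sub>2 + 1 > 0" using large(1) small(1) by simp
  ultimately show ?thesis by blast
qed

lemma log_growth_imp_growth:
  assumes growth: "log_growth \<Psi>" and \<eta>: "\<eta> \<le> 1 / 2"
    and bigo: "deriv0 (deriv0 (Phi \<Psi>)) \<in> O[at_top](\<lambda>t. t powr (-1/2) * (deriv0 (Phi \<Psi>) t) powr (1 + \<eta>))"
  obtains C where "growth \<Psi> (deriv0 \<Psi>) (deriv0 (deriv0 \<Psi>)) (deriv0 (Phi \<Psi>)) (deriv0 (deriv0 (Phi \<Psi>))) C"
proof -
  have "\<exists>C>0. \<forall>x\<ge>0.
      sqrt (1 + x) * deriv0 (deriv0 (Phi \<Psi>)) x \<le> C * (deriv0 (Phi \<Psi>) x * sqrt (deriv0 (Phi \<Psi>) x))"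
    by (rule bigo_powr_growth_le[OF \<eta> deriv0_deriv0_Phi_continuous[OF growth] log_growth_deriv0_pos[OF growth order_refl]
        deriv0_Phi_ge[OF growth] bigo])
  then obtain C where C: "C > 0" "\<And>x. x \<ge> 0 \<Longrightarrow>
      sqrt (1 + x) * deriv0 (deriv0 (Phi \<Psi>)) x \<le> C * (deriv0 (Phi \<Psi>) x * sqrt (deriv0 (Phi \<Psi>) x))"
    by blast
  have "growth \<Psi> (deriv0 \<Psi>) (deriv0 (deriv0 \<Psi>)) (deriv0 (Phi \<Psi>)) (deriv0 (deriv0 (Phi \<Psi>))) C"
  proof
    fix x :: real assume x: "x \<ge> 0"
    show "(deriv0 (Phi \<Psi>) has_real_derivative deriv0 (deriv0 (Phi \<Psi>)) x) (at x within {0..})"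
      using deriv0_Phi_has_real_derivative[OF growth x] by (simp add: deriv0_deriv0_Phi[OF growth x])
    show "deriv0 (deriv0 (Phi \<Psi>)) x \<ge> 0"
      using x log_growth_deriv0_deriv0_nonneg[OF growth x] log_growth_deriv0_deriv0_deriv0_nonneg[OF growth x]
      by (simp add: deriv0_deriv0_Phi[OF growth x])
  next
    fix x y :: real assume "0 \<le> x" "x \<le> y"
    then show "deriv0 (deriv0 \<Psi>) x \<le> deriv0 (deriv0 \<Psi>) y"
      using log_growth_deriv0_deriv0_deriv0[OF growth] log_growth_deriv0_deriv0_deriv0_nonneg[OF growth]
      by (rule nondecreasing_halfline)
  qed (use C growth in \<open>auto intro: log_growth_deriv0 log_growth_deriv0_deriv0 log_growth_deriv0_pos
      log_growth_deriv0_deriv0_nonneg deriv0_Phi\<close>)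
  then show ?thesis by (rule that)
qed

theorem theoremD:
  fixes \<Psi> :: "real \<Rightarrow> real" and \<nu> :: "(complex ^ 'n) measure"
  assumes "log_growth \<Psi>"
    and "\<exists>\<eta><1/2.
      deriv0 (deriv0 (Phi \<Psi>))
        \<in> O[at_top](\<lambda>t. t powr (-1/2) * (deriv0 (Phi \<Psi>) t) powr (1 + \<eta>)) \<and>
      (CARD('n) > 1 \<longrightarrow>
        deriv0 (deriv0 \<Psi>)
          \<in> O[at_top](\<lambda>t. t powr (-1/2) * (deriv0 \<Psi> t) powr (1 + \<eta>)))"
    and "sets \<nu> = sets borel"
  shows "(carleson_measure \<Psi> \<nu> \<longleftrightarrow>
      (\<exists>C>0. \<forall>z. (\<integral>\<^sup>+w. ennreal ((norm (fock_kernel \<Psi> w z))\<^sup>2 / Re (fock_kernel \<Psi> z z)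
                              * exp (- \<Psi> ((norm w)\<^sup>2))) \<partial>\<nu>) \<le> ennreal C))
    \<and> (carleson_measure \<Psi> \<nu> \<longleftrightarrow>
      (\<forall>r>0. \<exists>C>0. \<forall>z. emeasure \<nu> (bergman_ball \<Psi> z r)
                          \<le> ennreal C * emeasure lborel (bergman_ball \<Psi> z r)))
    \<and> (carleson_measure \<Psi> \<nu> \<longleftrightarrow>
      (\<exists>a. lattice_seq \<Psi> a \<and>
        (\<exists>C>0. \<forall>k. emeasure \<nu> (bergman_ball \<Psi> (a k) (max_covering_radius \<Psi> a))
                \<le> ennreal C * emeasure lborel (bergman_ball \<Psi> (a k) (max_covering_radius \<Psi> a)))))"
proof -
  obtain \<eta> where \<eta>: "\<eta> < 1 / 2"
    "deriv0 (deriv0 (Phi \<Psi>)) \<in> O[at_top](\<lambda>t. t powr (-1/2) * (deriv0 (Phi \<Psi>) t) powr (1 + \<eta>))"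
    using assms(2) by blast
  obtain C where "growth \<Psi> (deriv0 \<Psi>) (deriv0 (deriv0 \<Psi>)) (deriv0 (Phi \<Psi>)) (deriv0 (deriv0 (Phi \<Psi>))) C"
    using log_growth_imp_growth[OF assms(1) less_imp_le[OF \<eta>(1)] \<eta>(2)] by blast
  then interpret fock_growth \<Psi> "deriv0 \<Psi>" "deriv0 (deriv0 \<Psi>)" "deriv0 (Phi \<Psi>)" "deriv0 (deriv0 (Phi \<Psi>))" C "TYPE('n)"
    by (simp add: fock_growth_def)
  obtain metric_lower metric_upper diag_lower where
    "fock_metric TYPE('n) \<Psi> (deriv0 \<Psi>) (deriv0 (deriv0 \<Psi>)) (deriv0 (Phi \<Psi>)) (deriv0 (deriv0 (Phi \<Psi>))) C
      metric_lower metric_upper diag_lower"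
    using ex_fock_metric by blast
  then interpret fock_metric \<Psi> "deriv0 \<Psi>" "deriv0 (deriv0 \<Psi>)" "deriv0 (Phi \<Psi>)" "deriv0 (deriv0 (Phi \<Psi>))" C "TYPE('n)"
    metric_lower metric_upper diag_lower .
  show ?thesis by (rule carleson_characterisation[OF assms(3), unfolded berezin_eq])
qed

end
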